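(* Let $G$ be a finite group and let $n\geqslant 2$. Let $\mathcal M_n(G)$ consist of $\mathrm{Std}_n$ and one representation from each duality orbit in $\mathrm{Sph}_n(G)\setminus\{\mathrm{triv}\}$. Then $\mathcal M_n(G)$ is gap-determining and minimal. Moreover, every gap-determining family contains $\mathrm{Std}_n$ and meets every duality orbit in $\mathrm{Sph}_n(G)\setminus\{\mathrm{triv}\}$.
   Context: $W_n(G)=G\wr\mathfrak S_n=G^n\rtimes\mathfrak S_n$ with multiplication $(g;\pi)(h;\sigma)=(g(\pi\cdot h);\pi\sigma)$, $\pi\cdot g=(g_{\pi^{-1}(1)},\dots,g_{\pi^{-1}(n)})$; $G^n$ and $\mathfrak S_n$ are regarded as subgroups. All representations are finite-dimensional, complex and unitary; $\mathrm{Irr}(H)$ is the set of isomorphism classes of irreducible representations of $H$. For a finite group $H$ and $w=\sum_h\mathsf c_h h\in\mathbb R[H]$ with $\mathsf c_h=\mathsf c_{h^{-1}}\geqslant 0$, put $\Delta_H(w)=\sum_h\mathsf c_h(1_H-h)$. For a representation $V$ of $H$, $\psi_H(w,V)$ is the smallest eigenvalue of $\Delta_H(w)$ on $(V^H)^\perp$, with $V^H$ the fixed subspace, and $\psi_H(w,V)=+\infty$ if $V=V^H$. Put $\psi_H(w)=\psi_H(w,\mathrm{Reg}_H)$, with $\mathrm{Reg}_H$ the regular representation. An admissible element is $w=\sum_{1\leqslant i<j\leqslant n}\mathsf a_{ij}(ij)+\sum_{g\in G^n}\mathsf c_g g\in\mathbb R[W_n(G)]$ with $\mathsf a_{ij}\geqslant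 0$ and $\mathsf c_g=\mathsf c_{g^{-1}}\geqslant 0$. A collection $\mathcal E\subseteq\mathrm{Irr}(W_n(G))\setminus\{\mathrm{triv}\}$ is gap-determining if $\psi_{W_n(G)}(w)=\min_{V\in\mathcal E}\psi_{W_n(G)}(w,V)$ for every admissible $w$. It is minimal if no proper subcollection has this property. $\mathrm{Std}_n$ is the irreducible $\mathfrak S_n$-representation of shape $(n-1,1)$, lifted to $W_n(G)$ via the quotient map to $\mathfrak S_n$. $\mathrm{Sph}_n(G)$ is the set of (isomorphism classes of) irreducible representations of $W_n(G)$ that have a non-zero $\mathfrak S_n$-fixed vector. The duality orbit of $V$ is $\{V,V^*\}$, where $V^*$ is the contragredient. *)

theory Defs
  imports
    "HOL-Algebra.Sym_Groups"
    "HOL-Algebra.Product_Groups"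
    "HOL-Library.Extended_Real"
    "Jordan_Normal_Form.Schur_Decomposition"
    "Jordan_Normal_Form.VS_Connect"
begin

section \<open>Unitary representations\<close>

text \<open>
  A finite-dimensional unitary representation of a group \<open>H\<close> is modelled, after a choice of an
  orthonormal basis, by unitary matrices acting on \<^term>\<open>carrier_vec d :: complex vec set\<close>. Values
  outside \<^term>\<open>carrier H\<close> are irrelevant.
\<close>

definition rep_dim :: "('h, 'm) monoid_scheme \<Rightarrow> ('h \<Rightarrow> complex mat) \<Rightarrow> nat" where
  "rep_dim H \<rho> = dim_row (\<rho> \<one>\<^bsub>H\<^esub>)"

definition unitary_rep :: "('h, 'm) monoid_scheme \<Rightarrow> ('h \<Rightarrow> complex mat) \<Rightarrow> bool" where
  "unitary_rep H \<rho> \<longleftrightarrow>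
     (\<forall>h\<in>carrier H. \<rho> h \<in> carrier_mat (rep_dim H \<rho>) (rep_dim H \<rho>)) \<and>
     \<rho> \<one>\<^bsub>H\<^esub> = 1\<^sub>m (rep_dim H \<rho>) \<and>
     (\<forall>h\<in>carrier H. \<forall>k\<in>carrier H. \<rho> (h \<otimes>\<^bsub>H\<^esub> k) = \<rho> h * \<rho> k) \<and>
     (\<forall>h\<in>carrier H. \<rho> h * mat_adjoint (\<rho> h) = 1\<^sub>m (rep_dim H \<rho>))"

definition irreducible_rep :: "('h, 'm) monoid_scheme \<Rightarrow> ('h \<Rightarrow> complex mat) \<Rightarrow> bool" where
  "irreducible_rep H \<rho> \<longleftrightarrow>
     unitary_rep H \<rho> \<and> rep_dim H \<rho> > 0 \<and>
     (\<forall>U. VectorSpace.subspace class_ring U (module_vec TYPE(complex) (rep_dim H \<rho>)) \<and>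
          (\<forall>h\<in>carrier H. \<forall>u\<in>U. \<rho> h *\<^sub>v u \<in> U) \<longrightarrow>
          U = {0\<^sub>v (rep_dim H \<rho>)} \<or> U = carrier_vec (rep_dim H \<rho>))"

definition rep_iso ::
    "('h, 'm) monoid_scheme \<Rightarrow> ('h \<Rightarrow> complex mat) \<Rightarrow> ('h \<Rightarrow> complex mat) \<Rightarrow> bool" where
  "rep_iso H \<rho> \<sigma> \<longleftrightarrow>
     (\<exists>T\<in>carrier_mat (rep_dim H \<sigma>) (rep_dim H \<rho>).
        invertible_mat T \<and> (\<forall>h\<in>carrier H. T * \<rho> h = \<sigma> h * T))"

definition rep_class ::
    "('h, 'm) monoid_scheme \<Rightarrow> ('h \<Rightarrow> complex mat) \<Rightarrow> ('h \<Rightarrow> complex mat) set" where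
  "rep_class H \<rho> = {\<sigma>. unitary_rep H \<sigma> \<and> rep_iso H \<rho> \<sigma>}"

definition Irr :: "('h, 'm) monoid_scheme \<Rightarrow> ('h \<Rightarrow> complex mat) set set" where
  "Irr H = rep_class H ` {\<rho>. irreducible_rep H \<rho>}"

definition triv_class :: "('h, 'm) monoid_scheme \<Rightarrow> ('h \<Rightarrow> complex mat) set" where
  "triv_class H = rep_class H (\<lambda>h. 1\<^sub>m 1)"

text \<open>The contragredient, written in the basis dual to the standard one.\<close>

definition contragredient ::
    "('h, 'm) monoid_scheme \<Rightarrow> ('h \<Rightarrow> complex mat) \<Rightarrow> 'h \<Rightarrow> complex mat" where
  "contragredient H \<rho> = (\<lambda>h. transpose_mat (\<rho> (inv\<^bsub>H\<^esub> h)))"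

definition dual_class ::
    "('h, 'm) monoid_scheme \<Rightarrow> ('h \<Rightarrow> complex mat) set \<Rightarrow> ('h \<Rightarrow> complex mat) set" where
  "dual_class H C = (\<Union>\<rho>\<in>C. rep_class H (contragredient H \<rho>))"

text \<open>
  The left regular representation on the orthonormal basis \<^term>\<open>carrier H\<close>. The enumeration of
  this basis only affects the matrices up to simultaneous conjugation by a permutation matrix.
\<close>

definition group_enum :: "('h, 'm) monoid_scheme \<Rightarrow> nat \<Rightarrow> 'h" where
  "group_enum H = (SOME e. bij_betw e {..<Coset.order H} (carrier H))"

definition regular_rep :: "('h, 'm) monoid_scheme \<Rightarrow> 'h \<Rightarrow> complex mat" where
  "regular_rep H h =
     mat (Coset.order H) (Coset.order H) (\<lambda>(i, j). of_bool (group_enum H i = h \<otimes>\<^bsub>H\<^esub> group_enum H j))"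

section \<open>Laplacians and spectral gaps\<close>

text \<open>
  An element of the real group algebra of a finite group \<open>H\<close> is given by its coefficient function,
  of which only the values on \<^term>\<open>carrier H\<close> matter.
\<close>

definition galg_single :: "'h \<Rightarrow> 'h \<Rightarrow> real" where
  "galg_single h = (\<lambda>x. of_bool (x = h))"

definition laplacian :: "('h, 'm) monoid_scheme \<Rightarrow> ('h \<Rightarrow> real) \<Rightarrow> 'h \<Rightarrow> real" where
  "laplacian H w =
     (\<lambda>x. \<Sum>h\<in>carrier H. w h * (galg_single \<one>\<^bsub>H\<^esub> x - galg_single h x))"

definition galg_rep ::
    "('h, 'm) monoid_scheme \<Rightarrow> ('h \<Rightarrow> complex mat) \<Rightarrow> ('h \<Rightarrow> real) \<Rightarrow> complex mat" where
  "galg_rep H \<rho> w =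
     mat (rep_dim H \<rho>) (rep_dim H \<rho>) (\<lambda>ij. \<Sum>h\<in>carrier H. complex_of_real (w h) * \<rho> h $$ ij)"

definition fixed_space :: "('h, 'm) monoid_scheme \<Rightarrow> ('h \<Rightarrow> complex mat) \<Rightarrow> complex vec set" where
  "fixed_space H \<rho> = {v \<in> carrier_vec (rep_dim H \<rho>). \<forall>h\<in>carrier H. \<rho> h *\<^sub>v v = v}"

definition fixed_compl :: "('h, 'm) monoid_scheme \<Rightarrow> ('h \<Rightarrow> complex mat) \<Rightarrow> complex vec set" where
  "fixed_compl H \<rho> = {v \<in> carrier_vec (rep_dim H \<rho>). \<forall>u\<in>fixed_space H \<rho>. v \<bullet>c u = 0}"

text \<open>
  For symmetric \<open>w\<close> the Laplacian acts as a Hermitian matrix, so considering its real eigenvalues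
  loses nothing.
\<close>

definition psi ::
    "('h, 'm) monoid_scheme \<Rightarrow> ('h \<Rightarrow> real) \<Rightarrow> ('h \<Rightarrow> complex mat) \<Rightarrow> ereal" where
  "psi H w \<rho> =
     (if fixed_space H \<rho> = carrier_vec (rep_dim H \<rho>) then \<infinity>
      else ereal (Min {x. \<exists>v\<in>fixed_compl H \<rho>.
                            eigenvector (galg_rep H \<rho> (laplacian H w)) v (complex_of_real x)}))"

definition psi_class ::
    "('h, 'm) monoid_scheme \<Rightarrow> ('h \<Rightarrow> real) \<Rightarrow> ('h \<Rightarrow> complex mat) set \<Rightarrow> ereal" where
  "psi_class H w C = psi H w (SOME \<rho>. \<rho> \<in> C)"

definition psi_group :: "('h, 'm) monoid_scheme \<Rightarrow> ('h \<Rightarrow> real) \<Rightarrow> ereal" where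
  "psi_group H w = psi H w (regular_rep H)"

section \<open>Wreath products\<close>

definition base_group :: "nat \<Rightarrow> ('g, 'm) monoid_scheme \<Rightarrow> (nat \<Rightarrow> 'g) monoid" where
  "base_group n G = product_group {1..n} (\<lambda>i. G)"

definition perm_act :: "nat \<Rightarrow> (nat \<Rightarrow> nat) \<Rightarrow> (nat \<Rightarrow> 'g) \<Rightarrow> nat \<Rightarrow> 'g" where
  "perm_act n \<pi> g = (\<lambda>i\<in>{1..n}. g (Hilbert_Choice.inv \<pi> i))"

definition wreath :: "nat \<Rightarrow> ('g, 'm) monoid_scheme \<Rightarrow> ((nat \<Rightarrow> 'g) \<times> (nat \<Rightarrow> nat)) monoid" where
  "wreath n G =
     \<lparr>carrier = carrier (base_group n G) \<times> carrier (sym_group n),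
      monoid.mult = (\<lambda>(g, \<pi>) (h, \<sigma>).
        (g \<otimes>\<^bsub>base_group n G\<^esub> perm_act n \<pi> h, \<pi> \<otimes>\<^bsub>sym_group n\<^esub> \<sigma>)),
      one = (\<one>\<^bsub>base_group n G\<^esub>, \<one>\<^bsub>sym_group n\<^esub>)\<rparr>"

definition base_embed ::
    "nat \<Rightarrow> ('g, 'm) monoid_scheme \<Rightarrow> (nat \<Rightarrow> 'g) \<Rightarrow> (nat \<Rightarrow> 'g) \<times> (nat \<Rightarrow> nat)" where
  "base_embed n G g = (g, \<one>\<^bsub>sym_group n\<^esub>)"

definition sym_embed ::
    "nat \<Rightarrow> ('g, 'm) monoid_scheme \<Rightarrow> (nat \<Rightarrow> nat) \<Rightarrow> (nat \<Rightarrow> 'g) \<times> (nat \<Rightarrow> nat)" where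
  "sym_embed n G \<pi> = (\<one>\<^bsub>base_group n G\<^esub>, \<pi>)"

definition admissible ::
    "nat \<Rightarrow> ('g, 'm) monoid_scheme \<Rightarrow> ((nat \<Rightarrow> 'g) \<times> (nat \<Rightarrow> nat) \<Rightarrow> real) \<Rightarrow> bool" where
  "admissible n G w \<longleftrightarrow>
     (\<exists>(a :: nat \<Rightarrow> nat \<Rightarrow> real) (c :: (nat \<Rightarrow> 'g) \<Rightarrow> real).
        (\<forall>i j. 1 \<le> i \<and> i < j \<and> j \<le> n \<longrightarrow> a i j \<ge> 0) \<and>
        (\<forall>g\<in>carrier (base_group n G). c g \<ge> 0 \<and> c (inv\<^bsub>base_group n G\<^esub> g) = c g) \<and>
        w = (\<lambda>x.
          (\<Sum>(i, j)\<in>{(i, j). 1 \<le> i \<and> i < j \<and> j \<le> n}.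
             a i j * galg_single (sym_embed n G (Transposition.transpose i j)) x) +
          (\<Sum>g\<in>carrier (base_group n G). c g * galg_single (base_embed n G g) x)))"

text \<open>
  The infimum is a minimum because a finite group has finitely many irreducible representations;
  for the empty collection it is \<open>\<infinity>\<close>.
\<close>

definition gap_determining ::
    "nat \<Rightarrow> ('g, 'm) monoid_scheme \<Rightarrow> ((nat \<Rightarrow> 'g) \<times> (nat \<Rightarrow> nat) \<Rightarrow> complex mat) set set \<Rightarrow> bool" where
  "gap_determining n G \<E> \<longleftrightarrow>
     \<E> \<subseteq> Irr (wreath n G) - {triv_class (wreath n G)} \<and>
     (\<forall>w. admissible n G w \<longrightarrow>
        psi_group (wreath n G) w = (INF C\<in>\<E>. psi_class (wreath n G) w C))"

definition minimal_gap_determining ::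
    "nat \<Rightarrow> ('g, 'm) monoid_scheme \<Rightarrow> ((nat \<Rightarrow> 'g) \<times> (nat \<Rightarrow> nat) \<Rightarrow> complex mat) set set \<Rightarrow> bool" where
  "minimal_gap_determining n G \<E> \<longleftrightarrow>
     gap_determining n G \<E> \<and> (\<forall>\<E>'. \<E>' \<subset> \<E> \<longrightarrow> \<not> gap_determining n G \<E>')"

section \<open>Specht modules and the standard representation\<close>

text \<open>
  A shape is the list of its row lengths and cells are indexed from \<open>0\<close>. The tabloid of a tableau
  is encoded as the function that maps each entry to the index of its row, so that \<open>\<pi>\<close> sends the
  tabloid \<open>T\<close> to \<open>T \<circ> \<pi>\<inverse>\<close>, and hence a function \<open>f\<close> on tabloids to \<open>\<lambda>T. f (T \<circ> \<pi>)\<close>. The Specht module is the span of the polytabloids inside the permutation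
  module of complex functions on tabloids.
\<close>

definition cells :: "nat list \<Rightarrow> (nat \<times> nat) set" where
  "cells \<mu> = {(r, c). r < length \<mu> \<and> c < \<mu> ! r}"

definition tableaux :: "nat \<Rightarrow> nat list \<Rightarrow> (nat \<times> nat \<Rightarrow> nat) set" where
  "tableaux n \<mu> = {t \<in> extensional (cells \<mu>). bij_betw t (cells \<mu>) {1..n}}"

definition tabloid :: "nat \<Rightarrow> nat list \<Rightarrow> (nat \<times> nat \<Rightarrow> nat) \<Rightarrow> nat \<Rightarrow> nat" where
  "tabloid n \<mu> t = (\<lambda>i\<in>{1..n}. fst (inv_into (cells \<mu>) t i))"

definition column_stabilizer :: "nat \<Rightarrow> nat list \<Rightarrow> (nat \<times> nat \<Rightarrow> nat) \<Rightarrow> (nat \<Rightarrow> nat) set" where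
  "column_stabilizer n \<mu> t =
     {\<kappa> \<in> carrier (sym_group n).
        \<forall>i\<in>{1..n}. snd (inv_into (cells \<mu>) t (\<kappa> i)) = snd (inv_into (cells \<mu>) t i)}"

definition polytabloid ::
    "nat \<Rightarrow> nat list \<Rightarrow> (nat \<times> nat \<Rightarrow> nat) \<Rightarrow> (nat \<Rightarrow> nat) \<Rightarrow> complex" where
  "polytabloid n \<mu> t =
     (\<lambda>T. \<Sum>\<kappa>\<in>column_stabilizer n \<mu> t.
        of_int (sign \<kappa>) * of_bool (T = tabloid n \<mu> (restrict (\<kappa> \<circ> t) (cells \<mu>))))"

definition specht_module :: "nat \<Rightarrow> nat list \<Rightarrow> ((nat \<Rightarrow> nat) \<Rightarrow> complex) set" where
  "specht_module n \<mu> =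
     {f. \<exists>a. f = (\<lambda>T. \<Sum>t\<in>tableaux n \<mu>. a t * polytabloid n \<mu> t T)}"

definition affords_specht ::
    "nat \<Rightarrow> nat list \<Rightarrow> ((nat \<Rightarrow> nat) \<Rightarrow> complex mat) \<Rightarrow> bool" where
  "affords_specht n \<mu> \<sigma> \<longleftrightarrow>
     unitary_rep (sym_group n) \<sigma> \<and>
     (\<exists>\<Phi>. bij_betw \<Phi> (carrier_vec (rep_dim (sym_group n) \<sigma>)) (specht_module n \<mu>) \<and>
          (\<forall>u\<in>carrier_vec (rep_dim (sym_group n) \<sigma>). \<forall>v\<in>carrier_vec (rep_dim (sym_group n) \<sigma>).
             \<forall>T. \<Phi> (u + v) T = \<Phi> u T + \<Phi> v T) \<and>
          (\<forall>v\<in>carrier_vec (rep_dim (sym_group n) \<sigma>). \<forall>z T. \<Phi> (z \<cdot>\<^sub>v v) T = z * \<Phi> v T) \<and>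
          (\<forall>v\<in>carrier_vec (rep_dim (sym_group n) \<sigma>). \<forall>\<pi>\<in>carrier (sym_group n).
             \<forall>T. \<Phi> (\<sigma> \<pi> *\<^sub>v v) T = \<Phi> v (T \<circ> \<pi>)))"

text \<open>The lift along the quotient map \<^term>\<open>snd\<close> from the wreath product to the symmetric group.\<close>

definition Std_class ::
    "nat \<Rightarrow> ('g, 'm) monoid_scheme \<Rightarrow> ((nat \<Rightarrow> 'g) \<times> (nat \<Rightarrow> nat) \<Rightarrow> complex mat) set" where
  "Std_class n G =
     (\<Union>\<sigma>\<in>{\<sigma>. affords_specht n [n - 1, 1] \<sigma>}. rep_class (wreath n G) (\<sigma> \<circ> snd))"

section \<open>Spherical representations and duality orbits\<close>

definition Sph ::
    "nat \<Rightarrow> ('g, 'm) monoid_scheme \<Rightarrow> ((nat \<Rightarrow> 'g) \<times> (nat \<Rightarrow> nat) \<Rightarrow> complex mat) set set" where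
  "Sph n G =
     {C \<in> Irr (wreath n G).
        \<exists>\<rho>\<in>C. \<exists>v\<in>carrier_vec (rep_dim (wreath n G) \<rho>).
          v \<noteq> 0\<^sub>v (rep_dim (wreath n G) \<rho>) \<and>
          (\<forall>\<pi>\<in>carrier (sym_group n). \<rho> (sym_embed n G \<pi>) *\<^sub>v v = v)}"

definition Sph_duality_orbits ::
    "nat \<Rightarrow> ('g, 'm) monoid_scheme \<Rightarrow> ((nat \<Rightarrow> 'g) \<times> (nat \<Rightarrow> nat) \<Rightarrow> complex mat) set set set" where
  "Sph_duality_orbits n G =
     (\<lambda>C. {C, dual_class (wreath n G) C}) ` (Sph n G - {triv_class (wreath n G)})"

text \<open>
  Whether \<open>\<M>\<close> is one of the collections that consist of the standard representation together with
  exactly one representation from each duality orbit of non-trivial spherical representations.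
\<close>

definition is_std_sph_collection ::
    "nat \<Rightarrow> ('g, 'm) monoid_scheme \<Rightarrow> ((nat \<Rightarrow> 'g) \<times> (nat \<Rightarrow> nat) \<Rightarrow> complex mat) set set \<Rightarrow> bool" where
  "is_std_sph_collection n G \<M> \<longleftrightarrow>
     (\<exists>\<S>. \<M> = insert (Std_class n G) \<S> \<and>
          \<S> \<subseteq> Sph n G - {triv_class (wreath n G)} \<and>
          (\<forall>\<O>\<in>Sph_duality_orbits n G. \<exists>!C. C \<in> \<S> \<inter> \<O>))"

end

theory Submission
  imports Defs "HOL-Combinatorics.Permutations" "Jordan_Normal_Form.Spectral_Radius"
begin

text \<open>
  A least-dimensional representation in which an eigenvalue of the Laplacian occurs off the fixed
  vectors is irreducible, so the spectral gap is attained on a non-trivial irreducible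
  representation \<open>V\<close>. If \<open>V\<close> has no fixed vector under the symmetric group, the theorem of Caputo,
  Liggett and Richthammer on the interchange process (via the octopus inequality) bounds its gap
  below by that of the random walk, hence by that of the standard representation; if it has one,
  it is listed up to duality, and \<open>V\<close> and its contragredient have the same gaps.

  The standard representation is the only non-trivial irreducible representation with a vector
  fixed by the base group and by the stabilizer of the point \<open>n\<close>. Hence large weights on the base
  group and on the transpositions fixing \<open>n\<close>, and small weights on the transpositions moving \<open>n\<close>,
  leave a small gap on it alone. For a spherical representation with spherical vector \<open>v\<close> the
  weights \<open>c g = \<parallel>v\<parallel>\<^sup>2 + Re \<langle>g v, v\<rangle>\<close> on the base group act by zero, by orthogonality of matrix
  coefficients, on the spherical vectors of every non-trivial irreducible representation outside
  its duality orbit; together with a large weight on all transpositions they isolate the orbit.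
\<close>

section \<open>The octopus inequality\<close>

text \<open>A class, or duality orbit, is forced into every gap-determining family by an admissible
  element whose gap lies below some threshold there and at or above it on all other non-trivial
  classes; both necessity arguments construct such an element with its threshold. For the orbits the
  natural weights would be a matrix coefficient of \<open>V\<close>, but admissible weights are
  real, symmetric and nonnegative. Taking the real part brings in the contragredient, so an orbit is
  the finest thing that can be isolated, and the constant that restores nonnegativity is a multiple
  of the trivial coefficient, which is orthogonal to all non-trivial classes. Such weights say
  nothing about vectors orthogonal to the spherical ones; there a uniform rate on the transpositions
  takes over, bounded again by the interchange process. The octopus inequality is stated for
  positive definite functions instead of operators: for a vector \<open>v\<close> of a unitary
  representation, \<open>p \<mapsto> Re ((\<sigma> p v) \<bullet>c v)\<close> is such a function,
  and the identities behind the inequality become integer computations on at most five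
  points.\<close>

definition pos_def_on :: "'a set \<Rightarrow> (('a \<Rightarrow> 'a) \<Rightarrow> real) \<Rightarrow> bool" where
  "pos_def_on S \<phi> \<longleftrightarrow>
     (\<forall>\<alpha>. 0 \<le> (\<Sum>g | g permutes S. \<Sum>h | h permutes S. \<alpha> g * \<alpha> h * \<phi> (inv' g \<circ> h)))"

text \<open>A family may list the same permutation several times; collecting the weights of equal
  members gives one coefficient per permutation.\<close>

lemma pos_def_on_family:
  assumes pd: "pos_def_on S \<phi>" and "finite S" and "finite B"
    and g: "\<And>b. b \<in> B \<Longrightarrow> g b permutes S"
  shows "0 \<le> (\<Sum>a\<in>B. \<Sum>b\<in>B. x a * x b * \<phi> (inv' (g a) \<circ> g b))"
proof -
  let ?P = "{h. h permutes S}"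
  define \<alpha> where "\<alpha> h = (\<Sum>b\<in>B. if g b = h then x b else 0)" for h
  have fin: "finite ?P" by (rule finite_permutations[OF \<open>finite S\<close>])
  have expand: "(\<Sum>h\<in>?P. \<alpha> h * F h) = (\<Sum>b\<in>B. x b * F (g b))" for F
  proof -
    have "(\<Sum>h\<in>?P. \<alpha> h * F h) = (\<Sum>b\<in>B. \<Sum>h\<in>?P. if g b = h then x b * F h else 0)"
      unfolding \<alpha>_def sum_distrib_right by (subst sum.swap) (auto intro!: sum.cong)
    also have "\<dots> = (\<Sum>b\<in>B. x b * F (g b))"
      by (rule sum.cong[OF refl]) (use g fin in \<open>simp add: sum.delta'\<close>)
    finally show ?thesis .
  qed
  have "(\<Sum>a\<in>B. \<Sum>b\<in>B. x a * x b * \<phi> (inv' (g a) \<circ> g b)) =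
      (\<Sum>a\<in>B. x a * (\<Sum>b\<in>B. x b * \<phi> (inv' (g a) \<circ> g b)))"
    by (simp add: sum_distrib_left mult.assoc)
  also have "\<dots> = (\<Sum>a\<in>B. x a * (\<Sum>h\<in>?P. \<alpha> h * \<phi> (inv' (g a) \<circ> h)))"
    by (simp only: expand)
  also have "\<dots> = (\<Sum>k\<in>?P. \<alpha> k * (\<Sum>h\<in>?P. \<alpha> h * \<phi> (inv' k \<circ> h)))"
    by (simp only: expand)
  also have "\<dots> = (\<Sum>k\<in>?P. \<Sum>h\<in>?P. \<alpha> k * \<alpha> h * \<phi> (inv' k \<circ> h))"
    by (simp add: sum_distrib_left mult.assoc)
  also have "\<dots> \<ge> 0" using pd unfolding pos_def_on_def by blast
  finally show ?thesis .
qed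

subsection \<open>Computing in the group algebra of a small symmetric group\<close>

text \<open>A permutation of \<open>{..<N}\<close> is the list of its values, and an element of the integral group
  algebra is a list of weighted permutations.\<close>

type_synonym galg_list = "(int \<times> nat list) list"

definition lcomp :: "nat list \<Rightarrow> nat list \<Rightarrow> nat list" where
  "lcomp g h = map (\<lambda>i. g ! i) h"

definition linv :: "nat list \<Rightarrow> nat list" where
  "linv g = map (\<lambda>i. length (takeWhile (\<lambda>j. j \<noteq> i) g)) [0..<length g]"

definition lswap :: "nat \<Rightarrow> nat \<Rightarrow> nat \<Rightarrow> nat list" where
  "lswap N i j = map (\<lambda>k. if k = i then j else if k = j then i else k) [0..<N]"

definition lscale :: "int \<Rightarrow> galg_list \<Rightarrow> galg_list" where
  "lscale c X = map (\<lambda>(a, g). (c * a, g)) X"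

definition lstar :: "galg_list \<Rightarrow> galg_list" where
  "lstar X = map (\<lambda>(a, g). (a, linv g)) X"

text \<open>Cancelling terms are dropped, so that an identity in the group algebra can be tested by
  comparing the outcome with \<open>[]\<close>.\<close>

fun ladd :: "int \<times> nat list \<Rightarrow> galg_list \<Rightarrow> galg_list" where
  "ladd x [] = [x]"
| "ladd x (y # Y) = (if snd x = snd y
     then if fst x + fst y = 0 then Y else (fst x + fst y, snd y) # Y
     else y # ladd x Y)"

fun lrow :: "int \<times> nat list \<Rightarrow> galg_list \<Rightarrow> galg_list \<Rightarrow> galg_list" where
  "lrow x [] Z = Z"
| "lrow x (y # Y) Z = lrow x Y (ladd (fst x * fst y, lcomp (snd x) (snd y)) Z)"

text \<open>Adds \<open>X * Y\<close> to \<open>Z\<close>, which is kept in collected form.\<close>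

fun lmac :: "galg_list \<Rightarrow> galg_list \<Rightarrow> galg_list \<Rightarrow> galg_list" where
  "lmac [] Y Z = Z"
| "lmac (x # X) Y Z = lmac X Y (lrow x Y Z)"

definition lnorm :: "galg_list \<Rightarrow> galg_list" where
  "lnorm X = foldr ladd X []"

definition lev :: "(nat list \<Rightarrow> real) \<Rightarrow> galg_list \<Rightarrow> real" where
  "lev \<phi> X = sum_list (map (\<lambda>(a, g). of_int a * \<phi> g) X)"

lemma lev_Nil [simp]: "lev \<phi> [] = 0"
  and lev_Cons [simp]: "lev \<phi> (x # X) = of_int (fst x) * \<phi> (snd x) + lev \<phi> X"
  and lev_append [simp]: "lev \<phi> (X @ Y) = lev \<phi> X + lev \<phi> Y"
  by (auto simp: lev_def split_def)

lemma lev_ladd: "lev \<phi> (ladd x Y) = of_int (fst x) * \<phi> (snd x) + lev \<phi> Y"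
proof (induction Y)
  case (Cons y Y)
  have "of_int (fst x) * \<phi> (snd y) + of_int (fst y) * \<phi> (snd y) = 0"
    if "fst x + fst y = 0"
    using that by (metis distrib_right mult_eq_0_iff of_int_0 of_int_add)
  with Cons show ?case by (auto simp: algebra_simps)
qed simp

lemma lev_lnorm: "lev \<phi> (lnorm X) = lev \<phi> X"
  unfolding lnorm_def by (induction X) (auto simp: lev_ladd)

lemma lev_lscale: "lev \<phi> (lscale c X) = of_int c * lev \<phi> X"
  unfolding lscale_def by (induction X) (auto simp: algebra_simps)

lemma lev_lrow:
  "lev \<phi> (lrow x Y Z) =
     lev \<phi> Z + (\<Sum>y\<leftarrow>Y. of_int (fst x) * of_int (fst y) * \<phi> (lcomp (snd x) (snd y)))"
  by (induction x Y Z rule: lrow.induct) (auto simp: lev_ladd)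

lemma lev_lmac:
  "lev \<phi> (lmac X Y Z) =
     lev \<phi> Z + (\<Sum>x\<leftarrow>X. \<Sum>y\<leftarrow>Y. of_int (fst x) * of_int (fst y) * \<phi> (lcomp (snd x) (snd y)))"
  by (induction X Y Z rule: lmac.induct) (auto simp: lev_lrow)

text \<open>This is \<open>1 + (p q) - (p z) - (q z)\<close>. For \<open>p = q\<close> the swap is
  the identity, and the element becomes \<open>2 - 2 (p z)\<close>.\<close>

definition lB :: "nat \<Rightarrow> nat \<Rightarrow> nat \<Rightarrow> nat \<Rightarrow> galg_list" where
  "lB N p q z = [(1, [0..<N]), (1, lswap N p q), (-1, lswap N p z), (-1, lswap N q z)]"

text \<open>The centre \<open>z\<close> is the last point. The six summands are the three splittings
  of the four indices into two pairs, each in both orders; as \<open>lB\<close> is symmetric in its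
  pair, this is the symmetrisation over all 24 orderings divided by 4.\<close>

definition lPsi :: "nat \<Rightarrow> nat \<Rightarrow> nat \<Rightarrow> nat \<Rightarrow> nat \<Rightarrow> galg_list" where
  "lPsi N p q r s = (let z = N - 1;
     F = (\<lambda>a b c d. lmac (lscale (-1) (lB N a b z)) (lB N c d z)
           (lscale (if a = b then 4 else 2) (lB N c d z)))
     in F p q r s @ F r s p q @ F p r q s @ F q s p r @ F p s q r @ F q r p s)"

definition lvalid :: "nat \<Rightarrow> nat list \<Rightarrow> bool" where
  "lvalid N g \<longleftrightarrow> length g = N \<and> set g = set [0..<N]"

text \<open>The second condition says that \<open>X\<close> divided by 24 is a projection, so every
  positive definite function is nonnegative at \<open>X\<close>.\<close>

definition lsquare :: "nat \<Rightarrow> galg_list \<Rightarrow> bool" where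
  "lsquare N X \<longleftrightarrow> list_all (\<lambda>x. lvalid N (snd x)) X \<and>
     lmac (lstar X) X (lscale (-24) X) = []"

text \<open>A pattern of coincidences among four indices is a set partition of four positions. There
  are 15 of them; these are the 14 with at least one coincidence, labelled in order of first
  occurrence. The generic one is kept apart because it lives on five points.\<close>

lemma lsquare_lPsi_small:
  "lsquare 2 (lnorm (lPsi 2 0 0 0 0))"
  "lsquare 3 (lnorm (lPsi 3 0 0 0 1))"
  "lsquare 3 (lnorm (lPsi 3 0 0 1 0))"
  "lsquare 3 (lnorm (lPsi 3 0 0 1 1))"
  "lsquare 3 (lnorm (lPsi 3 0 1 0 0))"
  "lsquare 3 (lnorm (lPsi 3 0 1 0 1))"
  "lsquare 3 (lnorm (lPsi 3 0 1 1 0))"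
  "lsquare 3 (lnorm (lPsi 3 0 1 1 1))"
  "lsquare 4 (lnorm (lPsi 4 0 0 1 2))"
  "lsquare 4 (lnorm (lPsi 4 0 1 0 2))"
  "lsquare 4 (lnorm (lPsi 4 0 1 1 2))"
  "lsquare 4 (lnorm (lPsi 4 0 1 2 0))"
  "lsquare 4 (lnorm (lPsi 4 0 1 2 1))"
  "lsquare 4 (lnorm (lPsi 4 0 1 2 2))"
  by code_simp+

lemma lsquare_lPsi_5: "lsquare 5 (lnorm (lPsi 5 0 1 2 3))"
  by code_simp

section \<open>Reading a list computation at arbitrary distinct points\<close>

definition lperm :: "'a list \<Rightarrow> nat list \<Rightarrow> 'a \<Rightarrow> 'a" where
  "lperm ps g x =
     (if x \<in> set ps then ps ! (g ! (THE i. i < length ps \<and> ps ! i = x)) else x)"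

lemma lperm_nth:
  assumes "distinct ps" "i < length ps"
  shows "lperm ps g (ps ! i) = ps ! (g ! i)"
proof -
  have "(THE j. j < length ps \<and> ps ! j = ps ! i) = i"
    using assms by (intro the_equality) (auto simp: nth_eq_iff_index_eq)
  with assms show ?thesis by (simp add: lperm_def)
qed

lemma lperm_eqI:
  assumes "distinct ps" and "\<And>i. i < length ps \<Longrightarrow> f (ps ! i) = ps ! (g ! i)"
    and "\<And>x. x \<notin> set ps \<Longrightarrow> f x = x"
  shows "lperm ps g = f"
proof
  fix x show "lperm ps g x = f x"
  proof (cases "x \<in> set ps")
    case True
    then obtain i where "i < length ps" "x = ps ! i" by (auto simp: in_set_conv_nth)
    then show ?thesis using lperm_nth[OF assms(1)] assms(2) by simp
  qed (use assms(3) in \<open>simp add: lperm_def\<close>)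
qed

lemma lvalid_less: "lvalid N g \<Longrightarrow> i < N \<Longrightarrow> g ! i < N"
  unfolding lvalid_def by (metis atLeastLessThan_iff nth_mem set_upt)

lemma lperm_permutes:
  assumes d: "distinct ps" and v: "lvalid (length ps) g"
  shows "lperm ps g permutes set ps"
proof (rule bij_imp_permutes)
  have "lperm ps g ` set ps = set ps"
  proof
    show "lperm ps g ` set ps \<subseteq> set ps"
    proof (safe, unfold in_set_conv_nth, elim exE conjE)
      fix x i assume "i < length ps" "ps ! i = x"
      then show "\<exists>j<length ps. ps ! j = lperm ps g x"
        using lvalid_less[OF v] lperm_nth[OF d] by metis
    qed
    show "set ps \<subseteq> lperm ps g ` set ps"
    proof
      fix x assume "x \<in> set ps"
      then obtain i where i: "i < length ps" "x = ps ! i" by (auto simp: in_set_conv_nth)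
      then have "i \<in> set g" "length g = length ps" using v by (auto simp: lvalid_def)
      then obtain j where "j < length ps" "g ! j = i" by (auto simp: in_set_conv_nth)
      then have "x = lperm ps g (ps ! j)" "ps ! j \<in> set ps" using i d by (auto simp: lperm_nth)
      then show "x \<in> lperm ps g ` set ps" by blast
    qed
  qed
  then show "bij_betw (lperm ps g) (set ps) (set ps)"
    by (simp add: bij_betw_def eq_card_imp_inj_on)
qed (simp add: lperm_def)

lemma lperm_upt: "distinct ps \<Longrightarrow> lperm ps [0..<length ps] = id"
  by (rule lperm_eqI) auto

lemma lperm_lswap:
  assumes "distinct ps" "i < length ps" "j < length ps"
  shows "lperm ps (lswap (length ps) i j) = transpose (ps ! i) (ps ! j)"
  by (rule lperm_eqI)
    (use assms in \<open>auto simp: lswap_def transpose_def nth_eq_iff_index_eq\<close>)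

lemma lperm_lcomp:
  assumes "distinct ps" "lvalid (length ps) h"
  shows "lperm ps (lcomp g h) = lperm ps g \<circ> lperm ps h"
proof (rule lperm_eqI[OF assms(1)])
  show "(lperm ps g \<circ> lperm ps h) (ps ! i) = ps ! (lcomp g h ! i)" if "i < length ps" for i
    using assms that lvalid_less[OF assms(2) that] by (simp add: lperm_nth lcomp_def lvalid_def)
qed (simp add: lperm_def)

lemma lperm_linv:
  assumes d: "distinct ps" and v: "lvalid (length ps) g"
  shows "lperm ps (linv g) = inv' (lperm ps g)"
proof -
  let ?N = "length ps"
  have len: "length g = ?N" and "distinct g"
    using v card_distinct[of g] by (auto simp: lvalid_def)
  have "linv g ! (g ! i) = i" if "i < ?N" for i
  proof -
    have "takeWhile (\<lambda>j. j \<noteq> g ! i) g = take i g"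
      using \<open>distinct g\<close> that len by (intro takeWhile_eq_take_P_nth) (auto simp: nth_eq_iff_index_eq)
    then show ?thesis using that lvalid_less[OF v that] len by (simp add: linv_def)
  qed
  then have "lcomp (linv g) g = [0..<?N]"
    using len by (intro nth_equalityI) (auto simp: lcomp_def)
  then have "lperm ps (linv g) \<circ> lperm ps g = id"
    using lperm_lcomp[OF d v, of "linv g"] lperm_upt[OF d] by simp
  then show ?thesis
    by (metis comp_assoc comp_id id_comp permutes_inv_o(1) lperm_permutes[OF d v])
qed

text \<open>The relation between \<open>X\<close> and its adjoint turns 24 times the value of
  \<open>\<phi>\<close> at \<open>X\<close> into the quadratic form of \<open>\<phi>\<close> at the
  coefficients of \<open>X\<close>.\<close>

lemma lsquare_nonneg:
  assumes pd: "pos_def_on S \<phi>" and "finite S" and d: "distinct ps" and sub: "set ps \<subseteq> S"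
    and sq: "lsquare (length ps) X"
  shows "0 \<le> lev (\<lambda>g. \<phi> (lperm ps g)) X"
proof -
  let ?\<phi> = "\<lambda>g. \<phi> (lperm ps g)" and ?G = "\<lambda>i. lperm ps (snd (X ! i))"
    and ?x = "\<lambda>i. real_of_int (fst (X ! i))" and ?n = "length X"
  have valid: "lvalid (length ps) (snd (X ! i))" if "i < ?n" for i
    using sq that by (auto simp: lsquare_def list_all_length)
  have "0 = lev ?\<phi> (lmac (lstar X) X (lscale (-24) X))"
    using sq by (simp add: lsquare_def)
  also have "\<dots> = (\<Sum>x\<leftarrow>lstar X. \<Sum>y\<leftarrow>X. of_int (fst x) * of_int (fst y) *
      ?\<phi> (lcomp (snd x) (snd y))) - 24 * lev ?\<phi> X"
    by (simp add: lev_lmac lev_lscale)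
  also have "(\<Sum>x\<leftarrow>lstar X. \<Sum>y\<leftarrow>X. of_int (fst x) * of_int (fst y) * ?\<phi> (lcomp (snd x) (snd y))) =
      (\<Sum>i<?n. \<Sum>j<?n. ?x i * ?x j * \<phi> (inv' (?G i) \<circ> ?G j))"
    by (auto simp: sum_list_sum_nth lstar_def split_def atLeast0LessThan valid d
        lperm_lcomp lperm_linv intro!: sum.cong)
  finally have eq: "24 * lev ?\<phi> X = (\<Sum>i<?n. \<Sum>j<?n. ?x i * ?x j * \<phi> (inv' (?G i) \<circ> ?G j))"
    by simp
  have "0 \<le> 24 * lev ?\<phi> X"
    unfolding eq using lperm_permutes[OF d valid] sub
    by (intro pos_def_on_family[OF pd \<open>finite S\<close>]) (auto intro: permutes_subset)
  then show ?thesis by simp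
qed

subsection \<open>Symmetrised coefficients as squares\<close>

text \<open>
  Let \<open>Q\<close> be the sum of \<open>c\<^sub>p c\<^sub>q (1 + (p q) - (p z) - (q z))\<close> in the group algebra and let \<open>D\<close> be the sum
  of the \<open>c\<^sub>p c\<^sub>q\<close>, counted with factor 4 if \<open>p = q\<close> and 2 otherwise. Positivity of \<open>D Q - Q\<^sup>2\<close> implies
  that of \<open>Q\<close>. Symmetrised over \<open>p, q, r, s\<close>, its coefficients are elements \<open>\<Psi>\<close> of the group algebra
  on at most five points, and they satisfy \<open>\<Psi>* \<Psi> = 24 \<Psi>\<close>.
\<close>

definition octo_terms :: "'a \<Rightarrow> 'a \<Rightarrow> 'a \<Rightarrow> (real \<times> ('a \<Rightarrow> 'a)) list" where
  "octo_terms z p q =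
     [(1, id), (1, transpose p q), (-1, transpose p z), (-1, transpose q z)]"

definition octo_lin :: "(('a \<Rightarrow> 'a) \<Rightarrow> real) \<Rightarrow> 'a \<Rightarrow> 'a \<Rightarrow> 'a \<Rightarrow> real" where
  "octo_lin \<phi> z p q = (\<Sum>x\<leftarrow>octo_terms z p q. fst x * \<phi> (snd x))"

definition octo_quad :: "(('a \<Rightarrow> 'a) \<Rightarrow> real) \<Rightarrow> 'a \<Rightarrow> 'a \<Rightarrow> 'a \<Rightarrow> 'a \<Rightarrow> 'a \<Rightarrow> real" where
  "octo_quad \<phi> z p q r s =
     (\<Sum>x\<leftarrow>octo_terms z p q. \<Sum>y\<leftarrow>octo_terms z r s. fst x * fst y * \<phi> (snd x \<circ> snd y))"

definition octo_diff :: "(('a \<Rightarrow> 'a) \<Rightarrow> real) \<Rightarrow> 'a \<Rightarrow> 'a \<Rightarrow> 'a \<Rightarrow> 'a \<Rightarrow> 'a \<Rightarrow> real" where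
  "octo_diff \<phi> z p q r s =
     (if p = q then 4 else 2) * octo_lin \<phi> z r s - octo_quad \<phi> z p q r s"

lemma lev_octo_diff:
  assumes d: "distinct ps" and N: "N = length ps" and less: "a < N" "b < N" "c < N" "e < N"
    and "ps \<noteq> []"
  shows "lev (\<lambda>g. \<phi> (lperm ps g)) (lmac (lscale (-1) (lB N a b (N - 1))) (lB N c e (N - 1))
           (lscale (if a = b then 4 else 2) (lB N c e (N - 1)))) =
         octo_diff \<phi> (ps ! (N - 1)) (ps ! a) (ps ! b) (ps ! c) (ps ! e)"
proof -
  have valid: "lvalid N (snd x)" if "x \<in> set (lB N i j k)" "i < N" "j < N" "k < N" for x i j k
    using that by (auto simp: lB_def lvalid_def lswap_def image_iff split: if_splits)
  have "N - 1 < N" using assms by (cases ps) auto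
  note less = less this
  \<comment> \<open>Distinctness of \<open>ps\<close> matches the case split on list positions with
    the one on points in \<open>octo_diff\<close>.\<close>
  have eq: "ps ! a = ps ! b \<longleftrightarrow> a = b" using d less N by (simp add: nth_eq_iff_index_eq)
  have lin: "lev (\<lambda>g. \<phi> (lperm ps g)) (lB N c e (N - 1)) =
      octo_lin \<phi> (ps ! (N - 1)) (ps ! c) (ps ! e)"
    using less unfolding N by (simp add: lB_def octo_lin_def octo_terms_def lperm_upt[OF d] lperm_lswap[OF d])
  have comp: "lperm ps (lcomp (snd x) (snd y)) = lperm ps (snd x) \<circ> lperm ps (snd y)"
    if "y \<in> set (lB N c e (N - 1))" for x y :: "int \<times> nat list"
    using lperm_lcomp[OF d] valid[OF that] less unfolding N by blast
  have "(\<Sum>x\<leftarrow>lscale (-1) (lB N a b (N - 1)). \<Sum>y\<leftarrow>lB N c e (N - 1). of_int (fst x) * of_int (fst y) *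
         \<phi> (lperm ps (lcomp (snd x) (snd y)))) =
     (\<Sum>x\<leftarrow>lscale (-1) (lB N a b (N - 1)). \<Sum>y\<leftarrow>lB N c e (N - 1). of_int (fst x) * of_int (fst y) *
         \<phi> (lperm ps (snd x) \<circ> lperm ps (snd y)))"
    by (intro arg_cong[of _ _ sum_list] map_cong refl) (simp add: comp)
  also have "\<dots> = - octo_quad \<phi> (ps ! (N - 1)) (ps ! a) (ps ! b) (ps ! c) (ps ! e)"
    using less unfolding N
    by (simp add: lB_def lscale_def octo_quad_def octo_terms_def lperm_upt[OF d] lperm_lswap[OF d])
  finally show ?thesis
    by (simp add: lev_lmac lev_lscale lin octo_diff_def eq del: One_nat_def)
qed

definition octo_sym :: "(('a \<Rightarrow> 'a) \<Rightarrow> real) \<Rightarrow> 'a \<Rightarrow> 'a \<Rightarrow> 'a \<Rightarrow> 'a \<Rightarrow> 'a \<Rightarrow> real" where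
  "octo_sym \<phi> z p q r s =
     octo_diff \<phi> z p q r s + octo_diff \<phi> z r s p q + octo_diff \<phi> z p r q s +
     octo_diff \<phi> z q s p r + octo_diff \<phi> z p s q r + octo_diff \<phi> z q r p s"

lemma octo_sym_pattern:
  assumes pd: "pos_def_on S \<phi>" and "finite S" and d: "distinct ps" and sub: "set ps \<subseteq> S"
    and N: "N = length ps" and less: "p < N" "q < N" "r < N" "s < N"
    and sq: "lsquare N (lnorm (lPsi N p q r s))"
  shows "0 \<le> octo_sym \<phi> (ps ! (N - 1)) (ps ! p) (ps ! q) (ps ! r) (ps ! s)"
proof -
  have "ps \<noteq> []" using less N by auto
  note ld = lev_octo_diff[OF d N _ _ _ _ \<open>ps \<noteq> []\<close>]
  have "0 \<le> lev (\<lambda>g. \<phi> (lperm ps g)) (lnorm (lPsi N p q r s))"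
    by (rule lsquare_nonneg[OF assms(1-4)]) (use sq N in simp)
  also have "\<dots> = octo_sym \<phi> (ps ! (N - 1)) (ps ! p) (ps ! q) (ps ! r) (ps ! s)"
    unfolding lev_lnorm lPsi_def Let_def octo_sym_def lev_append
    by (simp only: ld less add.assoc)
  finally show ?thesis .
qed

text \<open>As \<open>z\<close> differs from the other points, only coincidences among
  \<open>p, q, r, s\<close> matter: one case for each of the 15 set partitions, each settled by its
  own computed identity.\<close>

lemma octo_sym_nonneg:
  assumes pd: "pos_def_on S \<phi>" and "finite S" and mem: "{p, q, r, s, z} \<subseteq> S"
    and "z \<notin> {p, q, r, s}"
  shows "0 \<le> octo_sym \<phi> z p q r s"
proof -
  have z: "p \<noteq> z" "q \<noteq> z" "r \<noteq> z" "s \<noteq> z" using assms(4) by auto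
  note pat = octo_sym_pattern[OF pd \<open>finite S\<close>]
  note sq = lsquare_lPsi_small
  consider
    "p = q" "p = r" "p = s" | "p = q" "p = r" "p \<noteq> s" | "p = q" "p = s" "p \<noteq> r"
  | "p = q" "p \<noteq> r" "r = s" | "p = q" "p \<noteq> r" "p \<noteq> s" "r \<noteq> s"
  | "p \<noteq> q" "p = r" "p = s" | "p \<noteq> q" "p = r" "q = s"
  | "p \<noteq> q" "p = r" "p \<noteq> s" "q \<noteq> s"
  | "p \<noteq> q" "q = r" "p = s" | "p \<noteq> q" "q = r" "q = s" | "p \<noteq> q" "q = r" "p \<noteq> s" "q \<noteq> s"
  | "p \<noteq> q" "p \<noteq> r" "q \<noteq> r" "p = s" | "p \<noteq> q" "p \<noteq> r" "q \<noteq> r" "q = s"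
  | "p \<noteq> q" "p \<noteq> r" "q \<noteq> r" "r = s"
  | "p \<noteq> q" "p \<noteq> r" "q \<noteq> r" "p \<noteq> s" "q \<noteq> s" "r \<noteq> s"
    by argo
  then show ?thesis
  proof cases
    case 1 then show ?thesis using pat[of "[p, z]" 2 0 0 0 0, OF _ _ _ _ _ _ _ sq(1)] mem z by simp
  next
    case 2 then show ?thesis using pat[of "[p, s, z]" 3 0 0 0 1, OF _ _ _ _ _ _ _ sq(2)] mem z by simp
  next
    case 3 then show ?thesis using pat[of "[p, r, z]" 3 0 0 1 0, OF _ _ _ _ _ _ _ sq(3)] mem z by simp
  next
    case 4 then show ?thesis using pat[of "[p, r, z]" 3 0 0 1 1, OF _ _ _ _ _ _ _ sq(4)] mem z by simp
  next
    case 5 then show ?thesis using pat[of "[p, r, s, z]" 4 0 0 1 2, OF _ _ _ _ _ _ _ sq(9)] mem z by simp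
  next
    case 6 then show ?thesis using pat[of "[p, q, z]" 3 0 1 0 0, OF _ _ _ _ _ _ _ sq(5)] mem z by simp
  next
    case 7 then show ?thesis using pat[of "[p, q, z]" 3 0 1 0 1, OF _ _ _ _ _ _ _ sq(6)] mem z by simp
  next
    case 8 then show ?thesis using pat[of "[p, q, s, z]" 4 0 1 0 2, OF _ _ _ _ _ _ _ sq(10)] mem z by simp
  next
    case 9 then show ?thesis using pat[of "[p, q, z]" 3 0 1 1 0, OF _ _ _ _ _ _ _ sq(7)] mem z by simp
  next
    case 10 then show ?thesis using pat[of "[p, q, z]" 3 0 1 1 1, OF _ _ _ _ _ _ _ sq(8)] mem z by simp
  next
    case 11 then show ?thesis using pat[of "[p, q, s, z]" 4 0 1 1 2, OF _ _ _ _ _ _ _ sq(11)] mem z by simp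
  next
    case 12 then show ?thesis using pat[of "[p, q, r, z]" 4 0 1 2 0, OF _ _ _ _ _ _ _ sq(12)] mem z by simp
  next
    case 13 then show ?thesis using pat[of "[p, q, r, z]" 4 0 1 2 1, OF _ _ _ _ _ _ _ sq(13)] mem z by simp
  next
    case 14 then show ?thesis using pat[of "[p, q, r, z]" 4 0 1 2 2, OF _ _ _ _ _ _ _ sq(14)] mem z by simp
  next
    case 15
    let ?ps = "[p, q, r, s, z]"
    have "distinct ?ps" using 15 z by simp
    moreover have "set ?ps \<subseteq> S" using mem by simp
    moreover have "5 = length ?ps" by simp
    ultimately have "0 \<le> octo_sym \<phi> (?ps ! (5 - 1)) (?ps ! 0) (?ps ! 1) (?ps ! 2) (?ps ! 3)"
      by (rule pat) (use lsquare_lPsi_5 in \<open>simp_all only: rel_simps\<close>)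
    then show ?thesis by (simp only: nth_Cons_0 nth_Cons_numeral diff_numeral_special arith_simps) simp
  qed
qed

text \<open>In terms of energies: the star with rates \<open>c\<close> at the centre
  \<open>z\<close> dominates the network on \<open>I\<close> with rates \<open>c p * c q\<close>
  divided by the total rate; the factor 2 is due to ordered pairs on the left. The proof evaluates
  \<open>\<phi>\<close> at \<open>D Q - Q^2\<close> and at \<open>Q^2\<close>, both of which are
  nonnegative.\<close>

lemma octopus:
  assumes pd: "pos_def_on S \<phi>" and "finite S" and "I \<subseteq> S" and "z \<in> S" and "z \<notin> I"
    and c: "\<And>i. i \<in> I \<Longrightarrow> 0 \<le> c i"
  shows "(\<Sum>p\<in>I. \<Sum>q\<in>I. c p * c q * (\<phi> id - \<phi> (transpose p q))) \<le>
     2 * (\<Sum>p\<in>I. c p) * (\<Sum>p\<in>I. c p * (\<phi> id - \<phi> (transpose p z)))"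
proof -
  have "finite I" using assms finite_subset by blast
  let ?d = "\<lambda>p q. if p = q then 4 else 2 :: real"
  define Q where "Q = (\<Sum>p\<in>I. \<Sum>q\<in>I. c p * c q * octo_lin \<phi> z p q)"
  \<comment> \<open>\<open>D\<close> is the value of \<open>Q\<close> at the sign character: a pair
    \<open>p \<noteq> q\<close> contributes \<open>1 - 1 + 1 + 1 = 2\<close> and
    \<open>p = q\<close> contributes \<open>2 + 2 = 4\<close>. At the trivial character
    \<open>Q\<close> vanishes, so positivity of \<open>D Q - Q^2\<close> is a sharp spectral
    statement at both ends.\<close>
  define D where "D = (\<Sum>p\<in>I. \<Sum>q\<in>I. c p * c q * ?d p q)"
  define T where "T f = (\<Sum>p\<in>I. \<Sum>q\<in>I. \<Sum>r\<in>I. \<Sum>s\<in>I. c p * c q * c r * c s * f p q r s)"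
    for f :: "'a \<Rightarrow> 'a \<Rightarrow> 'a \<Rightarrow> 'a \<Rightarrow> real"
  have T_add: "T (\<lambda>p q r s. f p q r s + g p q r s) = T f + T g" for f g
    by (simp add: T_def distrib_left sum.distrib)
  have T_diff: "T (\<lambda>p q r s. f p q r s - g p q r s) = T f - T g" for f g
    by (simp add: T_def right_diff_distrib sum_subtractf)
  have T_12: "T (\<lambda>p q r s. f q p r s) = T f" for f
    unfolding T_def by (subst sum.swap) (simp add: mult.commute mult.left_commute)
  have T_23: "T (\<lambda>p q r s. f p r q s) = T f" for f
    unfolding T_def
    by (rule sum.cong[OF refl], subst sum.swap) (simp add: mult.commute mult.left_commute)
  have T_34: "T (\<lambda>p q r s. f p q s r) = T f" for f
    unfolding T_def
    by (rule sum.cong[OF refl], rule sum.cong[OF refl], subst sum.swap)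
      (simp add: mult.commute mult.left_commute)
  \<comment> \<open>The weight \<open>c p * c q * c r * c s\<close> is symmetric, so
    \<open>T\<close> does not see the order of the indices and each of the six parts of
    \<open>octo_sym\<close> contributes the same amount.\<close>
  let ?f = "\<lambda>p q r s. octo_diff \<phi> z p q r s"
  have perm1: "T (\<lambda>p q r s. ?f p r q s) = T ?f" by (rule T_23)
  have perm2: "T (\<lambda>p q r s. ?f p s q r) = T ?f"
    using T_34[of "\<lambda>p q r s. ?f p r q s"] perm1 by simp
  have perm3: "T (\<lambda>p q r s. ?f q r p s) = T ?f"
    using T_12[of "\<lambda>p q r s. ?f p r q s"] perm1 by simp
  have perm4: "T (\<lambda>p q r s. ?f q s p r) = T ?f"
    using T_34[of "\<lambda>p q r s. ?f q r p s"] perm3 by simp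
  have perm5: "T (\<lambda>p q r s. ?f r s p q) = T ?f"
    using T_23[of "\<lambda>p q r s. ?f q s p r"] perm4 by simp
  have "0 \<le> T (octo_sym \<phi> z)"
    unfolding T_def using assms
    by (intro sum_nonneg mult_nonneg_nonneg octo_sym_nonneg[OF pd \<open>finite S\<close>] c) auto
  also have "T (octo_sym \<phi> z) = 6 * T ?f"
    unfolding octo_sym_def T_add perm1 perm2 perm3 perm4 perm5 by simp
  also have "T ?f = D * Q - T (octo_quad \<phi> z)"
  proof -
    have "T (\<lambda>p q r s. ?d p q * octo_lin \<phi> z r s) = (\<Sum>p\<in>I. \<Sum>q\<in>I. c p * c q * ?d p q * Q)"
      unfolding T_def Q_def by (intro sum.cong refl) (simp only: sum_distrib_left mult_ac)
    also have "\<dots> = D * Q" unfolding D_def by (simp only: sum_distrib_right)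
    finally have "T (\<lambda>p q r s. ?d p q * octo_lin \<phi> z r s) = D * Q" .
    then show ?thesis unfolding octo_diff_def T_diff by simp
  qed
  finally have DQ: "T (octo_quad \<phi> z) \<le> D * Q" by simp
  \<comment> \<open>All terms of \<open>Q\<close> are involutions, so \<open>Q\<close> is
    self-adjoint and \<open>Q^2\<close> gives a value of the quadratic form of
    \<open>\<phi>\<close>.\<close>
  have "0 \<le> T (octo_quad \<phi> z)"
  proof -
    let ?B = "I \<times> I \<times> {..<4::nat}"
    let ?x = "\<lambda>(p, q, k). c p * c q * fst (octo_terms z p q ! k)"
    let ?g = "\<lambda>(p, q, k). snd (octo_terms z p q ! k)"
    have len: "length (octo_terms z p q) = 4" for p q by (simp add: octo_terms_def)
    have four: "{..<4::nat} = {0, 1, 2, 3}" by auto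
    have perm: "?g b permutes S" if "b \<in> ?B" for b
      using that assms(3,4) unfolding four
      by (auto simp: octo_terms_def permutes_id intro!: permutes_swap_id)
    have inv': "inv' (?g b) = ?g b" if "b \<in> ?B" for b
      using that unfolding four by (auto simp: octo_terms_def)
    have "0 \<le> (\<Sum>a\<in>?B. \<Sum>b\<in>?B. ?x a * ?x b * \<phi> (inv' (?g a) \<circ> ?g b))"
      by (rule pos_def_on_family[OF pd \<open>finite S\<close>]) (use perm \<open>finite I\<close> in auto)
    also have "\<dots> = (\<Sum>a\<in>?B. \<Sum>b\<in>?B. ?x a * ?x b * \<phi> (?g a \<circ> ?g b))"
      by (intro sum.cong refl) (simp only: inv')
    also have "\<dots> = (\<Sum>p\<in>I. \<Sum>q\<in>I. \<Sum>k<4. \<Sum>r\<in>I. \<Sum>s\<in>I. \<Sum>l<4.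
        ?x (p, q, k) * ?x (r, s, l) * \<phi> (?g (p, q, k) \<circ> ?g (r, s, l)))"
      by (simp only: sum.cartesian_product' prod.case)
    also have "\<dots> = (\<Sum>p\<in>I. \<Sum>q\<in>I. \<Sum>r\<in>I. \<Sum>s\<in>I. \<Sum>k<4. \<Sum>l<4.
        ?x (p, q, k) * ?x (r, s, l) * \<phi> (?g (p, q, k) \<circ> ?g (r, s, l)))"
      by (simp only: sum.swap[of _ "{..<4}" I])
    also have "\<dots> = T (octo_quad \<phi> z)"
      unfolding T_def octo_quad_def
      by (simp add: sum_list_sum_nth len atLeast0LessThan sum_distrib_left mult_ac)
    finally show ?thesis .
  qed
  with DQ have "0 \<le> D * Q" by linarith
  have "0 \<le> Q"
  proof (cases "D = 0")
    \<comment> \<open>\<open>D\<close> contains the squares \<open>4 * (c p)^2\<close>, so it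
      vanishes only if all rates do.\<close>
    case True
    have "c p = 0" if "p \<in> I" for p
    proof -
      have "\<forall>p\<in>I. (\<Sum>q\<in>I. c p * c q * ?d p q) = 0"
        using True \<open>finite I\<close> c unfolding D_def
        by (subst (asm) sum_nonneg_eq_0_iff) (auto intro!: sum_nonneg)
      with that have "(\<Sum>q\<in>I. c p * c q * ?d p q) = 0" by blast
      then have "\<forall>q\<in>I. c p * c q * ?d p q = 0"
        using \<open>finite I\<close> c that by (subst (asm) sum_nonneg_eq_0_iff) auto
      then show ?thesis using that by auto
    qed
    then show ?thesis unfolding Q_def by simp
  next
    case False
    moreover have "0 \<le> D" unfolding D_def using c by (intro sum_nonneg) auto
    ultimately show ?thesis using \<open>0 \<le> D * Q\<close> by (simp add: zero_le_mult_iff)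
  qed
  also have "Q = 2 * (\<Sum>p\<in>I. c p) * (\<Sum>p\<in>I. c p * (\<phi> id - \<phi> (transpose p z))) -
      (\<Sum>p\<in>I. \<Sum>q\<in>I. c p * c q * (\<phi> id - \<phi> (transpose p q)))"
  proof -
    have "Q = (\<Sum>p\<in>I. \<Sum>q\<in>I. c q * (c p * (\<phi> id - \<phi> (transpose p z)))) +
        (\<Sum>p\<in>I. \<Sum>q\<in>I. c p * (c q * (\<phi> id - \<phi> (transpose q z)))) -
        (\<Sum>p\<in>I. \<Sum>q\<in>I. c p * c q * (\<phi> id - \<phi> (transpose p q)))"
      unfolding Q_def sum.distrib[symmetric] sum_subtractf[symmetric]
      by (intro sum.cong refl) (simp add: octo_lin_def octo_terms_def algebra_simps)
    also have "(\<Sum>p\<in>I. \<Sum>q\<in>I. c q * (c p * (\<phi> id - \<phi> (transpose p z)))) =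
        (\<Sum>p\<in>I. c p) * (\<Sum>p\<in>I. c p * (\<phi> id - \<phi> (transpose p z)))"
      by (subst sum.swap) (simp add: sum_product)
    also have "(\<Sum>p\<in>I. \<Sum>q\<in>I. c p * (c q * (\<phi> id - \<phi> (transpose q z)))) =
        (\<Sum>p\<in>I. c p) * (\<Sum>p\<in>I. c p * (\<phi> id - \<phi> (transpose p z)))"
      by (simp add: sum_product)
    finally show ?thesis by (simp only: mult_2 distrib_right)
  qed
  finally show ?thesis by simp
qed

section \<open>Hermitian linear algebra\<close>

lemma cscalar_prod_sum:
  fixes v w :: "complex vec"
  shows "w \<in> carrier_vec n \<Longrightarrow> v \<bullet>c w = (\<Sum>i<n. v $ i * cnj (w $ i))"
  by (auto simp: scalar_prod_def atLeast0LessThan intro!: sum.cong)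

lemma cs_add_left:
  fixes u v w :: "complex vec"
  assumes "u \<in> carrier_vec n" "v \<in> carrier_vec n" "w \<in> carrier_vec n"
  shows "(u + v) \<bullet>c w = u \<bullet>c w + v \<bullet>c w"
  using assms by (simp add: cscalar_prod_sum[of _ n] distrib_right sum.distrib)

lemma cs_add_right:
  fixes u v w :: "complex vec"
  assumes "u \<in> carrier_vec n" "v \<in> carrier_vec n" "w \<in> carrier_vec n"
  shows "w \<bullet>c (u + v) = w \<bullet>c u + w \<bullet>c v"
  using assms by (simp add: cscalar_prod_sum[of _ n] distrib_left sum.distrib)

lemma cs_minus_left:
  fixes u v w :: "complex vec"
  assumes "u \<in> carrier_vec n" "v \<in> carrier_vec n" "w \<in> carrier_vec n"
  shows "(u - v) \<bullet>c w = u \<bullet>c w - v \<bullet>c w"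
  using assms by (simp add: cscalar_prod_sum[of _ n] left_diff_distrib sum_subtractf)

lemma cs_minus_right:
  fixes u v w :: "complex vec"
  assumes "u \<in> carrier_vec n" "v \<in> carrier_vec n" "w \<in> carrier_vec n"
  shows "w \<bullet>c (u - v) = w \<bullet>c u - w \<bullet>c v"
  using assms by (simp add: cscalar_prod_sum[of _ n] right_diff_distrib sum_subtractf)

lemma cs_smult_left:
  fixes v w :: "complex vec"
  assumes "v \<in> carrier_vec n" "w \<in> carrier_vec n"
  shows "(c \<cdot>\<^sub>v v) \<bullet>c w = c * (v \<bullet>c w)"
  using assms by (simp add: cscalar_prod_sum[of _ n] sum_distrib_left mult.assoc)

lemma cs_smult_right:
  fixes v w :: "complex vec"
  assumes "v \<in> carrier_vec n" "w \<in> carrier_vec n"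
  shows "v \<bullet>c (c \<cdot>\<^sub>v w) = cnj c * (v \<bullet>c w)"
  using assms by (simp add: cscalar_prod_sum[of _ n] sum_distrib_left mult_ac)

lemma cs_commute:
  fixes v w :: "complex vec"
  assumes "v \<in> carrier_vec n" "w \<in> carrier_vec n"
  shows "w \<bullet>c v = cnj (v \<bullet>c w)"
  using assms by (simp add: cscalar_prod_sum[of _ n] mult.commute)

lemma cs_zero_left [simp]:
  fixes v :: "complex vec"
  assumes "v \<in> carrier_vec n"
  shows "0\<^sub>v n \<bullet>c v = 0"
  using assms by (simp add: cscalar_prod_sum[of _ n])

definition nsq :: "complex vec \<Rightarrow> real" where
  "nsq v = Re (v \<bullet>c v)"

lemma nsq_sum: "nsq v = (\<Sum>i<dim_vec v. (cmod (v $ i))\<^sup>2)"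
  unfolding nsq_def
  by (subst cscalar_prod_sum[of _ "dim_vec v"]) (auto simp: complex_mult_cnj cmod_power2)

lemma cs_self: "v \<bullet>c v = complex_of_real (nsq v)"
proof (rule complex_eqI)
  show "Im (v \<bullet>c v) = Im (complex_of_real (nsq v))"
    by (subst cscalar_prod_sum[of _ "dim_vec v"]) auto
qed (simp add: nsq_def)

lemma nsq_unit_vec: "i < n \<Longrightarrow> nsq (unit_vec n i) = 1"
  by (subst nsq_sum, subst sum.remove[of _ i]) (auto intro!: sum.neutral)

lemma nsq_nonneg [simp]: "0 \<le> nsq v"
  unfolding nsq_sum by (intro sum_nonneg) simp

lemma nsq_eq_0_iff: "v \<in> carrier_vec n \<Longrightarrow> nsq v = 0 \<longleftrightarrow> v = 0\<^sub>v n"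
  using conjugate_square_eq_0_vec[of v n] by (simp add: cs_self)

lemma nsq_pos_iff: "v \<in> carrier_vec n \<Longrightarrow> 0 < nsq v \<longleftrightarrow> v \<noteq> 0\<^sub>v n"
  using nsq_eq_0_iff[of v n] nsq_nonneg[of v] by (auto simp: less_le simp del: nsq_nonneg)

lemma nsq_smult: "nsq (c \<cdot>\<^sub>v v) = (cmod c)\<^sup>2 * nsq v"
  by (simp add: nsq_sum norm_mult power_mult_distrib sum_distrib_left)

lemma nsq_minus:
  assumes "v \<in> carrier_vec n" "w \<in> carrier_vec n"
  shows "nsq (v - w) = nsq v + nsq w - 2 * Re (v \<bullet>c w)"
  using assms cs_commute[OF assms]
  by (simp add: nsq_def cs_minus_left[of _ n] cs_minus_right[of _ n])

lemma nsq_add: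
  assumes "v \<in> carrier_vec n" "w \<in> carrier_vec n"
  shows "nsq (v + w) = nsq v + nsq w + 2 * Re (v \<bullet>c w)"
  using assms cs_commute[OF assms]
  by (simp add: nsq_def cs_add_left[of _ n] cs_add_right[of _ n])

text \<open>Operators that are sums over the group are compared through inner products, where the
  sums become sums of complex numbers.\<close>

lemma vec_eq_csI:
  fixes v w :: "complex vec"
  assumes "v \<in> carrier_vec n" "w \<in> carrier_vec n"
    and "\<And>u. u \<in> carrier_vec n \<Longrightarrow> v \<bullet>c u = w \<bullet>c u"
  shows "v = w"
proof -
  have "(v - w) \<bullet>c (v - w) = 0"
    using assms by (simp add: cs_minus_left[of _ n])
  then have "v - w = 0\<^sub>v n" using assms conjugate_square_eq_0_vec[of "v - w" n] by simp
  then have "(v - w) $ i = 0" if "i < n" for i using that by simp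
  then show ?thesis using assms by (intro eq_vecI) auto
qed

lemma mat_adjoint_dim [simp]:
  "dim_row (mat_adjoint A) = dim_col A" "dim_col (mat_adjoint A) = dim_row A"
  by (auto simp: mat_adjoint_def)

lemma mat_adjoint_carrier [simp]:
  "A \<in> carrier_mat n m \<Longrightarrow> mat_adjoint A \<in> carrier_mat m n"
  by (auto simp: mat_adjoint_def)

lemma mat_adjoint_index [simp]:
  "i < dim_col A \<Longrightarrow> j < dim_row A \<Longrightarrow> mat_adjoint A $$ (i, j) = conjugate (A $$ (j, i))"
  by (auto simp: mat_adjoint_def mat_of_rows_def)

lemma mat_adjoint_adjoint [simp]: "mat_adjoint (mat_adjoint A) = (A :: complex mat)"
  by (rule eq_matI) auto

lemma mat_vec_index:
  fixes A :: "complex mat"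
  assumes "A \<in> carrier_mat n m" "v \<in> carrier_vec m" "i < n"
  shows "(A *\<^sub>v v) $ i = (\<Sum>j<m. A $$ (i, j) * v $ j)"
  using assms by (auto simp: scalar_prod_def atLeast0LessThan intro!: sum.cong)

lemma cs_adjoint:
  fixes A :: "complex mat"
  assumes A: "A \<in> carrier_mat n m" and v: "v \<in> carrier_vec m" and w: "w \<in> carrier_vec n"
  shows "(A *\<^sub>v v) \<bullet>c w = v \<bullet>c (mat_adjoint A *\<^sub>v w)"
proof -
  have w': "mat_adjoint A *\<^sub>v w \<in> carrier_vec m"
    using mat_adjoint_carrier[OF A] w by (rule mult_mat_vec_carrier)
  have "(A *\<^sub>v v) \<bullet>c w = (\<Sum>i<n. \<Sum>j<m. A $$ (i, j) * v $ j * cnj (w $ i))"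
    using w by (simp add: cscalar_prod_sum[of _ n] mat_vec_index[OF A v] sum_distrib_right)
  also have "\<dots> = (\<Sum>j<m. \<Sum>i<n. A $$ (i, j) * v $ j * cnj (w $ i))" by (rule sum.swap)
  also have "\<dots> = v \<bullet>c (mat_adjoint A *\<^sub>v w)"
    unfolding cscalar_prod_sum[OF w'] mat_vec_index[OF A v]
    by (intro sum.cong refl, subst mat_vec_index[OF mat_adjoint_carrier[OF A] w])
      (use A in \<open>auto simp: sum_distrib_left mult_ac\<close>)
  finally show ?thesis .
qed

lemma cs_adjoint_right:
  fixes A :: "complex mat"
  assumes A: "A \<in> carrier_mat n m" and v: "v \<in> carrier_vec m" and w: "w \<in> carrier_vec n"
  shows "w \<bullet>c (A *\<^sub>v v) = (mat_adjoint A *\<^sub>v w) \<bullet>c v"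
  using cs_adjoint[OF mat_adjoint_carrier[OF A] w v] by simp

lemma mat_eq_vecI:
  fixes A B :: "complex mat"
  assumes A: "A \<in> carrier_mat n m" and B: "B \<in> carrier_mat n m"
    and eq: "\<And>v. v \<in> carrier_vec m \<Longrightarrow> A *\<^sub>v v = B *\<^sub>v v"
  shows "A = B"
proof (rule eq_matI)
  fix i j assume ij: "i < dim_row B" "j < dim_col B"
  have "(A *\<^sub>v unit_vec m j) $ i = (B *\<^sub>v unit_vec m j) $ i" using eq by simp
  then show "A $$ (i, j) = B $$ (i, j)" using ij A B by auto
qed (use A B in auto)

section \<open>Subspaces as ranges of isometries\<close>

definition vec_subspace :: "nat \<Rightarrow> complex vec set \<Rightarrow> bool" where
  "vec_subspace n U \<longleftrightarrow> U \<subseteq> carrier_vec n \<and> 0\<^sub>v n \<in> U \<and>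
     (\<forall>u\<in>U. \<forall>v\<in>U. u + v \<in> U) \<and> (\<forall>c. \<forall>u\<in>U. c \<cdot>\<^sub>v u \<in> U)"

lemma subspace_iff_vec_subspace:
  "VectorSpace.subspace class_ring U (module_vec TYPE(complex) n) \<longleftrightarrow> vec_subspace n U"
proof -
  interpret vec_space "TYPE(complex)" n .
  show ?thesis
    unfolding VectorSpace.subspace_def submodule_def vec_subspace_def
    using vec_vs[of n] vec_module[of n] by (auto simp: module_vec_simps class_ring_simps)
qed

lemma vec_subspace_minus:
  assumes "vec_subspace n U" "u \<in> U" "v \<in> U"
  shows "u - v \<in> U"
proof -
  have "u - v = u + (-1) \<cdot>\<^sub>v v"
    using assms by (intro eq_vecI) (auto simp: vec_subspace_def)
  then show ?thesis using assms by (auto simp: vec_subspace_def)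
qed

text \<open>The columns are orthonormal. A subspace is carried around as the range of such a matrix,
  so that a subrepresentation acts again on some \<open>carrier_vec k\<close>.\<close>

definition isometry_mat :: "nat \<Rightarrow> nat \<Rightarrow> complex mat \<Rightarrow> bool" where
  "isometry_mat n k Q \<longleftrightarrow> Q \<in> carrier_mat n k \<and> mat_adjoint Q * Q = 1\<^sub>m k"

lemma isometry_mat_vec:
  assumes "isometry_mat n k Q" "x \<in> carrier_vec k"
  shows "mat_adjoint Q *\<^sub>v (Q *\<^sub>v x) = x"
  using assms unfolding isometry_mat_def
  by (metis assoc_mult_mat_vec mat_adjoint_carrier one_mult_mat_vec)

lemma isometry_cs:
  assumes "isometry_mat n k Q" "x \<in> carrier_vec k" "y \<in> carrier_vec k"
  shows "(Q *\<^sub>v x) \<bullet>c (Q *\<^sub>v y) = x \<bullet>c y"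
  using assms isometry_mat_vec[OF assms(1,3)] cs_adjoint[of Q n k x "Q *\<^sub>v y"]
  by (auto simp: isometry_mat_def)

lemma isometry_mat_resid:
  assumes Q: "isometry_mat n k Q" and x: "x \<in> carrier_vec n" and y: "y \<in> carrier_vec k"
  shows "(x - Q *\<^sub>v (mat_adjoint Q *\<^sub>v x)) \<bullet>c (Q *\<^sub>v y) = 0"
proof -
  have c: "Q \<in> carrier_mat n k" using Q by (simp add: isometry_mat_def)
  note ca = mat_adjoint_carrier[OF c]
  have "x \<bullet>c (Q *\<^sub>v y) = (mat_adjoint Q *\<^sub>v x) \<bullet>c y"
    by (rule cs_adjoint_right[OF c y x])
  moreover have "(Q *\<^sub>v (mat_adjoint Q *\<^sub>v x)) \<bullet>c (Q *\<^sub>v y) = (mat_adjoint Q *\<^sub>v x) \<bullet>c y"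
    using isometry_cs[OF Q _ y] ca x by (metis mult_mat_vec_carrier)
  moreover have "Q *\<^sub>v (mat_adjoint Q *\<^sub>v x) \<in> carrier_vec n"
    "Q *\<^sub>v y \<in> carrier_vec n"
    using c ca x y by (auto intro!: mult_mat_vec_carrier)
  ultimately show ?thesis using x by (simp add: cs_minus_left[of _ n])
qed

lemma isometry_mat_Bessel:
  assumes Q: "isometry_mat n k Q" and x: "x \<in> carrier_vec n"
  shows "nsq (mat_adjoint Q *\<^sub>v x) \<le> nsq x"
proof -
  have c: "Q \<in> carrier_mat n k" using Q by (simp add: isometry_mat_def)
  note ca = mat_adjoint_carrier[OF c]
  let ?y = "mat_adjoint Q *\<^sub>v x"
  have y: "?y \<in> carrier_vec k" and Qy: "Q *\<^sub>v ?y \<in> carrier_vec n"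
    using c ca x by (auto intro!: mult_mat_vec_carrier)
  have "nsq (Q *\<^sub>v ?y) = nsq ?y" using isometry_cs[OF Q y y] by (simp add: nsq_def)
  moreover have "x \<bullet>c (Q *\<^sub>v ?y) = ?y \<bullet>c ?y" by (rule cs_adjoint_right[OF c y x])
  ultimately have "nsq (x - Q *\<^sub>v ?y) = nsq x - nsq ?y"
    using nsq_minus[OF x Qy] by (simp add: nsq_def)
  then show ?thesis using nsq_nonneg[of "x - Q *\<^sub>v ?y"] by linarith
qed

text \<open>The sum of the squared moduli of the entries is \<open>k\<close> when taken by columns,
  and at most \<open>n\<close> when taken by rows, since Bessel's inequality bounds each row by 1.
  This takes the place of a dimension argument.\<close>

lemma isometry_mat_le:
  assumes Q: "isometry_mat n k Q"
  shows "k \<le> n"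
proof -
  have c: "Q \<in> carrier_mat n k" using Q by (simp add: isometry_mat_def)
  note ca = mat_adjoint_carrier[OF c]
  have row: "nsq (mat_adjoint Q *\<^sub>v unit_vec n l) = (\<Sum>i<k. (cmod (Q $$ (l, i)))\<^sup>2)" if "l < n" for l
    using that c by (auto simp: nsq_sum intro!: sum.cong)
  have col: "(\<Sum>l<n. (cmod (Q $$ (l, i)))\<^sup>2) = 1" if "i < k" for i
  proof -
    have u: "unit_vec k i \<in> carrier_vec k" by simp
    have "nsq (Q *\<^sub>v unit_vec k i) = nsq (unit_vec k i)"
      using isometry_cs[OF Q u u] by (simp add: nsq_def)
    also have "\<dots> = 1" using that by (rule nsq_unit_vec)
    finally show ?thesis using that c by (auto simp: nsq_sum)
  qed
  have "real k = (\<Sum>i<k. \<Sum>l<n. (cmod (Q $$ (l, i)))\<^sup>2)" by (simp add: col)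
  also have "\<dots> = (\<Sum>l<n. nsq (mat_adjoint Q *\<^sub>v unit_vec n l))"
    by (subst sum.swap) (simp add: row)
  also have "\<dots> \<le> (\<Sum>l<n. nsq (unit_vec n l))"
    by (intro sum_mono isometry_mat_Bessel[OF Q]) simp
  also have "\<dots> = real n"
    by (simp add: nsq_unit_vec)
  finally show ?thesis by simp
qed

lemma isometry_mat_square:
  assumes "isometry_mat n n Q"
  shows "Q * mat_adjoint Q = 1\<^sub>m n"
  using assms mat_mult_left_right_inverse[of "mat_adjoint Q" n Q] by (auto simp: isometry_mat_def)

lemma isometry_mat_of_orthonormal:
  assumes q: "\<And>i. i < k \<Longrightarrow> q i \<in> carrier_vec n"
    and on: "\<And>i j. i < k \<Longrightarrow> j < k \<Longrightarrow> q i \<bullet>c q j = of_bool (i = j)"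
  shows "isometry_mat n k (mat n k (\<lambda>(l, i). q i $ l))" (is "isometry_mat n k ?Q")
proof -
  have c: "?Q \<in> carrier_mat n k" by simp
  have "mat_adjoint ?Q * ?Q = 1\<^sub>m k"
  proof (rule eq_matI)
    fix i j assume "i < dim_row (1\<^sub>m k :: complex mat)" "j < dim_col (1\<^sub>m k :: complex mat)"
    then have ij: "i < k" "j < k" by auto
    have "(mat_adjoint ?Q * ?Q) $$ (i, j) = (\<Sum>l<n. mat_adjoint ?Q $$ (i, l) * ?Q $$ (l, j))"
      using ij by (simp add: scalar_prod_def atLeast0LessThan del: mat_adjoint_index)
    also have "\<dots> = q j \<bullet>c q i"
      unfolding cscalar_prod_sum[OF q[OF ij(1)]]
      using ij by (intro sum.cong refl) (simp add: mult.commute)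
    finally show "(mat_adjoint ?Q * ?Q) $$ (i, j) = 1\<^sub>m k $$ (i, j)" using on ij by simp
  qed (use mat_adjoint_carrier[OF c] in auto)
  then show ?thesis by (simp add: isometry_mat_def)
qed

lemma mat_of_cols_vec_subspace:
  assumes U: "vec_subspace n U" and q: "\<And>i. i < k \<Longrightarrow> q i \<in> U" and x: "x \<in> carrier_vec k"
  shows "mat n k (\<lambda>(l, i). q i $ l) *\<^sub>v x \<in> U"
  using q x
proof (induction k arbitrary: x)
  case 0
  have "mat n 0 (\<lambda>(l, i). q i $ l) *\<^sub>v x = 0\<^sub>v n" using 0 by (intro eq_vecI) (auto simp: scalar_prod_def)
  then show ?case using U by (simp add: vec_subspace_def)
next
  case (Suc k)
  let ?y = "vec k (\<lambda>i. x $ i)"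
  have "q k \<in> carrier_vec n" using Suc.prems U by (auto simp: vec_subspace_def)
  then have "mat n (Suc k) (\<lambda>(l, i). q i $ l) *\<^sub>v x =
      mat n k (\<lambda>(l, i). q i $ l) *\<^sub>v ?y + (x $ k) \<cdot>\<^sub>v q k"
    using Suc.prems by (intro eq_vecI) (auto simp: scalar_prod_def)
  moreover have "mat n k (\<lambda>(l, i). q i $ l) *\<^sub>v ?y \<in> U" using Suc by auto
  ultimately show ?case using U Suc.prems by (auto simp: vec_subspace_def)
qed

text \<open>The bound \<open>k \<le> n\<close> gives an orthonormal family in \<open>U\<close> of
  maximal length. A vector of \<open>U\<close> outside its span would extend it, after subtracting
  the projection and normalising.\<close>

lemma vec_subspace_isometry:
  assumes U: "vec_subspace n U"
  obtains k Q where "isometry_mat n k Q" "U = {Q *\<^sub>v x | x. x \<in> carrier_vec k}"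
proof -
  define ON where "ON k q \<longleftrightarrow> (\<forall>i<k. q i \<in> U) \<and> (\<forall>i<k. \<forall>j<k. q i \<bullet>c q j = of_bool (i = j))"
    for k and q :: "nat \<Rightarrow> complex vec"
  have sub: "U \<subseteq> carrier_vec n" using U by (simp add: vec_subspace_def)
  let ?M = "\<lambda>k q. mat n k (\<lambda>(l, i). q i $ l) :: complex mat"
  have iso: "isometry_mat n k (?M k q)" if "ON k q" for k q
    using that sub by (intro isometry_mat_of_orthonormal) (auto simp: ON_def)
  have "\<exists>k. (\<exists>q. ON k q) \<and> (\<forall>j. (\<exists>q. ON j q) \<longrightarrow> j \<le> k)"
    by (rule ex_has_greatest_nat[of "\<lambda>k. \<exists>q. ON k q" 0 id "Suc n", simplified])
      (auto simp: ON_def less_Suc_eq_le intro: isometry_mat_le[OF iso])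
  then obtain k q where on: "ON k q" and max: "\<And>j q'. ON j q' \<Longrightarrow> j \<le> k" by blast
  let ?Q = "?M k q"
  note Q = iso[OF on]
  have c: "?Q \<in> carrier_mat n k" by simp
  note ca = mat_adjoint_carrier[OF c]
  have "u \<in> {?Q *\<^sub>v x | x. x \<in> carrier_vec k}" if u: "u \<in> U" for u
  proof -
    have un: "u \<in> carrier_vec n" using sub u by blast
    let ?y = "mat_adjoint ?Q *\<^sub>v u"
    let ?w = "u - ?Q *\<^sub>v ?y"
    have y: "?y \<in> carrier_vec k" using ca un by (rule mult_mat_vec_carrier)
    have "?Q *\<^sub>v ?y \<in> U" using on y by (intro mat_of_cols_vec_subspace[OF U]) (auto simp: ON_def)
    then have w: "?w \<in> U" using vec_subspace_minus[OF U u] by blast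
    then have wn: "?w \<in> carrier_vec n" using sub by blast
    have "?w = 0\<^sub>v n"
    proof (rule ccontr)
      assume "?w \<noteq> 0\<^sub>v n"
      then have pos: "0 < nsq ?w" using nsq_pos_iff[OF wn] by simp
      have orth: "?w \<bullet>c q i = 0" if i: "i < k" for i
      proof -
        have "?Q *\<^sub>v unit_vec k i = q i"
          using on sub i by (intro eq_vecI) (auto simp: ON_def)
        then show ?thesis using isometry_mat_resid[OF Q un, of "unit_vec k i"] by simp
      qed
      let ?c = "complex_of_real (1 / sqrt (nsq ?w))"
      have cU: "?c \<cdot>\<^sub>v ?w \<in> U" using U w by (simp add: vec_subspace_def)
      have unit: "(?c \<cdot>\<^sub>v ?w) \<bullet>c (?c \<cdot>\<^sub>v ?w) = 1"
        using pos by (simp add: cs_self nsq_smult power_divide norm_divide)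
      have left: "(?c \<cdot>\<^sub>v ?w) \<bullet>c q i = 0" "q i \<bullet>c (?c \<cdot>\<^sub>v ?w) = 0" if "i < k" for i
      proof -
        have qi: "q i \<in> carrier_vec n" using on that sub by (auto simp: ON_def)
        show l: "(?c \<cdot>\<^sub>v ?w) \<bullet>c q i = 0"
          using orth[OF that] cs_smult_left[OF wn qi] by simp
        have "?c \<cdot>\<^sub>v ?w \<in> carrier_vec n" using cU sub by blast
        from cs_commute[OF this qi] show "q i \<bullet>c (?c \<cdot>\<^sub>v ?w) = 0" using l by simp
      qed
      have "ON (Suc k) (q(k := ?c \<cdot>\<^sub>v ?w))"
        using on cU unit left unfolding ON_def by (auto simp: less_Suc_eq)
      from max[OF this] show False by simp
    qed
    then have "?w + ?Q *\<^sub>v ?y = ?Q *\<^sub>v ?y" using c y by (metis left_zero_vec mult_mat_vec_carrier)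
    moreover have "?w + ?Q *\<^sub>v ?y = u" using un c y by (intro eq_vecI) auto
    ultimately show ?thesis using y by auto
  qed
  moreover have "?Q *\<^sub>v x \<in> U" if "x \<in> carrier_vec k" for x
    using on that by (intro mat_of_cols_vec_subspace[OF U]) (auto simp: ON_def)
  ultimately have "U = {?Q *\<^sub>v x | x. x \<in> carrier_vec k}" by blast
  with Q show ?thesis using that by blast
qed

text \<open>A square isometry is onto. The strict inequality drives the inductions on the
  dimension.\<close>

lemma isometry_mat_proper:
  assumes Q: "isometry_mat n k Q" and "{Q *\<^sub>v x | x. x \<in> carrier_vec k} \<noteq> carrier_vec n"
  shows "k < n"
proof (rule ccontr)
  assume "\<not> k < n"
  then have k: "k = n" using isometry_mat_le[OF Q] by simp
  have c: "Q \<in> carrier_mat n n" using Q k by (simp add: isometry_mat_def)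
  have "v \<in> {Q *\<^sub>v x | x. x \<in> carrier_vec k}" if v: "v \<in> carrier_vec n" for v
  proof -
    have "Q *\<^sub>v (mat_adjoint Q *\<^sub>v v) = v"
      using isometry_mat_square[of n Q] Q k v c mat_adjoint_carrier[OF c]
      by (metis assoc_mult_mat_vec one_mult_mat_vec)
    moreover have "mat_adjoint Q *\<^sub>v v \<in> carrier_vec k"
      using mat_adjoint_carrier[OF c] v k by (metis mult_mat_vec_carrier)
    ultimately show ?thesis by (metis (mono_tags, lifting) mem_Collect_eq)
  qed
  then show False using assms(2) c k by auto
qed

text \<open>Phrased by inner products rather than by \<open>mat_adjoint\<close>, because the
  operators in question are known through their action on vectors.\<close>

definition hermitian_on :: "nat \<Rightarrow> complex mat \<Rightarrow> bool" where
  "hermitian_on n A \<longleftrightarrow> A \<in> carrier_mat n n \<and>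
     (\<forall>v\<in>carrier_vec n. \<forall>w\<in>carrier_vec n. (A *\<^sub>v v) \<bullet>c w = v \<bullet>c (A *\<^sub>v w))"

lemma hermitian_form_real:
  assumes "hermitian_on n A" "v \<in> carrier_vec n"
  shows "(A *\<^sub>v v) \<bullet>c v = complex_of_real (Re ((A *\<^sub>v v) \<bullet>c v))"
proof -
  have "A *\<^sub>v v \<in> carrier_vec n" using assms by (auto simp: hermitian_on_def)
  then have "(A *\<^sub>v v) \<bullet>c v = cnj ((A *\<^sub>v v) \<bullet>c v)"
    using assms cs_commute[of "A *\<^sub>v v" n v] by (simp add: hermitian_on_def)
  then show ?thesis by (metis Reals_cnj_iff of_real_Re)
qed

lemma hermitian_eigenvalue_real:
  assumes A: "hermitian_on n A" and e: "eigenvector A v x"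
  shows "x = complex_of_real (Re x)"
proof -
  have v: "v \<in> carrier_vec n" "v \<noteq> 0\<^sub>v n" "A *\<^sub>v v = x \<cdot>\<^sub>v v"
    using A e by (auto simp: eigenvector_def hermitian_on_def)
  have "(A *\<^sub>v v) \<bullet>c v = x * complex_of_real (nsq v)"
    using v by (simp add: cs_smult_left[of _ n] cs_self)
  moreover have "complex_of_real (nsq v) \<noteq> 0" using v nsq_eq_0_iff by simp
  ultimately have "x = complex_of_real (Re ((A *\<^sub>v v) \<bullet>c v) / nsq v)"
    using hermitian_form_real[OF A v(1)] by (metis nonzero_mult_div_cancel_right of_real_divide)
  then show ?thesis by simp
qed

lemma hermitian_eigenvector_exists:
  assumes A: "hermitian_on n A" and "0 < n"
  obtains v x where "eigenvector A v (complex_of_real x)"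
proof -
  have "A \<in> carrier_mat n n" using A by (simp add: hermitian_on_def)
  from spectrum_non_empty[OF this \<open>0 < n\<close>] obtain y v where e: "eigenvector A v y"
    by (auto simp: spectrum_def eigenvalue_def)
  with hermitian_eigenvalue_real[OF A e] that show ?thesis by metis
qed

lemma orth_compl_subspace:
  assumes "v \<in> carrier_vec n"
  shows "vec_subspace n {w \<in> carrier_vec n. w \<bullet>c v = 0}"
  using assms unfolding vec_subspace_def
  by (auto simp: cs_add_left[of _ n] cs_smult_left[of _ n])

text \<open>Induction on the dimension, splitting off one eigenvector at a time.\<close>

lemma hermitian_psd:
  assumes "hermitian_on n A"
    and "\<And>v x. eigenvector A v (complex_of_real x) \<Longrightarrow> 0 \<le> x"
    and "v \<in> carrier_vec n"
  shows "0 \<le> Re ((A *\<^sub>v v) \<bullet>c v)"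
  using assms
proof (induction n arbitrary: A v rule: less_induct)
  case (less n)
  note A = less.prems(1)
  have Ac: "A \<in> carrier_mat n n" using A by (simp add: hermitian_on_def)
  show ?case
  proof (cases "n = 0")
    case True
    then show ?thesis using less.prems Ac by (simp add: scalar_prod_def)
  next
    case False
    then obtain e x where e: "eigenvector A e (complex_of_real x)"
      using hermitian_eigenvector_exists[OF A] by auto
    then have "0 \<le> x" by (rule less.prems(2))
    have en: "e \<in> carrier_vec n" and e0: "e \<noteq> 0\<^sub>v n" and Ae: "A *\<^sub>v e = complex_of_real x \<cdot>\<^sub>v e"
      using e Ac by (auto simp: eigenvector_def)
    have pos: "0 < nsq e" using nsq_pos_iff[OF en] e0 by simp
    define U where "U = {w \<in> carrier_vec n. w \<bullet>c e = 0}"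
    have U: "vec_subspace n U" unfolding U_def by (rule orth_compl_subspace[OF en])
    then obtain k Q where Q: "isometry_mat n k Q" and UQ: "U = {Q *\<^sub>v y | y. y \<in> carrier_vec k}"
      by (rule vec_subspace_isometry)
    have "e \<notin> U" using pos by (simp add: U_def cs_self)
    then have "k < n" using isometry_mat_proper[OF Q] UQ en by blast
    have c: "Q \<in> carrier_mat n k" using Q by (simp add: isometry_mat_def)
    note ca = mat_adjoint_carrier[OF c]
    \<comment> \<open>The compression of \<open>A\<close> to the orthogonal complement of
      \<open>e\<close>, in orthonormal coordinates of that complement.\<close>
    define A' where "A' = mat_adjoint Q * A * Q"
    have A'c: "A' \<in> carrier_mat k k" using c ca Ac unfolding A'_def by (metis mult_carrier_mat)
    have A'v: "A' *\<^sub>v y = mat_adjoint Q *\<^sub>v (A *\<^sub>v (Q *\<^sub>v y))" if "y \<in> carrier_vec k" for y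
      unfolding A'_def assoc_mult_mat_vec[OF mult_carrier_mat[OF ca Ac] c that]
      by (rule assoc_mult_mat_vec[OF ca Ac mult_mat_vec_carrier[OF c that]])
    have Qy: "Q *\<^sub>v y \<in> carrier_vec n" "A *\<^sub>v (Q *\<^sub>v y) \<in> carrier_vec n" if "y \<in> carrier_vec k" for y
      using that c Ac by (auto intro!: mult_mat_vec_carrier)
    have form: "(A' *\<^sub>v y) \<bullet>c z = (A *\<^sub>v (Q *\<^sub>v y)) \<bullet>c (Q *\<^sub>v z)"
      if "y \<in> carrier_vec k" "z \<in> carrier_vec k" for y z
      using that Qy by (simp add: A'v cs_adjoint_right[OF c])
    have "hermitian_on k A'"
      unfolding hermitian_on_def
    proof (intro conjI ballI A'c)
      fix y z :: "complex vec" assume yz: "y \<in> carrier_vec k" "z \<in> carrier_vec k"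
      have "(A' *\<^sub>v y) \<bullet>c z = (Q *\<^sub>v y) \<bullet>c (A *\<^sub>v (Q *\<^sub>v z))"
        using A Qy yz by (simp add: form hermitian_on_def)
      also have "\<dots> = y \<bullet>c (A' *\<^sub>v z)" using Qy yz by (simp add: A'v cs_adjoint[OF c])
      finally show "(A' *\<^sub>v y) \<bullet>c z = y \<bullet>c (A' *\<^sub>v z)" .
    qed
    \<comment> \<open>The complement of the eigenvector \<open>e\<close> is invariant under the
      hermitian \<open>A\<close>, so an eigenvector of the compression is an eigenvector of
      \<open>A\<close> itself.\<close>
    moreover have "0 \<le> t" if t: "eigenvector A' y (complex_of_real t)" for y t
    proof -
      have y: "y \<in> carrier_vec k" "y \<noteq> 0\<^sub>v k" "A' *\<^sub>v y = complex_of_real t \<cdot>\<^sub>v y"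
        using t A'c by (auto simp: eigenvector_def)
      have "Q *\<^sub>v y \<in> U" using UQ y by blast
      have "(A *\<^sub>v (Q *\<^sub>v y)) \<bullet>c e = (Q *\<^sub>v y) \<bullet>c (A *\<^sub>v e)"
        using A Qy y en by (simp add: hermitian_on_def)
      also have "\<dots> = 0" using \<open>Q *\<^sub>v y \<in> U\<close> Qy[OF y(1)] en
        by (simp add: Ae cs_smult_right[of _ n] U_def)
      finally have "A *\<^sub>v (Q *\<^sub>v y) \<in> U" using Qy y by (simp add: U_def)
      then obtain z where z: "z \<in> carrier_vec k" "A *\<^sub>v (Q *\<^sub>v y) = Q *\<^sub>v z" using UQ by blast
      then have "z = A' *\<^sub>v y" using isometry_mat_vec[OF Q] y by (simp add: A'v)
      then have "A *\<^sub>v (Q *\<^sub>v y) = complex_of_real t \<cdot>\<^sub>v (Q *\<^sub>v y)"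
        using z y c by (simp add: mult_mat_vec)
      moreover have "Q *\<^sub>v y \<noteq> 0\<^sub>v n"
      proof
        assume "Q *\<^sub>v y = 0\<^sub>v n"
        then have "(Q *\<^sub>v y) \<bullet>c (Q *\<^sub>v y) = 0" by simp
        then show False using isometry_cs[OF Q y(1) y(1)] y(1,2) nsq_eq_0_iff[OF y(1)] by (simp add: cs_self)
      qed
      ultimately have "eigenvector A (Q *\<^sub>v y) (complex_of_real t)"
        using Ac Qy y by (simp add: eigenvector_def)
      then show ?thesis by (rule less.prems(2))
    qed
    ultimately have IH: "0 \<le> Re ((A' *\<^sub>v y) \<bullet>c y)" if "y \<in> carrier_vec k" for y
      using less.IH[OF \<open>k < n\<close>] that by blast
    \<comment> \<open>With \<open>a\<close> the coefficient of \<open>v\<close> along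
      \<open>e\<close>, the form splits into the part along \<open>e\<close> and the compressed
      form; both mixed terms vanish.\<close>
    define a where "a = (v \<bullet>c e) / complex_of_real (nsq e)"
    have vn: "v \<in> carrier_vec n" using less.prems by simp
    have "(v - a \<cdot>\<^sub>v e) \<bullet>c e = 0"
      using vn en pos by (simp add: cs_minus_left[of _ n] cs_smult_left[of _ n] cs_self a_def)
    then have "v - a \<cdot>\<^sub>v e \<in> U" using vn en by (simp add: U_def)
    then obtain y where y: "y \<in> carrier_vec k" "v - a \<cdot>\<^sub>v e = Q *\<^sub>v y" using UQ by blast
    let ?u = "Q *\<^sub>v y" and ?ae = "a \<cdot>\<^sub>v e"
    have un: "?u \<in> carrier_vec n" "?u \<bullet>c e = 0" using \<open>v - a \<cdot>\<^sub>v e \<in> U\<close> y by (auto simp: U_def)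
    have aen: "?ae \<in> carrier_vec n" using en by simp
    have "v = ?ae + ?u" unfolding y(2)[symmetric] using vn en by (intro eq_vecI) auto
    have Aae: "A *\<^sub>v ?ae = complex_of_real x \<cdot>\<^sub>v ?ae"
      using en Ac by (simp add: mult_mat_vec Ae smult_smult_assoc mult.commute)
    have "?ae \<bullet>c ?u = 0"
      using cs_commute[OF un(1) en] un en by (simp add: cs_smult_left[of _ n])
    moreover have "(A *\<^sub>v ?u) \<bullet>c ?ae = 0"
    proof -
      have "(A *\<^sub>v ?u) \<bullet>c ?ae = ?u \<bullet>c (A *\<^sub>v ?ae)" using A un aen by (simp add: hermitian_on_def)
      then show ?thesis using un en unfolding Aae by (simp add: cs_smult_right[of _ n])
    qed
    ultimately have "(A *\<^sub>v v) \<bullet>c v = complex_of_real (x * nsq ?ae) + (A' *\<^sub>v y) \<bullet>c y"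
      unfolding \<open>v = ?ae + ?u\<close> using un aen Ac y Qy[OF y(1)]
      by (simp add: mult_add_distrib_mat_vec[OF Ac] Aae cs_add_left[of _ n] cs_add_right[of _ n]
          cs_smult_left[OF aen] cs_self form)
    then show ?thesis using IH[OF y(1)] \<open>0 \<le> x\<close> by simp
  qed
qed

section \<open>Unitary representations of finite groups\<close>

lemma smult_mat_mult_vec:
  fixes A :: "complex mat"
  assumes A: "A \<in> carrier_mat n m" and v: "v \<in> carrier_vec m"
  shows "(c \<cdot>\<^sub>m A) *\<^sub>v v = c \<cdot>\<^sub>v (A *\<^sub>v v)"
proof (rule eq_vecI)
  fix i assume "i < dim_vec (c \<cdot>\<^sub>v (A *\<^sub>v v))"
  then have i: "i < n" using A by simp
  have cA: "c \<cdot>\<^sub>m A \<in> carrier_mat n m" using A by simp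
  have "((c \<cdot>\<^sub>m A) *\<^sub>v v) $ i = (\<Sum>j<m. c * (A $$ (i, j) * v $ j))"
    unfolding mat_vec_index[OF cA v i] using A i by (intro sum.cong refl) simp
  also have "\<dots> = c * (A *\<^sub>v v) $ i" unfolding mat_vec_index[OF A v i] sum_distrib_left ..
  finally show "((c \<cdot>\<^sub>m A) *\<^sub>v v) $ i = (c \<cdot>\<^sub>v (A *\<^sub>v v)) $ i" using A i by simp
qed (use A in simp)

locale urep = group H for H (structure) +
  fixes \<rho> :: "'a \<Rightarrow> complex mat"
  assumes fin: "finite (carrier H)" and ur: "unitary_rep H \<rho>"
begin

abbreviation d where "d \<equiv> rep_dim H \<rho>"

lemma rho_carrier [simp]: "h \<in> carrier H \<Longrightarrow> \<rho> h \<in> carrier_mat d d"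
  and rho_one: "\<rho> \<one> = 1\<^sub>m d"
  and rho_mult: "h \<in> carrier H \<Longrightarrow> k \<in> carrier H \<Longrightarrow> \<rho> (h \<otimes> k) = \<rho> h * \<rho> k"
  and rho_unitary: "h \<in> carrier H \<Longrightarrow> \<rho> h * mat_adjoint (\<rho> h) = 1\<^sub>m d"
  using ur by (auto simp: unitary_rep_def)

lemma act_in [simp]: "h \<in> carrier H \<Longrightarrow> v \<in> carrier_vec d \<Longrightarrow> \<rho> h *\<^sub>v v \<in> carrier_vec d"
  by (rule mult_mat_vec_carrier[OF rho_carrier])

lemma act_one [simp]: "v \<in> carrier_vec d \<Longrightarrow> \<rho> \<one> *\<^sub>v v = v"
  by (simp add: rho_one)

lemma act_zero [simp]: "h \<in> carrier H \<Longrightarrow> \<rho> h *\<^sub>v 0\<^sub>v d = 0\<^sub>v d"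
  using carrier_matD[OF rho_carrier[of h]] by (intro eq_vecI) auto

lemma act_act:
  "h \<in> carrier H \<Longrightarrow> k \<in> carrier H \<Longrightarrow> v \<in> carrier_vec d \<Longrightarrow>
    \<rho> h *\<^sub>v (\<rho> k *\<^sub>v v) = \<rho> (h \<otimes> k) *\<^sub>v v"
  by (simp add: rho_mult assoc_mult_mat_vec[of _ d d _ d])

lemma rho_adjoint:
  assumes h: "h \<in> carrier H"
  shows "mat_adjoint (\<rho> h) = \<rho> (inv h)"
proof -
  have c: "\<rho> (inv h) \<in> carrier_mat d d" "\<rho> h \<in> carrier_mat d d" using h by auto
  note ca = mat_adjoint_carrier[OF c(2)]
  have "\<rho> (inv h) = \<rho> (inv h) * (\<rho> h * mat_adjoint (\<rho> h))"
    using c by (simp add: rho_unitary[OF h])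
  also have "\<dots> = \<rho> (inv h) * \<rho> h * mat_adjoint (\<rho> h)"
    by (rule assoc_mult_mat[symmetric, OF c ca])
  also have "\<dots> = mat_adjoint (\<rho> h)"
    using h ca by (simp add: rho_mult[symmetric] rho_one left_mult_one_mat[of _ d d])
  finally show ?thesis by simp
qed

lemma cs_act_left:
  "h \<in> carrier H \<Longrightarrow> v \<in> carrier_vec d \<Longrightarrow> w \<in> carrier_vec d \<Longrightarrow>
    (\<rho> h *\<^sub>v v) \<bullet>c w = v \<bullet>c (\<rho> (inv h) *\<^sub>v w)"
  by (subst cs_adjoint[OF rho_carrier]) (auto simp: rho_adjoint)

lemma cs_act_act:
  "h \<in> carrier H \<Longrightarrow> v \<in> carrier_vec d \<Longrightarrow> w \<in> carrier_vec d \<Longrightarrow>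
    (\<rho> h *\<^sub>v v) \<bullet>c (\<rho> h *\<^sub>v w) = v \<bullet>c w"
  by (simp add: cs_act_left act_act)

lemma nsq_act: "h \<in> carrier H \<Longrightarrow> v \<in> carrier_vec d \<Longrightarrow> nsq (\<rho> h *\<^sub>v v) = nsq v"
  by (simp add: nsq_def cs_act_act)

abbreviation gop :: "('a \<Rightarrow> real) \<Rightarrow> complex mat" where "gop \<alpha> \<equiv> galg_rep H \<rho> \<alpha>"

lemma gop_carrier [simp]: "gop \<alpha> \<in> carrier_mat d d"
  by (simp add: galg_rep_def)

lemma gop_dim [simp]: "dim_row (gop \<alpha>) = d" "dim_col (gop \<alpha>) = d"
  by (simp_all add: galg_rep_def)

lemma gop_in [simp]: "v \<in> carrier_vec d \<Longrightarrow> gop \<alpha> *\<^sub>v v \<in> carrier_vec d"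
  by (rule mult_mat_vec_carrier[OF gop_carrier])

lemma gop_index:
  assumes "v \<in> carrier_vec d" "i < d"
  shows "(gop \<alpha> *\<^sub>v v) $ i = (\<Sum>h\<in>carrier H. complex_of_real (\<alpha> h) * (\<rho> h *\<^sub>v v) $ i)"
proof -
  have "(gop \<alpha> *\<^sub>v v) $ i =
      (\<Sum>j<d. \<Sum>h\<in>carrier H. complex_of_real (\<alpha> h) * (\<rho> h $$ (i, j) * v $ j))"
    by (subst mat_vec_index[OF gop_carrier assms])
      (use assms in \<open>auto simp: galg_rep_def sum_distrib_right mult.assoc intro!: sum.cong\<close>)
  also have "\<dots> = (\<Sum>h\<in>carrier H. \<Sum>j<d. complex_of_real (\<alpha> h) * (\<rho> h $$ (i, j) * v $ j))"
    by (rule sum.swap)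
  also have "\<dots> = (\<Sum>h\<in>carrier H. complex_of_real (\<alpha> h) * (\<rho> h *\<^sub>v v) $ i)"
    by (intro sum.cong refl, subst mat_vec_index[OF rho_carrier assms])
      (simp_all add: sum_distrib_left)
  finally show ?thesis .
qed

lemma cs_gop:
  assumes v: "v \<in> carrier_vec d" and w: "w \<in> carrier_vec d"
  shows "(gop \<alpha> *\<^sub>v v) \<bullet>c w = (\<Sum>h\<in>carrier H. complex_of_real (\<alpha> h) * ((\<rho> h *\<^sub>v v) \<bullet>c w))"
proof -
  have "(gop \<alpha> *\<^sub>v v) \<bullet>c w =
      (\<Sum>i<d. \<Sum>h\<in>carrier H. complex_of_real (\<alpha> h) * ((\<rho> h *\<^sub>v v) $ i * cnj (w $ i)))"
    by (simp add: cscalar_prod_sum[OF w] gop_index[OF v] sum_distrib_right mult.assoc del: index_mult_mat_vec)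
  also have "\<dots> = (\<Sum>h\<in>carrier H. \<Sum>i<d. complex_of_real (\<alpha> h) * ((\<rho> h *\<^sub>v v) $ i * cnj (w $ i)))"
    by (rule sum.swap)
  also have "\<dots> = (\<Sum>h\<in>carrier H. complex_of_real (\<alpha> h) * ((\<rho> h *\<^sub>v v) \<bullet>c w))"
    by (simp add: cscalar_prod_sum[OF w] sum_distrib_left)
  finally show ?thesis .
qed

lemma cs_gop_right:
  assumes v: "v \<in> carrier_vec d" and w: "w \<in> carrier_vec d"
  shows "w \<bullet>c (gop \<alpha> *\<^sub>v v) = (\<Sum>h\<in>carrier H. complex_of_real (\<alpha> h) * (w \<bullet>c (\<rho> h *\<^sub>v v)))"
proof -
  have "w \<bullet>c (gop \<alpha> *\<^sub>v v) = cnj ((gop \<alpha> *\<^sub>v v) \<bullet>c w)"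
    by (rule cs_commute[of _ d]) (use v w in simp_all)
  also have "\<dots> = (\<Sum>h\<in>carrier H. complex_of_real (\<alpha> h) * cnj ((\<rho> h *\<^sub>v v) \<bullet>c w))"
    by (simp add: cs_gop[OF v w])
  also have "\<dots> = (\<Sum>h\<in>carrier H. complex_of_real (\<alpha> h) * (w \<bullet>c (\<rho> h *\<^sub>v v)))"
    by (intro sum.cong refl) (use v w in \<open>simp add: cs_commute[of _ d w]\<close>)
  finally show ?thesis .
qed

lemma sum_inv_reindex: "(\<Sum>h\<in>carrier H. f (inv h)) = (\<Sum>h\<in>carrier H. f h)"
  by (rule sum.reindex_bij_witness[of _ "\<lambda>h. inv h" "\<lambda>h. inv h"]) auto

lemma sum_left_mult: "k \<in> carrier H \<Longrightarrow> (\<Sum>h\<in>carrier H. f (k \<otimes> h)) = (\<Sum>h\<in>carrier H. f h)"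
  by (rule sum.reindex_bij_witness[of _ "\<lambda>h. inv k \<otimes> h" "\<lambda>h. k \<otimes> h"])
    (auto simp: m_assoc[symmetric])

lemma hermitian_gop:
  assumes sym: "\<And>h. h \<in> carrier H \<Longrightarrow> \<alpha> (inv h) = \<alpha> h"
  shows "hermitian_on d (gop \<alpha>)"
  unfolding hermitian_on_def
proof (intro conjI ballI gop_carrier)
  fix v w :: "complex vec" assume v: "v \<in> carrier_vec d" and w: "w \<in> carrier_vec d"
  have "(gop \<alpha> *\<^sub>v v) \<bullet>c w = (\<Sum>h\<in>carrier H. complex_of_real (\<alpha> (inv h)) * (v \<bullet>c (\<rho> (inv h) *\<^sub>v w)))"
    unfolding cs_gop[OF v w] by (intro sum.cong refl) (use v w sym in \<open>simp add: cs_act_left\<close>)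
  also have "\<dots> = v \<bullet>c (gop \<alpha> *\<^sub>v w)"
    unfolding cs_gop_right[OF w v]
    by (rule sum_inv_reindex[of "\<lambda>h. complex_of_real (\<alpha> h) * (v \<bullet>c (\<rho> h *\<^sub>v w))"])
  finally show "(gop \<alpha> *\<^sub>v v) \<bullet>c w = v \<bullet>c (gop \<alpha> *\<^sub>v w)" .
qed

abbreviation lap :: "('a \<Rightarrow> real) \<Rightarrow> complex mat" where "lap w \<equiv> gop (laplacian H w)"

lemma laplacian_eq:
  "x \<in> carrier H \<Longrightarrow> laplacian H w x = (\<Sum>h\<in>carrier H. w h) * of_bool (x = \<one>) - w x"
proof -
  assume x: "x \<in> carrier H"
  have "(\<Sum>h\<in>carrier H. w h * galg_single h x) = (\<Sum>h\<in>carrier H. if h = x then w h else 0)"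
    by (intro sum.cong) (auto simp: galg_single_def)
  also have "\<dots> = w x" using fin x by simp
  finally show ?thesis
    by (simp add: laplacian_def right_diff_distrib sum_subtractf sum_distrib_right galg_single_def[of \<one>])
qed

lemma cs_lap:
  assumes v: "v \<in> carrier_vec d" and u: "u \<in> carrier_vec d"
  shows "(lap w *\<^sub>v v) \<bullet>c u =
    (\<Sum>h\<in>carrier H. complex_of_real (w h) * (v \<bullet>c u - (\<rho> h *\<^sub>v v) \<bullet>c u))"
proof -
  have "(lap w *\<^sub>v v) \<bullet>c u = (\<Sum>h\<in>carrier H. complex_of_real ((\<Sum>h\<in>carrier H. w h) * of_bool (h = \<one>) - w h) *
      ((\<rho> h *\<^sub>v v) \<bullet>c u))"
    unfolding cs_gop[OF v u] by (intro sum.cong refl) (simp add: laplacian_eq)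
  also have "\<dots> = (\<Sum>h\<in>carrier H. if h = \<one> then complex_of_real (\<Sum>h\<in>carrier H. w h) * ((\<rho> h *\<^sub>v v) \<bullet>c u) else 0) -
      (\<Sum>h\<in>carrier H. complex_of_real (w h) * ((\<rho> h *\<^sub>v v) \<bullet>c u))"
    unfolding sum_subtractf[symmetric] by (intro sum.cong refl) (auto simp: left_diff_distrib)
  also have "\<dots> = (\<Sum>h\<in>carrier H. complex_of_real (w h)) * (v \<bullet>c u) -
      (\<Sum>h\<in>carrier H. complex_of_real (w h) * ((\<rho> h *\<^sub>v v) \<bullet>c u))"
    using fin v by (simp add: sum.delta)
  finally show ?thesis by (simp add: right_diff_distrib sum_subtractf sum_distrib_right)
qed

lemma hermitian_lap:
  assumes "\<And>h. h \<in> carrier H \<Longrightarrow> w (inv h) = w h"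
  shows "hermitian_on d (lap w)"
  by (rule hermitian_gop) (use assms in \<open>auto simp: laplacian_eq inv_eq_1_iff\<close>)

text \<open>The contribution of a unit weight at \<open>h\<close> to the Dirichlet form
  \<open>Re ((lap w *\<^sub>v v) \<bullet>c v)\<close>.\<close>

definition diss :: "'a \<Rightarrow> complex vec \<Rightarrow> real" where
  "diss h v = nsq v - Re ((\<rho> h *\<^sub>v v) \<bullet>c v)"

lemma diss_eq: "h \<in> carrier H \<Longrightarrow> v \<in> carrier_vec d \<Longrightarrow> diss h v = nsq (\<rho> h *\<^sub>v v - v) / 2"
  by (simp add: nsq_minus[of _ d] nsq_act diss_def)

lemma diss_nonneg [simp]: "h \<in> carrier H \<Longrightarrow> v \<in> carrier_vec d \<Longrightarrow> 0 \<le> diss h v"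
  by (simp add: diss_eq)

text \<open>The difference of the two sides is half of
  \<open>nsq (\<rho> h *\<^sub>v v + v)\<close>. This later makes the weights built from a matrix
  coefficient nonnegative.\<close>

lemma diss_le: 
  assumes "h \<in> carrier H" "v \<in> carrier_vec d"
  shows "diss h v \<le> 2 * nsq v"
  using nsq_add[of "\<rho> h *\<^sub>v v" d v] assms nsq_nonneg[of "\<rho> h *\<^sub>v v + v"]
  by (simp add: diss_def nsq_act)

lemma Re_lap: 
  "v \<in> carrier_vec d \<Longrightarrow> Re ((lap w *\<^sub>v v) \<bullet>c v) = (\<Sum>h\<in>carrier H. w h * diss h v)"
  by (simp add: cs_lap diss_def nsq_def)

section \<open>Fixed vectors and the gap in a single representation\<close>

definition fixed_by :: "'a set \<Rightarrow> complex vec set" where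
  "fixed_by K = {v \<in> carrier_vec d. \<forall>k\<in>K. \<rho> k *\<^sub>v v = v}"

lemma fixed_space_eq: "fixed_space H \<rho> = fixed_by (carrier H)"
  by (simp add: fixed_space_def fixed_by_def)

lemma vec_subspace_fixed_by: "K \<subseteq> carrier H \<Longrightarrow> vec_subspace d (fixed_by K)"
  unfolding vec_subspace_def fixed_by_def
  by (auto simp: subset_iff mult_add_distrib_mat_vec[OF rho_carrier] mult_mat_vec[OF rho_carrier])

definition invariant :: "complex vec set \<Rightarrow> bool" where
  "invariant U \<longleftrightarrow> vec_subspace d U \<and> (\<forall>h\<in>carrier H. \<forall>u\<in>U. \<rho> h *\<^sub>v u \<in> U)"

lemma irreducible_iff:
  "irreducible_rep H \<rho> \<longleftrightarrow> 0 < d \<and> (\<forall>U. invariant U \<longrightarrow> U = {0\<^sub>v d} \<or> U = carrier_vec d)"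
  using ur by (simp add: irreducible_rep_def subspace_iff_vec_subspace invariant_def)

text \<open>For a representation without non-zero fixed vectors this says that the sum of all group
  elements acts as 0, which is how it is applied.\<close>

lemma average_fixed:
  assumes v: "v \<in> carrier_vec d"
  shows "gop (\<lambda>_. 1) *\<^sub>v v \<in> fixed_space H \<rho>"
  unfolding fixed_space_def
proof (safe intro!: gop_in v)
  fix k assume k: "k \<in> carrier H"
  show "\<rho> k *\<^sub>v (gop (\<lambda>_. 1) *\<^sub>v v) = gop (\<lambda>_. 1) *\<^sub>v v"
  proof (rule vec_eq_csI[of _ d])
    fix u :: "complex vec" assume u: "u \<in> carrier_vec d"
    have "(\<rho> k *\<^sub>v (gop (\<lambda>_. 1) *\<^sub>v v)) \<bullet>c u = (gop (\<lambda>_. 1) *\<^sub>v v) \<bullet>c (\<rho> (inv k) *\<^sub>v u)"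
      by (rule cs_act_left) (use k u v in simp_all)
    also have "\<dots> = (\<Sum>h\<in>carrier H. (\<rho> h *\<^sub>v v) \<bullet>c (\<rho> (inv k) *\<^sub>v u))"
      using k u v by (simp add: cs_gop)
    also have "\<dots> = (\<Sum>h\<in>carrier H. (\<rho> (k \<otimes> h) *\<^sub>v v) \<bullet>c u)"
    proof (intro sum.cong refl)
      fix h assume h: "h \<in> carrier H"
      have "(\<rho> (k \<otimes> h) *\<^sub>v v) \<bullet>c u = (\<rho> k *\<^sub>v (\<rho> h *\<^sub>v v)) \<bullet>c u"
        using h k v by (simp add: act_act)
      also have "\<dots> = (\<rho> h *\<^sub>v v) \<bullet>c (\<rho> (inv k) *\<^sub>v u)"
        by (rule cs_act_left) (use h k u v in simp_all)
      finally show "(\<rho> h *\<^sub>v v) \<bullet>c (\<rho> (inv k) *\<^sub>v u) = (\<rho> (k \<otimes> h) *\<^sub>v v) \<bullet>c u" ..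
    qed
    also have "\<dots> = (gop (\<lambda>_. 1) *\<^sub>v v) \<bullet>c u"
      using u v k by (simp add: cs_gop sum_left_mult[of k "\<lambda>h. (\<rho> h *\<^sub>v v) \<bullet>c u"])
    finally show "(\<rho> k *\<^sub>v (gop (\<lambda>_. 1) *\<^sub>v v)) \<bullet>c u = (gop (\<lambda>_. 1) *\<^sub>v v) \<bullet>c u" .
  qed (use k v in simp_all)
qed

lemma fixed_compl_iff:
  "v \<in> fixed_compl H \<rho> \<longleftrightarrow> v \<in> carrier_vec d \<and> (\<forall>u\<in>fixed_space H \<rho>. v \<bullet>c u = 0)"
  by (simp add: fixed_compl_def)

lemma psi_set_finite:
  "finite {x. \<exists>v\<in>fixed_compl H \<rho>. eigenvector (lap w) v (complex_of_real x)}"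
proof (rule finite_subset)
  show "{x. \<exists>v\<in>fixed_compl H \<rho>. eigenvector (lap w) v (complex_of_real x)} \<subseteq> Re ` spectrum (lap w)"
    by (force simp: spectrum_def eigenvalue_def image_iff)
  show "finite (Re ` spectrum (lap w))"
    using card_finite_spectrum(1)[OF gop_carrier] by (rule finite_imageI)
qed

lemma fixed_compl_nonzero:
  assumes "v \<in> fixed_compl H \<rho>" "eigenvector A v x" "A \<in> carrier_mat d d"
  shows "fixed_space H \<rho> \<noteq> carrier_vec d"
proof
  assume "fixed_space H \<rho> = carrier_vec d"
  then have "v \<bullet>c v = 0" "v \<in> carrier_vec d" using assms(1) by (auto simp: fixed_compl_iff)
  then have "v = 0\<^sub>v d" by (simp add: cs_self nsq_eq_0_iff)
  then show False using assms(2,3) by (simp add: eigenvector_def)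
qed

lemma psi_le:
  assumes "v \<in> fixed_compl H \<rho>" "eigenvector (lap w) v (complex_of_real x)"
  shows "psi H w \<rho> \<le> ereal x"
  using fixed_compl_nonzero[OF assms gop_carrier] psi_set_finite assms
  by (auto simp: psi_def intro!: Min_le)

text \<open>An eigenvector away from the fixed vectors is assumed because \<open>Min\<close> of an
  empty set is unspecified.\<close>

lemma psi_attained:
  assumes "v \<in> fixed_compl H \<rho>" "eigenvector (lap w) v (complex_of_real y)"
  obtains u x where "u \<in> fixed_compl H \<rho>" "eigenvector (lap w) u (complex_of_real x)"
    "psi H w \<rho> = ereal x"
proof -
  let ?S = "{x. \<exists>v\<in>fixed_compl H \<rho>. eigenvector (lap w) v (complex_of_real x)}"
  have "Min ?S \<in> ?S" using assms psi_set_finite by (intro Min_in) auto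
  moreover have "psi H w \<rho> = ereal (Min ?S)"
    using fixed_compl_nonzero[OF assms gop_carrier] by (simp add: psi_def)
  ultimately show ?thesis using that by blast
qed

end

text \<open>Non-triviality as the absence of fixed vectors makes \<open>fixed_compl\<close> the
  whole space; the agreement with being different from \<open>triv_class\<close> is shown
  below.\<close>

definition nontrivial_irrep :: "('h, 'm) monoid_scheme \<Rightarrow> ('h \<Rightarrow> complex mat) \<Rightarrow> bool" where
  "nontrivial_irrep H \<rho> \<longleftrightarrow> irreducible_rep H \<rho> \<and> fixed_space H \<rho> = {0\<^sub>v (rep_dim H \<rho>)}"

lemma irreducible_urep:
  "group H \<Longrightarrow> finite (carrier H) \<Longrightarrow> irreducible_rep H \<rho> \<Longrightarrow> urep H \<rho>"
  by (simp add: urep_def urep_axioms_def irreducible_rep_def)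

context urep begin

lemma nontrivial_fixed_compl: "nontrivial_irrep H \<rho> \<Longrightarrow> fixed_compl H \<rho> = carrier_vec d"
  by (auto simp: fixed_compl_def nontrivial_irrep_def)

lemma nontrivial_psi:
  assumes "nontrivial_irrep H \<rho>" and "\<And>h. h \<in> carrier H \<Longrightarrow> w (inv h) = w h"
  obtains u x where "u \<in> carrier_vec d" "u \<noteq> 0\<^sub>v d" "eigenvector (lap w) u (complex_of_real x)"
    "psi H w \<rho> = ereal x"
proof -
  have "0 < d" using assms(1) by (simp add: nontrivial_irrep_def irreducible_rep_def)
  then obtain v y where e: "eigenvector (lap w) v (complex_of_real y)"
    using hermitian_eigenvector_exists[OF hermitian_lap[of w, OF assms(2)]] by blast
  then have "v \<in> fixed_compl H \<rho>"
    using gop_carrier[of "laplacian H w"] unfolding nontrivial_fixed_compl[OF assms(1)] eigenvector_def by auto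
  from psi_attained[OF this e] obtain u x where u: "u \<in> fixed_compl H \<rho>"
    "eigenvector (lap w) u (complex_of_real x)" "psi H w \<rho> = ereal x" by blast
  then show ?thesis
    using that[of u x] gop_carrier[of "laplacian H w"]
    unfolding nontrivial_fixed_compl[OF assms(1)] by (auto simp: eigenvector_def)
qed

lemma eigen_form:
  assumes "eigenvector A v (complex_of_real x)" "A \<in> carrier_mat d d"
  shows "Re ((A *\<^sub>v v) \<bullet>c v) = x * nsq v"
  using assms cs_smult_left[of v d v "complex_of_real x"]
  by (auto simp: eigenvector_def cs_self)

text \<open>As \<open>x\<close> is the least eigenvalue, the Laplacian minus \<open>x\<close> is
  hermitian with nonnegative eigenvalues, hence positive semidefinite.\<close>

lemma nontrivial_psi_Rayleigh:
  assumes n: "nontrivial_irrep H \<rho>" and sym: "\<And>h. h \<in> carrier H \<Longrightarrow> w (inv h) = w h"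
    and v: "v \<in> carrier_vec d" and x: "psi H w \<rho> = ereal x"
  shows "x * nsq v \<le> Re ((lap w *\<^sub>v v) \<bullet>c v)"
proof -
  define A where "A = lap w - complex_of_real x \<cdot>\<^sub>m 1\<^sub>m d"
  have Ac: "A \<in> carrier_mat d d" by (simp add: A_def minus_carrier_mat)
  have Av: "A *\<^sub>v u = lap w *\<^sub>v u - complex_of_real x \<cdot>\<^sub>v u" if "u \<in> carrier_vec d" for u
  proof -
    have "(complex_of_real x \<cdot>\<^sub>m 1\<^sub>m d) *\<^sub>v u = complex_of_real x \<cdot>\<^sub>v u"
      using that by (simp add: smult_mat_mult_vec[of _ d d])
    then show ?thesis
      unfolding A_def using that by (simp add: minus_mult_distrib_mat_vec[of _ d d])
  qed
  note L = hermitian_lap[of w, OF sym]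
  have "hermitian_on d A"
    unfolding hermitian_on_def using L Ac
    by (auto simp: Av cs_minus_left[of _ d] cs_minus_right[of _ d] cs_smult_left[of _ d]
        cs_smult_right[of _ d] hermitian_on_def)
  then have "0 \<le> Re ((A *\<^sub>v v) \<bullet>c v)"
  proof (rule hermitian_psd[OF _ _ v])
    fix u y assume e: "eigenvector A u (complex_of_real y)"
    then have u: "u \<in> carrier_vec d" "u \<noteq> 0\<^sub>v d" "A *\<^sub>v u = complex_of_real y \<cdot>\<^sub>v u"
      using Ac by (auto simp: eigenvector_def)
    have "lap w *\<^sub>v u = A *\<^sub>v u + complex_of_real x \<cdot>\<^sub>v u"
      using u(1) gop_carrier[of "laplacian H w"] unfolding Av[OF u(1)] by (intro eq_vecI) auto
    also have "\<dots> = complex_of_real (y + x) \<cdot>\<^sub>v u"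
      using u by (simp add: add_smult_distrib_vec)
    finally have "eigenvector (lap w) u (complex_of_real (y + x))"
      using u gop_carrier[of "laplacian H w"] by (auto simp: eigenvector_def)
    moreover have "u \<in> fixed_compl H \<rho>" using u by (simp add: nontrivial_fixed_compl[OF n])
    ultimately have "psi H w \<rho> \<le> ereal (y + x)" by (metis psi_le)
    then show "0 \<le> y" using x by simp
  qed
  then show ?thesis using v by (simp add: Av cs_minus_left[of _ d] cs_smult_left[of _ d] cs_self)
qed

subsection \<open>Subrepresentations\<close>

lemma orth_compl_invariant:
  assumes U: "invariant U"
  shows "invariant {w \<in> carrier_vec d. \<forall>u\<in>U. w \<bullet>c u = 0}"
  unfolding invariant_def
proof (intro conjI ballI)
  have sub: "U \<subseteq> carrier_vec d" using U by (simp add: invariant_def vec_subspace_def)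
  show "vec_subspace d {w \<in> carrier_vec d. \<forall>u\<in>U. w \<bullet>c u = 0}"
    using sub unfolding vec_subspace_def
    by (auto simp: subset_iff cs_add_left[of _ d] cs_smult_left[of _ d])
  fix h w assume h: "h \<in> carrier H" and "w \<in> {w \<in> carrier_vec d. \<forall>u\<in>U. w \<bullet>c u = 0}"
  then show "\<rho> h *\<^sub>v w \<in> {w \<in> carrier_vec d. \<forall>u\<in>U. w \<bullet>c u = 0}"
    using U sub by (auto simp: cs_act_left invariant_def subset_iff)
qed

definition subrep :: "complex mat \<Rightarrow> 'a \<Rightarrow> complex mat" where
  "subrep Q h = mat_adjoint Q * \<rho> h * Q"

context
  fixes k Q
  assumes Q: "isometry_mat d k Q" and inv: "invariant {Q *\<^sub>v x | x. x \<in> carrier_vec k}"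
begin

lemma subrep_Q [simp]: "Q \<in> carrier_mat d k" "mat_adjoint Q \<in> carrier_mat k d"
  using Q by (auto simp: isometry_mat_def)

lemma subrep_Q_vec [simp]:
  "x \<in> carrier_vec k \<Longrightarrow> Q *\<^sub>v x \<in> carrier_vec d"
  "v \<in> carrier_vec d \<Longrightarrow> mat_adjoint Q *\<^sub>v v \<in> carrier_vec k"
  by (rule mult_mat_vec_carrier, simp_all)+

lemma subrep_carrier [simp]: "h \<in> carrier H \<Longrightarrow> subrep Q h \<in> carrier_mat k k"
  unfolding subrep_def by (meson mult_carrier_mat rho_carrier subrep_Q)

lemma subrep_vec:
  assumes "h \<in> carrier H" "x \<in> carrier_vec k"
  shows "subrep Q h *\<^sub>v x = mat_adjoint Q *\<^sub>v (\<rho> h *\<^sub>v (Q *\<^sub>v x))"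
  unfolding subrep_def
    assoc_mult_mat_vec[OF mult_carrier_mat[OF subrep_Q(2) rho_carrier[OF assms(1)]] subrep_Q(1) assms(2)]
  by (rule assoc_mult_mat_vec[OF subrep_Q(2) rho_carrier[OF assms(1)]]) (simp add: assms(2))

lemma subrep_intertwines:
  assumes "h \<in> carrier H" "x \<in> carrier_vec k"
  shows "Q *\<^sub>v (subrep Q h *\<^sub>v x) = \<rho> h *\<^sub>v (Q *\<^sub>v x)"
proof -
  obtain y where y: "y \<in> carrier_vec k" "\<rho> h *\<^sub>v (Q *\<^sub>v x) = Q *\<^sub>v y"
    using inv assms by (auto simp: invariant_def)
  then show ?thesis using isometry_mat_vec[OF Q] by (simp add: subrep_vec assms)
qed

lemma subrep_dim [simp]: "rep_dim H (subrep Q) = k"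
  unfolding rep_dim_def by (rule carrier_matD(1)[OF subrep_carrier[OF one_closed]])

lemma subrep_in: "h \<in> carrier H \<Longrightarrow> x \<in> carrier_vec k \<Longrightarrow> subrep Q h *\<^sub>v x \<in> carrier_vec k"
  by (rule mult_mat_vec_carrier[OF subrep_carrier])

lemma subrep_eqI:
  assumes "x \<in> carrier_vec k" "y \<in> carrier_vec k" "Q *\<^sub>v x = Q *\<^sub>v y"
  shows "x = y"
  using assms isometry_mat_vec[OF Q] by metis

lemma subrep_urep: "urep H (subrep Q)"
proof -
  have "subrep Q \<one> = 1\<^sub>m k"
    by (rule mat_eq_vecI[of _ k k]) (simp_all add: subrep_vec isometry_mat_vec[OF Q])
  moreover have mult: "subrep Q (h \<otimes> h') = subrep Q h * subrep Q h'"
    if h: "h \<in> carrier H" "h' \<in> carrier H" for h h'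
  proof (rule mat_eq_vecI[of _ k k])
    fix x :: "complex vec" assume x: "x \<in> carrier_vec k"
    show "subrep Q (h \<otimes> h') *\<^sub>v x = subrep Q h * subrep Q h' *\<^sub>v x"
      unfolding assoc_mult_mat_vec[OF subrep_carrier[OF h(1)] subrep_carrier[OF h(2)] x]
      by (rule subrep_eqI) (use h x in \<open>simp_all add: subrep_in subrep_intertwines act_act\<close>)
  next
    show "subrep Q h * subrep Q h' \<in> carrier_mat k k" using h by (meson mult_carrier_mat subrep_carrier)
  qed (use h in simp)
  moreover have "mat_adjoint (subrep Q h) = subrep Q (inv h)" if h: "h \<in> carrier H" for h
  proof (rule mat_eq_vecI[of _ k k])
    fix x :: "complex vec" assume x: "x \<in> carrier_vec k"
    show "mat_adjoint (subrep Q h) *\<^sub>v x = subrep Q (inv h) *\<^sub>v x"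
    proof (rule vec_eq_csI[of _ k])
      fix y :: "complex vec" assume y: "y \<in> carrier_vec k"
      have "(mat_adjoint (subrep Q h) *\<^sub>v x) \<bullet>c y = x \<bullet>c (subrep Q h *\<^sub>v y)"
        by (rule cs_adjoint_right[symmetric, OF subrep_carrier[OF h] y x])
      also have "\<dots> = (Q *\<^sub>v x) \<bullet>c (\<rho> h *\<^sub>v (Q *\<^sub>v y))"
        using isometry_cs[OF Q x subrep_in[OF h y]] by (simp add: subrep_intertwines h y)
      also have "\<dots> = (\<rho> (inv h) *\<^sub>v (Q *\<^sub>v x)) \<bullet>c (Q *\<^sub>v y)"
        using h x y by (simp add: cs_act_left)
      also have "\<dots> = (subrep Q (inv h) *\<^sub>v x) \<bullet>c y"
        using isometry_cs[OF Q subrep_in[OF inv_closed[OF h] x] y] by (simp add: subrep_intertwines h x)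
      finally show "(mat_adjoint (subrep Q h) *\<^sub>v x) \<bullet>c y = (subrep Q (inv h) *\<^sub>v x) \<bullet>c y" .
    qed (use mult_mat_vec_carrier[OF mat_adjoint_carrier[OF subrep_carrier[OF h]] x]
          subrep_in[OF inv_closed[OF h] x] in simp_all)
  qed (use h in simp_all)
  ultimately show ?thesis
    using fin by (unfold_locales) (auto simp: unitary_rep_def mult[symmetric])
qed

text \<open>The projection onto an invariant subspace commutes with a unitary action, so it maps an
  eigenvector to zero or to an eigenvector; and a fixed vector of the subrepresentation is fixed in
  the whole space.\<close>

lemma subrep_eigenvector:
  assumes v: "v \<in> fixed_compl H \<rho>" and e: "eigenvector (gop \<alpha>) v x"
    and ne: "mat_adjoint Q *\<^sub>v v \<noteq> 0\<^sub>v k"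
  shows "mat_adjoint Q *\<^sub>v v \<in> fixed_compl H (subrep Q)"
    "eigenvector (galg_rep H (subrep Q) \<alpha>) (mat_adjoint Q *\<^sub>v v) x"
proof -
  interpret S: urep H "subrep Q" by (rule subrep_urep)
  let ?y = "mat_adjoint Q *\<^sub>v v"
  have vd: "v \<in> carrier_vec d" and ev: "gop \<alpha> *\<^sub>v v = x \<cdot>\<^sub>v v"
    using v e by (auto simp: fixed_compl_iff eigenvector_def)
  have yk: "?y \<in> carrier_vec k" using vd by simp
  have proj: "?y \<bullet>c z = v \<bullet>c (Q *\<^sub>v z)" if "z \<in> carrier_vec k" for z
    by (rule cs_adjoint_right[symmetric, OF subrep_Q(1) that vd])
  show "?y \<in> fixed_compl H (subrep Q)"
    unfolding S.fixed_compl_iff subrep_dim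
  proof (intro conjI ballI yk)
    fix z assume z: "z \<in> fixed_space H (subrep Q)"
    then have zk: "z \<in> carrier_vec k" and fz: "\<And>h. h \<in> carrier H \<Longrightarrow> subrep Q h *\<^sub>v z = z"
      by (auto simp: fixed_space_def)
    have "Q *\<^sub>v z \<in> fixed_space H \<rho>"
      using zk fz subrep_intertwines[OF _ zk] by (auto simp: fixed_space_def)
    then show "?y \<bullet>c z = 0" using v by (simp add: proj[OF zk] fixed_compl_iff)
  qed
  have "galg_rep H (subrep Q) \<alpha> *\<^sub>v ?y = x \<cdot>\<^sub>v ?y"
  proof (rule vec_eq_csI[of _ k])
    fix z :: "complex vec" assume z: "z \<in> carrier_vec k"
    have "(galg_rep H (subrep Q) \<alpha> *\<^sub>v ?y) \<bullet>c z =
        (\<Sum>h\<in>carrier H. complex_of_real (\<alpha> h) * ((subrep Q h *\<^sub>v ?y) \<bullet>c z))"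
      using S.cs_gop[of ?y z] yk z by simp
    also have "\<dots> = (\<Sum>h\<in>carrier H. complex_of_real (\<alpha> h) * ((\<rho> h *\<^sub>v v) \<bullet>c (Q *\<^sub>v z)))"
    proof (intro sum.cong refl arg_cong2[of _ _ _ _ times])
      fix h assume h: "h \<in> carrier H"
      have "(subrep Q h *\<^sub>v ?y) \<bullet>c z = ?y \<bullet>c (subrep Q (inv h) *\<^sub>v z)"
        using S.cs_act_left[OF h] yk z by simp
      also have "\<dots> = v \<bullet>c (\<rho> (inv h) *\<^sub>v (Q *\<^sub>v z))"
        using h z by (simp add: proj subrep_in subrep_intertwines)
      also have "\<dots> = (\<rho> h *\<^sub>v v) \<bullet>c (Q *\<^sub>v z)"
        using h z vd by (simp add: cs_act_left)
      finally show "(subrep Q h *\<^sub>v ?y) \<bullet>c z = (\<rho> h *\<^sub>v v) \<bullet>c (Q *\<^sub>v z)" .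
    qed
    also have "\<dots> = (gop \<alpha> *\<^sub>v v) \<bullet>c (Q *\<^sub>v z)"
      by (rule cs_gop[symmetric, OF vd]) (simp add: z)
    also have "\<dots> = x * (v \<bullet>c (Q *\<^sub>v z))"
      using vd z by (simp add: ev cs_smult_left[of _ d])
    also have "\<dots> = (x \<cdot>\<^sub>v ?y) \<bullet>c z" using yk z by (simp add: cs_smult_left[of _ k] proj)
    finally show "(galg_rep H (subrep Q) \<alpha> *\<^sub>v ?y) \<bullet>c z = (x \<cdot>\<^sub>v ?y) \<bullet>c z" .
  qed (use yk S.gop_in[of ?y] in simp_all)
  then show "eigenvector (galg_rep H (subrep Q) \<alpha>) ?y x"
    using ne yk S.gop_carrier[of \<alpha>] by (simp add: eigenvector_def galg_rep_def)
qed

end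

end

text \<open>A unitary representation of least dimension in which the eigenvalue occurs away from the
  fixed vectors is irreducible.\<close>

lemma irrep_with_eigenvalue:
  assumes "urep H \<rho>" and "v \<in> fixed_compl H \<rho>" and "eigenvector (galg_rep H \<rho> \<alpha>) v x"
  obtains \<sigma> u where "nontrivial_irrep H \<sigma>" "eigenvector (galg_rep H \<sigma> \<alpha>) u x"
proof -
  have "\<exists>\<sigma> u. nontrivial_irrep H \<sigma> \<and> eigenvector (galg_rep H \<sigma> \<alpha>) u x"
    using assms
  proof (induction "rep_dim H \<rho>" arbitrary: \<rho> v rule: less_induct)
    case less
    interpret urep H \<rho> by (rule less.prems)
    have v: "v \<in> carrier_vec d" "v \<noteq> 0\<^sub>v d"
      using less.prems(2,3) gop_carrier[of \<alpha>] by (auto simp: fixed_compl_iff eigenvector_def)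
    show ?case
    proof (cases "irreducible_rep H \<rho>")
      case True
      have "invariant (fixed_space H \<rho>)"
        using vec_subspace_fixed_by[of "carrier H"] unfolding invariant_def fixed_space_eq
        by (auto simp: fixed_by_def)
      then have "fixed_space H \<rho> = {0\<^sub>v d} \<or> fixed_space H \<rho> = carrier_vec d"
        using True irreducible_iff by blast
      then show ?thesis
        using True fixed_compl_nonzero[OF less.prems(2,3) gop_carrier] less.prems(3)
        unfolding nontrivial_irrep_def by blast
    next
      case False
      have "0 < d" using v by (cases d) auto
      then obtain U where U: "invariant U" "U \<noteq> {0\<^sub>v d}" "U \<noteq> carrier_vec d"
        using False irreducible_iff by blast
      then have sub: "U \<subseteq> carrier_vec d" "0\<^sub>v d \<in> U" by (auto simp: invariant_def vec_subspace_def)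
      \<comment> \<open>Either \<open>v\<close> pairs non-trivially with some vector of
        \<open>U\<close>, or \<open>v\<close> lies in the orthogonal complement of \<open>U\<close>,
        which is invariant as well and where \<open>v\<close> pairs with itself.\<close>
      obtain U' u where U': "invariant U'" "U' \<noteq> carrier_vec d" and u: "u \<in> U'" "v \<bullet>c u \<noteq> 0"
      proof (cases "\<forall>u\<in>U. v \<bullet>c u = 0")
        case True
        let ?W = "{w \<in> carrier_vec d. \<forall>u\<in>U. w \<bullet>c u = 0}"
        obtain u where u: "u \<in> U" "u \<noteq> 0\<^sub>v d" using U sub by blast
        then have "u \<in> carrier_vec d" "u \<bullet>c u \<noteq> 0" using sub by (auto simp: cs_self nsq_eq_0_iff[of u d])
        then have "?W \<noteq> carrier_vec d" using u(1) by blast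
        moreover have "v \<in> ?W" "v \<bullet>c v \<noteq> 0" using True v by (auto simp: cs_self nsq_eq_0_iff[of v d])
        ultimately show ?thesis using that[of ?W v] orth_compl_invariant[OF U(1)] by simp
      qed (use that U in blast)
      have "vec_subspace d U'" using U' by (simp add: invariant_def)
      then obtain k Q where Q: "isometry_mat d k Q" and UQ: "U' = {Q *\<^sub>v x | x. x \<in> carrier_vec k}"
        by (rule vec_subspace_isometry)
      have inv: "invariant {Q *\<^sub>v x | x. x \<in> carrier_vec k}" using U' UQ by simp
      have "k < d" using isometry_mat_proper[OF Q] U'(2) UQ by simp
      have "mat_adjoint Q *\<^sub>v v \<noteq> 0\<^sub>v k"
      proof
        assume z: "mat_adjoint Q *\<^sub>v v = 0\<^sub>v k"
        obtain y where y: "y \<in> carrier_vec k" "u = Q *\<^sub>v y" using u UQ by blast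
        have "v \<bullet>c u = (mat_adjoint Q *\<^sub>v v) \<bullet>c y"
          unfolding y(2) by (rule cs_adjoint_right[OF subrep_Q(1)[OF Q inv] y(1) v(1)])
        then show False using u y z by simp
      qed
      note E = subrep_eigenvector[OF Q inv less.prems(2,3) this]
      show ?thesis
        by (rule less.hyps[OF _ subrep_urep[OF Q inv] E]) (simp add: subrep_dim[OF Q inv] \<open>k < d\<close>)
    qed
  qed
  then show ?thesis using that by blast
qed

section \<open>Isomorphisms and Schur's lemma\<close>

lemma mat_mult_zero_vec:
  fixes A :: "complex mat"
  assumes "A \<in> carrier_mat n m"
  shows "A *\<^sub>v 0\<^sub>v m = 0\<^sub>v n"
  using assms by (intro eq_vecI) (auto intro!: scalar_prod_right_zero)

locale urep_pair = R: urep H \<rho> + S: urep H \<sigma>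
  for H (structure) and \<rho> \<sigma> :: "'a \<Rightarrow> complex mat"
begin

definition intertwiner :: "complex mat \<Rightarrow> bool" where
  "intertwiner T \<longleftrightarrow> T \<in> carrier_mat S.d R.d \<and>
     (\<forall>h\<in>carrier H. \<forall>v\<in>carrier_vec R.d. T *\<^sub>v (\<rho> h *\<^sub>v v) = \<sigma> h *\<^sub>v (T *\<^sub>v v))"

lemma intertwiner_carrier: "intertwiner T \<Longrightarrow> T \<in> carrier_mat S.d R.d"
  by (simp add: intertwiner_def)

lemma intertwiner_in: "intertwiner T \<Longrightarrow> v \<in> carrier_vec R.d \<Longrightarrow> T *\<^sub>v v \<in> carrier_vec S.d"
  by (auto simp: intertwiner_def intro: mult_mat_vec_carrier)

lemma intertwiner_gop:
  assumes T: "intertwiner T" and v: "v \<in> carrier_vec R.d"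
  shows "T *\<^sub>v (R.gop \<alpha> *\<^sub>v v) = S.gop \<alpha> *\<^sub>v (T *\<^sub>v v)"
proof (rule vec_eq_csI[of _ S.d])
  note c = intertwiner_carrier[OF T]
  note Tv = intertwiner_in[OF T]
  fix z :: "complex vec" assume z: "z \<in> carrier_vec S.d"
  have z': "mat_adjoint T *\<^sub>v z \<in> carrier_vec R.d"
    using mat_adjoint_carrier[OF c] z by (rule mult_mat_vec_carrier)
  have "(T *\<^sub>v (R.gop \<alpha> *\<^sub>v v)) \<bullet>c z = (R.gop \<alpha> *\<^sub>v v) \<bullet>c (mat_adjoint T *\<^sub>v z)"
    by (rule cs_adjoint[OF c]) (use v z in simp_all)
  also have "\<dots> = (\<Sum>h\<in>carrier H. complex_of_real (\<alpha> h) * ((\<rho> h *\<^sub>v v) \<bullet>c (mat_adjoint T *\<^sub>v z)))"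
    by (rule R.cs_gop[OF v z'])
  also have "\<dots> = (\<Sum>h\<in>carrier H. complex_of_real (\<alpha> h) * ((\<sigma> h *\<^sub>v (T *\<^sub>v v)) \<bullet>c z))"
  proof (intro sum.cong refl arg_cong2[of _ _ _ _ times])
    fix h assume h: "h \<in> carrier H"
    have "(\<rho> h *\<^sub>v v) \<bullet>c (mat_adjoint T *\<^sub>v z) = (T *\<^sub>v (\<rho> h *\<^sub>v v)) \<bullet>c z"
      by (rule cs_adjoint[OF c, symmetric]) (use h v z in simp_all)
    then show "(\<rho> h *\<^sub>v v) \<bullet>c (mat_adjoint T *\<^sub>v z) = (\<sigma> h *\<^sub>v (T *\<^sub>v v)) \<bullet>c z"
      using T h v by (simp add: intertwiner_def)
  qed
  also have "\<dots> = (S.gop \<alpha> *\<^sub>v (T *\<^sub>v v)) \<bullet>c z"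
    by (rule S.cs_gop[symmetric, OF Tv[OF v] z])
  finally show "(T *\<^sub>v (R.gop \<alpha> *\<^sub>v v)) \<bullet>c z = (S.gop \<alpha> *\<^sub>v (T *\<^sub>v v)) \<bullet>c z" .
qed (use intertwiner_in[OF T] v in simp_all)

lemma intertwiner_zero: "intertwiner T \<Longrightarrow> T *\<^sub>v 0\<^sub>v R.d = 0\<^sub>v S.d"
  by (rule mat_mult_zero_vec[OF intertwiner_carrier])

lemma rep_isoE:
  assumes "rep_iso H \<rho> \<sigma>"
  obtains T T' where "intertwiner T" "urep_pair.intertwiner H \<sigma> \<rho> T'" "R.d = S.d"
    "\<And>v. v \<in> carrier_vec R.d \<Longrightarrow> T' *\<^sub>v (T *\<^sub>v v) = v"
    "\<And>v. v \<in> carrier_vec S.d \<Longrightarrow> T *\<^sub>v (T' *\<^sub>v v) = v"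
proof -
  interpret P: urep_pair H \<sigma> \<rho> by unfold_locales
  obtain T where T: "T \<in> carrier_mat S.d R.d" "invertible_mat T"
    and eq: "\<And>h. h \<in> carrier H \<Longrightarrow> T * \<rho> h = \<sigma> h * T"
    using assms by (auto simp: rep_iso_def)
  have dim: "R.d = S.d" using T by (auto simp: invertible_mat_def)
  obtain T' where T': "T * T' = 1\<^sub>m (dim_row T)" "T' * T = 1\<^sub>m (dim_row T')"
    using T by (auto simp: invertible_mat_def inverts_mat_def)
  have "dim_col T' = S.d" using T arg_cong[OF T'(1), of dim_col] by simp
  moreover have "dim_row T' = R.d" using T arg_cong[OF T'(2), of dim_col] by simp
  ultimately have T'c: "T' \<in> carrier_mat R.d S.d" by auto
  have inv1: "T' *\<^sub>v (T *\<^sub>v v) = v" if "v \<in> carrier_vec R.d" for v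
    using T T'c T'(2) that by (metis assoc_mult_mat_vec carrier_matD(1) one_mult_mat_vec)
  have inv2: "T *\<^sub>v (T' *\<^sub>v v) = v" if "v \<in> carrier_vec S.d" for v
    using T T'c T'(1) that by (metis assoc_mult_mat_vec carrier_matD(1) one_mult_mat_vec)
  have i: "T *\<^sub>v (\<rho> h *\<^sub>v v) = \<sigma> h *\<^sub>v (T *\<^sub>v v)" if "h \<in> carrier H" "v \<in> carrier_vec R.d" for h v
    using eq[OF that(1)] T(1) that R.rho_carrier[OF that(1)] S.rho_carrier[OF that(1)]
    by (metis assoc_mult_mat_vec)
  have "intertwiner T" using T i by (simp add: intertwiner_def)
  moreover have "P.intertwiner T'"
    unfolding P.intertwiner_def
  proof (intro conjI ballI T'c)
    fix h and v :: "complex vec"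
    assume h: "h \<in> carrier H" and v: "v \<in> carrier_vec S.d"
    have T'v: "T' *\<^sub>v v \<in> carrier_vec R.d" using T'c v by (rule mult_mat_vec_carrier)
    have "T' *\<^sub>v (\<sigma> h *\<^sub>v v) = T' *\<^sub>v (\<sigma> h *\<^sub>v (T *\<^sub>v (T' *\<^sub>v v)))" by (simp add: inv2 v)
    also have "\<dots> = T' *\<^sub>v (T *\<^sub>v (\<rho> h *\<^sub>v (T' *\<^sub>v v)))" using i[OF h T'v] by simp
    also have "\<dots> = \<rho> h *\<^sub>v (T' *\<^sub>v v)" using h T'v by (intro inv1) simp
    finally show "T' *\<^sub>v (\<sigma> h *\<^sub>v v) = \<rho> h *\<^sub>v (T' *\<^sub>v v)" .
  qed
  ultimately show ?thesis using that inv1 inv2 dim by blast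
qed

lemma rep_isoI:
  assumes T: "intertwiner T" and T': "T' \<in> carrier_mat R.d S.d" and dim: "R.d = S.d"
    and inv1: "\<And>v. v \<in> carrier_vec R.d \<Longrightarrow> T' *\<^sub>v (T *\<^sub>v v) = v"
    and inv2: "\<And>v. v \<in> carrier_vec S.d \<Longrightarrow> T *\<^sub>v (T' *\<^sub>v v) = v"
  shows "rep_iso H \<rho> \<sigma>"
  unfolding rep_iso_def
proof (intro bexI conjI ballI)
  show Tc: "T \<in> carrier_mat S.d R.d" by (rule intertwiner_carrier[OF T])
  have "T' * T = 1\<^sub>m R.d"
    by (rule mat_eq_vecI[of _ R.d R.d])
      (use T' Tc inv1 in \<open>simp_all add: assoc_mult_mat_vec[OF T' Tc]\<close>)
  moreover have "T * T' = 1\<^sub>m S.d"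
    by (rule mat_eq_vecI[of _ S.d S.d])
      (use T' Tc inv2 in \<open>simp_all add: assoc_mult_mat_vec[OF Tc T']\<close>)
  ultimately show "invertible_mat T"
    using T' Tc dim unfolding invertible_mat_def inverts_mat_def by auto
  fix h assume h: "h \<in> carrier H"
  have c1: "T * \<rho> h \<in> carrier_mat S.d R.d" by (rule mult_carrier_mat[OF Tc R.rho_carrier[OF h]])
  have c2: "\<sigma> h * T \<in> carrier_mat S.d R.d" by (rule mult_carrier_mat[OF S.rho_carrier[OF h] Tc])
  show "T * \<rho> h = \<sigma> h * T"
  proof (rule mat_eq_vecI[OF c1 c2])
    fix v :: "complex vec" assume v: "v \<in> carrier_vec R.d"
    show "T * \<rho> h *\<^sub>v v = \<sigma> h * T *\<^sub>v v"
      using T h v by (simp add: assoc_mult_mat_vec[OF Tc R.rho_carrier[OF h] v]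
          assoc_mult_mat_vec[OF S.rho_carrier[OF h] Tc v] intertwiner_def)
  qed
qed

end

lemma rep_iso_refl: "urep H \<rho> \<Longrightarrow> rep_iso H \<rho> \<rho>"
proof -
  assume "urep H \<rho>"
  then interpret P: urep_pair H \<rho> \<rho> by (simp add: urep_pair_def)
  show ?thesis
    by (rule P.rep_isoI[of "1\<^sub>m P.R.d" "1\<^sub>m P.R.d"]) (auto simp: P.intertwiner_def)
qed

lemma rep_iso_sym:
  assumes "urep H \<rho>" "urep H \<sigma>" "rep_iso H \<rho> \<sigma>"
  shows "rep_iso H \<sigma> \<rho>"
proof -
  interpret P: urep_pair H \<rho> \<sigma> using assms by (simp add: urep_pair_def)
  interpret Q: urep_pair H \<sigma> \<rho> using assms by (simp add: urep_pair_def)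
  obtain T T' where "P.intertwiner T" "Q.intertwiner T'" "P.R.d = P.S.d"
    "\<And>v. v \<in> carrier_vec P.R.d \<Longrightarrow> T' *\<^sub>v (T *\<^sub>v v) = v"
    "\<And>v. v \<in> carrier_vec P.S.d \<Longrightarrow> T *\<^sub>v (T' *\<^sub>v v) = v"
    by (rule P.rep_isoE[OF assms(3)]) blast
  note T = this
  show ?thesis
    by (rule Q.rep_isoI[OF T(2) P.intertwiner_carrier[OF T(1)] T(3)[symmetric] T(5,4)])
qed

lemma rep_iso_trans:
  assumes "urep H \<rho>" "urep H \<sigma>" "urep H \<tau>" "rep_iso H \<rho> \<sigma>" "rep_iso H \<sigma> \<tau>"
  shows "rep_iso H \<rho> \<tau>"
proof -
  interpret P: urep_pair H \<rho> \<sigma> using assms by (simp add: urep_pair_def)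
  interpret Q: urep_pair H \<sigma> \<tau> using assms by (simp add: urep_pair_def)
  interpret X: urep_pair H \<rho> \<tau> using assms by (simp add: urep_pair_def)
  interpret P': urep_pair H \<sigma> \<rho> using assms by (simp add: urep_pair_def)
  interpret Q': urep_pair H \<tau> \<sigma> using assms by (simp add: urep_pair_def)
  obtain T T' where T: "P.intertwiner T" "P'.intertwiner T'" "P.R.d = P.S.d"
    "\<And>v. v \<in> carrier_vec P.R.d \<Longrightarrow> T' *\<^sub>v (T *\<^sub>v v) = v"
    "\<And>v. v \<in> carrier_vec P.S.d \<Longrightarrow> T *\<^sub>v (T' *\<^sub>v v) = v"
    by (rule P.rep_isoE[OF assms(4)]) blast
  obtain U U' where U: "Q.intertwiner U" "Q'.intertwiner U'" "P.S.d = Q.S.d"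
    "\<And>v. v \<in> carrier_vec P.S.d \<Longrightarrow> U' *\<^sub>v (U *\<^sub>v v) = v"
    "\<And>v. v \<in> carrier_vec Q.S.d \<Longrightarrow> U *\<^sub>v (U' *\<^sub>v v) = v"
    by (rule Q.rep_isoE[OF assms(5)]) blast
  note c = P.intertwiner_carrier[OF T(1)] P'.intertwiner_carrier[OF T(2)]
    Q.intertwiner_carrier[OF U(1)] Q'.intertwiner_carrier[OF U(2)]
  note i = P.intertwiner_in[OF T(1)] Q'.intertwiner_in[OF U(2)]
  note a = assoc_mult_mat_vec[OF c(3) c(1)] assoc_mult_mat_vec[OF c(2) c(4)]
  show ?thesis
  proof (rule X.rep_isoI[of "U * T" "T' * U'"])
    show "T' * U' \<in> carrier_mat P.R.d Q.S.d" by (rule mult_carrier_mat[OF c(2) c(4)])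
    then show "X.intertwiner (U * T)"
      using T(1) U(1) mult_carrier_mat[OF c(3) c(1)] unfolding X.intertwiner_def
      by (simp add: a i P.intertwiner_def Q.intertwiner_def)
    show "T' * U' *\<^sub>v (U * T *\<^sub>v v) = v" if "v \<in> carrier_vec P.R.d" for v
      using that i(1)[OF that] T U mult_mat_vec_carrier[OF c(3) i(1)[OF that]] by (simp add: a)
    show "U * T *\<^sub>v (T' * U' *\<^sub>v v) = v" if "v \<in> carrier_vec Q.S.d" for v
      using that i(2)[OF that] T U mult_mat_vec_carrier[OF c(2) i(2)[OF that]] by (simp add: a)
  qed (use T U in simp)
qed

lemma in_rep_class_self: "urep H \<rho> \<Longrightarrow> \<rho> \<in> rep_class H \<rho>"
  by (simp add: rep_class_def rep_iso_refl urep.ur)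

lemma in_rep_class_iff:
  "urep H \<rho> \<Longrightarrow> \<sigma> \<in> rep_class H \<rho> \<longleftrightarrow> urep H \<sigma> \<and> rep_iso H \<rho> \<sigma>"
  unfolding rep_class_def urep_def urep_axioms_def by auto

lemma rep_class_eqI:
  assumes "urep H \<rho>" "urep H \<sigma>" "rep_iso H \<rho> \<sigma>"
  shows "rep_class H \<rho> = rep_class H \<sigma>"
  using assms rep_iso_trans rep_iso_sym by (auto simp: in_rep_class_iff) blast+

lemma rep_class_eq_iff:
  assumes "urep H \<rho>" "urep H \<sigma>"
  shows "rep_class H \<rho> = rep_class H \<sigma> \<longleftrightarrow> rep_iso H \<rho> \<sigma>"
  using assms rep_class_eqI in_rep_class_self[of H \<sigma>] by (auto simp: in_rep_class_iff)

context urep_pair begin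

lemma iso_fixed_by:
  assumes "rep_iso H \<rho> \<sigma>" and "K \<subseteq> carrier H" and "R.fixed_by K \<noteq> {0\<^sub>v R.d}"
  shows "S.fixed_by K \<noteq> {0\<^sub>v S.d}"
proof -
  interpret P: urep_pair H \<sigma> \<rho> by unfold_locales
  obtain T T' where T: "intertwiner T" "P.intertwiner T'"
    "\<And>v. v \<in> carrier_vec R.d \<Longrightarrow> T' *\<^sub>v (T *\<^sub>v v) = v"
    by (rule rep_isoE[OF assms(1)]) blast
  have "0\<^sub>v R.d \<in> R.fixed_by K" using R.vec_subspace_fixed_by[OF assms(2)] by (simp add: vec_subspace_def)
  then obtain v where v: "v \<in> R.fixed_by K" "v \<noteq> 0\<^sub>v R.d" using assms(3) by blast
  then have vd: "v \<in> carrier_vec R.d" by (simp add: R.fixed_by_def)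
  have "\<sigma> k *\<^sub>v (T *\<^sub>v v) = T *\<^sub>v v" if "k \<in> K" for k
  proof -
    have "\<sigma> k *\<^sub>v (T *\<^sub>v v) = T *\<^sub>v (\<rho> k *\<^sub>v v)"
      using T(1) that assms(2) vd by (auto simp: intertwiner_def)
    then show ?thesis using v that by (simp add: R.fixed_by_def)
  qed
  then have "T *\<^sub>v v \<in> S.fixed_by K" using T vd by (auto simp: S.fixed_by_def intertwiner_in)
  moreover have "T *\<^sub>v v \<noteq> 0\<^sub>v S.d" using T(3)[OF vd] v P.intertwiner_zero[OF T(2)] by auto
  ultimately show ?thesis by blast
qed

lemma iso_irreducible:
  assumes iso: "rep_iso H \<rho> \<sigma>" and irr: "irreducible_rep H \<rho>"
  shows "irreducible_rep H \<sigma>"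
  unfolding S.irreducible_iff
proof (intro conjI allI impI)
  interpret P: urep_pair H \<sigma> \<rho> by unfold_locales
  obtain T T' where T: "intertwiner T" "P.intertwiner T'" "R.d = S.d"
    "\<And>v. v \<in> carrier_vec R.d \<Longrightarrow> T' *\<^sub>v (T *\<^sub>v v) = v"
    "\<And>v. v \<in> carrier_vec S.d \<Longrightarrow> T *\<^sub>v (T' *\<^sub>v v) = v"
    by (rule rep_isoE[OF iso]) blast
  show "0 < S.d" using irr T by (simp add: irreducible_rep_def)
  fix U assume U: "S.invariant U"
  then have sub: "U \<subseteq> carrier_vec S.d" by (simp add: S.invariant_def vec_subspace_def)
  note T'c = P.intertwiner_carrier[OF T(2)]
  have "R.invariant ((\<lambda>u. T' *\<^sub>v u) ` U)"
    unfolding R.invariant_def vec_subspace_def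
  proof (intro conjI ballI allI)
    show "(\<lambda>u. T' *\<^sub>v u) ` U \<subseteq> carrier_vec R.d" using sub P.intertwiner_in[OF T(2)] by blast
    show "0\<^sub>v R.d \<in> (\<lambda>u. T' *\<^sub>v u) ` U"
      using P.intertwiner_zero[OF T(2)] U by (metis S.invariant_def image_eqI vec_subspace_def)
    show "u + v \<in> (\<lambda>u. T' *\<^sub>v u) ` U"
      if uv: "u \<in> (\<lambda>u. T' *\<^sub>v u) ` U" "v \<in> (\<lambda>u. T' *\<^sub>v u) ` U" for u v
    proof -
      obtain x y where xy: "x \<in> U" "y \<in> U" "u = T' *\<^sub>v x" "v = T' *\<^sub>v y" using uv by blast
      then have "u + v = T' *\<^sub>v (x + y)" using sub by (simp add: mult_add_distrib_mat_vec[OF T'c] subset_iff)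
      moreover have "x + y \<in> U" using xy U by (simp add: S.invariant_def vec_subspace_def)
      ultimately show ?thesis by blast
    qed
    show "c \<cdot>\<^sub>v u \<in> (\<lambda>u. T' *\<^sub>v u) ` U" if uv: "u \<in> (\<lambda>u. T' *\<^sub>v u) ` U" for c u
    proof -
      obtain x where x: "x \<in> U" "u = T' *\<^sub>v x" using uv by blast
      then have "c \<cdot>\<^sub>v u = T' *\<^sub>v (c \<cdot>\<^sub>v x)" using sub by (simp add: mult_mat_vec[OF T'c] subset_iff)
      moreover have "c \<cdot>\<^sub>v x \<in> U" using x U by (simp add: S.invariant_def vec_subspace_def)
      ultimately show ?thesis by blast
    qed
    show "\<rho> h *\<^sub>v u \<in> (\<lambda>u. T' *\<^sub>v u) ` U" if h: "h \<in> carrier H" and uv: "u \<in> (\<lambda>u. T' *\<^sub>v u) ` U" for h u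
    proof -
      obtain x where x: "x \<in> U" "u = T' *\<^sub>v x" using uv by blast
      then have "\<rho> h *\<^sub>v u = T' *\<^sub>v (\<sigma> h *\<^sub>v x)"
        using T(2) h sub by (auto simp: P.intertwiner_def)
      moreover have "\<sigma> h *\<^sub>v x \<in> U" using x h U by (simp add: S.invariant_def)
      ultimately show ?thesis by blast
    qed
  qed
  then consider "(\<lambda>u. T' *\<^sub>v u) ` U = {0\<^sub>v R.d}" | "(\<lambda>u. T' *\<^sub>v u) ` U = carrier_vec R.d"
    using irr R.irreducible_iff by blast
  then show "U = {0\<^sub>v S.d} \<or> U = carrier_vec S.d"
  proof cases
    case 1
    have "u = 0\<^sub>v S.d" if u: "u \<in> U" for u
    proof -
      have "T' *\<^sub>v u = 0\<^sub>v R.d" using 1 u by blast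
      then show ?thesis using T(5)[of u] u sub intertwiner_zero[OF T(1)] by auto
    qed
    moreover have "0\<^sub>v S.d \<in> U" using U by (simp add: S.invariant_def vec_subspace_def)
    ultimately show ?thesis by blast
  next
    case 2
    have "v \<in> U" if v: "v \<in> carrier_vec S.d" for v
    proof -
      have "T' *\<^sub>v v \<in> (\<lambda>u. T' *\<^sub>v u) ` U" using 2 P.intertwiner_in[OF T(2) v] by simp
      then obtain u where u: "u \<in> U" "T' *\<^sub>v v = T' *\<^sub>v u" by blast
      then have "v = u" using T(5)[OF v] T(5)[of u] sub by (metis subsetD)
      then show ?thesis using u by simp
    qed
    then show ?thesis using sub by blast
  qed
qed

lemma iso_nontrivial:
  assumes iso: "rep_iso H \<rho> \<sigma>" and n: "nontrivial_irrep H \<rho>"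
  shows "nontrivial_irrep H \<sigma>"
proof -
  interpret P: urep_pair H \<sigma> \<rho> by unfold_locales
  have "rep_iso H \<sigma> \<rho>" by (rule rep_iso_sym[OF _ _ iso]) unfold_locales
  then have "S.fixed_by (carrier H) = {0\<^sub>v S.d}"
    using P.iso_fixed_by[of "carrier H"] n by (auto simp: nontrivial_irrep_def R.fixed_space_eq)
  then show ?thesis
    using iso_irreducible[OF iso] n by (simp add: nontrivial_irrep_def S.fixed_space_eq)
qed

lemma iso_eigenvector:
  assumes iso: "rep_iso H \<rho> \<sigma>" and e: "eigenvector (R.gop \<alpha>) v x"
  obtains u where "eigenvector (S.gop \<alpha>) u x"
proof -
  interpret P: urep_pair H \<sigma> \<rho> by unfold_locales
  obtain T T' where T: "intertwiner T" "P.intertwiner T'"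
    "\<And>v. v \<in> carrier_vec R.d \<Longrightarrow> T' *\<^sub>v (T *\<^sub>v v) = v"
    by (rule rep_isoE[OF iso]) blast
  have v: "v \<in> carrier_vec R.d" "v \<noteq> 0\<^sub>v R.d" "R.gop \<alpha> *\<^sub>v v = x \<cdot>\<^sub>v v"
    using e by (auto simp: eigenvector_def)
  have "S.gop \<alpha> *\<^sub>v (T *\<^sub>v v) = x \<cdot>\<^sub>v (T *\<^sub>v v)"
    using intertwiner_gop[OF T(1) v(1), of \<alpha>] v mult_mat_vec[OF intertwiner_carrier[OF T(1)] v(1), of x] by simp
  moreover have "T *\<^sub>v v \<noteq> 0\<^sub>v S.d" using T(3)[OF v(1)] v P.intertwiner_zero[OF T(2)] by auto
  ultimately have "eigenvector (S.gop \<alpha>) (T *\<^sub>v v) x"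
    using intertwiner_in[OF T(1) v(1)] by (simp add: eigenvector_def)
  then show ?thesis by (rule that)
qed

end

context urep begin

text \<open>An eigenspace of an operator commuting with the action is invariant and non-zero, hence
  the whole space. The hermitian case covers the products of an intertwiner with its
  adjoint.\<close>

lemma Schur_scalar:
  assumes irr: "irreducible_rep H \<rho>" and A: "hermitian_on d A"
    and comm: "\<And>h v. h \<in> carrier H \<Longrightarrow> v \<in> carrier_vec d \<Longrightarrow> A *\<^sub>v (\<rho> h *\<^sub>v v) = \<rho> h *\<^sub>v (A *\<^sub>v v)"
  obtains x where "\<And>v. v \<in> carrier_vec d \<Longrightarrow> A *\<^sub>v v = complex_of_real x \<cdot>\<^sub>v v"
proof -
  have Ac: "A \<in> carrier_mat d d" using A by (simp add: hermitian_on_def)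
  have "0 < d" using irr by (simp add: irreducible_rep_def)
  then obtain e x where e: "eigenvector A e (complex_of_real x)"
    using hermitian_eigenvector_exists[OF A] by blast
  then have e': "e \<in> carrier_vec d" "e \<noteq> 0\<^sub>v d" "A *\<^sub>v e = complex_of_real x \<cdot>\<^sub>v e"
    using Ac by (auto simp: eigenvector_def)
  let ?U = "{v \<in> carrier_vec d. A *\<^sub>v v = complex_of_real x \<cdot>\<^sub>v v}"
  have zero: "A *\<^sub>v 0\<^sub>v d = 0\<^sub>v d" using Ac by (intro eq_vecI) auto
  have "invariant ?U"
    unfolding invariant_def vec_subspace_def
    by (auto simp: zero comm mult_add_distrib_mat_vec[OF Ac] mult_mat_vec[OF Ac]
        mult_mat_vec[OF rho_carrier] smult_add_distrib_vec smult_smult_assoc mult.commute)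
  moreover have "?U \<noteq> {0\<^sub>v d}" using e' by blast
  ultimately have "?U = carrier_vec d" using irr irreducible_iff by blast
  then show ?thesis using that by blast
qed

end

lemma scaled_isometry_dim_le:
  assumes T: "T \<in> carrier_mat n m" and pos: "0 < x"
    and x: "\<And>v. v \<in> carrier_vec m \<Longrightarrow> mat_adjoint T *\<^sub>v (T *\<^sub>v v) = complex_of_real x \<cdot>\<^sub>v v"
  shows "m \<le> n"
proof (rule isometry_mat_le)
  let ?Q = "complex_of_real (1 / sqrt x) \<cdot>\<^sub>m T"
  have Qc: "?Q \<in> carrier_mat n m" using T by simp
  note Qc' = mat_adjoint_carrier[OF Qc]
  have Tu: "T *\<^sub>v u \<in> carrier_vec n" if "u \<in> carrier_vec m" for u
    by (rule mult_mat_vec_carrier[OF T that])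
  have Qu: "?Q *\<^sub>v u = complex_of_real (1 / sqrt x) \<cdot>\<^sub>v (T *\<^sub>v u)" if "u \<in> carrier_vec m" for u
    by (rule smult_mat_mult_vec[OF T that])
  have "mat_adjoint ?Q * ?Q = 1\<^sub>m m"
  proof (rule mat_eq_vecI[of _ m m])
    fix u :: "complex vec" assume u: "u \<in> carrier_vec m"
    show "mat_adjoint ?Q * ?Q *\<^sub>v u = 1\<^sub>m m *\<^sub>v u"
    proof (rule vec_eq_csI[of _ m])
      fix w :: "complex vec" assume w: "w \<in> carrier_vec m"
      have form: "(T *\<^sub>v u) \<bullet>c (T *\<^sub>v w) = complex_of_real x * (u \<bullet>c w)"
        unfolding cs_adjoint_right[OF T w Tu[OF u]] x[OF u] by (rule cs_smult_left[OF u w])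
      have "(mat_adjoint ?Q * ?Q *\<^sub>v u) \<bullet>c w = (?Q *\<^sub>v u) \<bullet>c (?Q *\<^sub>v w)"
        using cs_adjoint_right[OF Qc w mult_mat_vec_carrier[OF Qc u]] assoc_mult_mat_vec[OF Qc' Qc u] by simp
      also have "\<dots> = complex_of_real (1 / sqrt x) * (complex_of_real (1 / sqrt x) * (complex_of_real x * (u \<bullet>c w)))"
        unfolding Qu[OF u] Qu[OF w] using u w Tu
        by (simp add: cs_smult_left[of _ n] cs_smult_right[of _ n] form)
      also have "\<dots> = complex_of_real (1 / sqrt x * (1 / sqrt x) * x) * (u \<bullet>c w)"
        by (simp only: of_real_mult mult.assoc)
      also have "1 / sqrt x * (1 / sqrt x) * x = 1" using pos by (simp add: field_simps)
      finally show "(mat_adjoint ?Q * ?Q *\<^sub>v u) \<bullet>c w = (1\<^sub>m m *\<^sub>v u) \<bullet>c w" using u by simp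
    qed (use mult_mat_vec_carrier[OF mult_carrier_mat[OF Qc' Qc] u] u in simp_all)
  qed (use mult_carrier_mat[OF Qc' Qc] in simp_all)
  with Qc show "isometry_mat n m ?Q" by (simp add: isometry_mat_def)
qed

context urep_pair begin

text \<open>The product of the adjoint with \<open>T\<close> commutes with the action, so it is a
  scalar \<open>x\<close>; from \<open>T v \<noteq> 0\<close> one gets \<open>x > 0\<close>, and
  \<open>T\<close> divided by the root of \<open>x\<close> is an isometry, which compares the
  dimensions.\<close>

lemma Schur_isometry:
  assumes irr: "irreducible_rep H \<rho>" and T: "intertwiner T"
    and T': "urep_pair.intertwiner H \<sigma> \<rho> (mat_adjoint T)"
    and ne: "v \<in> carrier_vec R.d" "T *\<^sub>v v \<noteq> 0\<^sub>v S.d"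
  obtains x where "0 < x" "\<And>v. v \<in> carrier_vec R.d \<Longrightarrow> mat_adjoint T *\<^sub>v (T *\<^sub>v v) = complex_of_real x \<cdot>\<^sub>v v"
    "R.d \<le> S.d"
proof -
  interpret P: urep_pair H \<sigma> \<rho> by unfold_locales
  note c = intertwiner_carrier[OF T]
  note c' = mat_adjoint_carrier[OF c]
  note a = assoc_mult_mat_vec[OF c' c]
  note i = intertwiner_in[OF T]
  have cs: "(mat_adjoint T * T *\<^sub>v u) \<bullet>c w = (T *\<^sub>v u) \<bullet>c (T *\<^sub>v w)"
    if "u \<in> carrier_vec R.d" "w \<in> carrier_vec R.d" for u w
    using that by (simp add: a i cs_adjoint_right[OF c])
  have "hermitian_on R.d (mat_adjoint T * T)"
    unfolding hermitian_on_def
  proof (intro conjI ballI)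
    show "mat_adjoint T * T \<in> carrier_mat R.d R.d" by (rule mult_carrier_mat[OF c' c])
    show "(mat_adjoint T * T *\<^sub>v u) \<bullet>c w = u \<bullet>c (mat_adjoint T * T *\<^sub>v w)"
      if "u \<in> carrier_vec R.d" "w \<in> carrier_vec R.d" for u w
      using that by (simp add: cs) (simp add: a i cs_adjoint[OF c])
  qed
  moreover have "mat_adjoint T * T *\<^sub>v (\<rho> h *\<^sub>v u) = \<rho> h *\<^sub>v (mat_adjoint T * T *\<^sub>v u)"
    if "h \<in> carrier H" "u \<in> carrier_vec R.d" for h u
    using that T T' i by (simp add: a intertwiner_def P.intertwiner_def)
  ultimately obtain x where x: "\<And>v. v \<in> carrier_vec R.d \<Longrightarrow> mat_adjoint T * T *\<^sub>v v = complex_of_real x \<cdot>\<^sub>v v"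
    by (rule R.Schur_scalar[OF irr, of "mat_adjoint T * T"]) auto
  have form: "complex_of_real x * (u \<bullet>c w) = (T *\<^sub>v u) \<bullet>c (T *\<^sub>v w)"
    if "u \<in> carrier_vec R.d" "w \<in> carrier_vec R.d" for u w
    using cs[OF that] x[OF that(1)] cs_smult_left[OF that] by simp
  have "x * nsq v = nsq (T *\<^sub>v v)"
    using form[OF ne(1) ne(1)] unfolding cs_self by (metis of_real_eq_iff of_real_mult)
  moreover have "0 < nsq (T *\<^sub>v v)" using ne i nsq_pos_iff by blast
  ultimately have pos: "0 < x" using nsq_nonneg[of v] by (metis zero_less_mult_pos2 mult_zero_right less_eq_real_def)
  have "mat_adjoint T *\<^sub>v (T *\<^sub>v u) = complex_of_real x \<cdot>\<^sub>v u" if "u \<in> carrier_vec R.d" for u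
    using x[OF that] a[OF that] by simp
  from scaled_isometry_dim_le[OF c pos this] have "R.d \<le> S.d" .
  then show ?thesis using that pos x a by metis
qed

lemma adjoint_intertwiner:
  assumes T: "intertwiner T"
  shows "urep_pair.intertwiner H \<sigma> \<rho> (mat_adjoint T)"
proof -
  interpret P: urep_pair H \<sigma> \<rho> by unfold_locales
  note c = intertwiner_carrier[OF T]
  note c' = mat_adjoint_carrier[OF c]
  show ?thesis
    unfolding P.intertwiner_def
  proof (intro conjI ballI c')
    fix h and v :: "complex vec"
    assume h: "h \<in> carrier H" and v: "v \<in> carrier_vec S.d"
    have v': "mat_adjoint T *\<^sub>v v \<in> carrier_vec R.d" by (rule mult_mat_vec_carrier[OF c' v])
    have hv: "\<sigma> h *\<^sub>v v \<in> carrier_vec S.d" using h v by simp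
    show "mat_adjoint T *\<^sub>v (\<sigma> h *\<^sub>v v) = \<rho> h *\<^sub>v (mat_adjoint T *\<^sub>v v)"
    proof (rule vec_eq_csI[of _ R.d])
      fix w :: "complex vec" assume w: "w \<in> carrier_vec R.d"
      have Tw: "T *\<^sub>v w \<in> carrier_vec S.d" by (rule intertwiner_in[OF T w])
      have "(mat_adjoint T *\<^sub>v (\<sigma> h *\<^sub>v v)) \<bullet>c w = (\<sigma> h *\<^sub>v v) \<bullet>c (T *\<^sub>v w)"
        by (rule cs_adjoint_right[symmetric, OF c w hv])
      also have "\<dots> = v \<bullet>c (T *\<^sub>v (\<rho> (inv h) *\<^sub>v w))"
        using S.cs_act_left[OF h v Tw] T h w by (simp add: intertwiner_def)
      also have "\<dots> = (mat_adjoint T *\<^sub>v v) \<bullet>c (\<rho> (inv h) *\<^sub>v w)"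
        by (rule cs_adjoint_right[OF c]) (use h w v in simp_all)
      also have "\<dots> = (\<rho> h *\<^sub>v (mat_adjoint T *\<^sub>v v)) \<bullet>c w"
        by (rule R.cs_act_left[symmetric, OF h v' w])
      finally show "(mat_adjoint T *\<^sub>v (\<sigma> h *\<^sub>v v)) \<bullet>c w = (\<rho> h *\<^sub>v (mat_adjoint T *\<^sub>v v)) \<bullet>c w" .
    qed (use mult_mat_vec_carrier[OF c' hv] h v' in simp_all)
  qed
qed

text \<open>The previous lemma applies to \<open>T\<close> and to its adjoint. Hence both products
  are positive scalars and the dimensions agree, and the adjoint divided by \<open>x\<close> inverts
  \<open>T\<close>.\<close>

lemma Schur:
  assumes irr: "irreducible_rep H \<rho>" "irreducible_rep H \<sigma>" and T: "intertwiner T"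
    and ne: "v \<in> carrier_vec R.d" "T *\<^sub>v v \<noteq> 0\<^sub>v S.d"
  shows "rep_iso H \<rho> \<sigma>"
proof -
  interpret P: urep_pair H \<sigma> \<rho> by unfold_locales
  note c = intertwiner_carrier[OF T]
  note T' = adjoint_intertwiner[OF T]
  obtain x where x: "0 < x" "\<And>v. v \<in> carrier_vec R.d \<Longrightarrow> mat_adjoint T *\<^sub>v (T *\<^sub>v v) = complex_of_real x \<cdot>\<^sub>v v"
    "R.d \<le> S.d"
    by (rule Schur_isometry[OF irr(1) T T' ne]) blast
  have v0: "v \<noteq> 0\<^sub>v R.d" using ne intertwiner_zero[OF T] by auto
  have ne': "mat_adjoint T *\<^sub>v (T *\<^sub>v v) \<noteq> 0\<^sub>v R.d"
  proof
    assume "mat_adjoint T *\<^sub>v (T *\<^sub>v v) = 0\<^sub>v R.d"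
    then have "(complex_of_real x \<cdot>\<^sub>v v) $ i = 0" if "i < R.d" for i using x(2)[OF ne(1)] that by simp
    then have "v = 0\<^sub>v R.d" using ne(1) x(1) by (intro eq_vecI) auto
    then show False using v0 by simp
  qed
  obtain y where y: "0 < y" "\<And>v. v \<in> carrier_vec S.d \<Longrightarrow> T *\<^sub>v (mat_adjoint T *\<^sub>v v) = complex_of_real y \<cdot>\<^sub>v v"
    "S.d \<le> R.d"
    by (rule P.Schur_isometry[OF irr(2) T' _ intertwiner_in[OF T ne(1)] ne', unfolded mat_adjoint_adjoint])
      (use T in simp, blast)
  \<comment> \<open>Both sides compute \<open>T\<close> applied to the adjoint applied to
    \<open>T v\<close>, once through the scalar \<open>y\<close> on the target and once through
    \<open>x\<close> on the source.\<close>
  have xy: "complex_of_real x \<cdot>\<^sub>v (T *\<^sub>v v) = complex_of_real y \<cdot>\<^sub>v (T *\<^sub>v v)"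
    using y(2)[OF intertwiner_in[OF T ne(1)]] x(2)[OF ne(1)] mult_mat_vec[OF c ne(1), of "complex_of_real x"] by simp
  obtain i where i: "i < S.d" "(T *\<^sub>v v) $ i \<noteq> 0"
    using ne intertwiner_in[OF T ne(1)] by (metis carrier_vecD eq_vecI index_zero_vec)
  have "complex_of_real x * (T *\<^sub>v v) $ i = complex_of_real y * (T *\<^sub>v v) $ i"
    using arg_cong[OF xy, of "\<lambda>u. u $ i"] carrier_vecD[OF intertwiner_in[OF T ne(1)]] i(1)
    by (simp only: index_smult_vec)
  then have "x = y" using i(2) by (metis mult_right_cancel of_real_eq_iff)
  let ?T' = "complex_of_real (1 / x) \<cdot>\<^sub>m mat_adjoint T"
  have T'v: "?T' *\<^sub>v w = complex_of_real (1 / x) \<cdot>\<^sub>v (mat_adjoint T *\<^sub>v w)" if "w \<in> carrier_vec S.d" for w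
    by (rule smult_mat_mult_vec[OF mat_adjoint_carrier[OF c] that])
  have one: "complex_of_real (1 / x) \<cdot>\<^sub>v (complex_of_real x \<cdot>\<^sub>v w) = w" for w
    using x(1) by (intro eq_vecI) auto
  show ?thesis
  proof (rule rep_isoI[OF T])
    show "?T' \<in> carrier_mat R.d S.d" using mat_adjoint_carrier[OF c] by simp
    show "R.d = S.d" using x y by simp
    show "?T' *\<^sub>v (T *\<^sub>v w) = w" if "w \<in> carrier_vec R.d" for w
      using that by (simp only: T'v intertwiner_in[OF T] x(2) one)
    show "T *\<^sub>v (?T' *\<^sub>v w) = w" if "w \<in> carrier_vec S.d" for w
      using that mult_mat_vec[OF c P.intertwiner_in[OF T' that]]
      by (simp only: T'v y(2) one \<open>x = y\<close>[symmetric])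
  qed
qed

end

section \<open>Classes of irreducible representations\<close>

lemma urep_triv: "group H \<Longrightarrow> finite (carrier H) \<Longrightarrow> urep H (\<lambda>h. 1\<^sub>m 1)"
proof -
  have "1\<^sub>m 1 * mat_adjoint (1\<^sub>m 1) = (1\<^sub>m 1 :: complex mat)"
    by (rule eq_matI) (auto simp: scalar_prod_def)
  then show "group H \<Longrightarrow> finite (carrier H) \<Longrightarrow> urep H (\<lambda>h. 1\<^sub>m 1)"
    by (simp add: urep_def urep_axioms_def unitary_rep_def rep_dim_def)
qed

context urep begin

lemma invariant_fixed_space: "invariant (fixed_space H \<rho>)"
  using vec_subspace_fixed_by[of "carrier H"] unfolding invariant_def fixed_space_eq
  by (auto simp: fixed_by_def)

lemma nontrivial_iff_triv_class:
  assumes irr: "irreducible_rep H \<rho>"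
  shows "nontrivial_irrep H \<rho> \<longleftrightarrow> rep_class H \<rho> \<noteq> triv_class H"
proof -
  have triv: "urep H (\<lambda>h. 1\<^sub>m 1)" by (rule urep_triv[OF is_group fin])
  have cls: "rep_class H \<rho> = triv_class H \<longleftrightarrow> rep_iso H \<rho> (\<lambda>h. 1\<^sub>m 1)"
    unfolding triv_class_def by (rule rep_class_eq_iff[OF urep_axioms triv])
  from triv  interpret P: urep_pair H \<rho> "\<lambda>h. 1\<^sub>m 1" by (simp add: urep_pair_def urep_axioms)
  have d1: "P.S.d = 1" by (simp add: rep_dim_def)
  have fixed1: "P.S.fixed_by (carrier H) = carrier_vec 1"
    unfolding P.S.fixed_by_def d1 by auto
  have ne1: "carrier_vec 1 \<noteq> {0\<^sub>v 1 :: complex vec}"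
  proof
    assume "carrier_vec 1 = {0\<^sub>v 1 :: complex vec}"
    then have "unit_vec 1 0 = (0\<^sub>v 1 :: complex vec)" by (metis singletonD unit_vec_carrier)
    then have "unit_vec 1 0 $ 0 = (0\<^sub>v 1 :: complex vec) $ 0" by simp
    then show False by simp
  qed
  show ?thesis
  proof
    assume n: "nontrivial_irrep H \<rho>"
    show "rep_class H \<rho> \<noteq> triv_class H"
    proof
      assume "rep_class H \<rho> = triv_class H"
      then have "rep_iso H \<rho> (\<lambda>h. 1\<^sub>m 1)"
        by (simp only: cls)
      then have "nontrivial_irrep H (\<lambda>h. 1\<^sub>m 1)" by (rule P.iso_nontrivial[OF _ n])
      then show False using fixed1 ne1 unfolding nontrivial_irrep_def P.S.fixed_space_eq d1 by blast
    qed
  next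
    assume t: "rep_class H \<rho> \<noteq> triv_class H"
    show "nontrivial_irrep H \<rho>"
    proof (rule ccontr)
      assume "\<not> nontrivial_irrep H \<rho>"
      then have fixed: "fixed_space H \<rho> = carrier_vec d"
        using irr irreducible_iff invariant_fixed_space by (auto simp: nontrivial_irrep_def)
      then have act: "\<rho> h *\<^sub>v v = v" if "h \<in> carrier H" "v \<in> carrier_vec d" for h v
        using that by (auto simp: fixed_space_def)
      have "0 < d" using irr by (simp add: irreducible_rep_def)
      \<comment> \<open>When every vector is fixed every line is invariant, so irreducibility leaves
        only dimension 1.\<close>
      let ?U = "{c \<cdot>\<^sub>v unit_vec d 0 | c :: complex. True}"
      have "invariant ?U"
        unfolding invariant_def vec_subspace_def
      proof (intro conjI ballI allI)
        show "0\<^sub>v d \<in> ?U" by (rule CollectI, rule exI[of _ 0]) (auto intro!: eq_vecI)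
        show "u + v \<in> ?U" if "u \<in> ?U" "v \<in> ?U" for u v
          using that by (auto simp: add_smult_distrib_vec[symmetric])
        show "c \<cdot>\<^sub>v u \<in> ?U" if "u \<in> ?U" for c u
          using that by (auto simp: smult_smult_assoc)
        show "\<rho> h *\<^sub>v u \<in> ?U" if "h \<in> carrier H" "u \<in> ?U" for h u
          using that by (auto simp: act)
      qed auto
      moreover have "?U \<noteq> {0\<^sub>v d}"
      proof
        assume U0: "?U = {0\<^sub>v d}"
        have "1 \<cdot>\<^sub>v unit_vec d 0 \<in> ?U" by blast
        then have "(1 \<cdot>\<^sub>v unit_vec d 0) $ 0 = (0\<^sub>v d :: complex vec) $ 0" unfolding U0 by simp
        then show False using \<open>0 < d\<close> by simp
      qed
      ultimately have U: "?U = carrier_vec d" using irr irreducible_iff by blast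
      have "d = 1"
      proof (rule ccontr)
        assume "d \<noteq> 1"
        then have "1 < d" using \<open>0 < d\<close> by simp
        have "unit_vec d 1 \<in> ?U" unfolding U by simp
        then obtain c :: complex where "unit_vec d 1 = c \<cdot>\<^sub>v unit_vec d 0" by blast
        then have "(unit_vec d 1 :: complex vec) $ 1 = (c \<cdot>\<^sub>v unit_vec d 0) $ 1" by simp
        then show False using \<open>1 < d\<close> by simp
      qed
      have "P.intertwiner (1\<^sub>m 1)"
        using \<open>d = 1\<close> d1 by (auto simp: P.intertwiner_def act simp del: One_nat_def)
      then have "rep_iso H \<rho> (\<lambda>h. 1\<^sub>m 1)"
        by (rule P.rep_isoI[of _ "1\<^sub>m 1"]) (use \<open>d = 1\<close> d1 in \<open>auto simp del: One_nat_def\<close>)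
      then have "rep_class H \<rho> = triv_class H"
        by (simp only: cls)
      with t show False by simp
    qed
  qed
qed

end

lemma Irr_nontrivial_iff:
  assumes "group H" "finite (carrier H)"
  shows "C \<in> Irr H - {triv_class H} \<longleftrightarrow> (\<exists>\<rho>. nontrivial_irrep H \<rho> \<and> C = rep_class H \<rho>)"
proof -
  have "nontrivial_irrep H \<rho> \<longleftrightarrow> irreducible_rep H \<rho> \<and> rep_class H \<rho> \<noteq> triv_class H" for \<rho>
    using urep.nontrivial_iff_triv_class[OF irreducible_urep[OF assms], of \<rho>]
    by (auto simp: nontrivial_irrep_def)
  then show ?thesis unfolding Irr_def by blast
qed

lemma nontrivial_urep:
  "group H \<Longrightarrow> finite (carrier H) \<Longrightarrow> nontrivial_irrep H \<rho> \<Longrightarrow> urep H \<rho>"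
  by (simp add: irreducible_urep nontrivial_irrep_def)

lemma (in urep) nontrivial_eigenvector_psi_le:
  assumes "nontrivial_irrep H \<rho>" "eigenvector (lap w) v (complex_of_real x)"
  shows "psi H w \<rho> \<le> ereal x"
proof (rule psi_le[OF _ assms(2)])
  show "v \<in> fixed_compl H \<rho>"
    using assms(2) by (simp add: nontrivial_fixed_compl[OF assms(1)] eigenvector_def)
qed

lemma (in urep_pair) iso_psi:
  assumes iso: "rep_iso H \<rho> \<sigma>" and n: "nontrivial_irrep H \<rho>"
    and sym: "\<And>h. h \<in> carrier H \<Longrightarrow> w (inv h) = w h"
  shows "psi H w \<sigma> \<le> psi H w \<rho>"
proof -
  obtain u x where u: "eigenvector (R.lap w) u (complex_of_real x)" "psi H w \<rho> = ereal x"
    by (rule R.nontrivial_psi[OF n, of w]) (use sym in auto)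
  obtain u' where "eigenvector (S.lap w) u' (complex_of_real x)"
    by (rule iso_eigenvector[OF iso u(1)])
  then show ?thesis
    using S.nontrivial_eigenvector_psi_le[OF iso_nontrivial[OF iso n]] u(2) by simp
qed

text \<open>Isomorphisms are merely invertible, not unitary, but they transport eigenvalues, and on
  a non-trivial irreducible representation every eigenvector counts for \<open>psi\<close>. So the
  representative picked by \<open>SOME\<close> is immaterial.\<close>

lemma psi_class_eq:
  assumes G: "group H" "finite (carrier H)" and n: "nontrivial_irrep H \<rho>"
    and sym: "\<And>h. h \<in> carrier H \<Longrightarrow> w (inv\<^bsub>H\<^esub> h) = w h"
  shows "psi_class H w (rep_class H \<rho>) = psi H w \<rho>"
proof -
  define \<sigma> where "\<sigma> = (SOME \<sigma>. \<sigma> \<in> rep_class H \<rho>)"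
  have r: "urep H \<rho>" by (rule nontrivial_urep[OF G n])
  have "\<sigma> \<in> rep_class H \<rho>" unfolding \<sigma>_def by (rule someI[of _ \<rho>]) (rule in_rep_class_self[OF r])
  then have s: "urep H \<sigma>" and iso: "rep_iso H \<rho> \<sigma>" using in_rep_class_iff[OF r] by auto
  interpret P: urep_pair H \<rho> \<sigma> using r s by (simp add: urep_pair_def)
  interpret Q: urep_pair H \<sigma> \<rho> using r s by (simp add: urep_pair_def)
  have "psi H w \<sigma> = psi H w \<rho>"
    using P.iso_psi[OF iso n, of w] Q.iso_psi[OF rep_iso_sym[OF r s iso] P.iso_nontrivial[OF iso n], of w] sym
    by force
  then show ?thesis by (simp add: psi_class_def \<sigma>_def)
qed

section \<open>Contragredient representations\<close>

lemma conj_mat_vec: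
  fixes A B :: "complex mat"
  assumes A: "A \<in> carrier_mat n m" and B: "B \<in> carrier_mat n m" and v: "v \<in> carrier_vec m"
    and eq: "\<And>i j. i < n \<Longrightarrow> j < m \<Longrightarrow> B $$ (i, j) = cnj (A $$ (i, j))"
  shows "B *\<^sub>v conjugate v = conjugate (A *\<^sub>v v)"
proof (rule eq_vecI)
  fix i assume "i < dim_vec (conjugate (A *\<^sub>v v))"
  then have i: "i < n" using A by simp
  have cv: "conjugate v \<in> carrier_vec m" using v by simp
  have Av: "A *\<^sub>v v \<in> carrier_vec n" by (rule mult_mat_vec_carrier[OF A v])
  have "(B *\<^sub>v conjugate v) $ i = (\<Sum>j<m. cnj (A $$ (i, j) * v $ j))"
    unfolding mat_vec_index[OF B cv i] using v by (intro sum.cong refl) (simp add: eq i)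
  also have "\<dots> = cnj ((A *\<^sub>v v) $ i)" by (simp only: mat_vec_index[OF A v i] cnj_sum)
  also have "\<dots> = conjugate (A *\<^sub>v v) $ i" by (subst vec_index_conjugate) (use i A in auto)
  finally show "(B *\<^sub>v conjugate v) $ i = conjugate (A *\<^sub>v v) $ i" .
qed (use A B in simp)

context urep begin

abbreviation contra where "contra \<equiv> contragredient H \<rho>"

lemma contra_carrier: "h \<in> carrier H \<Longrightarrow> contra h \<in> carrier_mat d d"
  by (simp add: contragredient_def)

text \<open>For unitary matrices the transposed inverse is the entrywise conjugate. Hence
  conjugation of vectors carries \<open>\<rho>\<close> to its contragredient antilinearly, and the
  facts below are transported along it.\<close>

lemma contra_index:
  assumes "h \<in> carrier H" "i < d" "j < d"
  shows "contra h $$ (i, j) = cnj (\<rho> h $$ (i, j))"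
proof -
  have "\<rho> (inv h) = mat_adjoint (\<rho> h)" using assms by (simp add: rho_adjoint)
  then show ?thesis using assms carrier_matD[OF rho_carrier[OF assms(1)]] by (simp add: contragredient_def)
qed

lemma contra_dim: "rep_dim H contra = d"
  unfolding rep_dim_def using carrier_matD(1)[OF contra_carrier[OF one_closed]] by (simp add: rep_dim_def)

lemma contra_vec: "h \<in> carrier H \<Longrightarrow> v \<in> carrier_vec d \<Longrightarrow> contra h *\<^sub>v conjugate v = conjugate (\<rho> h *\<^sub>v v)"
  by (rule conj_mat_vec[OF rho_carrier contra_carrier]) (auto simp: contra_index)

lemma contra_vec': "h \<in> carrier H \<Longrightarrow> v \<in> carrier_vec d \<Longrightarrow> contra h *\<^sub>v v = conjugate (\<rho> h *\<^sub>v conjugate v)"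
  using contra_vec[of h "conjugate v"] by simp

lemma contra_urep: "urep H contra"
proof -
  have one: "contra \<one> = 1\<^sub>m d" by (simp add: contragredient_def rho_one)
  have mult: "contra (h \<otimes> k) = contra h * contra k" if "h \<in> carrier H" "k \<in> carrier H" for h k
    using that unfolding contragredient_def
    by (simp add: inv_mult_group rho_mult transpose_mult[of _ d d _ d])
  have unit: "contra h * mat_adjoint (contra h) = 1\<^sub>m d" if h: "h \<in> carrier H" for h
  proof -
    have "mat_adjoint (contra h) = contra (inv h)"
    proof (rule eq_matI)
      fix i j assume "i < dim_row (contra (inv h))" "j < dim_col (contra (inv h))"
      then have ij: "i < d" "j < d" using contra_carrier[of "inv h"] h by auto
      have "mat_adjoint (contra h) $$ (i, j) = cnj (contra h $$ (j, i))"
        using ij carrier_matD[OF contra_carrier[OF h]] by simp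
      also have "\<dots> = \<rho> h $$ (j, i)" using ij h by (simp add: contra_index)
      also have "\<dots> = contra (inv h) $$ (i, j)"
        using ij h carrier_matD[OF rho_carrier[OF h]] by (simp add: contragredient_def)
      finally show "mat_adjoint (contra h) $$ (i, j) = contra (inv h) $$ (i, j)" .
    qed (use carrier_matD[OF contra_carrier[OF h]] carrier_matD[OF contra_carrier[OF inv_closed[OF h]]] in simp_all)
    then show ?thesis using h one by (simp add: mult[symmetric])
  qed
  show ?thesis
    by unfold_locales (use fin one mult unit contra_carrier in \<open>auto simp: unitary_rep_def contra_dim\<close>)
qed

lemma contra_fixed_by:
  assumes "K \<subseteq> carrier H" "v \<in> fixed_by K"
  shows "conjugate v \<in> urep.fixed_by H contra K"
proof -
  interpret S: urep H contra by (rule contra_urep)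
  show ?thesis using assms unfolding S.fixed_by_def fixed_by_def contra_dim
    by (auto simp: subset_iff contra_vec)
qed

lemma contra_fixed_by':
  assumes "K \<subseteq> carrier H" "v \<in> urep.fixed_by H contra K"
  shows "conjugate v \<in> fixed_by K"
proof -
  interpret S: urep H contra by (rule contra_urep)
  have "\<rho> k *\<^sub>v conjugate v = conjugate v" if "k \<in> K" for k
  proof -
    have "conjugate (\<rho> k *\<^sub>v conjugate v) = v"
      using assms that unfolding S.fixed_by_def contra_dim by (auto simp: subset_iff contra_vec')
    then show ?thesis by (metis conjugate_id)
  qed
  then show ?thesis using assms unfolding S.fixed_by_def fixed_by_def contra_dim by simp
qed

lemma contra_irreducible:
  assumes irr: "irreducible_rep H \<rho>"
  shows "irreducible_rep H contra"
proof -
  interpret S: urep H contra by (rule contra_urep)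
  show ?thesis
    unfolding S.irreducible_iff contra_dim
  proof (intro conjI allI impI)
    show "0 < d" using irr by (simp add: irreducible_rep_def)
    fix U assume U: "S.invariant U"
    then have sub: "U \<subseteq> carrier_vec d" and U0: "0\<^sub>v d \<in> U"
      and add: "\<And>u v. u \<in> U \<Longrightarrow> v \<in> U \<Longrightarrow> u + v \<in> U"
      and smult: "\<And>c u. u \<in> U \<Longrightarrow> c \<cdot>\<^sub>v u \<in> U"
      and act: "\<And>h u. h \<in> carrier H \<Longrightarrow> u \<in> U \<Longrightarrow> contra h *\<^sub>v u \<in> U"
      unfolding S.invariant_def vec_subspace_def contra_dim by auto
    have "invariant {v \<in> carrier_vec d. conjugate v \<in> U}"
      unfolding invariant_def vec_subspace_def
      by (auto simp: U0 add smult act conjugate_add_vec[of _ d] conjugate_smult_vec contra_vec[symmetric])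
    then consider "{v \<in> carrier_vec d. conjugate v \<in> U} = {0\<^sub>v d}"
      | "{v \<in> carrier_vec d. conjugate v \<in> U} = carrier_vec d"
      using irr irreducible_iff by blast
    then show "U = {0\<^sub>v d} \<or> U = carrier_vec d"
    proof cases
      case 1
      have "u = 0\<^sub>v d" if "u \<in> U" for u
      proof -
        have "conjugate u \<in> {v \<in> carrier_vec d. conjugate v \<in> U}" using that sub by auto
        then show ?thesis unfolding 1 by simp
      qed
      then show ?thesis using U0 by blast
    next
      case 2
      have "u \<in> U" if "u \<in> carrier_vec d" for u
      proof -
        have "conjugate u \<in> {v \<in> carrier_vec d. conjugate v \<in> U}" unfolding 2 using that by simp
        then show ?thesis by simp
      qed
      then show ?thesis using sub by blast
    qed
  qed
qed

lemma contra_nontrivial: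
  assumes n: "nontrivial_irrep H \<rho>"
  shows "nontrivial_irrep H contra"
proof -
  interpret S: urep H contra by (rule contra_urep)
  have "v = 0\<^sub>v d" if "v \<in> S.fixed_by (carrier H)" for v
  proof -
    have "conjugate v \<in> fixed_by (carrier H)" by (rule contra_fixed_by'[OF _ that]) simp
    then show ?thesis using n by (simp add: nontrivial_irrep_def fixed_space_eq)
  qed
  moreover have "0\<^sub>v d \<in> S.fixed_by (carrier H)"
    using S.vec_subspace_fixed_by[of "carrier H"] by (simp add: vec_subspace_def contra_dim)
  ultimately have "S.fixed_by (carrier H) = {0\<^sub>v d}" by blast
  then show ?thesis
    using n contra_irreducible by (simp add: nontrivial_irrep_def S.fixed_space_eq contra_dim)
qed

text \<open>This rests on real coefficients \<open>\<alpha>\<close>, and it is why the gaps of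
  \<open>V\<close> and its contragredient agree.\<close>

lemma contra_gop:
  assumes v: "v \<in> carrier_vec d"
  shows "galg_rep H contra \<alpha> *\<^sub>v conjugate v = conjugate (gop \<alpha> *\<^sub>v v)"
proof (rule conj_mat_vec[OF gop_carrier _ v])
  show "galg_rep H contra \<alpha> \<in> carrier_mat d d" by (simp add: galg_rep_def contra_dim)
  show "galg_rep H contra \<alpha> $$ (i, j) = cnj (gop \<alpha> $$ (i, j))" if "i < d" "j < d" for i j
    using that by (simp add: galg_rep_def contra_dim contra_index)
qed

lemma contra_eigenvector:
  assumes e: "eigenvector (gop \<alpha>) v (complex_of_real x)"
  shows "eigenvector (galg_rep H contra \<alpha>) (conjugate v) (complex_of_real x)"
proof -
  have v: "v \<in> carrier_vec d" "v \<noteq> 0\<^sub>v d" "gop \<alpha> *\<^sub>v v = complex_of_real x \<cdot>\<^sub>v v"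
    using e by (auto simp: eigenvector_def)
  then have "galg_rep H contra \<alpha> *\<^sub>v conjugate v = complex_of_real x \<cdot>\<^sub>v conjugate v"
    by (simp add: contra_gop conjugate_smult_vec)
  moreover have "dim_row (galg_rep H contra \<alpha>) = d" by (simp add: galg_rep_def contra_dim)
  ultimately show ?thesis using v by (simp add: eigenvector_def)
qed

lemma contra_psi_le:
  assumes n: "nontrivial_irrep H \<rho>" and sym: "\<And>h. h \<in> carrier H \<Longrightarrow> w (inv h) = w h"
  shows "psi H w contra \<le> psi H w \<rho>"
proof -
  obtain u x where u: "eigenvector (lap w) u (complex_of_real x)" "psi H w \<rho> = ereal x"
    by (rule nontrivial_psi[OF n, of w]) (use sym in auto)
  show ?thesis
    using urep.nontrivial_eigenvector_psi_le[OF contra_urep contra_nontrivial[OF n] contra_eigenvector[OF u(1)]]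
      u(2) by simp
qed

end

lemma contra_iso:
  assumes r: "urep H \<rho>" and s: "urep H \<sigma>" and iso: "rep_iso H \<rho> \<sigma>"
  shows "rep_iso H (contragredient H \<rho>) (contragredient H \<sigma>)"
proof -
  interpret P: urep_pair H \<rho> \<sigma> using r s by (simp add: urep_pair_def)
  interpret P': urep_pair H \<sigma> \<rho> using r s by (simp add: urep_pair_def)
  interpret Q: urep_pair H P.R.contra P.S.contra
    by (rule urep_pair.intro[OF P.R.contra_urep P.S.contra_urep])
  obtain T T' where T: "P.intertwiner T" "P'.intertwiner T'" "P.R.d = P.S.d"
    "\<And>v. v \<in> carrier_vec P.R.d \<Longrightarrow> T' *\<^sub>v (T *\<^sub>v v) = v"
    "\<And>v. v \<in> carrier_vec P.S.d \<Longrightarrow> T *\<^sub>v (T' *\<^sub>v v) = v"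
    by (rule P.rep_isoE[OF iso]) blast
  note c = P.intertwiner_carrier[OF T(1)]
  note c' = P'.intertwiner_carrier[OF T(2)]
  note i = P.intertwiner_in[OF T(1)]
  note i' = P'.intertwiner_in[OF T(2)]
  have bc: "map_mat cnj T *\<^sub>v v = conjugate (T *\<^sub>v conjugate v)" if "v \<in> carrier_vec P.R.d" for v
    using conj_mat_vec[of T P.S.d P.R.d "map_mat cnj T" "conjugate v"] c that by auto
  have bc': "map_mat cnj T' *\<^sub>v v = conjugate (T' *\<^sub>v conjugate v)" if "v \<in> carrier_vec P.S.d" for v
    using conj_mat_vec[of T' P.R.d P.S.d "map_mat cnj T'" "conjugate v"] c' that by auto
  show ?thesis
  proof (rule Q.rep_isoI[of "map_mat cnj T" "map_mat cnj T'", unfolded P.R.contra_dim P.S.contra_dim])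
    show "Q.intertwiner (map_mat cnj T)"
      unfolding Q.intertwiner_def P.R.contra_dim P.S.contra_dim
      using c T(1) i by (simp add: bc P.R.contra_vec' P.S.contra_vec' P.intertwiner_def)
    show "map_mat cnj T' \<in> carrier_mat P.R.d P.S.d" using c' by simp
    show "map_mat cnj T' *\<^sub>v (map_mat cnj T *\<^sub>v v) = v" if "v \<in> carrier_vec P.R.d" for v
      using that i[of "conjugate v"] T(4)[of "conjugate v"] by (simp add: bc bc')
    show "map_mat cnj T *\<^sub>v (map_mat cnj T' *\<^sub>v v) = v" if "v \<in> carrier_vec P.S.d" for v
      using that i'[of "conjugate v"] T(5)[of "conjugate v"] by (simp add: bc bc')
  qed (rule T(3))
qed

lemma dual_class_eq:
  assumes r: "urep H \<rho>"
  shows "dual_class H (rep_class H \<rho>) = rep_class H (contragredient H \<rho>)"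
proof -
  have "rep_class H (contragredient H \<sigma>) = rep_class H (contragredient H \<rho>)" if "\<sigma> \<in> rep_class H \<rho>" for \<sigma>
  proof -
    have s: "urep H \<sigma>" and iso: "rep_iso H \<rho> \<sigma>" using that in_rep_class_iff[OF r] by auto
    show ?thesis
      by (rule rep_class_eqI[symmetric])
        (rule urep.contra_urep[OF r] urep.contra_urep[OF s] contra_iso[OF r s iso])+
  qed
  moreover have "\<rho> \<in> rep_class H \<rho>" by (rule in_rep_class_self[OF r])
  ultimately show ?thesis unfolding dual_class_def by blast
qed

section \<open>Permutation representations and the regular representation\<close>

text \<open>Serves both the regular representation and the natural action on \<open>n\<close>
  points.\<close>

definition perm_rep :: "nat \<Rightarrow> ('h \<Rightarrow> nat \<Rightarrow> nat) \<Rightarrow> 'h \<Rightarrow> complex mat" where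
  "perm_rep N a h = mat N N (\<lambda>(i, j). of_bool (i = a h j))"

locale perm_action = group H for H (structure) +
  fixes N :: nat and a :: "'a \<Rightarrow> nat \<Rightarrow> nat"
  assumes fin: "finite (carrier H)"
    and a_less: "h \<in> carrier H \<Longrightarrow> i < N \<Longrightarrow> a h i < N"
    and a_one: "i < N \<Longrightarrow> a \<one> i = i"
    and a_mult: "h \<in> carrier H \<Longrightarrow> k \<in> carrier H \<Longrightarrow> i < N \<Longrightarrow> a (h \<otimes> k) i = a h (a k i)"
begin

lemma a_inv_eq_iff:
  assumes "h \<in> carrier H" "i < N" "j < N"
  shows "i = a h j \<longleftrightarrow> j = a (inv h) i"
  using assms a_mult[of "inv h" h j] a_mult[of h "inv h" i] by (auto simp: a_one)

lemma perm_rep_dim: "rep_dim H (perm_rep N a) = N"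
  by (simp add: rep_dim_def perm_rep_def)

lemma perm_rep_index:
  assumes h: "h \<in> carrier H" and x: "x \<in> carrier_vec N" and i: "i < N"
  shows "(perm_rep N a h *\<^sub>v x) $ i = x $ a (inv h) i"
proof -
  have c: "perm_rep N a h \<in> carrier_mat N N" by (simp add: perm_rep_def)
  have "(perm_rep N a h *\<^sub>v x) $ i = (\<Sum>j<N. if j = a (inv h) i then x $ j else 0)"
    unfolding mat_vec_index[OF c x i]
  proof (intro sum.cong refl)
    fix j assume "j \<in> {..<N}"
    then show "perm_rep N a h $$ (i, j) * x $ j = (if j = a (inv h) i then x $ j else 0)"
      using i a_inv_eq_iff[OF h i, of j] by (auto simp: perm_rep_def)
  qed
  then show ?thesis using a_less[of "inv h" i] h i by simp
qed

lemma perm_rep_urep: "urep H (perm_rep N a)"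
proof -
  have c: "perm_rep N a h \<in> carrier_mat N N" for h by (simp add: perm_rep_def)
  have one: "perm_rep N a \<one> = 1\<^sub>m N"
    by (rule eq_matI) (auto simp: perm_rep_def a_one)
  have mult: "perm_rep N a (h \<otimes> k) = perm_rep N a h * perm_rep N a k"
    if h: "h \<in> carrier H" "k \<in> carrier H" for h k
  proof (rule mat_eq_vecI[OF c mult_carrier_mat[OF c c]])
    fix x :: "complex vec" assume x: "x \<in> carrier_vec N"
    have kx: "perm_rep N a k *\<^sub>v x \<in> carrier_vec N" by (rule mult_mat_vec_carrier[OF c x])
    show "perm_rep N a (h \<otimes> k) *\<^sub>v x = perm_rep N a h * perm_rep N a k *\<^sub>v x"
      unfolding assoc_mult_mat_vec[OF c c x]
    proof (rule eq_vecI)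
      fix i assume "i < dim_vec (perm_rep N a h *\<^sub>v (perm_rep N a k *\<^sub>v x))"
      then have i: "i < N" by (simp add: perm_rep_def)
      show "(perm_rep N a (h \<otimes> k) *\<^sub>v x) $ i = (perm_rep N a h *\<^sub>v (perm_rep N a k *\<^sub>v x)) $ i"
        using h i x kx a_less[of "inv h" i]
        by (simp add: perm_rep_index inv_mult_group a_mult del: index_mult_mat_vec)
    qed (simp add: perm_rep_def)
  qed
  have unit: "perm_rep N a h * mat_adjoint (perm_rep N a h) = 1\<^sub>m N" if h: "h \<in> carrier H" for h
  proof -
    have "mat_adjoint (perm_rep N a h) = perm_rep N a (inv h)"
    proof (rule eq_matI)
      fix i j assume "i < dim_row (perm_rep N a (inv h))" "j < dim_col (perm_rep N a (inv h))"
      then have ij: "i < N" "j < N" by (auto simp: perm_rep_def)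
      then show "mat_adjoint (perm_rep N a h) $$ (i, j) = perm_rep N a (inv h) $$ (i, j)"
        using a_inv_eq_iff[OF h ij(2,1)] by (simp add: perm_rep_def)
    qed (simp_all add: perm_rep_def)
    then show ?thesis using h one by (simp add: mult[symmetric])
  qed
  show ?thesis
    by unfold_locales (use fin one mult unit c in \<open>auto simp: unitary_rep_def perm_rep_dim\<close>)
qed

end

definition reg_act :: "('h, 'm) monoid_scheme \<Rightarrow> 'h \<Rightarrow> nat \<Rightarrow> nat" where
  "reg_act H h i = inv_into {..<Coset.order H} (group_enum H) (h \<otimes>\<^bsub>H\<^esub> group_enum H i)"

context
  fixes H (structure)
  assumes G: "group H" and finH: "finite (carrier H)"
begin

interpretation group H by (rule G)

lemma group_enum_bij: "bij_betw (group_enum H) {..<Coset.order H} (carrier H)"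
proof -
  have "\<exists>e. bij_betw e {..<Coset.order H} (carrier H)"
    using ex_bij_betw_nat_finite[OF finH] by (auto simp: Coset.order_def atLeast0LessThan)
  then show ?thesis unfolding group_enum_def by (rule someI_ex)
qed

lemma group_enum_in: "i < Coset.order H \<Longrightarrow> group_enum H i \<in> carrier H"
  using bij_betwE[OF group_enum_bij] by simp

lemma group_enum_reg_act:
  "h \<in> carrier H \<Longrightarrow> i < Coset.order H \<Longrightarrow> group_enum H (reg_act H h i) = h \<otimes> group_enum H i"
  unfolding reg_act_def
  by (rule bij_betw_inv_into_right[OF group_enum_bij]) (simp add: group_enum_in)

lemma reg_act_less: "h \<in> carrier H \<Longrightarrow> i < Coset.order H \<Longrightarrow> reg_act H h i < Coset.order H"
  unfolding reg_act_def
  using bij_betwE[OF bij_betw_inv_into[OF group_enum_bij]] by (simp add: group_enum_in)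

lemma group_enum_eq_iff:
  "i < Coset.order H \<Longrightarrow> j < Coset.order H \<Longrightarrow> group_enum H i = group_enum H j \<longleftrightarrow> i = j"
  using bij_betw_imp_inj_on[OF group_enum_bij] by (simp add: inj_on_eq_iff)

lemma reg_perm_action: "perm_action H (Coset.order H) (reg_act H)"
proof unfold_locales
  fix i assume i: "i < Coset.order H"
  have "group_enum H (reg_act H \<one> i) = group_enum H i"
    using i by (simp add: group_enum_reg_act group_enum_in)
  then show "reg_act H \<one> i = i" using i by (simp add: group_enum_eq_iff reg_act_less)
  fix h k assume h: "h \<in> carrier H" and k: "k \<in> carrier H"
  have "group_enum H (reg_act H (h \<otimes> k) i) = group_enum H (reg_act H h (reg_act H k i))"
    using i h k by (simp add: group_enum_reg_act group_enum_in reg_act_less m_assoc)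
  then show "reg_act H (h \<otimes> k) i = reg_act H h (reg_act H k i)"
    using i h k by (simp add: group_enum_eq_iff reg_act_less)
qed (use finH reg_act_less in auto)

lemma regular_rep_eq: "h \<in> carrier H \<Longrightarrow> regular_rep H h = perm_rep (Coset.order H) (reg_act H) h"
  unfolding regular_rep_def perm_rep_def
  by (rule eq_matI) (auto simp: group_enum_reg_act[symmetric] group_enum_eq_iff reg_act_less)

lemma regular_dim: "rep_dim H (regular_rep H) = Coset.order H"
  by (simp add: rep_dim_def regular_rep_def)

lemma regular_urep: "urep H (regular_rep H)"
proof -
  interpret perm_action H "Coset.order H" "reg_act H" by (rule reg_perm_action)
  show ?thesis
    using perm_rep_urep perm_rep_dim unfolding urep_def urep_axioms_def unitary_rep_def
    by (auto simp: regular_dim regular_rep_eq)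
qed

lemma regular_index:
  assumes "h \<in> carrier H" "x \<in> carrier_vec (Coset.order H)" "i < Coset.order H"
  shows "(regular_rep H h *\<^sub>v x) $ i = x $ reg_act H (inv h) i"
  using perm_action.perm_rep_index[OF reg_perm_action assms] regular_rep_eq[OF assms(1)] by simp

text \<open>Matrix coefficients embed every irreducible representation into the regular one.\<close>

lemma irrep_eigenvector_regular:
  assumes n: "nontrivial_irrep H \<rho>" and e: "eigenvector (galg_rep H \<rho> \<alpha>) v x"
  obtains f where "f \<in> fixed_compl H (regular_rep H)"
    "eigenvector (galg_rep H (regular_rep H) \<alpha>) f x"
proof -
  interpret R: urep H \<rho> by (rule nontrivial_urep[OF G finH n])
  interpret S: urep H "regular_rep H" by (rule regular_urep)
  let ?N = "Coset.order H" and ?e = "group_enum H"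
  have v: "v \<in> carrier_vec R.d" "v \<noteq> 0\<^sub>v R.d" and ev: "R.gop \<alpha> *\<^sub>v v = x \<cdot>\<^sub>v v"
    using e by (auto simp: eigenvector_def)
  \<comment> \<open>The coefficient \<open>h \<mapsto> v \<bullet>c (\<rho> h v)\<close>. It is
    linear in its first argument, so it inherits the eigenvalue equation of \<open>v\<close>; its
    value at the identity is \<open>nsq v\<close>.\<close>
  define f where "f = vec ?N (\<lambda>i. v \<bullet>c (\<rho> (?e i) *\<^sub>v v))"
  have fN: "f \<in> carrier_vec ?N" by (simp add: f_def)
  have fi: "f $ i = v \<bullet>c (\<rho> (?e i) *\<^sub>v v)" if "i < ?N" for i using that by (simp add: f_def)
  have shift: "f $ reg_act H (inv h) i = (\<rho> h *\<^sub>v v) \<bullet>c (\<rho> (?e i) *\<^sub>v v)"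
    if h: "h \<in> carrier H" and i: "i < ?N" for h i
    using R.cs_act_left[OF h v(1), of "\<rho> (?e i) *\<^sub>v v"] h i v
    by (simp add: fi reg_act_less group_enum_reg_act group_enum_in R.act_act)
  have "S.gop \<alpha> *\<^sub>v f = x \<cdot>\<^sub>v f"
  proof (rule eq_vecI)
    fix i assume "i < dim_vec (x \<cdot>\<^sub>v f)"
    then have i: "i < ?N" by (simp add: f_def)
    have "(S.gop \<alpha> *\<^sub>v f) $ i = (\<Sum>h\<in>carrier H. complex_of_real (\<alpha> h) * (regular_rep H h *\<^sub>v f) $ i)"
      by (rule S.gop_index) (use i fN in \<open>simp_all add: regular_dim\<close>)
    also have "\<dots> = (\<Sum>h\<in>carrier H. complex_of_real (\<alpha> h) * ((\<rho> h *\<^sub>v v) \<bullet>c (\<rho> (?e i) *\<^sub>v v)))"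
      by (intro sum.cong refl) (simp only: regular_index[OF _ fN i] shift i)
    also have "\<dots> = (R.gop \<alpha> *\<^sub>v v) \<bullet>c (\<rho> (?e i) *\<^sub>v v)"
      by (rule R.cs_gop[symmetric, OF v(1)]) (simp add: v group_enum_in i)
    also have "\<dots> = (x \<cdot>\<^sub>v f) $ i"
      using v i fN by (simp add: ev cs_smult_left[of _ R.d] group_enum_in fi)
    finally show "(S.gop \<alpha> *\<^sub>v f) $ i = (x \<cdot>\<^sub>v f) $ i" .
  qed (use fN in \<open>simp add: regular_dim\<close>)
  moreover have "f \<noteq> 0\<^sub>v ?N"
  proof
    assume f0: "f = 0\<^sub>v ?N"
    obtain i where i: "i < ?N" "?e i = \<one>"
      using group_enum_bij by (metis bij_betw_imp_surj_on imageE lessThan_iff one_closed)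
    have "v \<bullet>c v = 0" using fi[OF i(1)] i f0 v by simp
    then show False using v by (simp add: cs_self nsq_eq_0_iff)
  qed
  ultimately have "eigenvector (S.gop \<alpha>) f x" using fN by (simp add: eigenvector_def regular_dim)
  moreover have "f \<in> fixed_compl H (regular_rep H)"
    unfolding S.fixed_compl_iff regular_dim
  proof (intro conjI ballI fN)
    fix u assume u: "u \<in> fixed_space H (regular_rep H)"
    then have uN: "u \<in> carrier_vec ?N" and fixed: "\<And>h. h \<in> carrier H \<Longrightarrow> regular_rep H h *\<^sub>v u = u"
      by (auto simp: fixed_space_def regular_dim)
    have "0 < ?N" using finH by (simp add: Coset.order_def card_gt_0_iff) (metis one_closed empty_iff)
    \<comment> \<open>A fixed vector of the regular representation is constant, so orthogonality to
      it reduces to the vanishing of the sum of \<open>f\<close> over the group.\<close>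
    have const: "u $ i = u $ 0" if i: "i < ?N" for i
    proof -
      let ?h = "?e i \<otimes> inv (?e 0)"
      have h: "?h \<in> carrier H" using i \<open>0 < ?N\<close> by (simp add: group_enum_in)
      have "?e (reg_act H (inv ?h) i) = ?e 0"
        using h i \<open>0 < ?N\<close> by (simp add: group_enum_reg_act group_enum_in inv_mult_group m_assoc)
      then have "reg_act H (inv ?h) i = 0" using h i \<open>0 < ?N\<close> by (simp add: group_enum_eq_iff reg_act_less)
      then show ?thesis using regular_index[OF h uN i] fixed[OF h] by simp
    qed
    have "f \<bullet>c u = (\<Sum>i<?N. v \<bullet>c (\<rho> (?e i) *\<^sub>v v)) * cnj (u $ 0)"
      unfolding cscalar_prod_sum[OF uN] sum_distrib_right
    proof (intro sum.cong refl)
      fix i assume "i \<in> {..<?N}"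
      then show "f $ i * cnj (u $ i) = v \<bullet>c (\<rho> (?e i) *\<^sub>v v) * cnj (u $ 0)"
        using fi[of i] const[of i] by simp
    qed
    also have "(\<Sum>i<?N. v \<bullet>c (\<rho> (?e i) *\<^sub>v v)) = (\<Sum>h\<in>carrier H. v \<bullet>c (\<rho> h *\<^sub>v v))"
      by (rule sum.reindex_bij_betw[OF group_enum_bij])
    also have "\<dots> = v \<bullet>c (R.gop (\<lambda>_. 1) *\<^sub>v v)" using v by (simp add: R.cs_gop_right)
    also have "R.gop (\<lambda>_. 1) *\<^sub>v v = 0\<^sub>v R.d"
      using R.average_fixed[OF v(1)] n by (simp add: nontrivial_irrep_def)
    finally show "f \<bullet>c u = 0" using v by simp
  qed
  ultimately show ?thesis using that by blast
qed

lemma psi_group_le: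
  assumes n: "nontrivial_irrep H \<rho>" and sym: "\<And>h. h \<in> carrier H \<Longrightarrow> w (inv h) = w h"
  shows "psi_group H w \<le> psi H w \<rho>"
proof -
  interpret R: urep H \<rho> by (rule nontrivial_urep[OF G finH n])
  interpret S: urep H "regular_rep H" by (rule regular_urep)
  obtain u x where u: "eigenvector (R.lap w) u (complex_of_real x)" "psi H w \<rho> = ereal x"
    by (rule R.nontrivial_psi[OF n, of w]) (use sym in auto)
  obtain f where "f \<in> fixed_compl H (regular_rep H)" "eigenvector (S.lap w) f (complex_of_real x)"
    by (rule irrep_eigenvector_regular[OF n u(1)])
  then show ?thesis unfolding psi_group_def u(2) by (rule S.psi_le)
qed

text \<open>The given \<open>\<rho>\<close> supplies the eigenvector of the regular representation
  from which \<open>psi_attained\<close> starts; the minimal eigenvalue then reappears in some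
  irreducible \<open>\<sigma>\<close>.\<close>

lemma psi_group_attained:
  assumes n: "nontrivial_irrep H \<rho>" and sym: "\<And>h. h \<in> carrier H \<Longrightarrow> w (inv h) = w h"
  obtains \<sigma> where "nontrivial_irrep H \<sigma>" "psi H w \<sigma> \<le> psi_group H w"
proof -
  interpret R: urep H \<rho> by (rule nontrivial_urep[OF G finH n])
  interpret S: urep H "regular_rep H" by (rule regular_urep)
  obtain u y where u: "eigenvector (R.lap w) u (complex_of_real y)"
    by (rule R.nontrivial_psi[OF n, of w]) (use sym in auto)
  obtain f where "f \<in> fixed_compl H (regular_rep H)" "eigenvector (S.lap w) f (complex_of_real y)"
    by (rule irrep_eigenvector_regular[OF n u])
  then obtain g x where g: "g \<in> fixed_compl H (regular_rep H)"
    "eigenvector (S.lap w) g (complex_of_real x)" "psi H w (regular_rep H) = ereal x"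
    by (rule S.psi_attained)
  obtain \<sigma> v where s: "nontrivial_irrep H \<sigma>" "eigenvector (galg_rep H \<sigma> (laplacian H w)) v (complex_of_real x)"
    by (rule irrep_with_eigenvalue[OF regular_urep g(1,2)])
  have "psi H w \<sigma> \<le> ereal x"
    by (rule urep.nontrivial_eigenvector_psi_le[OF nontrivial_urep[OF G finH s(1)] s])
  then show ?thesis using that s(1) g(3) by (simp add: psi_group_def)
qed

end

section \<open>Sums over pairs\<close>

text \<open>The larger index is summed outside, so that passing from \<open>m\<close> to
  \<open>Suc m\<close> adds precisely the edges at the vertex \<open>Suc m\<close>.\<close>

definition pair_sum :: "nat \<Rightarrow> (nat \<Rightarrow> nat \<Rightarrow> 'b :: comm_monoid_add) \<Rightarrow> 'b" where
  "pair_sum m F = (\<Sum>j\<in>{1..m}. \<Sum>i\<in>{1..<j}. F i j)"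

lemma pair_sum_0 [simp]: "pair_sum 0 F = 0"
  by (simp add: pair_sum_def)

lemma pair_sum_Suc: "pair_sum (Suc m) F = pair_sum m F + (\<Sum>i\<in>{1..m}. F i (Suc m))"
  by (simp add: pair_sum_def atLeastLessThanSuc_atLeastAtMost)

lemma pair_sum_cong:
  "(\<And>i j. 1 \<le> i \<Longrightarrow> i < j \<Longrightarrow> j \<le> m \<Longrightarrow> F i j = F' i j) \<Longrightarrow> pair_sum m F = pair_sum m F'"
  unfolding pair_sum_def by (intro sum.cong refl) auto

lemma pair_sum_add: "pair_sum m (\<lambda>i j. F i j + F' i j) = pair_sum m F + pair_sum m F'"
  by (simp add: pair_sum_def sum.distrib)

lemma pair_sum_mult: "pair_sum m (\<lambda>i j. c * F i j) = c * pair_sum m F" for c :: "'b :: comm_semiring_0"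
  by (simp add: pair_sum_def sum_distrib_left)

lemma pair_sum_mult_right: "pair_sum m (\<lambda>i j. F i j * c) = pair_sum m F * c" for c :: "'b :: comm_semiring_0"
  by (simp add: pair_sum_def sum_distrib_right)

lemma pair_sum_sum: "pair_sum m (\<lambda>i j. \<Sum>x\<in>A. F i j x) = (\<Sum>x\<in>A. pair_sum m (\<lambda>i j. F i j x))"
  unfolding pair_sum_def by (simp only: sum.swap[of _ A])

lemma pair_sum_nonneg:
  "(\<And>i j. 1 \<le> i \<Longrightarrow> i < j \<Longrightarrow> j \<le> m \<Longrightarrow> 0 \<le> F i j) \<Longrightarrow> 0 \<le> pair_sum m (F :: nat \<Rightarrow> nat \<Rightarrow> real)"
  unfolding pair_sum_def by (intro sum_nonneg) auto

lemma pair_sum_of_real: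
  "complex_of_real (pair_sum m F) = pair_sum m (\<lambda>i j. complex_of_real (F i j))"
  by (simp add: pair_sum_def)

lemma double_sum_pair_sum:
  fixes F :: "nat \<Rightarrow> nat \<Rightarrow> real"
  assumes "\<And>i j. F i j = F j i" and "\<And>i. F i i = 0"
  shows "(\<Sum>i\<in>{1..m}. \<Sum>j\<in>{1..m}. F i j) = 2 * pair_sum m F"
proof (induction m)
  case (Suc m)
  have "(\<Sum>i\<in>{1..Suc m}. \<Sum>j\<in>{1..Suc m}. F i j) =
      (\<Sum>i\<in>{1..m}. \<Sum>j\<in>{1..m}. F i j) + (\<Sum>i\<in>{1..m}. F i (Suc m)) + (\<Sum>j\<in>{1..m}. F (Suc m) j) + F (Suc m) (Suc m)"
    by (simp add: sum.distrib)
  also have "(\<Sum>j\<in>{1..m}. F (Suc m) j) = (\<Sum>i\<in>{1..m}. F i (Suc m))"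
    using assms(1) by (intro sum.cong) auto
  finally show ?case using Suc assms(2) by (simp add: pair_sum_Suc)
qed simp

text \<open>The walk on the complete graph with unit rates has gap \<open>m\<close>; this provides
  \<open>walk_gap\<close> for constant rates in the necessity arguments.\<close>

lemma pair_sum_complete:
  fixes f :: "nat \<Rightarrow> real"
  assumes "(\<Sum>i\<in>{1..m}. f i) = 0"
  shows "pair_sum m (\<lambda>i j. (f i - f j)\<^sup>2) = real m * (\<Sum>i\<in>{1..m}. (f i)\<^sup>2)"
proof -
  let ?S = "\<Sum>i\<in>{1..m}. (f i)\<^sup>2"
  have "2 * pair_sum m (\<lambda>i j. (f i - f j)\<^sup>2) = (\<Sum>i\<in>{1..m}. \<Sum>j\<in>{1..m}. (f i - f j)\<^sup>2)"
    by (rule double_sum_pair_sum[symmetric]) (auto simp: power2_commute)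
  also have "\<dots> = (\<Sum>i\<in>{1..m}. real m * (f i)\<^sup>2 + ?S - 2 * f i * (\<Sum>j\<in>{1..m}. f j))"
    by (intro sum.cong refl)
      (simp add: power2_diff sum_subtractf sum.distrib sum_distrib_left mult.assoc)
  also have "\<dots> = 2 * (real m * ?S)"
    using assms by (simp add: sum.distrib sum_distrib_left)
  finally show ?thesis by simp
qed

section \<open>Averaging over subgroups\<close>

context urep begin

lemma cs_act_right:
  "h \<in> carrier H \<Longrightarrow> v \<in> carrier_vec d \<Longrightarrow> w \<in> carrier_vec d \<Longrightarrow>
    v \<bullet>c (\<rho> h *\<^sub>v w) = (\<rho> (inv h) *\<^sub>v v) \<bullet>c w"
  by (simp add: cs_act_left)

text \<open>For a subgroup \<open>K\<close> this is the orthogonal projection onto the vectors fixed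
  by \<open>K\<close>. Written as a group algebra element it falls under the rules for
  \<open>gop\<close>.\<close>

definition proj :: "'a set \<Rightarrow> complex mat" where
  "proj K = gop (\<lambda>h. of_bool (h \<in> K) / real (card K))"

lemma proj_carrier [simp]: "proj K \<in> carrier_mat d d"
  by (simp add: proj_def)

lemma proj_in [simp]: "v \<in> carrier_vec d \<Longrightarrow> proj K *\<^sub>v v \<in> carrier_vec d"
  by (simp add: proj_def)

lemma cs_proj:
  assumes K: "K \<subseteq> carrier H" and v: "v \<in> carrier_vec d" and u: "u \<in> carrier_vec d"
  shows "(proj K *\<^sub>v v) \<bullet>c u = (\<Sum>h\<in>K. (\<rho> h *\<^sub>v v) \<bullet>c u) / of_nat (card K)"
proof -
  have "(proj K *\<^sub>v v) \<bullet>c u =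
      (\<Sum>h\<in>carrier H. if h \<in> K then (\<rho> h *\<^sub>v v) \<bullet>c u / of_nat (card K) else 0)"
    unfolding proj_def cs_gop[OF v u] by (intro sum.cong refl) auto
  also have "\<dots> = (\<Sum>h\<in>K. (\<rho> h *\<^sub>v v) \<bullet>c u / of_nat (card K))"
    using fin K by (subst sum.inter_restrict[symmetric]) (auto simp: Int_absorb1)
  finally show ?thesis by (simp add: sum_divide_distrib)
qed

lemma proj_fixed:
  assumes K: "subgroup K H" and v: "v \<in> carrier_vec d"
  shows "proj K *\<^sub>v v \<in> fixed_by K"
  unfolding fixed_by_def
proof (safe intro!: proj_in v)
  interpret K: subgroup K H by (rule K)
  fix k assume k: "k \<in> K"
  show "\<rho> k *\<^sub>v (proj K *\<^sub>v v) = proj K *\<^sub>v v"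
  proof (rule vec_eq_csI[of _ d])
    fix u :: "complex vec" assume u: "u \<in> carrier_vec d"
    have "(\<rho> k *\<^sub>v (proj K *\<^sub>v v)) \<bullet>c u = (proj K *\<^sub>v v) \<bullet>c (\<rho> (inv k) *\<^sub>v u)"
      by (rule cs_act_left) (use k u v in simp_all)
    also have "\<dots> = (\<Sum>h\<in>K. (\<rho> h *\<^sub>v v) \<bullet>c (\<rho> (inv k) *\<^sub>v u)) / of_nat (card K)"
      by (rule cs_proj) (use k u v K.subset in auto)
    also have "(\<Sum>h\<in>K. (\<rho> h *\<^sub>v v) \<bullet>c (\<rho> (inv k) *\<^sub>v u)) = (\<Sum>h\<in>K. (\<rho> (k \<otimes> h) *\<^sub>v v) \<bullet>c u)"
    proof (intro sum.cong refl)
      fix h assume h: "h \<in> K"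
      have "(\<rho> (k \<otimes> h) *\<^sub>v v) \<bullet>c u = (\<rho> k *\<^sub>v (\<rho> h *\<^sub>v v)) \<bullet>c u"
        using h k v by (simp add: act_act)
      also have "\<dots> = (\<rho> h *\<^sub>v v) \<bullet>c (\<rho> (inv k) *\<^sub>v u)"
        by (rule cs_act_left) (use h k u v in simp_all)
      finally show "(\<rho> h *\<^sub>v v) \<bullet>c (\<rho> (inv k) *\<^sub>v u) = (\<rho> (k \<otimes> h) *\<^sub>v v) \<bullet>c u" ..
    qed
    also have "\<dots> = (\<Sum>h\<in>K. (\<rho> h *\<^sub>v v) \<bullet>c u)"
      by (rule sum.reindex_bij_witness[of _ "\<lambda>h. inv k \<otimes> h" "\<lambda>h. k \<otimes> h"])
        (use k in \<open>auto simp: m_assoc[symmetric]\<close>)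
    finally show "(\<rho> k *\<^sub>v (proj K *\<^sub>v v)) \<bullet>c u = (proj K *\<^sub>v v) \<bullet>c u"
      using cs_proj[OF K.subset v u] by simp
  qed (use k v in simp_all)
qed

lemma proj_id:
  assumes K: "subgroup K H" and u: "u \<in> fixed_by K"
  shows "proj K *\<^sub>v u = u"
proof (rule vec_eq_csI[of _ d])
  interpret K: subgroup K H by (rule K)
  have ud: "u \<in> carrier_vec d" using u by (simp add: fixed_by_def)
  fix w :: "complex vec" assume w: "w \<in> carrier_vec d"
  have "K \<noteq> {}" using K.one_closed by blast
  then have "card K \<noteq> 0" using finite_subset[OF K.subset fin] by simp
  then show "(proj K *\<^sub>v u) \<bullet>c w = u \<bullet>c w"
    using u by (simp add: cs_proj[OF K.subset ud w] fixed_by_def)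
qed (use u in \<open>simp_all add: fixed_by_def\<close>)

lemma hermitian_proj:
  assumes K: "subgroup K H"
  shows "hermitian_on d (proj K)"
proof -
  interpret K: subgroup K H by (rule K)
  have "inv h \<in> K \<longleftrightarrow> h \<in> K" if "h \<in> carrier H" for h
    using that K.m_inv_closed by (metis inv_inv)
  then show ?thesis unfolding proj_def by (intro hermitian_gop) simp
qed

lemma proj_orth:
  assumes K: "subgroup K H" and v: "v \<in> carrier_vec d" and orth: "\<And>u. u \<in> fixed_by K \<Longrightarrow> v \<bullet>c u = 0"
  shows "proj K *\<^sub>v v = 0\<^sub>v d"
proof (rule vec_eq_csI[of _ d])
  fix w :: "complex vec" assume w: "w \<in> carrier_vec d"
  have "(proj K *\<^sub>v v) \<bullet>c w = v \<bullet>c (proj K *\<^sub>v w)"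
    using hermitian_proj[OF K] v w by (simp add: hermitian_on_def)
  then show "(proj K *\<^sub>v v) \<bullet>c w = 0\<^sub>v d \<bullet>c w" using orth[OF proj_fixed[OF K w]] w by simp
qed (use v in simp_all)

lemma resid_orth:
  assumes K: "subgroup K H" and v: "v \<in> carrier_vec d" and u: "u \<in> fixed_by K"
  shows "(v - proj K *\<^sub>v v) \<bullet>c u = 0"
proof -
  have ud: "u \<in> carrier_vec d" using u by (simp add: fixed_by_def)
  have "(proj K *\<^sub>v v) \<bullet>c u = v \<bullet>c (proj K *\<^sub>v u)"
    using hermitian_proj[OF K] v ud by (simp add: hermitian_on_def)
  then show ?thesis using v ud by (simp add: cs_minus_left[of _ d] proj_id[OF K u])
qed

end

section \<open>The theorem of Caputo, Liggett and Richthammer\<close>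

text \<open>These permutations fix every point above \<open>m\<close>, so \<open>perms m\<close> is
  the pointwise stabilizer of the remaining points in \<open>perms n\<close>, without any
  embedding.\<close>

definition perms :: "nat \<Rightarrow> (nat \<Rightarrow> nat) set" where
  "perms m = {p. p permutes {1..m}}"

lemma perms_mono: "m \<le> n \<Longrightarrow> perms m \<subseteq> perms n"
  unfolding perms_def by (auto elim!: permutes_subset)

lemma carrier_sym_group: "carrier (sym_group n) = perms n"
  by (auto simp: perms_def sym_group_carrier)

lemma perms_subgroup:
  assumes "m \<le> n"
  shows "subgroup (perms m) (sym_group n)"
proof
  show sub: "perms m \<subseteq> carrier (sym_group n)" using perms_mono[OF assms] by (simp add: carrier_sym_group)
  show "x \<otimes>\<^bsub>sym_group n\<^esub> y \<in> perms m" if "x \<in> perms m" "y \<in> perms m" for x y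
    using that by (auto simp: perms_def sym_group_mult intro: permutes_compose)
  show "\<one>\<^bsub>sym_group n\<^esub> \<in> perms m" by (simp add: perms_def sym_group_one permutes_id)
  show "inv\<^bsub>sym_group n\<^esub> x \<in> perms m" if "x \<in> perms m" for x
  proof -
    have "x \<in> carrier (sym_group n)" using that sub by blast
    moreover have "inv' x \<in> perms m" using that by (simp add: perms_def permutes_inv)
    ultimately show ?thesis by simp
  qed
qed

lemma transpose_perms: "i \<in> {1..m} \<Longrightarrow> j \<in> {1..m} \<Longrightarrow> Transposition.transpose i j \<in> perms m"
  unfolding perms_def by (auto intro: permutes_swap_id)

lemma perms_fix:
  assumes "p \<in> perms (Suc m)" "p (Suc m) = Suc m"
  shows "p \<in> perms m"
proof -
  have "p permutes {1..m}"
  proof (rule permutes_superset[of p "{1..Suc m}"])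
    show "p permutes {1..Suc m}" using assms(1) by (simp add: perms_def)
    fix x assume "x \<in> {1..Suc m} - {1..m}"
    then have "x = Suc m" by auto
    then show "p x = x" using assms(2) by simp
  qed
  then show ?thesis by (simp add: perms_def)
qed

definition trans_weight :: "nat \<Rightarrow> (nat \<Rightarrow> nat \<Rightarrow> real) \<Rightarrow> (nat \<Rightarrow> nat) \<Rightarrow> real" where
  "trans_weight m a h = pair_sum m (\<lambda>i j. a i j * of_bool (h = Transposition.transpose i j))"

text \<open>A Poincare inequality: \<open>\<kappa>\<close> is a lower bound for the gap of the walk
  with rates \<open>a\<close>. Such bounds survive the removal of a vertex.\<close>

definition walk_gap :: "nat \<Rightarrow> (nat \<Rightarrow> nat \<Rightarrow> real) \<Rightarrow> real \<Rightarrow> bool" where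
  "walk_gap m a \<kappa> \<longleftrightarrow> (\<forall>f :: nat \<Rightarrow> real. (\<Sum>i\<in>{1..m}. f i) = 0 \<longrightarrow>
     \<kappa> * (\<Sum>i\<in>{1..m}. (f i)\<^sup>2) \<le> pair_sum m (\<lambda>i j. a i j * (f i - f j)\<^sup>2))"

lemma walk_gapD:
  "walk_gap m a \<kappa> \<Longrightarrow> (\<Sum>i\<in>{1..m}. f i) = 0 \<Longrightarrow>
     \<kappa> * (\<Sum>i\<in>{1..m}. (f i)\<^sup>2) \<le> pair_sum m (\<lambda>i j. a i j * (f i - f j)\<^sup>2)"
  by (simp add: walk_gap_def)

text \<open>Extending a function harmonically to the removed vertex preserves its energy and does not
  decrease its variance.\<close>

lemma walk_gap_reduction:
  assumes gap: "walk_gap (Suc m) a \<kappa>" and "0 \<le> \<kappa>"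
    and C: "C = (\<Sum>i\<in>{1..m}. a i (Suc m))" "C \<noteq> 0"
  shows "walk_gap m (\<lambda>i j. a i j + a i (Suc m) * a j (Suc m) / C) \<kappa>"
  unfolding walk_gap_def
proof (intro allI impI)
  fix f :: "nat \<Rightarrow> real" assume f: "(\<Sum>i\<in>{1..m}. f i) = 0"
  let ?c = "\<lambda>i. a i (Suc m)" and ?S = "\<Sum>i\<in>{1..m}. (f i)\<^sup>2"
  \<comment> \<open>\<open>z\<close> is the harmonic value at the removed vertex. Since
    \<open>f\<close> sums to 0 over the first \<open>m\<close> points, \<open>t\<close> is the mean
    of the extended function, and subtracting it gives a function of sum 0.\<close>
  define z where "z = (\<Sum>i\<in>{1..m}. ?c i * f i) / C"
  define t where "t = z / real (Suc m)"
  define g where "g i = (if i = Suc m then z else f i) - t" for i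
  have g1: "g i = f i - t" if "i \<in> {1..m}" for i using that by (simp add: g_def)
  have gz: "g (Suc m) = z - t" by (simp add: g_def)
  have cf: "(\<Sum>i\<in>{1..m}. ?c i * f i) = C * z" using C(2) by (simp add: z_def)
  have zt: "z = real (Suc m) * t" by (simp add: t_def)
  have "(\<Sum>i\<in>{1..m}. g i) = (\<Sum>i\<in>{1..m}. f i - t)" by (intro sum.cong refl g1)
  also have "\<dots> = - (real m * t)" using f by (simp add: sum_subtractf)
  finally have "(\<Sum>i\<in>{1..Suc m}. g i) = 0" using zt by (simp add: gz algebra_simps)
  from walk_gapD[OF gap this]
  have "\<kappa> * (\<Sum>i\<in>{1..Suc m}. (g i)\<^sup>2) \<le> pair_sum (Suc m) (\<lambda>i j. a i j * (g i - g j)\<^sup>2)" .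
  moreover have "?S \<le> (\<Sum>i\<in>{1..Suc m}. (g i)\<^sup>2)"
  proof -
    have "(\<Sum>i\<in>{1..m}. (g i)\<^sup>2) = (\<Sum>i\<in>{1..m}. (f i - t)\<^sup>2)" by (intro sum.cong refl) (simp add: g1)
    also have "\<dots> = ?S + real m * t\<^sup>2 - 2 * t * (\<Sum>i\<in>{1..m}. f i)"
      by (simp add: power2_diff sum_subtractf sum.distrib sum_distrib_left mult_ac)
    finally have "(\<Sum>i\<in>{1..Suc m}. (g i)\<^sup>2) = ?S + real m * t\<^sup>2 + (z - t)\<^sup>2" using f by (simp add: gz)
    then show ?thesis by simp
  qed
  then have "\<kappa> * ?S \<le> \<kappa> * (\<Sum>i\<in>{1..Suc m}. (g i)\<^sup>2)" using \<open>0 \<le> \<kappa>\<close> by (rule mult_left_mono)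
  \<comment> \<open>With the harmonic value \<open>z\<close>, the edges at the removed vertex
    contribute \<open>?D - C * z^2\<close>, which is also what the new rates
    \<open>?c i * ?c j / C\<close> contribute.\<close>
  moreover have "pair_sum (Suc m) (\<lambda>i j. a i j * (g i - g j)\<^sup>2) =
      pair_sum m (\<lambda>i j. (a i j + ?c i * ?c j / C) * (f i - f j)\<^sup>2)"
  proof -
    let ?D = "\<Sum>i\<in>{1..m}. ?c i * (f i)\<^sup>2"
    have "2 * pair_sum m (\<lambda>i j. ?c i * ?c j / C * (f i - f j)\<^sup>2) =
        (\<Sum>i\<in>{1..m}. \<Sum>j\<in>{1..m}. ?c i * ?c j / C * (f i - f j)\<^sup>2)"
      by (rule double_sum_pair_sum[symmetric]) (auto simp: power2_commute)
    also have "\<dots> = (\<Sum>i\<in>{1..m}. \<Sum>j\<in>{1..m}. ?c i * (f i)\<^sup>2 * ?c j / C + ?c i * (?c j * (f j)\<^sup>2) / C -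
        2 * (?c i * f i) * (?c j * f j) / C)"
      by (intro sum.cong refl) (simp add: power2_diff algebra_simps add_divide_distrib diff_divide_distrib)
    also have "\<dots> = ?D * C / C + C * ?D / C - 2 * (C * z) * (C * z) / C"
      unfolding sum.distrib sum_subtractf sum_divide_distrib[symmetric] sum_distrib_left[symmetric]
        sum_distrib_right[symmetric] C(1)[symmetric] cf ..
    also have "\<dots> = 2 * (?D - C * z\<^sup>2)" using C(2) by (simp add: power2_eq_square)
    finally have 1: "pair_sum m (\<lambda>i j. ?c i * ?c j / C * (f i - f j)\<^sup>2) = ?D - C * z\<^sup>2" by simp
    have "(\<Sum>i\<in>{1..m}. ?c i * (g i - g (Suc m))\<^sup>2) = (\<Sum>i\<in>{1..m}. ?c i * (f i)\<^sup>2 + ?c i * z\<^sup>2 - 2 * z * (?c i * f i))"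
      by (intro sum.cong refl) (simp add: g1 gz power2_diff algebra_simps)
    also have "\<dots> = ?D + C * z\<^sup>2 - 2 * z * (C * z)"
      unfolding sum.distrib sum_subtractf sum_distrib_left[symmetric] sum_distrib_right[symmetric]
        C(1)[symmetric] cf ..
    also have "\<dots> = ?D - C * z\<^sup>2" by (simp add: power2_eq_square)
    finally have 2: "(\<Sum>i\<in>{1..m}. ?c i * (g i - g (Suc m))\<^sup>2) = ?D - C * z\<^sup>2" .
    have "pair_sum m (\<lambda>i j. a i j * (g i - g j)\<^sup>2) = pair_sum m (\<lambda>i j. a i j * (f i - f j)\<^sup>2)"
      by (intro pair_sum_cong) (simp add: g1)
    then show ?thesis using 1 2 by (simp add: pair_sum_Suc distrib_right pair_sum_add)
  qed
  ultimately show "\<kappa> * ?S \<le> pair_sum m (\<lambda>i j. (a i j + ?c i * ?c j / C) * (f i - f j)\<^sup>2)" by linarith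
qed

text \<open>The function equal to 1 on the first \<open>m\<close> points and \<open>- m\<close> at
  the isolated one has sum 0 and energy 0.\<close>

lemma walk_gap_isolated:
  assumes gap: "walk_gap (Suc m) a \<kappa>" and "1 \<le> m" and a: "\<And>i. i \<in> {1..m} \<Longrightarrow> a i (Suc m) = 0"
  shows "\<kappa> \<le> 0"
proof -
  let ?f = "\<lambda>i. if i = Suc m then - real m else 1"
  have "pair_sum m (\<lambda>i j. a i j * (?f i - ?f j)\<^sup>2) = pair_sum m (\<lambda>i j. 0)"
    by (intro pair_sum_cong) simp
  also have "\<dots> = 0" by (simp add: pair_sum_def)
  finally have "pair_sum (Suc m) (\<lambda>i j. a i j * (?f i - ?f j)\<^sup>2) = 0"
    using a by (simp add: pair_sum_Suc)
  moreover have "(\<Sum>i\<in>{1..m}. ?f i) = real m" by simp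
  then have "(\<Sum>i\<in>{1..Suc m}. ?f i) = 0" by simp
  ultimately have "\<kappa> * (\<Sum>i\<in>{1..Suc m}. (?f i)\<^sup>2) \<le> 0" using walk_gapD[OF gap] by fastforce
  moreover have "0 < (\<Sum>i\<in>{1..Suc m}. (?f i)\<^sup>2)" using \<open>1 \<le> m\<close> by (intro sum_pos2[of _ 1]) auto
  ultimately show ?thesis by (simp add: mult_le_0_iff)
qed

locale sym_urep = urep "sym_group n" \<sigma> for n and \<sigma> :: "(nat \<Rightarrow> nat) \<Rightarrow> complex mat"
begin

abbreviation tr :: "nat \<Rightarrow> nat \<Rightarrow> nat \<Rightarrow> nat" where "tr \<equiv> Transposition.transpose"

lemma in_carrier: "m \<le> n \<Longrightarrow> p \<in> perms m \<Longrightarrow> p \<in> carrier (sym_group n)"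
  using perms_mono carrier_sym_group by blast

lemma tr_carrier: "i \<in> {1..n} \<Longrightarrow> j \<in> {1..n} \<Longrightarrow> tr i j \<in> carrier (sym_group n)"
  by (simp add: carrier_sym_group transpose_perms)

lemma act_comp:
  "p \<in> carrier (sym_group n) \<Longrightarrow> q \<in> carrier (sym_group n) \<Longrightarrow> v \<in> carrier_vec d \<Longrightarrow>
    \<sigma> p *\<^sub>v (\<sigma> q *\<^sub>v v) = \<sigma> (p \<circ> q) *\<^sub>v v"
  by (simp add: act_act sym_group_mult)

lemma act_id: "v \<in> carrier_vec d \<Longrightarrow> \<sigma> id *\<^sub>v v = v"
  using act_one by (simp add: sym_group_one)

lemma cs_tr:
  "i \<in> {1..n} \<Longrightarrow> j \<in> {1..n} \<Longrightarrow> v \<in> carrier_vec d \<Longrightarrow> w \<in> carrier_vec d \<Longrightarrow>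
    (\<sigma> (tr i j) *\<^sub>v v) \<bullet>c w = v \<bullet>c (\<sigma> (tr i j) *\<^sub>v w)"
  using cs_act_left[OF tr_carrier] by (simp add: tr_carrier)

lemma sum_trans_weight:
  assumes "m \<le> n"
  shows "(\<Sum>h\<in>carrier (sym_group n). complex_of_real (trans_weight m a h) * X h) =
    pair_sum m (\<lambda>i j. complex_of_real (a i j) * X (tr i j))"
proof -
  have "(\<Sum>h\<in>carrier (sym_group n). complex_of_real (trans_weight m a h) * X h) =
      (\<Sum>h\<in>carrier (sym_group n). pair_sum m (\<lambda>i j. if h = tr i j then complex_of_real (a i j) * X h else 0))"
    unfolding trans_weight_def pair_sum_of_real pair_sum_mult_right[symmetric]
    by (intro sum.cong refl pair_sum_cong) simp
  also have "\<dots> = pair_sum m (\<lambda>i j. \<Sum>h\<in>carrier (sym_group n). if h = tr i j then complex_of_real (a i j) * X h else 0)"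
    by (rule pair_sum_sum[symmetric])
  also have "\<dots> = pair_sum m (\<lambda>i j. complex_of_real (a i j) * X (tr i j))"
    using fin tr_carrier assms by (intro pair_sum_cong) (simp add: sum.delta)
  finally show ?thesis .
qed

lemma trans_weight_inv:
  assumes "h \<in> carrier (sym_group n)"
  shows "trans_weight m a (inv\<^bsub>sym_group n\<^esub> h) = trans_weight m a h"
proof -
  have "inv' h = tr i j \<longleftrightarrow> h = tr i j" for i j
    using assms by (metis inv_inv_eq inv_transpose_eq permutes_bij sym_group_carrier)
  then show ?thesis using assms by (simp add: trans_weight_def)
qed

lemma cs_lap_trans:
  assumes "m \<le> n" "v \<in> carrier_vec d" "w \<in> carrier_vec d"
  shows "(lap (trans_weight m a) *\<^sub>v v) \<bullet>c w =
    pair_sum m (\<lambda>i j. complex_of_real (a i j) * (v \<bullet>c w - (\<sigma> (tr i j) *\<^sub>v v) \<bullet>c w))"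
  unfolding cs_lap[OF assms(2,3)]
  by (rule sum_trans_weight[OF assms(1), of a "\<lambda>h. v \<bullet>c w - (\<sigma> h *\<^sub>v v) \<bullet>c w"])

text \<open>The Dirichlet form of the interchange process on the first \<open>m\<close> points,
  inside a fixed representation of the larger symmetric group.\<close>

definition energy :: "nat \<Rightarrow> (nat \<Rightarrow> nat \<Rightarrow> real) \<Rightarrow> complex vec \<Rightarrow> real" where
  "energy m a v = pair_sum m (\<lambda>i j. a i j * diss (tr i j) v)"

lemma Re_lap_trans:
  assumes "m \<le> n" "v \<in> carrier_vec d"
  shows "Re ((lap (trans_weight m a) *\<^sub>v v) \<bullet>c v) = energy m a v"
  unfolding cs_lap_trans[OF assms(1,2,2)] energy_def pair_sum_def
  by (simp add: diss_def nsq_def)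

lemma energy_nonneg:
  assumes "m \<le> n" "v \<in> carrier_vec d" "\<And>i j. 1 \<le> i \<Longrightarrow> i < j \<Longrightarrow> j \<le> m \<Longrightarrow> 0 \<le> a i j"
  shows "0 \<le> energy m a v"
  unfolding energy_def using assms tr_carrier
  by (intro pair_sum_nonneg mult_nonneg_nonneg diss_nonneg) auto

text \<open>The quadratic form at \<open>\<alpha>\<close> is the squared norm of
  \<open>gop \<alpha> *\<^sub>v v\<close>.\<close>

lemma pos_def_coefficient:
  assumes v: "v \<in> carrier_vec d"
  shows "pos_def_on {1..n} (\<lambda>p. Re ((\<sigma> p *\<^sub>v v) \<bullet>c v))"
  unfolding pos_def_on_def
proof
  fix \<alpha> :: "(nat \<Rightarrow> nat) \<Rightarrow> real"
  let ?C = "carrier (sym_group n)"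
  have C: "{g. g permutes {1..n}} = ?C" by (auto simp: sym_group_carrier)
  have "nsq (gop \<alpha> *\<^sub>v v) = Re (\<Sum>h\<in>?C. complex_of_real (\<alpha> h) * ((\<sigma> h *\<^sub>v v) \<bullet>c (gop \<alpha> *\<^sub>v v)))"
    unfolding nsq_def by (subst cs_gop) (use v in simp_all)
  also have "\<dots> = (\<Sum>h\<in>?C. \<Sum>g\<in>?C. \<alpha> g * \<alpha> h * Re ((\<sigma> (inv' g \<circ> h) *\<^sub>v v) \<bullet>c v))"
  proof -
    have "(\<sigma> h *\<^sub>v v) \<bullet>c (\<sigma> g *\<^sub>v v) = (\<sigma> (inv' g \<circ> h) *\<^sub>v v) \<bullet>c v"
      if g: "g \<in> ?C" and h: "h \<in> ?C" for g h
    proof -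
      have g': "inv' g \<in> ?C" by (rule sym_group_inv_closed[OF g])
      have "(\<sigma> (inv' g) *\<^sub>v (\<sigma> h *\<^sub>v v)) \<bullet>c v = (\<sigma> h *\<^sub>v v) \<bullet>c (\<sigma> (inv\<^bsub>sym_group n\<^esub> (inv' g)) *\<^sub>v v)"
        by (rule cs_act_left) (use g' h v in simp_all)
      moreover have "inv\<^bsub>sym_group n\<^esub> (inv' g) = g"
        using g g' by (simp add: inv_inv_eq permutes_bij[of g "{1..n}"] sym_group_carrier)
      ultimately show ?thesis using g' h v by (simp add: act_comp)
    qed
    then show ?thesis
      using v by (simp add: cs_gop_right sum_distrib_left mult_ac)
  qed
  also have "\<dots> = (\<Sum>g\<in>?C. \<Sum>h\<in>?C. \<alpha> g * \<alpha> h * Re ((\<sigma> (inv' g \<circ> h) *\<^sub>v v) \<bullet>c v))"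
    by (rule sum.swap)
  finally show "0 \<le> (\<Sum>g | g permutes {1..n}. \<Sum>h | h permutes {1..n}.
      \<alpha> g * \<alpha> h * Re ((\<sigma> (inv' g \<circ> h) *\<^sub>v v) \<bullet>c v))"
    unfolding C using nsq_nonneg[of "gop \<alpha> *\<^sub>v v"] by simp
qed

text \<open>The octopus inequality with centre \<open>Suc m\<close>. The rates on the left are those
  of \<open>walk_gap_reduction\<close>, so the representation and the walk are reduced to the same
  network.\<close>

lemma energy_reduction:
  assumes m: "Suc m \<le> n" and v: "v \<in> carrier_vec d"
    and c: "\<And>i. i \<in> {1..m} \<Longrightarrow> 0 \<le> a i (Suc m)"
    and C: "C = (\<Sum>i\<in>{1..m}. a i (Suc m))" "C \<noteq> 0"
  shows "energy m (\<lambda>i j. a i j + a i (Suc m) * a j (Suc m) / C) v \<le> energy (Suc m) a v"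
proof -
  let ?c = "\<lambda>i. a i (Suc m)" and ?\<phi> = "\<lambda>p. Re ((\<sigma> p *\<^sub>v v) \<bullet>c v)"
  have diss: "diss p v = ?\<phi> id - ?\<phi> p" for p
    using act_id[OF v] by (simp add: diss_def nsq_def)
  have "0 < C" using C c sum_nonneg[of "{1..m}" ?c] by auto
  have "(\<Sum>p\<in>{1..m}. \<Sum>q\<in>{1..m}. ?c p * ?c q * (?\<phi> id - ?\<phi> (tr p q))) \<le>
     2 * (\<Sum>p\<in>{1..m}. ?c p) * (\<Sum>p\<in>{1..m}. ?c p * (?\<phi> id - ?\<phi> (tr p (Suc m))))"
    by (rule octopus[OF pos_def_coefficient[OF v]]) (use m c in auto)
  moreover have "(\<Sum>p\<in>{1..m}. \<Sum>q\<in>{1..m}. ?c p * ?c q * (?\<phi> id - ?\<phi> (tr p q))) =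
      2 * pair_sum m (\<lambda>p q. ?c p * ?c q * (?\<phi> id - ?\<phi> (tr p q)))"
    by (rule double_sum_pair_sum) (auto simp: transpose_commute id_def)
  ultimately have "pair_sum m (\<lambda>p q. ?c p * ?c q * diss (tr p q) v) \<le>
      C * (\<Sum>p\<in>{1..m}. ?c p * diss (tr p (Suc m)) v)"
    unfolding diss C(1) by simp
  then have "pair_sum m (\<lambda>p q. ?c p * ?c q * diss (tr p q) v) / C \<le>
      (\<Sum>p\<in>{1..m}. ?c p * diss (tr p (Suc m)) v)"
    using \<open>0 < C\<close> by (simp add: divide_le_eq mult.commute)
  moreover have "pair_sum m (\<lambda>p q. ?c p * ?c q * diss (tr p q) v) / C =
      pair_sum m (\<lambda>p q. ?c p * ?c q / C * diss (tr p q) v)"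
    by (simp add: pair_sum_def sum_divide_distrib)
  ultimately show ?thesis
    unfolding energy_def by (simp add: pair_sum_Suc distrib_right pair_sum_add)
qed

text \<open>A vector that is not orthogonal to the translates of a vector fixed by the stabilizer of a
  point yields an eigenfunction of the random walk.\<close>

lemma walk_eigenfunction:
  assumes m: "Suc m \<le> n" and gap: "walk_gap (Suc m) a \<kappa>"
    and v: "v \<in> carrier_vec d" and orth: "\<And>u. u \<in> fixed_by (perms (Suc m)) \<Longrightarrow> v \<bullet>c u = 0"
    and ev: "\<And>w. w \<in> carrier_vec d \<Longrightarrow> (lap (trans_weight (Suc m) a) *\<^sub>v v) \<bullet>c w = complex_of_real x * (v \<bullet>c w)"
    and u: "u \<in> fixed_by (perms m)" and p: "p \<in> perms (Suc m)" and ne: "v \<bullet>c (\<sigma> p *\<^sub>v u) \<noteq> 0"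
  shows "\<kappa> \<le> x"
proof -
  let ?N = "Suc m" and ?G = "sym_group n"
  \<comment> \<open>The stabilizer of the last point fixes \<open>u\<close>, so the translates of
    \<open>u\<close> are indexed by the points; \<open>f\<close> pairs \<open>v\<close> with
    them.\<close>
  define f where "f i = v \<bullet>c (\<sigma> (tr i ?N) *\<^sub>v u)" for i
  have ud: "u \<in> carrier_vec d" using u by (simp add: fixed_by_def)
  have tc: "tr i ?N \<in> carrier ?G" if "i \<in> {1..?N}" for i using that m by (intro tr_carrier) auto
  \<comment> \<open>The translate of \<open>u\<close> by \<open>q\<close> depends only on the image
    of the last point, because \<open>q\<close> and the transposition with that image differ by an
    element of the stabilizer.\<close>
  have act_u: "\<sigma> q *\<^sub>v u = \<sigma> (tr (q ?N) ?N) *\<^sub>v u" if q: "q \<in> perms ?N" for q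
  proof -
    have qN: "q ?N \<in> {1..?N}" using q permutes_in_image[of q "{1..?N}" ?N] by (auto simp: perms_def)
    have "tr (q ?N) ?N \<circ> q \<in> perms m"
    proof (rule perms_fix)
      show "tr (q ?N) ?N \<circ> q \<in> perms ?N"
        using q transpose_perms[OF qN, of ?N] by (auto simp: perms_def intro: permutes_compose)
    qed simp
    then have "\<sigma> (tr (q ?N) ?N \<circ> q) *\<^sub>v u = u" using u by (simp add: fixed_by_def)
    then have "\<sigma> (tr (q ?N) ?N) *\<^sub>v (\<sigma> (tr (q ?N) ?N) *\<^sub>v (\<sigma> q *\<^sub>v u)) = \<sigma> (tr (q ?N) ?N) *\<^sub>v u"
      using act_comp[OF tc[OF qN] in_carrier[OF m q] ud] by simp
    moreover have "\<sigma> (tr (q ?N) ?N) *\<^sub>v (\<sigma> (tr (q ?N) ?N) *\<^sub>v w) = w" if "w \<in> carrier_vec d" for w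
      using act_comp[OF tc[OF qN] tc[OF qN] that] act_id[OF that] by simp
    ultimately show ?thesis using in_carrier[OF m q] ud by simp
  qed
  have f_act: "v \<bullet>c (\<sigma> q *\<^sub>v (\<sigma> (tr i ?N) *\<^sub>v u)) = f (q i)" if q: "q \<in> perms ?N" and i: "i \<in> {1..?N}" for q i
  proof -
    have "q \<circ> tr i ?N \<in> perms ?N"
      using q transpose_perms[OF i, of ?N] by (auto simp: perms_def intro: permutes_compose)
    from act_u[OF this] show ?thesis
      using act_comp[OF in_carrier[OF m q] tc[OF i] ud] by (simp add: f_def)
  qed
  have sum0: "(\<Sum>i\<in>{1..?N}. f i) = 0"
  proof -
    \<comment> \<open>Encodes the sum of all translates of \<open>u\<close> as a group algebra
      element. Permutations permute the translates, so the sum is fixed and hence orthogonal to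
      \<open>v\<close>.\<close>
    define \<alpha> where "\<alpha> h = (\<Sum>i\<in>{1..?N}. of_bool (h = tr i ?N) :: real)" for h
    have cs_y: "w \<bullet>c (gop \<alpha> *\<^sub>v u) = (\<Sum>i\<in>{1..?N}. w \<bullet>c (\<sigma> (tr i ?N) *\<^sub>v u))" if w: "w \<in> carrier_vec d" for w
    proof -
      have "w \<bullet>c (gop \<alpha> *\<^sub>v u) = (\<Sum>h\<in>carrier ?G. \<Sum>i\<in>{1..?N}. if h = tr i ?N then w \<bullet>c (\<sigma> h *\<^sub>v u) else 0)"
        unfolding cs_gop_right[OF ud w] \<alpha>_def of_real_sum sum_distrib_right by (intro sum.cong refl) simp
      also have "\<dots> = (\<Sum>i\<in>{1..?N}. \<Sum>h\<in>carrier ?G. if h = tr i ?N then w \<bullet>c (\<sigma> h *\<^sub>v u) else 0)"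
        by (rule sum.swap)
      also have "\<dots> = (\<Sum>i\<in>{1..?N}. w \<bullet>c (\<sigma> (tr i ?N) *\<^sub>v u))"
        using fin tc by (intro sum.cong refl) (simp add: sum.delta)
      finally show ?thesis .
    qed
    have "gop \<alpha> *\<^sub>v u \<in> fixed_by (perms ?N)"
      unfolding fixed_by_def
    proof (safe intro!: gop_in ud)
      fix q assume q: "q \<in> perms ?N"
      note qc = in_carrier[OF m q]
      show "\<sigma> q *\<^sub>v (gop \<alpha> *\<^sub>v u) = gop \<alpha> *\<^sub>v u"
      proof (rule vec_eq_csI[of _ d])
        fix w :: "complex vec" assume w: "w \<in> carrier_vec d"
        let ?w = "\<sigma> (inv\<^bsub>?G\<^esub> q) *\<^sub>v w"
        have w': "?w \<in> carrier_vec d" by (rule act_in[OF inv_closed[OF qc] w])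
        have "w \<bullet>c (\<sigma> q *\<^sub>v (gop \<alpha> *\<^sub>v u)) = ?w \<bullet>c (gop \<alpha> *\<^sub>v u)"
          by (rule cs_act_right[OF qc w gop_in[OF ud]])
        also have "\<dots> = (\<Sum>i\<in>{1..?N}. ?w \<bullet>c (\<sigma> (tr i ?N) *\<^sub>v u))" by (rule cs_y[OF w'])
        also have "\<dots> = (\<Sum>i\<in>{1..?N}. w \<bullet>c (\<sigma> (tr (q i) ?N) *\<^sub>v u))"
        proof (intro sum.cong refl)
          fix i assume i: "i \<in> {1..?N}"
          have q': "q \<circ> tr i ?N \<in> perms ?N"
            using q transpose_perms[OF i, of ?N] by (auto simp: perms_def intro: permutes_compose)
          have "?w \<bullet>c (\<sigma> (tr i ?N) *\<^sub>v u) = w \<bullet>c (\<sigma> q *\<^sub>v (\<sigma> (tr i ?N) *\<^sub>v u))"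
            by (rule cs_act_right[symmetric, OF qc w act_in[OF tc[OF i] ud]])
          then show "?w \<bullet>c (\<sigma> (tr i ?N) *\<^sub>v u) = w \<bullet>c (\<sigma> (tr (q i) ?N) *\<^sub>v u)"
            using act_u[OF q'] act_comp[OF qc tc[OF i] ud] by simp
        qed
        also have "\<dots> = (\<Sum>i\<in>{1..?N}. w \<bullet>c (\<sigma> (tr i ?N) *\<^sub>v u))"
          using permutes_imp_bij[of q "{1..?N}"] q
          by (intro sum.reindex_bij_betw[of q "{1..?N}" "{1..?N}" "\<lambda>i. w \<bullet>c (\<sigma> (tr i ?N) *\<^sub>v u)"]) (simp add: perms_def)
        also have "\<dots> = w \<bullet>c (gop \<alpha> *\<^sub>v u)" by (rule cs_y[OF w, symmetric])
        finally show "(\<sigma> q *\<^sub>v (gop \<alpha> *\<^sub>v u)) \<bullet>c w = (gop \<alpha> *\<^sub>v u) \<bullet>c w"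
          using cs_commute[OF w, of "\<sigma> q *\<^sub>v (gop \<alpha> *\<^sub>v u)"] cs_commute[OF w, of "gop \<alpha> *\<^sub>v u"] qc ud by simp
      qed (use qc ud in simp_all)
    qed
    then have "v \<bullet>c (gop \<alpha> *\<^sub>v u) = 0" by (rule orth)
    then show ?thesis using cs_y[OF v] by (simp add: f_def)
  qed
  \<comment> \<open>Pairing the eigenvalue equation with the translate at \<open>i\<close> and
    moving each transposition to the other side turns it into the equation of the walk.\<close>
  have eig: "complex_of_real x * f i = pair_sum ?N (\<lambda>j k. complex_of_real (a j k) * (f i - f (tr j k i)))"
    if i: "i \<in> {1..?N}" for i
  proof -
    have ui: "\<sigma> (tr i ?N) *\<^sub>v u \<in> carrier_vec d" using tc[OF i] ud by simp
    have "complex_of_real x * f i = pair_sum ?N (\<lambda>j k. complex_of_real (a j k) *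
        (v \<bullet>c (\<sigma> (tr i ?N) *\<^sub>v u) - (\<sigma> (tr j k) *\<^sub>v v) \<bullet>c (\<sigma> (tr i ?N) *\<^sub>v u)))"
      unfolding f_def ev[OF ui, symmetric] by (rule cs_lap_trans[OF m v ui])
    also have "\<dots> = pair_sum ?N (\<lambda>j k. complex_of_real (a j k) * (f i - f (tr j k i)))"
    proof (rule pair_sum_cong)
      fix j k assume jk: "1 \<le> j" "j < k" "k \<le> ?N"
      have "(\<sigma> (tr j k) *\<^sub>v v) \<bullet>c (\<sigma> (tr i ?N) *\<^sub>v u) = v \<bullet>c (\<sigma> (tr j k) *\<^sub>v (\<sigma> (tr i ?N) *\<^sub>v u))"
        using jk m by (intro cs_tr v ui) auto
      also have "\<dots> = f (tr j k i)" using jk by (intro f_act[OF transpose_perms i]) auto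
      finally show "complex_of_real (a j k) * (v \<bullet>c (\<sigma> (tr i ?N) *\<^sub>v u) - (\<sigma> (tr j k) *\<^sub>v v) \<bullet>c (\<sigma> (tr i ?N) *\<^sub>v u)) =
        complex_of_real (a j k) * (f i - f (tr j k i))" by (simp add: f_def)
    qed
    finally show ?thesis .
  qed
  let ?S = "\<Sum>i\<in>{1..?N}. (cmod (f i))\<^sup>2"
  \<comment> \<open>A transposition moves only \<open>j\<close> and \<open>k\<close>, so just these
    two terms survive and combine into one square.\<close>
  have local_diff: "(\<Sum>i\<in>{1..?N}. (f i - f (tr j k i)) * cnj (f i)) = complex_of_real ((cmod (f j - f k))\<^sup>2)"
    if jk: "1 \<le> j" "j < k" "k \<le> ?N" for j k
  proof -
    have "(\<Sum>i\<in>{1..?N}. (f i - f (tr j k i)) * cnj (f i)) = (\<Sum>i\<in>{j, k}. (f i - f (tr j k i)) * cnj (f i))"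
      by (rule sum.mono_neutral_right) (use jk in \<open>auto simp: transpose_def\<close>)
    also have "\<dots> = (f j - f k) * cnj (f j - f k)" using jk by (simp add: algebra_simps)
    finally show ?thesis by (simp only: complex_norm_square)
  qed
  have "complex_of_real (x * ?S) = (\<Sum>i\<in>{1..?N}. complex_of_real x * f i * cnj (f i))"
    by (simp only: of_real_mult of_real_sum sum_distrib_left complex_norm_square mult.assoc)
  also have "\<dots> = (\<Sum>i\<in>{1..?N}. pair_sum ?N (\<lambda>j k. complex_of_real (a j k) * ((f i - f (tr j k i)) * cnj (f i))))"
    by (intro sum.cong refl) (simp only: eig pair_sum_mult_right[symmetric] mult.assoc)
  also have "\<dots> = pair_sum ?N (\<lambda>j k. \<Sum>i\<in>{1..?N}. complex_of_real (a j k) * ((f i - f (tr j k i)) * cnj (f i)))"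
    by (rule pair_sum_sum[symmetric])
  also have "\<dots> = pair_sum ?N (\<lambda>j k. complex_of_real (a j k * (cmod (f j - f k))\<^sup>2))"
    by (intro pair_sum_cong) (simp only: sum_distrib_left[symmetric] local_diff of_real_mult)
  also have "\<dots> = complex_of_real (pair_sum ?N (\<lambda>j k. a j k * (cmod (f j - f k))\<^sup>2))"
    by (rule pair_sum_of_real[symmetric])
  finally have eq: "x * ?S = pair_sum ?N (\<lambda>j k. a j k * (cmod (f j - f k))\<^sup>2)"
    unfolding of_real_eq_iff .
  have "\<kappa> * ?S \<le> x * ?S"
  proof -
    \<comment> \<open>\<open>walk_gap\<close> speaks of real functions; real and imaginary part of
      \<open>f\<close> are treated separately and added.\<close>
    have "(\<Sum>i\<in>{1..?N}. Re (f i)) = 0" "(\<Sum>i\<in>{1..?N}. Im (f i)) = 0"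
      using arg_cong[OF sum0, of Re] arg_cong[OF sum0, of Im] by simp_all
    then have "\<kappa> * (\<Sum>i\<in>{1..?N}. (Re (f i))\<^sup>2) + \<kappa> * (\<Sum>i\<in>{1..?N}. (Im (f i))\<^sup>2) \<le>
        pair_sum ?N (\<lambda>j k. a j k * (Re (f j) - Re (f k))\<^sup>2) + pair_sum ?N (\<lambda>j k. a j k * (Im (f j) - Im (f k))\<^sup>2)"
      by (intro add_mono walk_gapD[OF gap])
    moreover have "?S = (\<Sum>i\<in>{1..?N}. (Re (f i))\<^sup>2) + (\<Sum>i\<in>{1..?N}. (Im (f i))\<^sup>2)"
      unfolding cmod_power2 by (rule sum.distrib)
    moreover have "pair_sum ?N (\<lambda>j k. a j k * (cmod (f j - f k))\<^sup>2) =
        pair_sum ?N (\<lambda>j k. a j k * (Re (f j) - Re (f k))\<^sup>2) + pair_sum ?N (\<lambda>j k. a j k * (Im (f j) - Im (f k))\<^sup>2)"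
      unfolding pair_sum_add[symmetric] by (intro pair_sum_cong) (simp add: cmod_power2 distrib_left)
    ultimately show ?thesis unfolding eq by (simp only: distrib_left)
  qed
  moreover have "0 < ?S"
  proof (rule sum_pos2[of _ "p ?N"])
    show "p ?N \<in> {1..?N}" using p permutes_in_image[of p "{1..?N}" ?N] by (auto simp: perms_def)
    \<comment> \<open>The assumed non-zero pairing is the value of \<open>f\<close> at
      \<open>p ?N\<close>, so \<open>f\<close> is not the zero function and its norm can be
      cancelled.\<close>
    have "f (p ?N) \<noteq> 0" using ne act_u[OF p] by (simp add: f_def)
    then show "0 < (cmod (f (p ?N)))\<^sup>2" by simp
  qed simp_all
  ultimately show ?thesis by (simp only: mult_le_cancel_right)
qed

text \<open>The induction on \<open>m\<close> stays within one representation of the symmetric group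
  on \<open>n\<close> points. Consider an eigenvector orthogonal to the fixed vectors of the larger
  group. If it pairs with a translate of a vector fixed by the stabilizer of the last point, its
  eigenvalue belongs to the walk. Otherwise it meets the assumptions of the induction hypothesis,
  which is applied to the reduced network and transferred back by the octopus inequality.\<close>

theorem aldous_gap:
  assumes "m \<le> n" and a: "\<And>i j. 1 \<le> i \<Longrightarrow> i < j \<Longrightarrow> j \<le> m \<Longrightarrow> 0 \<le> a i j"
    and gap: "walk_gap m a \<kappa>"
    and v: "v \<in> carrier_vec d" and orth: "\<And>u. u \<in> fixed_by (perms m) \<Longrightarrow> v \<bullet>c u = 0"
  shows "\<kappa> * nsq v \<le> energy m a v"
  using assms
proof (induction m arbitrary: a v)
  case 0
  have "perms 0 = {id}" by (simp add: perms_def permutes_empty id_def)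
  then have "v \<in> fixed_by (perms 0)" using 0 act_id by (simp add: fixed_by_def)
  then have "v \<bullet>c v = 0" by (rule 0)
  then show ?case by (simp add: cs_self energy_def)
next
  case (Suc m)
  let ?N = "Suc m" and ?G = "sym_group n"
  have N: "?N \<le> n" by (rule Suc.prems)
  show ?case
  proof (cases "\<kappa> \<le> 0")
    case True
    have "0 \<le> energy ?N a v" by (rule energy_nonneg) (use Suc.prems in auto)
    moreover have "\<kappa> * nsq v \<le> 0" using True by (simp add: mult_nonpos_nonneg)
    ultimately show ?thesis by linarith
  next
    case False
    then have pos: "0 < \<kappa>" by simp
    show ?thesis
    proof (cases "m = 0")
      case True
      have "perms 1 = {id}" by (simp add: perms_def permutes_sing id_def)
      then have "v \<in> fixed_by (perms ?N)" using True Suc.prems(4) act_id by (simp add: fixed_by_def)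
      then have "v \<bullet>c v = 0" by (rule Suc.prems)
      then show ?thesis using energy_nonneg[of ?N v a] Suc.prems by (simp add: cs_self)
    next
      case False
      define C where "C = (\<Sum>i\<in>{1..m}. a i ?N)"
      have c: "0 \<le> a i ?N" if "i \<in> {1..m}" for i using that Suc.prems(2)[of i ?N] by simp
      \<comment> \<open>A positive \<open>\<kappa>\<close> excludes an isolated last vertex, so the
        reduced rates are meaningful.\<close>
      have "C \<noteq> 0"
      proof
        assume "C = 0"
        then have "a i ?N = 0" if "i \<in> {1..m}" for i
          using that sum_nonneg_eq_0_iff[of "{1..m}" "\<lambda>i. a i ?N"] c by (simp add: C_def)
        then have "\<kappa> \<le> 0" using walk_gap_isolated[OF Suc.prems(3)] False by simp
        then show False using pos by simp
      qed
      then have "0 < C" using c sum_nonneg[of "{1..m}" "\<lambda>i. a i ?N"] by (simp add: C_def less_le)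
      let ?a = "\<lambda>i j. a i j + a i ?N * a j ?N / C"
      have a': "0 \<le> ?a i j" if "1 \<le> i" "i < j" "j \<le> m" for i j
        using that Suc.prems(2)[of i j] c[of i] c[of j] \<open>0 < C\<close> by simp
      have IH: "\<kappa> * nsq w \<le> energy m ?a w"
        if "w \<in> carrier_vec d" "\<And>u. u \<in> fixed_by (perms m) \<Longrightarrow> w \<bullet>c u = 0" for w
        by (rule Suc.IH[OF _ a' walk_gap_reduction[OF Suc.prems(3) less_imp_le[OF pos] C_def \<open>C \<noteq> 0\<close>] that])
          (use N in auto)
      note sub = perms_subgroup[OF N]
      let ?w = "trans_weight ?N a"
      \<comment> \<open>The operator is the Laplacian minus \<open>\<kappa>\<close> plus
        \<open>\<kappa>\<close> times the projection onto the vectors fixed by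
        \<open>perms ?N\<close>. The last term makes it vanish on those vectors, so a bound on their
        complement becomes positivity on the whole space, where \<open>hermitian_psd\<close>
        applies.\<close>
      define \<beta> where "\<beta> h = laplacian ?G ?w h - \<kappa> * of_bool (h = id) + \<kappa> * (of_bool (h \<in> perms ?N) / real (card (perms ?N)))" for h
      have cs_B: "(gop \<beta> *\<^sub>v x) \<bullet>c y = (lap ?w *\<^sub>v x) \<bullet>c y - complex_of_real \<kappa> * (x \<bullet>c y) +
          complex_of_real \<kappa> * ((proj (perms ?N) *\<^sub>v x) \<bullet>c y)"
        if x: "x \<in> carrier_vec d" and y: "y \<in> carrier_vec d" for x y
      proof -
        have "(\<Sum>h\<in>carrier ?G. complex_of_real (of_bool (h = id)) * ((\<sigma> h *\<^sub>v x) \<bullet>c y)) =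
            (\<Sum>h\<in>carrier ?G. if h = id then (\<sigma> h *\<^sub>v x) \<bullet>c y else 0)"
          by (intro sum.cong refl) simp
        also have "\<dots> = x \<bullet>c y"
          using fin one_closed act_id[OF x] by (simp add: sum.delta sym_group_one)
        finally have "(\<Sum>h\<in>carrier ?G. complex_of_real (of_bool (h = id)) * ((\<sigma> h *\<^sub>v x) \<bullet>c y)) = x \<bullet>c y" .
        note id_sum = this
        have "(gop \<beta> *\<^sub>v x) \<bullet>c y = (\<Sum>h\<in>carrier ?G. complex_of_real (laplacian ?G ?w h) * ((\<sigma> h *\<^sub>v x) \<bullet>c y) -
            complex_of_real \<kappa> * (complex_of_real (of_bool (h = id)) * ((\<sigma> h *\<^sub>v x) \<bullet>c y)) +
            complex_of_real \<kappa> * (complex_of_real (of_bool (h \<in> perms ?N) / real (card (perms ?N))) * ((\<sigma> h *\<^sub>v x) \<bullet>c y)))"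
          unfolding cs_gop[OF x y] \<beta>_def
          by (intro sum.cong refl)
            (simp only: of_real_add of_real_diff of_real_mult distrib_right left_diff_distrib mult.assoc)
        then show ?thesis
          unfolding sum.distrib sum_subtractf sum_distrib_left[symmetric] id_sum cs_gop[OF x y] proj_def .
      qed
      have herm_lap: "hermitian_on d (lap ?w)" by (rule hermitian_lap) (rule trans_weight_inv)
      have Bc: "gop \<beta> *\<^sub>v x \<in> carrier_vec d" if "x \<in> carrier_vec d" for x using that by simp
      have "hermitian_on d (gop \<beta>)"
        unfolding hermitian_on_def
      proof (intro conjI ballI gop_carrier)
        fix x y :: "complex vec" assume x: "x \<in> carrier_vec d" and y: "y \<in> carrier_vec d"
        have "x \<bullet>c (gop \<beta> *\<^sub>v y) = cnj ((gop \<beta> *\<^sub>v y) \<bullet>c x)" by (rule cs_commute[OF Bc[OF y] x])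
        also have "\<dots> = cnj ((lap ?w *\<^sub>v y) \<bullet>c x) - complex_of_real \<kappa> * cnj (y \<bullet>c x) +
            complex_of_real \<kappa> * cnj ((proj (perms ?N) *\<^sub>v y) \<bullet>c x)"
          by (simp add: cs_B[OF y x])
        also have "\<dots> = (gop \<beta> *\<^sub>v x) \<bullet>c y"
          using cs_commute[of "lap ?w *\<^sub>v y" d x] cs_commute[of y d x] cs_commute[of "proj (perms ?N) *\<^sub>v y" d x]
            herm_lap hermitian_proj[OF sub] x y by (simp add: cs_B[OF x y] hermitian_on_def)
        finally show "(gop \<beta> *\<^sub>v x) \<bullet>c y = x \<bullet>c (gop \<beta> *\<^sub>v y)" ..
      qed
      then have "0 \<le> Re ((gop \<beta> *\<^sub>v v) \<bullet>c v)"
      proof (rule hermitian_psd[OF _ _ Suc.prems(4)])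
        fix e y assume e: "eigenvector (gop \<beta>) e (complex_of_real y)"
        then have ed: "e \<in> carrier_vec d" and e0: "e \<noteq> 0\<^sub>v d" and ev: "gop \<beta> *\<^sub>v e = complex_of_real y \<cdot>\<^sub>v e"
          by (auto simp: eigenvector_def)
        show "0 \<le> y"
        proof (rule ccontr)
          assume "\<not> 0 \<le> y"
          then have "y < 0" by simp
          \<comment> \<open>The operator annihilates the vectors fixed by \<open>perms ?N\<close>,
            so an eigenvector for \<open>y \<noteq> 0\<close> is orthogonal to them.\<close>
          have orth: "e \<bullet>c u = 0" if u: "u \<in> fixed_by (perms ?N)" for u
          proof -
            have ud: "u \<in> carrier_vec d" using u by (simp add: fixed_by_def)
            have "(lap ?w *\<^sub>v e) \<bullet>c u = 0"
            proof -
              have "(\<sigma> (tr i j) *\<^sub>v e) \<bullet>c u = e \<bullet>c u" if "1 \<le> i" "i < j" "j \<le> ?N" for i j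
                using u that N transpose_perms[of i ?N j] cs_tr[of i j e u] ed ud by (auto simp: fixed_by_def)
              then have "pair_sum ?N (\<lambda>i j. complex_of_real (a i j) * (e \<bullet>c u - (\<sigma> (tr i j) *\<^sub>v e) \<bullet>c u)) =
                  pair_sum ?N (\<lambda>i j. 0)" by (intro pair_sum_cong) simp
              then show ?thesis unfolding cs_lap_trans[OF N ed ud] by (simp add: pair_sum_def)
            qed
            moreover have "(proj (perms ?N) *\<^sub>v e) \<bullet>c u = e \<bullet>c u"
              using hermitian_proj[OF sub] proj_id[OF sub u] ed ud by (simp add: hermitian_on_def)
            ultimately have "complex_of_real y * (e \<bullet>c u) = 0"
              using cs_B[OF ed ud] cs_smult_left[OF ed ud] by (simp add: ev)
            then show ?thesis using \<open>y < 0\<close> by simp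
          qed
          note proj0 = proj_orth[OF sub ed orth]
          have lap_ev: "(lap ?w *\<^sub>v e) \<bullet>c w = complex_of_real (\<kappa> + y) * (e \<bullet>c w)" if w: "w \<in> carrier_vec d" for w
          proof -
            have "complex_of_real y * (e \<bullet>c w) = (lap ?w *\<^sub>v e) \<bullet>c w - complex_of_real \<kappa> * (e \<bullet>c w)"
              using cs_B[OF ed w] cs_smult_left[OF ed w] w by (simp add: ev proj0)
            then show ?thesis by (simp add: algebra_simps)
          qed
          show False
          proof (cases "\<exists>u\<in>fixed_by (perms m). \<exists>p\<in>perms ?N. e \<bullet>c (\<sigma> p *\<^sub>v u) \<noteq> 0")
            case True
            then obtain u p where "u \<in> fixed_by (perms m)" "p \<in> perms ?N" "e \<bullet>c (\<sigma> p *\<^sub>v u) \<noteq> 0" by blast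
            then have "\<kappa> \<le> \<kappa> + y"
              using walk_eigenfunction[OF N Suc.prems(3) ed orth lap_ev] by blast
            then show False using \<open>y < 0\<close> by simp
          next
            case False
            have orth': "e \<bullet>c u = 0" if u: "u \<in> fixed_by (perms m)" for u
            proof -
              have "id \<in> perms ?N" by (simp add: perms_def permutes_id)
              moreover have "\<sigma> id *\<^sub>v u = u" using u act_id by (simp add: fixed_by_def)
              ultimately show ?thesis using False u by metis
            qed
            \<comment> \<open>Here \<open>e\<close> is orthogonal to all vectors fixed by the
              smaller group, so its energy in the reduced network is bounded by induction, against
              the eigenvalue \<open>\<kappa> + y\<close> below \<open>\<kappa>\<close>.\<close>
            have "\<kappa> * nsq e \<le> energy m ?a e" by (rule IH[OF ed orth'])
            also have "\<dots> \<le> energy ?N a e" by (rule energy_reduction[where a = a and m = m, OF N ed c C_def \<open>C \<noteq> 0\<close>])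
            also have "\<dots> = (\<kappa> + y) * nsq e"
              using lap_ev[OF ed] Re_lap_trans[OF N ed, of a] by (simp add: cs_self)
            finally have "0 \<le> y * nsq e" by (simp add: algebra_simps)
            moreover have "0 < nsq e" using nsq_pos_iff[OF ed] e0 by simp
            ultimately show False using \<open>y < 0\<close> by (simp add: zero_le_mult_iff)
          qed
        qed
      qed
      moreover have "proj (perms ?N) *\<^sub>v v = 0\<^sub>v d" by (rule proj_orth[OF sub Suc.prems(4,5)])
      ultimately show ?thesis
        using cs_B[OF Suc.prems(4,4)] Suc.prems(4) Re_lap_trans[OF N Suc.prems(4), of a] by (simp add: cs_self)
    qed
  qed
qed

end

section \<open>The wreath product\<close>

lemma inv'_comp_apply:
  assumes "p \<in> perms n"
  shows "inv' p (p i) = i" "p (inv' p i) = i"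
  using assms permutes_inverses[of p "{1..n}"] by (auto simp: perms_def)

lemma perms_in: "p \<in> perms n \<Longrightarrow> i \<in> {1..n} \<Longrightarrow> p i \<in> {1..n}"
  using permutes_in_image[of p "{1..n}" i] by (simp add: perms_def)

lemma perms_inv': "p \<in> perms n \<Longrightarrow> inv' p \<in> perms n"
  by (simp add: perms_def permutes_inv)

lemma perms_comp: "p \<in> perms n \<Longrightarrow> q \<in> perms n \<Longrightarrow> p \<circ> q \<in> perms n"
  by (auto simp: perms_def intro: permutes_compose)

lemma perms_id [simp]: "id \<in> perms n"
  by (simp add: perms_def permutes_id)

locale wreath_setup =
  fixes G :: "('g, 'm) monoid_scheme" and n :: nat
  assumes G: "group G" and finG: "finite (carrier G)"
begin

abbreviation "B \<equiv> base_group n G"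
abbreviation "W \<equiv> wreath n G"
abbreviation "be \<equiv> base_embed n G"
abbreviation "se \<equiv> sym_embed n G"
abbreviation "tr \<equiv> (Transposition.transpose :: nat \<Rightarrow> nat \<Rightarrow> nat \<Rightarrow> nat)"

lemma B_group: "group B"
  unfolding base_group_def using G by simp

sublocale B: group B by (rule B_group)

lemma B_carrier: "carrier B = (\<Pi>\<^sub>E i\<in>{1..n}. carrier G)"
  by (simp add: base_group_def)

lemma B_finite: "finite (carrier B)"
  unfolding B_carrier using finG by (intro finite_PiE) auto

lemma B_mult: "x \<otimes>\<^bsub>B\<^esub> y = (\<lambda>i\<in>{1..n}. x i \<otimes>\<^bsub>G\<^esub> y i)"
  by (simp add: base_group_def)

lemma B_one: "\<one>\<^bsub>B\<^esub> = (\<lambda>i\<in>{1..n}. \<one>\<^bsub>G\<^esub>)"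
  by (simp add: base_group_def)

lemma perm_act_in: "p \<in> perms n \<Longrightarrow> g \<in> carrier B \<Longrightarrow> perm_act n p g \<in> carrier B"
  using perms_in[OF perms_inv'] by (auto simp: perm_act_def B_carrier PiE_iff)

lemma perm_act_mult:
  "p \<in> perms n \<Longrightarrow> perm_act n p (x \<otimes>\<^bsub>B\<^esub> y) = perm_act n p x \<otimes>\<^bsub>B\<^esub> perm_act n p y"
  using perms_in[OF perms_inv', of p n] by (auto simp: perm_act_def B_mult fun_eq_iff restrict_def)

lemma perm_act_comp:
  assumes "p \<in> perms n" "q \<in> perms n"
  shows "perm_act n (p \<circ> q) g = perm_act n p (perm_act n q g)"
proof -
  have "inv' (p \<circ> q) = inv' q \<circ> inv' p"
    using assms by (intro o_inv_distrib) (auto simp: perms_def permutes_bij)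
  then show ?thesis
    using perms_in[OF perms_inv'[OF assms(1)]] by (auto simp: perm_act_def fun_eq_iff restrict_def)
qed

lemma perm_act_id: "g \<in> carrier B \<Longrightarrow> perm_act n id g = g"
  by (auto simp: perm_act_def B_carrier PiE_iff extensional_def fun_eq_iff)

lemma perm_act_one: "p \<in> perms n \<Longrightarrow> perm_act n p \<one>\<^bsub>B\<^esub> = \<one>\<^bsub>B\<^esub>"
  using perms_in[OF perms_inv', of p n] by (auto simp: perm_act_def B_one fun_eq_iff restrict_def)

lemma W_carrier: "carrier W = carrier B \<times> perms n"
  by (simp add: wreath_def carrier_sym_group)

lemma W_mult: "(g, p) \<otimes>\<^bsub>W\<^esub> (h, q) = (g \<otimes>\<^bsub>B\<^esub> perm_act n p h, p \<circ> q)"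
  by (simp add: wreath_def sym_group_mult)

lemma W_one: "\<one>\<^bsub>W\<^esub> = (\<one>\<^bsub>B\<^esub>, id)"
  by (simp add: wreath_def sym_group_one)

lemma W_group: "group W"
proof (rule groupI)
  fix x y z assume "x \<in> carrier W" "y \<in> carrier W" "z \<in> carrier W"
  then show "x \<otimes>\<^bsub>W\<^esub> y \<otimes>\<^bsub>W\<^esub> z = x \<otimes>\<^bsub>W\<^esub> (y \<otimes>\<^bsub>W\<^esub> z)"
    by (cases x, cases y, cases z)
      (simp add: W_carrier W_mult perm_act_in perm_act_mult perm_act_comp B.m_assoc comp_assoc)
next
  fix x assume "x \<in> carrier W"
  then obtain g p where x: "x = (g, p)" "g \<in> carrier B" "p \<in> perms n" by (auto simp: W_carrier)
  let ?y = "(perm_act n (inv' p) (inv\<^bsub>B\<^esub> g), inv' p)"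
  have "inv' p \<circ> p = id" using x by (simp add: fun_eq_iff inv'_comp_apply)
  then have "?y \<otimes>\<^bsub>W\<^esub> x = \<one>\<^bsub>W\<^esub>"
    using x by (simp add: W_mult W_one perm_act_mult[symmetric] perms_inv' perm_act_one)
  moreover have "?y \<in> carrier W" using x by (simp add: W_carrier perm_act_in perms_inv')
  ultimately show "\<exists>y\<in>carrier W. y \<otimes>\<^bsub>W\<^esub> x = \<one>\<^bsub>W\<^esub>" by blast
qed (auto simp: W_carrier W_mult W_one perm_act_in perms_comp perm_act_id)

sublocale W: group W by (rule W_group)

lemma perms_finite: "finite (perms n)"
  unfolding perms_def by (rule finite_permutations) simp

lemma W_finite: "finite (carrier W)"
  by (simp add: W_carrier B_finite perms_finite)

lemma be_in [simp]: "g \<in> carrier B \<Longrightarrow> be g \<in> carrier W"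
  by (simp add: base_embed_def W_carrier sym_group_one)

lemma se_in [simp]: "p \<in> perms n \<Longrightarrow> se p \<in> carrier W"
  by (simp add: sym_embed_def W_carrier)

lemma be_mult: "g \<in> carrier B \<Longrightarrow> h \<in> carrier B \<Longrightarrow> be (g \<otimes>\<^bsub>B\<^esub> h) = be g \<otimes>\<^bsub>W\<^esub> be h"
  by (simp add: base_embed_def W_mult sym_group_one perm_act_id)

lemma se_mult: "p \<in> perms n \<Longrightarrow> q \<in> perms n \<Longrightarrow> se (p \<circ> q) = se p \<otimes>\<^bsub>W\<^esub> se q"
  by (simp add: sym_embed_def W_mult perm_act_one)

lemma be_one: "be \<one>\<^bsub>B\<^esub> = \<one>\<^bsub>W\<^esub>"
  by (simp add: base_embed_def W_one sym_group_one)

lemma se_one: "se id = \<one>\<^bsub>W\<^esub>"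
  by (simp add: sym_embed_def W_one)

lemma be_se: "g \<in> carrier B \<Longrightarrow> p \<in> perms n \<Longrightarrow> be g \<otimes>\<^bsub>W\<^esub> se p = (g, p)"
  by (simp add: base_embed_def sym_embed_def W_mult sym_group_one perm_act_id)

lemma se_be: "g \<in> carrier B \<Longrightarrow> p \<in> perms n \<Longrightarrow> se p \<otimes>\<^bsub>W\<^esub> be g = be (perm_act n p g) \<otimes>\<^bsub>W\<^esub> se p"
  by (simp add: be_se perm_act_in) (simp add: base_embed_def sym_embed_def W_mult sym_group_one perm_act_in)

lemma inv_be: "g \<in> carrier B \<Longrightarrow> inv\<^bsub>W\<^esub> (be g) = be (inv\<^bsub>B\<^esub> g)"
  by (rule W.inv_equality) (simp_all add: be_mult[symmetric] be_one)

lemma inv_se: "p \<in> perms n \<Longrightarrow> inv\<^bsub>W\<^esub> (se p) = se (inv' p)"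
proof -
  assume p: "p \<in> perms n"
  have "inv' p \<circ> p = id" using p by (simp add: fun_eq_iff inv'_comp_apply)
  then show ?thesis
    using p by (intro W.inv_equality) (simp_all add: se_mult[symmetric] perms_inv' se_one)
qed

lemma be_subgroup: "subgroup (be ` carrier B) W"
proof
  show "inv\<^bsub>W\<^esub> x \<in> be ` carrier B" if "x \<in> be ` carrier B" for x using that by (auto simp: inv_be)
  show "\<one>\<^bsub>W\<^esub> \<in> be ` carrier B" using be_one by (metis B.one_closed image_eqI)
qed (auto simp: be_mult[symmetric])

lemma se_subgroup:
  assumes "m \<le> n"
  shows "subgroup (se ` perms m) W"
proof
  have sub: "perms m \<subseteq> perms n" by (rule perms_mono[OF assms])
  show "se ` perms m \<subseteq> carrier W" using sub by auto
  show "x \<otimes>\<^bsub>W\<^esub> y \<in> se ` perms m" if "x \<in> se ` perms m" "y \<in> se ` perms m" for x y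
    using that sub by (auto simp: se_mult[symmetric] perms_comp subset_iff)
  show "\<one>\<^bsub>W\<^esub> \<in> se ` perms m" using se_one by (metis image_eqI perms_id)
  show "inv\<^bsub>W\<^esub> x \<in> se ` perms m" if "x \<in> se ` perms m" for x
    using that sub by (auto simp: inv_se perms_inv' subset_iff)
qed

text \<open>The admissible element with its weights as parameters, so that particular weights can be
  inserted in the necessity arguments.\<close>

definition adm :: "(nat \<Rightarrow> nat \<Rightarrow> real) \<Rightarrow> ((nat \<Rightarrow> 'g) \<Rightarrow> real) \<Rightarrow> (nat \<Rightarrow> 'g) \<times> (nat \<Rightarrow> nat) \<Rightarrow> real" where
  "adm a c x = pair_sum n (\<lambda>i j. a i j * of_bool (x = se (tr i j))) +
     (\<Sum>g\<in>carrier B. c g * of_bool (x = be g))"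

definition weights :: "(nat \<Rightarrow> nat \<Rightarrow> real) \<Rightarrow> ((nat \<Rightarrow> 'g) \<Rightarrow> real) \<Rightarrow> bool" where
  "weights a c \<longleftrightarrow> (\<forall>i j. 1 \<le> i \<and> i < j \<and> j \<le> n \<longrightarrow> 0 \<le> a i j) \<and>
     (\<forall>g\<in>carrier B. 0 \<le> c g \<and> c (inv\<^bsub>B\<^esub> g) = c g)"

lemma pair_set_sum:
  "(\<Sum>(i, j)\<in>{(i, j). 1 \<le> i \<and> i < j \<and> j \<le> n}. F i j) = pair_sum n F" for F :: "nat \<Rightarrow> nat \<Rightarrow> real"
proof -
  have "pair_sum n F = (\<Sum>(j, i)\<in>Sigma {1..n} (\<lambda>j. {1..<j}). F i j)"
    unfolding pair_sum_def by (rule sum.Sigma) auto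
  also have "\<dots> = (\<Sum>(i, j)\<in>{(i, j). 1 \<le> i \<and> i < j \<and> j \<le> n}. F i j)"
    by (rule sum.reindex_bij_witness[of _ "\<lambda>(i, j). (j, i)" "\<lambda>(j, i). (i, j)"]) auto
  finally show ?thesis ..
qed

lemma admissible_iff: "admissible n G w \<longleftrightarrow> (\<exists>a c. weights a c \<and> w = adm a c)"
  unfolding admissible_def weights_def adm_def[abs_def] galg_single_def pair_set_sum by auto

lemma sum_adm:
  fixes X :: "(nat \<Rightarrow> 'g) \<times> (nat \<Rightarrow> nat) \<Rightarrow> 'c :: real_algebra_1"
  shows "(\<Sum>h\<in>carrier W. of_real (adm a c h) * X h) =
    pair_sum n (\<lambda>i j. of_real (a i j) * X (se (tr i j))) + (\<Sum>g\<in>carrier B. of_real (c g) * X (be g))"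
proof -
  have "(\<Sum>h\<in>carrier W. of_real (adm a c h) * X h) =
      (\<Sum>h\<in>carrier W. pair_sum n (\<lambda>i j. if h = se (tr i j) then of_real (a i j) * X h else 0)) +
      (\<Sum>h\<in>carrier W. \<Sum>g\<in>carrier B. if h = be g then of_real (c g) * X h else 0)"
    unfolding adm_def sum.distrib[symmetric] pair_sum_def of_real_add of_real_sum distrib_right sum_distrib_right
    by (intro sum.cong refl arg_cong2[of _ _ _ _ "(+)"]) auto
  also have "(\<Sum>h\<in>carrier W. pair_sum n (\<lambda>i j. if h = se (tr i j) then of_real (a i j) * X h else 0)) =
      pair_sum n (\<lambda>i j. \<Sum>h\<in>carrier W. if h = se (tr i j) then of_real (a i j) * X h else 0)"
    by (rule pair_sum_sum[symmetric])
  also have "\<dots> = pair_sum n (\<lambda>i j. of_real (a i j) * X (se (tr i j)))"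
    using W_finite by (intro pair_sum_cong) (simp add: sum.delta transpose_perms)
  also have "(\<Sum>h\<in>carrier W. \<Sum>g\<in>carrier B. if h = be g then of_real (c g) * X h else 0) =
      (\<Sum>g\<in>carrier B. \<Sum>h\<in>carrier W. if h = be g then of_real (c g) * X h else 0)"
    by (rule sum.swap)
  also have "\<dots> = (\<Sum>g\<in>carrier B. of_real (c g) * X (be g))"
    using W_finite by (intro sum.cong refl) (simp add: sum.delta)
  finally show ?thesis .
qed

lemma adm_inv:
  assumes w: "weights a c" and h: "h \<in> carrier W"
  shows "adm a c (inv\<^bsub>W\<^esub> h) = adm a c h"
proof -
  have "inv\<^bsub>W\<^esub> h = se (tr i j) \<longleftrightarrow> h = se (tr i j)" if "i \<in> {1..n}" "j \<in> {1..n}" for i j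
  proof -
    have t: "tr i j \<in> perms n" by (rule transpose_perms[OF that])
    then have "inv\<^bsub>W\<^esub> (se (tr i j)) = se (tr i j)" by (simp add: inv_se)
    then show ?thesis using h t by (metis W.inv_inv se_in)
  qed
  then have "pair_sum n (\<lambda>i j. a i j * of_bool (inv\<^bsub>W\<^esub> h = se (tr i j))) =
      pair_sum n (\<lambda>i j. a i j * of_bool (h = se (tr i j)))"
    by (intro pair_sum_cong) auto
  moreover have "(\<Sum>g\<in>carrier B. c g * of_bool (inv\<^bsub>W\<^esub> h = be g)) = (\<Sum>g\<in>carrier B. c g * of_bool (h = be g))"
  proof (rule sum.reindex_bij_witness[of _ "\<lambda>g. inv\<^bsub>B\<^esub> g" "\<lambda>g. inv\<^bsub>B\<^esub> g"])
    fix g assume g: "g \<in> carrier B"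
    have "inv\<^bsub>W\<^esub> h = be g \<longleftrightarrow> h = be (inv\<^bsub>B\<^esub> g)"
      using g h by (metis W.inv_inv be_in inv_be)
    then show "c (inv\<^bsub>B\<^esub> g) * of_bool (h = be (inv\<^bsub>B\<^esub> g)) = c g * of_bool (inv\<^bsub>W\<^esub> h = be g)"
      using w g by (simp add: weights_def)
  qed auto
  ultimately show ?thesis by (simp add: adm_def)
qed

lemma sum_W_base:
  fixes F :: "(nat \<Rightarrow> 'g) \<times> (nat \<Rightarrow> nat) \<Rightarrow> 'c :: semiring_1"
  assumes "\<And>g p. g \<in> carrier B \<Longrightarrow> p \<in> perms n \<Longrightarrow> F (g, p) = F (be g)"
  shows "(\<Sum>h\<in>carrier W. F h) = of_nat (card (perms n)) * (\<Sum>g\<in>carrier B. F (be g))"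
proof -
  have "(\<Sum>h\<in>carrier W. F h) = (\<Sum>g\<in>carrier B. \<Sum>p\<in>perms n. F (g, p))"
    unfolding W_carrier by (simp add: sum.cartesian_product)
  also have "\<dots> = (\<Sum>g\<in>carrier B. \<Sum>p\<in>perms n. F (be g))"
    by (intro sum.cong refl assms)
  finally show ?thesis by (simp add: sum_distrib_left)
qed

end

locale wreath_urep = wreath_setup G n + R: urep "wreath n G" \<rho>
  for G :: "('g, 'm) monoid_scheme" and n and \<rho>
begin

lemma restrict_sym_urep: "sym_urep n (\<rho> \<circ> se)"
proof -
  interpret S: group "sym_group n" by (rule sym_group_is_group)
  have dim: "rep_dim (sym_group n) (\<rho> \<circ> se) = R.d"
    by (simp add: rep_dim_def sym_group_one se_one)
  have "unitary_rep (sym_group n) (\<rho> \<circ> se)"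
    unfolding unitary_rep_def dim
    by (auto simp: carrier_sym_group sym_group_one sym_group_mult se_one R.rho_one se_mult R.rho_mult R.rho_unitary)
  then show ?thesis
    by unfold_locales (simp_all add: carrier_sym_group perms_finite)
qed

sublocale S: sym_urep n "\<rho> \<circ> se" by (rule restrict_sym_urep)

lemma S_dim: "S.d = R.d"
  by (simp add: rep_dim_def sym_group_one se_one)

lemma S_fixed_by: "S.fixed_by (perms m) = R.fixed_by (se ` perms m)"
  by (auto simp: S.fixed_by_def R.fixed_by_def S_dim)

lemma S_diss: "S.diss p v = R.diss (se p) v"
  by (simp add: S.diss_def R.diss_def)

lemma wreath_aldous:
  assumes "m \<le> n" and "\<And>i j. 1 \<le> i \<Longrightarrow> i < j \<Longrightarrow> j \<le> m \<Longrightarrow> 0 \<le> a i j"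
    and "walk_gap m a \<kappa>"
    and "v \<in> carrier_vec R.d" and "\<And>u. u \<in> R.fixed_by (se ` perms m) \<Longrightarrow> v \<bullet>c u = 0"
  shows "\<kappa> * nsq v \<le> pair_sum m (\<lambda>i j. a i j * R.diss (se (tr i j)) v)"
  using S.aldous_gap[of m a \<kappa> v] assms unfolding S_dim S_fixed_by S.energy_def S_diss by blast

lemma Re_lap_adm:
  assumes "v \<in> carrier_vec R.d"
  shows "Re ((R.lap (adm a c) *\<^sub>v v) \<bullet>c v) =
    pair_sum n (\<lambda>i j. a i j * R.diss (se (tr i j)) v) + (\<Sum>g\<in>carrier B. c g * R.diss (be g) v)"
  using sum_adm[of a c "\<lambda>h. R.diss h v"] by (simp add: R.Re_lap[OF assms])

text \<open>\<open>Sph\<close> asks for a spherical vector in some representative of the class; an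
  isomorphism carries it to \<open>\<rho>\<close>.\<close>

lemma spherical_iff:
  assumes "irreducible_rep W \<rho>"
  shows "rep_class W \<rho> \<in> Sph n G \<longleftrightarrow> R.fixed_by (se ` perms n) \<noteq> {0\<^sub>v R.d}"
proof
  assume "rep_class W \<rho> \<in> Sph n G"
  then obtain \<sigma> v where s: "\<sigma> \<in> rep_class W \<rho>" and v: "v \<in> carrier_vec (rep_dim W \<sigma>)"
    "v \<noteq> 0\<^sub>v (rep_dim W \<sigma>)" "\<forall>\<pi>\<in>carrier (sym_group n). \<sigma> (se \<pi>) *\<^sub>v v = v"
    by (auto simp: Sph_def)
  have s': "urep W \<sigma>" "rep_iso W \<rho> \<sigma>" using s in_rep_class_iff[OF R.urep_axioms] by auto
  interpret P: urep_pair W \<sigma> \<rho> using s' R.urep_axioms by (simp add: urep_pair_def)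
  have "v \<in> P.R.fixed_by (se ` perms n)" using v by (auto simp: P.R.fixed_by_def carrier_sym_group)
  then have "P.R.fixed_by (se ` perms n) \<noteq> {0\<^sub>v P.R.d}" using v by blast
  moreover have "se ` perms n \<subseteq> carrier W" by auto
  ultimately show "R.fixed_by (se ` perms n) \<noteq> {0\<^sub>v R.d}"
    using P.iso_fixed_by[OF rep_iso_sym[OF R.urep_axioms s'], of "se ` perms n"] by blast
next
  assume ne: "R.fixed_by (se ` perms n) \<noteq> {0\<^sub>v R.d}"
  have "se ` perms n \<subseteq> carrier W" by auto
  from R.vec_subspace_fixed_by[OF this] have "0\<^sub>v R.d \<in> R.fixed_by (se ` perms n)"
    by (simp add: vec_subspace_def)
  then obtain v where v: "v \<in> R.fixed_by (se ` perms n)" "v \<noteq> 0\<^sub>v R.d" using ne by blast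
  moreover have "rep_class W \<rho> \<in> Irr W" using assms by (simp add: Irr_def)
  moreover have "\<rho> \<in> rep_class W \<rho>" by (rule in_rep_class_self[OF R.urep_axioms])
  ultimately show "rep_class W \<rho> \<in> Sph n G"
    unfolding Sph_def by (auto simp: R.fixed_by_def carrier_sym_group intro!: bexI[of _ \<rho>] bexI[of _ v])
qed

end

section \<open>The standard representation\<close>

text \<open>Permutations act on points counted from 1, vector entries are counted from 0.\<close>

definition nat_act :: "(nat \<Rightarrow> nat) \<Rightarrow> nat \<Rightarrow> nat" where
  "nat_act p i = p (Suc i) - 1"

lemma nat_act_Suc: "p \<in> perms n \<Longrightarrow> i < n \<Longrightarrow> Suc (nat_act p i) = p (Suc i)"
  using perms_in[of p n "Suc i"] by (auto simp: nat_act_def)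

lemma nat_perm_action: "perm_action (sym_group n) n nat_act"
proof -
  interpret S: group "sym_group n" by (rule sym_group_is_group)
  show ?thesis
  proof unfold_locales
    show "finite (carrier (sym_group n))" unfolding carrier_sym_group perms_def by (rule finite_permutations) simp
    fix h k i assume h: "h \<in> carrier (sym_group n)" and i: "i < n"
    then have h': "h \<in> perms n" by (simp add: carrier_sym_group)
    show less: "nat_act h i < n" using perms_in[OF h', of "Suc i"] i by (auto simp: nat_act_def)
  next
    fix h k i assume h: "h \<in> carrier (sym_group n)" and k: "k \<in> carrier (sym_group n)" and i: "i < n"
    then have "Suc (nat_act k i) = k (Suc i)" by (intro nat_act_Suc[of k n]) (simp_all add: carrier_sym_group)
    then show "nat_act (h \<otimes>\<^bsub>sym_group n\<^esub> k) i = nat_act h (nat_act k i)"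
      by (simp add: nat_act_def[of h] nat_act_def[of "h \<circ> k"] sym_group_mult)
  qed (simp_all add: nat_act_def sym_group_one)
qed

locale std_rep =
  fixes n :: nat
  assumes n2: "2 \<le> n"
begin

abbreviation "P \<equiv> perm_rep n nat_act"
abbreviation "tr \<equiv> (Transposition.transpose :: nat \<Rightarrow> nat \<Rightarrow> nat \<Rightarrow> nat)"

sublocale A: perm_action "sym_group n" n nat_act by (rule nat_perm_action)
sublocale P: urep "sym_group n" P by (rule A.perm_rep_urep)

lemma P_dim [simp]: "P.d = n" by (rule A.perm_rep_dim)

lemma P_row [simp]: "dim_row (P p) = n" by (simp add: perm_rep_def)

lemma cs_unit_vec:
  fixes v :: "complex vec"
  assumes "l < n"
  shows "v \<bullet>c unit_vec n l = v $ l"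
proof -
  have "v \<bullet>c unit_vec n l = (\<Sum>i<n. if i = l then v $ i else 0)"
    unfolding cscalar_prod_sum[OF unit_vec_carrier] using assms by (intro sum.cong) auto
  then show ?thesis using assms by simp
qed

lemma P_index:
  assumes "p \<in> perms n" "x \<in> carrier_vec n" "i < n"
  shows "(P p *\<^sub>v x) $ i = x $ (inv' p (Suc i) - 1)"
  using A.perm_rep_index[of p x i] assms by (simp add: carrier_sym_group nat_act_def)

section \<open>The sum-zero part of the permutation representation\<close>

definition sum_zero :: "complex vec set" where
  "sum_zero = {x \<in> carrier_vec n. (\<Sum>i<n. x $ i) = 0}"

lemma P_sum:
  assumes "p \<in> perms n" "x \<in> carrier_vec n"
  shows "(\<Sum>i<n. F ((P p *\<^sub>v x) $ i)) = (\<Sum>i<n. F (x $ i))"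
proof -
  have "(\<Sum>i<n. F ((P p *\<^sub>v x) $ i)) = (\<Sum>i<n. F (x $ (inv' p (Suc i) - 1)))"
    using assms by (intro sum.cong refl) (simp add: P_index del: index_mult_mat_vec)
  also have "\<dots> = (\<Sum>i<n. F (x $ i))"
  proof (rule sum.reindex_bij_witness[of _ "nat_act p" "nat_act (inv' p)"])
    fix i assume "i \<in> {..<n}"
    then have i: "i < n" by simp
    note p' = perms_inv'[OF assms(1)]
    show "nat_act p (nat_act (inv' p) i) = i"
      using nat_act_Suc[OF p' i] by (simp add: nat_act_def[of p] inv'_comp_apply[OF assms(1)])
    show "nat_act (inv' p) (nat_act p i) = i"
      using nat_act_Suc[OF assms(1) i] by (simp add: nat_act_def[of "inv' p"] inv'_comp_apply[OF assms(1)])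
    show "nat_act p i \<in> {..<n}" "nat_act (inv' p) i \<in> {..<n}"
      using A.a_less[OF _ i] assms(1) p' by (auto simp: carrier_sym_group)
  qed (simp add: nat_act_def)
  finally show ?thesis .
qed

lemma sum_zero_invariant: "P.invariant sum_zero"
  unfolding P.invariant_def vec_subspace_def P_dim
proof (intro conjI ballI allI)
  show "P h *\<^sub>v u \<in> sum_zero" if "h \<in> carrier (sym_group n)" "u \<in> sum_zero" for h u
    using that P_sum[of h u "\<lambda>z. z"] P.act_in[of h u] by (auto simp: sum_zero_def carrier_sym_group)
qed (auto simp: sum_zero_def sum.distrib sum_distrib_left[symmetric])

text \<open>An orthonormal basis of the sum-zero vectors, chosen once and for all; it identifies
  them with \<open>carrier_vec k\<close>, as needed for a representation by matrices.\<close>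

definition kQ :: "nat \<times> complex mat" where
  "kQ = (SOME kQ. isometry_mat n (fst kQ) (snd kQ) \<and> sum_zero = {snd kQ *\<^sub>v x | x. x \<in> carrier_vec (fst kQ)})"

definition "k = fst kQ"
definition "Q = snd kQ"

lemma Q_props: "isometry_mat n k Q" "sum_zero = {Q *\<^sub>v x | x. x \<in> carrier_vec k}"
proof -
  have "vec_subspace n sum_zero" using sum_zero_invariant by (simp add: P.invariant_def)
  then obtain k' Q' where "isometry_mat n k' Q'" "sum_zero = {Q' *\<^sub>v x | x. x \<in> carrier_vec k'}"
    by (rule vec_subspace_isometry)
  then have "\<exists>kQ. isometry_mat n (fst kQ) (snd kQ) \<and> sum_zero = {snd kQ *\<^sub>v x | x. x \<in> carrier_vec (fst kQ)}"
    by (intro exI[of _ "(k', Q')"]) simp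
  from someI_ex[OF this] show "isometry_mat n k Q" "sum_zero = {Q *\<^sub>v x | x. x \<in> carrier_vec k}"
    by (simp_all add: kQ_def k_def Q_def)
qed

lemma Q_inv: "P.invariant {Q *\<^sub>v x | x. x \<in> carrier_vec k}"
  using sum_zero_invariant Q_props(2) by simp

lemma Q_iso: "isometry_mat P.d k Q" using Q_props(1) by simp

lemma Q_carrier: "Q \<in> carrier_mat n k" using Q_props(1) by (simp add: isometry_mat_def)

lemma Q_in: "y \<in> carrier_vec k \<Longrightarrow> Q *\<^sub>v y \<in> sum_zero" using Q_props(2) by blast

lemma Q_in': "y \<in> carrier_vec k \<Longrightarrow> Q *\<^sub>v y \<in> carrier_vec n" using Q_in by (auto simp: sum_zero_def)

lemma QH_in: "x \<in> carrier_vec n \<Longrightarrow> mat_adjoint Q *\<^sub>v x \<in> carrier_vec k"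
  by (rule mult_mat_vec_carrier[OF mat_adjoint_carrier[OF Q_carrier]])

lemma QH_Q: "y \<in> carrier_vec k \<Longrightarrow> mat_adjoint Q *\<^sub>v (Q *\<^sub>v y) = y"
  by (rule isometry_mat_vec[OF Q_props(1)])

lemma Q_QH: "x \<in> sum_zero \<Longrightarrow> Q *\<^sub>v (mat_adjoint Q *\<^sub>v x) = x"
  using Q_props(2) QH_Q by auto

definition std :: "(nat \<Rightarrow> nat) \<Rightarrow> complex mat" where
  "std = P.subrep Q"

lemma std_urep: "urep (sym_group n) std"
  unfolding std_def by (rule P.subrep_urep[OF Q_iso Q_inv])

sublocale T: sym_urep n std unfolding sym_urep_def by (rule std_urep)

lemma std_dim [simp]: "T.d = k"
  unfolding std_def by (rule P.subrep_dim[OF Q_iso Q_inv])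

lemma std_Q: "p \<in> perms n \<Longrightarrow> y \<in> carrier_vec k \<Longrightarrow> Q *\<^sub>v (std p *\<^sub>v y) = P p *\<^sub>v (Q *\<^sub>v y)"
  unfolding std_def by (rule P.subrep_intertwines[OF Q_iso Q_inv]) (simp_all add: carrier_sym_group)

lemma std_in: "p \<in> perms n \<Longrightarrow> y \<in> carrier_vec k \<Longrightarrow> std p *\<^sub>v y \<in> carrier_vec k"
  using T.act_in by (simp add: carrier_sym_group)

lemma Q_nsq: "y \<in> carrier_vec k \<Longrightarrow> nsq (Q *\<^sub>v y) = nsq y"
  using isometry_cs[OF Q_props(1), of y y] by (simp add: nsq_def)

lemma tr_P_index:
  assumes "i \<in> {1..n}" "j \<in> {1..n}" "x \<in> carrier_vec n" "l < n"
  shows "(P (tr i j) *\<^sub>v x) $ l = x $ (tr i j (Suc l) - 1)"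
  using P_index[OF transpose_perms[OF assms(1,2)] assms(3,4)] by simp

lemma diff_P:
  assumes ij: "i \<in> {1..n}" "j \<in> {1..n}" "i \<noteq> j" and x: "x \<in> carrier_vec n"
  shows "x - P (tr i j) *\<^sub>v x = (x $ (i - 1) - x $ (j - 1)) \<cdot>\<^sub>v (unit_vec n (i - 1) - unit_vec n (j - 1))"
proof (rule eq_vecI)
  fix l assume "l < dim_vec ((x $ (i - 1) - x $ (j - 1)) \<cdot>\<^sub>v (unit_vec n (i - 1) - unit_vec n (j - 1) :: complex vec))"
  then have l: "l < n" by simp
  have px: "P (tr i j) *\<^sub>v x \<in> carrier_vec n" using P.act_in[of "tr i j" x] ij x
    by (simp add: carrier_sym_group transpose_perms)
  have "(x - P (tr i j) *\<^sub>v x) $ l = x $ l - (P (tr i j) *\<^sub>v x) $ l"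
    by (rule index_minus_vec(1)) (use l in simp)
  also have "\<dots> = x $ l - x $ (tr i j (Suc l) - 1)" by (simp only: tr_P_index[OF ij(1,2) x l])
  also have "\<dots> = ((x $ (i - 1) - x $ (j - 1)) \<cdot>\<^sub>v (unit_vec n (i - 1) - unit_vec n (j - 1))) $ l"
    using ij l by (auto simp: transpose_def)
  finally show "(x - P (tr i j) *\<^sub>v x) $ l =
      ((x $ (i - 1) - x $ (j - 1)) \<cdot>\<^sub>v (unit_vec n (i - 1) - unit_vec n (j - 1))) $ l" .
qed simp

text \<open>By \<open>diff_P\<close>, one minus a transposition maps \<open>x\<close> to a multiple
  of \<open>e_i - e_j\<close>, a vector of squared norm 2. Halving the squared norm leaves the
  square of the coordinate difference, so the Dirichlet form of \<open>std\<close> is that of the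
  walk.\<close>

lemma std_diss:
  assumes ij: "i \<in> {1..n}" "j \<in> {1..n}" "i \<noteq> j" and y: "y \<in> carrier_vec k"
  shows "T.diss (tr i j) y = (cmod ((Q *\<^sub>v y) $ (i - 1) - (Q *\<^sub>v y) $ (j - 1)))\<^sup>2"
proof -
  note t = transpose_perms[OF ij(1,2)]
  let ?x = "Q *\<^sub>v y"
  have x: "?x \<in> carrier_vec n" by (rule Q_in'[OF y])
  have sy: "std (tr i j) *\<^sub>v y \<in> carrier_vec k" by (rule std_in[OF t y])
  have e: "i - 1 < n" "j - 1 < n" "i - 1 \<noteq> j - 1" using ij by auto
  have u: "nsq (unit_vec n (i - 1) - unit_vec n (j - 1)) = 2"
    using e nsq_minus[of "unit_vec n (i - 1)" n "unit_vec n (j - 1)"]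
    by (simp add: nsq_unit_vec cs_unit_vec)
  have "2 * T.diss (tr i j) y = nsq (std (tr i j) *\<^sub>v y - y)"
    using T.diss_eq[of "tr i j" y] t y by (simp add: carrier_sym_group)
  also have "\<dots> = nsq (y - std (tr i j) *\<^sub>v y)"
    using nsq_minus[OF sy y] nsq_minus[OF y sy] cs_commute[OF sy y] by simp
  also have "\<dots> = nsq (Q *\<^sub>v (y - std (tr i j) *\<^sub>v y))"
    using Q_nsq[of "y - std (tr i j) *\<^sub>v y"] y sy by simp
  also have "Q *\<^sub>v (y - std (tr i j) *\<^sub>v y) = ?x - P (tr i j) *\<^sub>v ?x"
    using mult_minus_distrib_mat_vec[OF Q_carrier y sy] std_Q[OF t y] by simp
  also have "nsq \<dots> = (cmod (?x $ (i - 1) - ?x $ (j - 1)))\<^sup>2 * 2"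
    unfolding diff_P[OF ij x] nsq_smult u ..
  finally show ?thesis by simp
qed

text \<open>A real function of sum 0 is a vector of \<open>std\<close> whose Dirichlet form is the
  energy of the walk, so a Rayleigh bound for \<open>std\<close> is a Poincare inequality.\<close>

lemma walk_gap_std:
  assumes ray: "\<And>y. y \<in> carrier_vec k \<Longrightarrow> x * nsq y \<le> T.energy n a y"
  shows "walk_gap n a x"
  unfolding walk_gap_def
proof (intro allI impI)
  fix f :: "nat \<Rightarrow> real" assume f: "(\<Sum>i\<in>{1..n}. f i) = 0"
  define z where "z = vec n (\<lambda>i. complex_of_real (f (Suc i)))"
  have shift: "(\<Sum>i\<in>{1..n}. F i) = (\<Sum>i<n. F (Suc i))" for F :: "nat \<Rightarrow> real"
    by (rule sum.reindex_bij_witness[of _ Suc "\<lambda>i. i - 1"]) auto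
  have "(\<Sum>i<n. z $ i) = complex_of_real (\<Sum>i<n. f (Suc i))" by (simp add: z_def)
  then have z: "z \<in> sum_zero" using f unfolding shift by (simp add: sum_zero_def z_def)
  define y where "y = mat_adjoint Q *\<^sub>v z"
  have zn: "z \<in> carrier_vec n" using z by (simp add: sum_zero_def)
  have y: "y \<in> carrier_vec k" unfolding y_def by (rule QH_in[OF zn])
  have Qy: "Q *\<^sub>v y = z" unfolding y_def by (rule Q_QH[OF z])
  have "nsq y = nsq z" using Q_nsq[OF y] Qy by simp
  also have "\<dots> = (\<Sum>i\<in>{1..n}. (f i)\<^sup>2)" unfolding shift by (simp add: nsq_sum z_def)
  finally have nsq: "nsq y = (\<Sum>i\<in>{1..n}. (f i)\<^sup>2)" .
  have "T.energy n a y = pair_sum n (\<lambda>i j. a i j * (f i - f j)\<^sup>2)"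
    unfolding T.energy_def
  proof (rule pair_sum_cong)
    fix i j assume ij: "1 \<le> i" "i < j" "j \<le> n"
    then have "Suc (i - 1) = i" "Suc (j - 1) = j" "i - 1 < n" "j - 1 < n" by auto
    then have "z $ (i - 1) - z $ (j - 1) = complex_of_real (f i - f j)"
      unfolding z_def by (simp only: index_vec of_real_diff)
    then show "a i j * T.diss (tr i j) y = a i j * (f i - f j)\<^sup>2"
      using std_diss[of i j y] ij y Qy by (simp del: of_real_diff)
  qed
  then show "x * (\<Sum>i\<in>{1..n}. (f i)\<^sup>2) \<le> pair_sum n (\<lambda>i j. a i j * (f i - f j)\<^sup>2)"
    using ray[OF y] nsq by simp
qed

lemma std_fixed: "T.fixed_by (perms n) = {0\<^sub>v k}"
proof -
  have "y = 0\<^sub>v k" if fy: "y \<in> T.fixed_by (perms n)" for y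
  proof -
    have y: "y \<in> carrier_vec k" using fy by (simp add: T.fixed_by_def)
    have x: "Q *\<^sub>v y \<in> sum_zero" by (rule Q_in[OF y])
    then have xn: "Q *\<^sub>v y \<in> carrier_vec n" by (simp add: sum_zero_def)
    have const: "(Q *\<^sub>v y) $ i = (Q *\<^sub>v y) $ 0" if "i < n" for i
    proof -
      have t: "tr (Suc i) 1 \<in> perms n" using that by (intro transpose_perms) auto
      have "P (tr (Suc i) 1) *\<^sub>v (Q *\<^sub>v y) = Q *\<^sub>v y"
        using std_Q[OF t y] fy t by (simp add: T.fixed_by_def)
      then show ?thesis using tr_P_index[of "Suc i" 1 "Q *\<^sub>v y" i] that xn n2 by simp
    qed
    have "(\<Sum>i<n. (Q *\<^sub>v y) $ i) = (\<Sum>i<n. (Q *\<^sub>v y) $ 0)"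
      by (rule sum.cong[OF refl]) (metis const lessThan_iff)
    then have "(Q *\<^sub>v y) $ 0 = 0" using x n2 by (simp add: sum_zero_def del: index_mult_mat_vec)
    then have "(Q *\<^sub>v y) $ i = 0" if "i < n" for i using const[OF that] by simp
    then have "Q *\<^sub>v y = 0\<^sub>v n" using Q_carrier by (intro eq_vecI) (auto simp del: index_mult_mat_vec)
    then show ?thesis
      using QH_Q[OF y] mat_mult_zero_vec[OF mat_adjoint_carrier[OF Q_carrier]] by simp
  qed
  moreover have "0\<^sub>v k \<in> T.fixed_by (perms n)"
    using T.vec_subspace_fixed_by[of "perms n"] by (simp add: vec_subspace_def carrier_sym_group)
  ultimately show ?thesis by blast
qed

lemma k_pos: "0 < k"
proof (rule ccontr)
  assume "\<not> 0 < k"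
  then have k0: "k = 0" by simp
  let ?x = "unit_vec n 0 - unit_vec n 1 :: complex vec"
  have "(\<Sum>i<n. ?x $ i) = 0"
  proof -
    have "(\<Sum>i<n. unit_vec n l $ i) = (1 :: complex)" if "l < n" for l
      using that by (subst sum.remove[of _ l]) (auto intro!: sum.neutral)
    from this[of 0] this[of 1] show ?thesis using n2 by (simp add: sum_subtractf)
  qed
  then have "?x \<in> sum_zero" by (simp add: sum_zero_def)
  then have "Q *\<^sub>v (mat_adjoint Q *\<^sub>v ?x) = ?x" by (rule Q_QH)
  moreover have "Q *\<^sub>v (mat_adjoint Q *\<^sub>v ?x) = 0\<^sub>v n"
    using QH_in[of ?x] Q_carrier k0 by (intro eq_vecI) (auto simp: scalar_prod_def)
  ultimately have "?x $ 0 = (0\<^sub>v n :: complex vec) $ 0" by simp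
  then show False using n2 by simp
qed

text \<open>A non-zero invariant subspace contains some \<open>e_i - e_j\<close>, hence all its
  translates. A vector orthogonal to these has equal coordinates because the action is doubly
  transitive, so it is fixed and therefore 0.\<close>

lemma std_irreducible: "irreducible_rep (sym_group n) std"
  unfolding T.irreducible_iff std_dim
proof (intro conjI allI impI k_pos)
  fix U assume U: "T.invariant U"
  then have sub: "vec_subspace k U" and Uk: "U \<subseteq> carrier_vec k"
    by (auto simp: T.invariant_def vec_subspace_def)
  show "U = {0\<^sub>v k} \<or> U = carrier_vec k"
  proof (rule ccontr)
    assume "\<not> (U = {0\<^sub>v k} \<or> U = carrier_vec k)"
    moreover have "0\<^sub>v k \<in> U" using sub by (simp add: vec_subspace_def)
    ultimately obtain y where y: "y \<in> U" "y \<noteq> 0\<^sub>v k" and Une: "U \<noteq> carrier_vec k" by blast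
    have yk: "y \<in> carrier_vec k" using y Uk by blast
    have "\<exists>i\<in>{1..n}. \<exists>j\<in>{1..n}. i \<noteq> j \<and> (Q *\<^sub>v y) $ (i - 1) \<noteq> (Q *\<^sub>v y) $ (j - 1)"
    proof (rule ccontr)
      assume neg: "\<not> (\<exists>i\<in>{1..n}. \<exists>j\<in>{1..n}. i \<noteq> j \<and> (Q *\<^sub>v y) $ (i - 1) \<noteq> (Q *\<^sub>v y) $ (j - 1))"
      have const: "(Q *\<^sub>v y) $ i = (Q *\<^sub>v y) $ 0" if "i < n" for i
      proof (cases "i = 0")
        case False
        have "Suc i \<in> {1..n}" "1 \<in> {1..n}" "Suc i \<noteq> 1" using that n2 False by auto
        then have "(Q *\<^sub>v y) $ (Suc i - 1) = (Q *\<^sub>v y) $ (1 - 1)" using neg by blast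
        then show ?thesis by simp
      qed simp
      have "std p *\<^sub>v y = y" if p: "p \<in> perms n" for p
      proof -
        have "P p *\<^sub>v (Q *\<^sub>v y) = Q *\<^sub>v y"
        proof (rule eq_vecI)
          fix i assume "i < dim_vec (Q *\<^sub>v y)"
          then have i: "i < n" using Q_carrier by simp
          have "inv' p (Suc i) - 1 < n" using perms_in[OF perms_inv'[OF p], of "Suc i"] i by auto
          then show "(P p *\<^sub>v (Q *\<^sub>v y)) $ i = (Q *\<^sub>v y) $ i"
            using P_index[OF p Q_in'[OF yk] i] const[OF i] const[of "inv' p (Suc i) - 1"] by simp
        qed (use Q_carrier in \<open>simp add: perm_rep_def\<close>)
        then show ?thesis using std_Q[OF p yk] QH_Q std_in[OF p yk] yk by metis
      qed
      then have "y \<in> T.fixed_by (perms n)" using yk by (simp add: T.fixed_by_def)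
      then show False using y std_fixed by simp
    qed
    then obtain i j where ij: "i \<in> {1..n}" "j \<in> {1..n}" "i \<noteq> j"
      and ne: "(Q *\<^sub>v y) $ (i - 1) - (Q *\<^sub>v y) $ (j - 1) \<noteq> 0" by auto
    let ?c = "(Q *\<^sub>v y) $ (i - 1) - (Q *\<^sub>v y) $ (j - 1)"
    let ?e = "\<lambda>i j. unit_vec n (i - 1) - unit_vec n (j - 1) :: complex vec"
    note t = transpose_perms[OF ij(1,2)]
    \<comment> \<open>One minus the transposition, applied to \<open>y\<close> and divided by the
      coordinate difference, yields an element of \<open>U\<close> corresponding to
      \<open>e_i - e_j\<close>.\<close>
    define z where "z = inverse ?c \<cdot>\<^sub>v (y - std (tr i j) *\<^sub>v y)"
    have "std (tr i j) *\<^sub>v y \<in> U" using U y t by (simp add: T.invariant_def carrier_sym_group)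
    then have zU: "z \<in> U" using vec_subspace_minus[OF sub y(1)] sub by (simp add: z_def vec_subspace_def)
    have Qz: "Q *\<^sub>v z = ?e i j"
    proof -
      have sy: "std (tr i j) *\<^sub>v y \<in> carrier_vec k" by (rule std_in[OF t yk])
      have "Q *\<^sub>v z = inverse ?c \<cdot>\<^sub>v (Q *\<^sub>v y - P (tr i j) *\<^sub>v (Q *\<^sub>v y))"
        unfolding z_def using mult_mat_vec[OF Q_carrier, of "y - std (tr i j) *\<^sub>v y"] yk sy
          mult_minus_distrib_mat_vec[OF Q_carrier yk sy] std_Q[OF t yk] by simp
      then show ?thesis unfolding diff_P[OF ij Q_in'[OF yk]] using ne by (simp add: smult_smult_assoc)
    qed
    obtain k' Q' where Q': "isometry_mat k k' Q'" and UQ: "U = {Q' *\<^sub>v x | x. x \<in> carrier_vec k'}"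
      by (rule vec_subspace_isometry[OF sub])
    have "\<exists>v\<in>carrier_vec k. v \<notin> U" using Une Uk by blast
    then obtain v where v: "v \<in> carrier_vec k" "v \<notin> U" by blast
    \<comment> \<open>The component orthogonal to \<open>U\<close> of a vector outside
      \<open>U\<close>.\<close>
    define r where "r = v - Q' *\<^sub>v (mat_adjoint Q' *\<^sub>v v)"
    have Q'c: "Q' \<in> carrier_mat k k'" using Q' by (simp add: isometry_mat_def)
    have pk: "mat_adjoint Q' *\<^sub>v v \<in> carrier_vec k'"
      by (rule mult_mat_vec_carrier[OF mat_adjoint_carrier[OF Q'c] v(1)])
    have pU: "Q' *\<^sub>v (mat_adjoint Q' *\<^sub>v v) \<in> U" using UQ pk by blast
    have rk: "r \<in> carrier_vec k" using v pU Uk by (auto simp: r_def)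
    have orth: "r \<bullet>c u = 0" if "u \<in> U" for u
      using that isometry_mat_resid[OF Q' v(1)] unfolding UQ r_def by auto
    have Qr: "Q *\<^sub>v r \<in> carrier_vec n" by (rule Q_in'[OF rk])
    \<comment> \<open>Translating \<open>z\<close> by \<open>p\<close> stays in \<open>U\<close>,
      and orthogonality of \<open>r\<close> to that translate equates two of its
      coordinates.\<close>
    have const: "(Q *\<^sub>v r) $ (p i - 1) = (Q *\<^sub>v r) $ (p j - 1)" if p: "p \<in> perms n" for p
    proof -
      have "std p *\<^sub>v z \<in> U" using U zU p by (simp add: T.invariant_def carrier_sym_group)
      then have "r \<bullet>c (std p *\<^sub>v z) = 0" by (rule orth)
      then have "(Q *\<^sub>v r) \<bullet>c (P p *\<^sub>v ?e i j) = 0"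
      proof -
        have zk: "z \<in> carrier_vec k" using zU Uk by blast
        then show "r \<bullet>c (std p *\<^sub>v z) = 0 \<Longrightarrow> (Q *\<^sub>v r) \<bullet>c (P p *\<^sub>v ?e i j) = 0"
          using isometry_cs[OF Q_props(1) rk std_in[OF p zk]] std_Q[OF p zk] Qz by simp
      qed
      moreover have "P p *\<^sub>v ?e i j = ?e (p i) (p j)"
      proof (rule eq_vecI)
        fix l assume "l < dim_vec (?e (p i) (p j))"
        then have l: "l < n" by simp
        have pi: "p i \<in> {1..n}" "p j \<in> {1..n}" using perms_in[OF p] ij by auto
        have il: "inv' p (Suc l) \<in> {1..n}" using perms_in[OF perms_inv'[OF p], of "Suc l"] l by auto
        have eq: "inv' p (Suc l) - 1 = q - 1 \<longleftrightarrow> l = p q - 1" if q: "q \<in> {1..n}" for q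
        proof -
          have pq: "p q \<in> {1..n}" by (rule perms_in[OF p q])
          have "inv' p (Suc l) - 1 = q - 1 \<longleftrightarrow> inv' p (Suc l) = q" using il q by auto
          also have "\<dots> \<longleftrightarrow> Suc l = p q" using inv'_comp_apply[OF p] by metis
          also have "\<dots> \<longleftrightarrow> l = p q - 1" using pq by auto
          finally show ?thesis .
        qed
        have "(P p *\<^sub>v ?e i j) $ l = ?e i j $ (inv' p (Suc l) - 1)" by (rule P_index[OF p _ l]) simp
        also have "\<dots> = ?e (p i) (p j) $ l"
        proof -
          have "inv' p (Suc l) - 1 < n" using il by auto
          then show ?thesis using l eq[OF ij(1)] eq[OF ij(2)] pi ij by (simp add: unit_vec_def)
        qed
        finally show "(P p *\<^sub>v ?e i j) $ l = ?e (p i) (p j) $ l" .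
      qed (simp add: perm_rep_def)
      ultimately have "(Q *\<^sub>v r) \<bullet>c ?e (p i) (p j) = 0" by simp
      moreover have "(Q *\<^sub>v r) \<bullet>c ?e (p i) (p j) = (Q *\<^sub>v r) $ (p i - 1) - (Q *\<^sub>v r) $ (p j - 1)"
      proof -
        have pi: "p i - 1 < n" "p j - 1 < n" using perms_in[OF p] ij by fastforce+
        show ?thesis using cs_minus_right[OF _ _ Qr, of "unit_vec n (p i - 1)" "unit_vec n (p j - 1)"] pi
          by (simp add: cs_unit_vec del: index_mult_mat_vec)
      qed
      ultimately show ?thesis by simp
    qed
    have "std p *\<^sub>v r = r" if p: "p \<in> perms n" for p
    proof -
      have all: "(Q *\<^sub>v r) $ (s - 1) = (Q *\<^sub>v r) $ (t - 1)" if st: "s \<in> {1..n}" "t \<in> {1..n}" for s t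
      proof (cases "s = t")
        case False
        \<comment> \<open>Double transitivity: \<open>?q1\<close> takes \<open>i\<close> to
          \<open>s\<close>, and \<open>?q2\<close> then takes the image of \<open>j\<close> to
          \<open>t\<close> without moving \<open>s\<close>.\<close>
        let ?q1 = "tr s i" let ?q2 = "tr t (?q1 j)"
        have q1: "?q1 \<in> perms n" using st ij by (intro transpose_perms) auto
        have q1j: "?q1 j \<in> {1..n}" "?q1 j \<noteq> s"
          using perms_in[OF q1 ij(2)] ij by (auto simp: transpose_def)
        have q2: "?q2 \<in> perms n" using st q1j by (intro transpose_perms) auto
        have "(?q2 \<circ> ?q1) i = s" using False q1j by (simp add: transpose_def)
        moreover have "(?q2 \<circ> ?q1) j = t" by (simp add: transpose_def)
        ultimately show ?thesis using const[OF perms_comp[OF q2 q1]] by simp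
      qed simp
      have "P p *\<^sub>v (Q *\<^sub>v r) = Q *\<^sub>v r"
      proof (rule eq_vecI)
        fix l assume "l < dim_vec (Q *\<^sub>v r)"
        then have l: "l < n" using Q_carrier by simp
        have "inv' p (Suc l) \<in> {1..n}" using perms_in[OF perms_inv'[OF p], of "Suc l"] l by auto
        then show "(P p *\<^sub>v (Q *\<^sub>v r)) $ l = (Q *\<^sub>v r) $ l"
          using P_index[OF p Qr l] all[of "inv' p (Suc l)" "Suc l"] l by simp
      qed (use Q_carrier in \<open>simp add: perm_rep_def\<close>)
      then show ?thesis using std_Q[OF p rk] QH_Q std_in[OF p rk] rk by metis
    qed
    then have "r \<in> T.fixed_by (perms n)" using rk by (simp add: T.fixed_by_def)
    then have "r = 0\<^sub>v k" using std_fixed by simp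
    then have "v = Q' *\<^sub>v (mat_adjoint Q' *\<^sub>v v)"
    proof -
      have "v $ l = (Q' *\<^sub>v (mat_adjoint Q' *\<^sub>v v)) $ l" if "l < k" for l
      proof -
        have "r $ l = v $ l - (Q' *\<^sub>v (mat_adjoint Q' *\<^sub>v v)) $ l"
          unfolding r_def by (rule index_minus_vec(1)) (use that Q'c in simp)
        then show ?thesis using \<open>r = 0\<^sub>v k\<close> that by simp
      qed
      then show ?thesis using v Q'c by (intro eq_vecI) (auto simp del: index_mult_mat_vec)
    qed
    then show False using pU v by simp
  qed
qed

end

section \<open>The Specht module of shape $(n-1,1)$\<close>

text \<open>The isomorphism in \<open>affords_specht\<close> is an abstract linear map, whereas
  \<open>rep_iso\<close> asks for a matrix.\<close>

lemma linear_matrix: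
  fixes L :: "complex vec \<Rightarrow> complex vec"
  assumes L: "\<And>v. v \<in> carrier_vec m \<Longrightarrow> L v \<in> carrier_vec k"
    and add: "\<And>u v. u \<in> carrier_vec m \<Longrightarrow> v \<in> carrier_vec m \<Longrightarrow> L (u + v) = L u + L v"
    and smult: "\<And>c v. v \<in> carrier_vec m \<Longrightarrow> L (c \<cdot>\<^sub>v v) = c \<cdot>\<^sub>v L v"
  obtains M where "M \<in> carrier_mat k m" "\<And>v. v \<in> carrier_vec m \<Longrightarrow> L v = M *\<^sub>v v"
proof -
  define M where "M = mat k m (\<lambda>(i, j). L (unit_vec m j) $ i)"
  have M: "M \<in> carrier_mat k m" by (simp add: M_def)
  have partial: "L (vec m (\<lambda>j. if j < l then v $ j else 0)) $ i = (\<Sum>j<l. M $$ (i, j) * v $ j)"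
    if "l \<le> m" "i < k" for l i and v :: "complex vec"
    using that
  proof (induction l)
    case 0
    have "vec m (\<lambda>j. if j < 0 then v $ j else 0) = 0 \<cdot>\<^sub>v 0\<^sub>v m" by (intro eq_vecI) auto
    then show ?case using smult[of "0\<^sub>v m" 0] L[of "0\<^sub>v m"] 0 by simp
  next
    case (Suc l)
    let ?p = "\<lambda>l. vec m (\<lambda>j. if j < l then v $ j else 0)"
    have "?p (Suc l) = ?p l + v $ l \<cdot>\<^sub>v unit_vec m l"
      using Suc.prems by (intro eq_vecI) (auto simp: less_Suc_eq)
    then have "L (?p (Suc l)) = L (?p l) + v $ l \<cdot>\<^sub>v L (unit_vec m l)"
      using add[of "?p l" "v $ l \<cdot>\<^sub>v unit_vec m l"] smult[of "unit_vec m l" "v $ l"] by simp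
    then show ?case
      using Suc L[of "?p l"] L[of "unit_vec m l"] by (simp add: M_def mult.commute)
  qed
  have "L v = M *\<^sub>v v" if v: "v \<in> carrier_vec m" for v
  proof (rule eq_vecI)
    fix i assume "i < dim_vec (M *\<^sub>v v)"
    then have i: "i < k" using M by simp
    have "vec m (\<lambda>j. if j < m then v $ j else 0) = v" using v by (intro eq_vecI) auto
    then show "L v $ i = (M *\<^sub>v v) $ i"
      using partial[of m i v] i by (simp only: mat_vec_index[OF M v i])
  qed (use L[OF v] M in simp)
  with M show ?thesis using that by blast
qed

context std_rep begin

definition "\<mu> = [n - 1, 1 :: nat]"

text \<open>A tabloid of this shape is determined by the single entry \<open>l\<close> of its second
  row, which has row index 1.\<close>

definition tab :: "nat \<Rightarrow> nat \<Rightarrow> nat" where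
  "tab l = (\<lambda>i\<in>{1..n}. of_bool (i = l))"

lemma tab_inj: "j \<in> {1..n} \<Longrightarrow> l \<in> {1..n} \<Longrightarrow> tab j = tab l \<longleftrightarrow> j = l"
  by (auto simp: tab_def fun_eq_iff split: if_splits)

lemma tab_comp:
  assumes "p \<in> perms n" "l \<in> {1..n}"
  shows "tab l \<circ> p = tab (inv' p l)"
proof
  fix i
  have "p i \<in> {1..n} \<longleftrightarrow> i \<in> {1..n}" using assms(1) permutes_in_image[of p "{1..n}" i] by (simp add: perms_def)
  moreover have "p i = l \<longleftrightarrow> i = inv' p l" using inv'_comp_apply[OF assms(1)] by metis
  ultimately show "(tab l \<circ> p) i = tab (inv' p l) i" by (auto simp: tab_def)
qed

lemma cells_mu: "cells \<mu> = insert (1, 0) ((\<lambda>c. (0, c)) ` {..<n - 1})"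
proof -
  have "(r, c) \<in> cells \<mu> \<longleftrightarrow> (r, c) \<in> insert (1, 0) ((\<lambda>c. (0, c)) ` {..<n - 1})" for r c
    by (cases r) (auto simp: cells_def \<mu>_def)
  then show ?thesis by auto
qed

lemma cells_base: "(0, 0) \<in> cells \<mu>" "(1, 0) \<in> cells \<mu>"
  using n2 by (auto simp: cells_mu)

context
  fixes t assumes t: "t \<in> tableaux n \<mu>"
begin

lemma t_bij: "bij_betw t (cells \<mu>) {1..n}"
  using t by (simp add: tableaux_def)

lemma t_inv: "x \<in> cells \<mu> \<Longrightarrow> inv_into (cells \<mu>) t (t x) = x"
  by (rule bij_betw_inv_into_left[OF t_bij])

lemma t_inv': "i \<in> {1..n} \<Longrightarrow> inv_into (cells \<mu>) t i \<in> cells \<mu>" "i \<in> {1..n} \<Longrightarrow> t (inv_into (cells \<mu>) t i) = i"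
  using bij_betw_imp_surj_on[OF t_bij] bij_betw_inv_into_right[OF t_bij]
  by (auto simp: inv_into_into)

lemma t_in: "x \<in> cells \<mu> \<Longrightarrow> t x \<in> {1..n}"
  using bij_betwE[OF t_bij] by blast

lemma t_ne: "t (0, 0) \<noteq> t (1, 0)"
  using t_inv[OF cells_base(1)] t_inv[OF cells_base(2)] by auto

lemma tabloid_eq: "tabloid n \<mu> t = tab (t (1, 0))"
proof
  fix i
  have "fst (inv_into (cells \<mu>) t i) = of_bool (i = t (1, 0))" if i: "i \<in> {1..n}"
  proof (cases "i = t (1, 0)")
    case True
    then show ?thesis using t_inv[OF cells_base(2)] by simp
  next
    case False
    then have "inv_into (cells \<mu>) t i \<noteq> (1, 0)" using t_inv'(2)[OF i] by metis
    then have "fst (inv_into (cells \<mu>) t i) = 0" using t_inv'(1)[OF i] by (auto simp: cells_mu)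
    then show ?thesis using False by simp
  qed
  then show "tabloid n \<mu> t i = tab (t (1, 0)) i" by (simp add: tabloid_def tab_def)
qed

text \<open>The second row has length 1, so the first column is the only one with two cells.\<close>

lemma column_stabilizer_eq:
  "column_stabilizer n \<mu> t = {id, tr (t (0, 0)) (t (1, 0))}"
proof -
  let ?a = "t (0, 0)" and ?b = "t (1, 0)" and ?c = "\<lambda>i. snd (inv_into (cells \<mu>) t i)"
  have ab: "?a \<in> {1..n}" "?b \<in> {1..n}" using t_in cells_base by blast+
  have c0: "?c ?a = 0" "?c ?b = 0" using t_inv[OF cells_base(1)] t_inv[OF cells_base(2)] by simp_all
  have uniq: "i = j" if "i \<in> {1..n}" "j \<in> {1..n}" "?c i = ?c j" "i \<notin> {?a, ?b}" for i j
  proof -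
    have "inv_into (cells \<mu>) t i \<noteq> (0, 0)" "inv_into (cells \<mu>) t i \<noteq> (1, 0)"
      using t_inv'(2)[OF that(1)] that(4) by (metis insertI1, metis insertI1 insertI2)
    then have "inv_into (cells \<mu>) t i = (0, ?c i)" "?c i \<noteq> 0"
      using t_inv'(1)[OF that(1)] unfolding cells_mu by auto
    moreover have "inv_into (cells \<mu>) t j = (0, ?c j)"
      using t_inv'[OF that(2)] calculation that(3) by (auto simp: cells_mu)
    ultimately have "inv_into (cells \<mu>) t i = inv_into (cells \<mu>) t j" using that(3) by simp
    then show ?thesis using t_inv'(2) that by metis
  qed
  show ?thesis
  proof (intro Set.set_eqI iffI)
    fix p assume p: "p \<in> column_stabilizer n \<mu> t"
    then have pn: "p permutes {1..n}" and col: "\<And>i. i \<in> {1..n} \<Longrightarrow> ?c (p i) = ?c i"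
      by (auto simp: column_stabilizer_def sym_group_carrier)
    have "p permutes {?a, ?b}"
    proof (rule permutes_superset[OF pn])
      fix i assume i: "i \<in> {1..n} - {?a, ?b}"
      then have "p i \<in> {1..n}" using permutes_in_image[OF pn, of i] by blast
      then show "p i = i" using uniq[of i "p i"] col[of i] i by auto
    qed
    then show "p \<in> {id, tr ?a ?b}" by (simp add: permutes_doubleton_iff)
  next
    fix p assume p: "p \<in> {id, tr ?a ?b}"
    then have "p permutes {1..n}" using ab by (auto intro: permutes_swap_id permutes_id)
    moreover have "?c (p i) = ?c i" for i
    proof (cases "p = id")
      case False
      then have "p = tr ?a ?b" using p by blast
      then show ?thesis using c0 by (cases "i = ?a"; cases "i = ?b") (auto simp: transpose_def)
    qed simp
    ultimately show "p \<in> column_stabilizer n \<mu> t"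
      by (simp add: column_stabilizer_def sym_group_carrier)
  qed
qed

end

lemma restrict_tableau:
  assumes t: "t \<in> tableaux n \<mu>" and p: "p \<in> perms n"
  shows "restrict (p \<circ> t) (cells \<mu>) \<in> tableaux n \<mu>"
proof -
  have "bij_betw (p \<circ> t) (cells \<mu>) {1..n}"
    using t_bij[OF t] permutes_imp_bij[of p "{1..n}"] p by (auto simp: perms_def intro: bij_betw_trans)
  then show ?thesis by (simp add: tableaux_def bij_betw_restrict_eq)
qed

lemma polytabloid_eq:
  assumes t: "t \<in> tableaux n \<mu>"
  shows "polytabloid n \<mu> t T = of_bool (T = tab (t (1, 0))) - of_bool (T = tab (t (0, 0)))"
proof -
  let ?a = "t (0, 0)" and ?b = "t (1, 0)"
  have "?a \<in> {1..n}" "?b \<in> {1..n}" using t_in[OF t] cells_base by blast+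
  then have tp: "tr ?a ?b \<in> perms n" by (rule transpose_perms)
  have "id \<noteq> tr ?a ?b" using t_ne[OF t] by (metis id_apply transpose_apply_first)
  moreover have "sum f {x, y} = f x + f y" if "x \<noteq> y" for f :: "(nat \<Rightarrow> nat) \<Rightarrow> complex" and x y
    using that by simp
  ultimately have "polytabloid n \<mu> t T =
      of_int (sign (id :: nat \<Rightarrow> nat)) * of_bool (T = tabloid n \<mu> (restrict (id \<circ> t) (cells \<mu>))) +
      of_int (sign (tr ?a ?b)) * of_bool (T = tabloid n \<mu> (restrict (tr ?a ?b \<circ> t) (cells \<mu>)))"
    unfolding polytabloid_def column_stabilizer_eq[OF t] by blast
  moreover have "tabloid n \<mu> (restrict (id \<circ> t) (cells \<mu>)) = tab ?b"
    using tabloid_eq[OF restrict_tableau[OF t perms_id]] cells_base by simp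
  moreover have "tabloid n \<mu> (restrict (tr ?a ?b \<circ> t) (cells \<mu>)) = tab ?a"
    using tabloid_eq[OF restrict_tableau[OF t tp]] cells_base by simp
  ultimately show ?thesis using t_ne[OF t] by (simp add: sign_swap_id sign_id)
qed

lemma finite_tableaux: "finite (tableaux n \<mu>)"
proof (rule finite_subset)
  show "tableaux n \<mu> \<subseteq> (\<Pi>\<^sub>E x\<in>cells \<mu>. {1..n})"
    by (auto simp: tableaux_def PiE_def bij_betw_def)
  show "finite (\<Pi>\<^sub>E x\<in>cells \<mu>. {1..n})"
    by (intro finite_PiE) (auto simp: cells_mu)
qed

definition tab_comb :: "(nat \<Rightarrow> complex) \<Rightarrow> (nat \<Rightarrow> nat) \<Rightarrow> complex" where
  "tab_comb F T = (\<Sum>k\<in>{1..n}. F k * of_bool (T = tab k))"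

lemma tab_comb_tab: "l \<in> {1..n} \<Longrightarrow> tab_comb F (tab l) = F l"
proof -
  assume l: "l \<in> {1..n}"
  have "tab_comb F (tab l) = (\<Sum>k\<in>{1..n}. if k = l then F k else 0)"
    unfolding tab_comb_def using l by (intro sum.cong refl) (simp add: tab_inj)
  then show ?thesis using l by simp
qed

text \<open>Each polytabloid is the difference of two distinct tabloids, and such differences span
  the combinations of coefficient sum 0.\<close>

lemma specht_iff:
  "f \<in> specht_module n \<mu> \<longleftrightarrow> (\<exists>F. (\<Sum>k\<in>{1..n}. F k) = 0 \<and> f = tab_comb F)"
proof
  assume "f \<in> specht_module n \<mu>"
  then obtain \<alpha> where f: "f = (\<lambda>T. \<Sum>t\<in>tableaux n \<mu>. \<alpha> t * polytabloid n \<mu> t T)"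
    by (auto simp: specht_module_def)
  define F where "F l = (\<Sum>t\<in>tableaux n \<mu>. \<alpha> t * (of_bool (l = t (1, 0)) - of_bool (l = t (0, 0))))" for l
  have one: "(\<Sum>k\<in>{1..n}. of_bool (k = l) * X k) = X l" if "l \<in> {1..n}" for l :: nat and X :: "nat \<Rightarrow> complex"
  proof -
    have "(\<Sum>k\<in>{1..n}. of_bool (k = l) * X k) = (\<Sum>k\<in>{1..n}. if k = l then X k else 0)"
      by (intro sum.cong) auto
    then show ?thesis using that by simp
  qed
  have ab: "t (0, 0) \<in> {1..n}" "t (1, 0) \<in> {1..n}" if "t \<in> tableaux n \<mu>" for t
    using t_in[OF that] cells_base by blast+
  have comb: "(\<Sum>k\<in>{1..n}. F k * X k) = (\<Sum>t\<in>tableaux n \<mu>. \<alpha> t * (X (t (1, 0)) - X (t (0, 0))))" for X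
  proof -
    have "(\<Sum>k\<in>{1..n}. F k * X k) =
        (\<Sum>t\<in>tableaux n \<mu>. \<Sum>k\<in>{1..n}. \<alpha> t * (of_bool (k = t (1, 0)) * X k - of_bool (k = t (0, 0)) * X k))"
      unfolding F_def sum_distrib_right by (subst sum.swap) (simp add: left_diff_distrib mult.assoc)
    also have "\<dots> = (\<Sum>t\<in>tableaux n \<mu>. \<alpha> t * (X (t (1, 0)) - X (t (0, 0))))"
      unfolding sum_distrib_left[symmetric] sum_subtractf by (intro sum.cong refl) (simp only: one ab)
    finally show ?thesis .
  qed
  have "(\<Sum>k\<in>{1..n}. F k) = 0" using comb[of "\<lambda>_. 1"] by simp
  moreover have "f = tab_comb F"
  proof
    fix T show "f T = tab_comb F T"
      unfolding f tab_comb_def comb by (intro sum.cong refl) (simp only: polytabloid_eq)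
  qed
  ultimately show "\<exists>F. (\<Sum>k\<in>{1..n}. F k) = 0 \<and> f = tab_comb F" by blast
next
  assume "\<exists>F. (\<Sum>k\<in>{1..n}. F k) = 0 \<and> f = tab_comb F"
  then obtain F where F: "(\<Sum>k\<in>{1..n}. F k) = 0" and f: "f = tab_comb F" by blast
  \<comment> \<open>\<open>t0\<close> has rows \<open>1, ..., n - 1\<close> and \<open>n\<close>.
    Exchanging \<open>n\<close> and \<open>l\<close> in it gives \<open>tk l\<close>, whose
    polytabloid is \<open>tab l\<close> minus \<open>tab 1\<close>; the coefficient at
    \<open>tab 1\<close> comes out right because \<open>F\<close> sums to 0.\<close>
  define t0 where "t0 = restrict (\<lambda>(r, c). if r = 0 then Suc c else n) (cells \<mu>)"
  have t0: "t0 \<in> tableaux n \<mu>"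
  proof -
    have "bij_betw (\<lambda>(r, c). if r = 0 then Suc c else n) (cells \<mu>) {1..n}"
    proof (rule bij_betw_byWitness[of _ "\<lambda>i. if i = n then (1, 0) else (0, i - 1)"])
      show "\<forall>x\<in>cells \<mu>. (if (case x of (r, c) \<Rightarrow> if r = 0 then Suc c else n) = n then (1, 0)
          else (0, (case x of (r, c) \<Rightarrow> if r = 0 then Suc c else n) - 1)) = x"
        using n2 by (auto simp: cells_mu)
      show "(\<lambda>(r, c). if r = 0 then Suc c else n) ` cells \<mu> \<subseteq> {1..n}"
        using n2 by (auto simp: cells_mu)
      show "(\<lambda>i. if i = n then (1, 0) else (0, i - 1)) ` {1..n} \<subseteq> cells \<mu>"
        by (auto simp: cells_mu)
    qed auto
    then show ?thesis by (simp add: t0_def tableaux_def bij_betw_restrict_eq)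
  qed
  have t0_vals: "t0 (0, 0) = 1" "t0 (1, 0) = n" using cells_base by (auto simp: t0_def)
  define tk where "tk l = restrict (tr n l \<circ> t0) (cells \<mu>)" for l
  have tk: "tk l \<in> tableaux n \<mu>" "tk l (0, 0) = 1" "tk l (1, 0) = l" if "l \<in> {2..n}" for l
  proof -
    have "tr n l \<in> perms n" using that by (intro transpose_perms) auto
    then show "tk l \<in> tableaux n \<mu>" unfolding tk_def by (rule restrict_tableau[OF t0])
    show "tk l (0, 0) = 1" "tk l (1, 0) = l"
      using cells_base t0_vals that n2 by (auto simp: tk_def transpose_def)
  qed
  define \<alpha> where "\<alpha> t = (\<Sum>k\<in>{2..n}. F k * of_bool (t = tk k))" for t
  have "f = (\<lambda>T. \<Sum>t\<in>tableaux n \<mu>. \<alpha> t * polytabloid n \<mu> t T)"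
  proof
    fix T
    have "(\<Sum>t\<in>tableaux n \<mu>. \<alpha> t * polytabloid n \<mu> t T) =
        (\<Sum>k\<in>{2..n}. \<Sum>t\<in>tableaux n \<mu>. if t = tk k then F k * polytabloid n \<mu> t T else 0)"
      unfolding \<alpha>_def sum_distrib_right by (subst sum.swap) (intro sum.cong refl, simp)
    also have "\<dots> = (\<Sum>k\<in>{2..n}. F k * (of_bool (T = tab k) - of_bool (T = tab 1)))"
      using finite_tableaux tk by (intro sum.cong refl) (simp add: sum.delta polytabloid_eq)
    also have "\<dots> = (\<Sum>k\<in>{2..n}. F k * of_bool (T = tab k)) - (\<Sum>k\<in>{2..n}. F k) * of_bool (T = tab 1)"
      by (simp add: right_diff_distrib sum_subtractf sum_distrib_right)
    also have "\<dots> = tab_comb F T"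
    proof -
      have split: "(\<Sum>k\<in>{1..n}. X k) = X 1 + (\<Sum>k\<in>{2..n}. X k)" for X :: "nat \<Rightarrow> complex"
      proof -
        have "{1..n} = insert 1 {2..n}" using n2 by auto
        then show ?thesis by simp
      qed
      have "(\<Sum>k\<in>{2..n}. F k) = - F 1" using F unfolding split by (simp add: eq_neg_iff_add_eq_0 add.commute)
      then show ?thesis unfolding tab_comb_def split by simp
    qed
    finally show "f T = (\<Sum>t\<in>tableaux n \<mu>. \<alpha> t * polytabloid n \<mu> t T)" by (simp add: f)
  qed
  then show "f \<in> specht_module n \<mu>" by (auto simp: specht_module_def)
qed

lemma shift_sum: "(\<Sum>k\<in>{1..n}. F k) = (\<Sum>i<n. F (Suc i))" for F :: "nat \<Rightarrow> complex"
  by (rule sum.reindex_bij_witness[of _ Suc "\<lambda>i. i - 1"]) auto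

definition \<Phi> :: "complex vec \<Rightarrow> (nat \<Rightarrow> nat) \<Rightarrow> complex" where
  "\<Phi> y = tab_comb (\<lambda>k. (Q *\<^sub>v y) $ (k - 1))"

lemma \<Phi>_tab: "i < n \<Longrightarrow> \<Phi> y (tab (Suc i)) = (Q *\<^sub>v y) $ i"
  unfolding \<Phi>_def by (subst tab_comb_tab) auto

lemma \<Phi>_act:
  assumes p: "p \<in> perms n" and y: "y \<in> carrier_vec k"
  shows "\<Phi> (std p *\<^sub>v y) T = \<Phi> y (T \<circ> p)"
proof -
  have "\<Phi> (std p *\<^sub>v y) T = (\<Sum>l\<in>{1..n}. (Q *\<^sub>v y) $ (inv' p l - 1) * of_bool (T = tab l))"
    unfolding \<Phi>_def tab_comb_def
  proof (intro sum.cong refl)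
    fix l assume l: "l \<in> {1..n}"
    have "(Q *\<^sub>v (std p *\<^sub>v y)) $ (l - 1) = (Q *\<^sub>v y) $ (inv' p (Suc (l - 1)) - 1)"
      unfolding std_Q[OF p y] by (rule P_index[OF p Q_in'[OF y]]) (use l in auto)
    then show "(Q *\<^sub>v (std p *\<^sub>v y)) $ (l - 1) * of_bool (T = tab l) =
        (Q *\<^sub>v y) $ (inv' p l - 1) * of_bool (T = tab l)" using l by simp
  qed
  also have "\<dots> = (\<Sum>l\<in>{1..n}. (Q *\<^sub>v y) $ (l - 1) * of_bool (T = tab (p l)))"
    by (rule sum.reindex_bij_witness[of _ p "inv' p"])
      (use perms_in[OF p] perms_in[OF perms_inv'[OF p]] inv'_comp_apply[OF p] in auto)
  also have "\<dots> = \<Phi> y (T \<circ> p)"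
    unfolding \<Phi>_def tab_comb_def
  proof (intro sum.cong refl arg_cong2[of _ _ _ _ times] arg_cong[of _ _ of_bool])
    fix l assume l: "l \<in> {1..n}"
    have "tab (p l) \<circ> p = tab l"
      using tab_comp[OF p perms_in[OF p l]] inv'_comp_apply[OF p] by simp
    moreover have "T \<circ> p = T' \<circ> p \<longleftrightarrow> T = T'" for T' :: "nat \<Rightarrow> nat"
      using inv'_comp_apply[OF p] by (auto simp: fun_eq_iff) metis
    ultimately show "(T = tab (p l)) = (T \<circ> p = tab l)" by metis
  qed
  finally show ?thesis .
qed

lemma tab_comb_specht: "x \<in> sum_zero \<Longrightarrow> tab_comb (\<lambda>k. x $ (k - 1)) \<in> specht_module n \<mu>"
  unfolding specht_iff
  by (intro exI[of _ "\<lambda>k. x $ (k - 1)"]) (simp add: shift_sum sum_zero_def del: One_nat_def)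

lemma specht_sum_zero:
  assumes f: "f \<in> specht_module n \<mu>"
  defines "x \<equiv> vec n (\<lambda>i. f (tab (Suc i)))"
  shows "x \<in> sum_zero" "f = tab_comb (\<lambda>k. x $ (k - 1))"
proof -
  obtain F where F: "(\<Sum>k\<in>{1..n}. F k) = 0" and f': "f = tab_comb F" using f specht_iff by blast
  have xi: "x $ i = F (Suc i)" if "i < n" for i
    using that unfolding x_def f' by (simp add: tab_comb_tab)
  show "x \<in> sum_zero" using F unfolding shift_sum by (simp add: sum_zero_def xi) (simp add: x_def)
  show "f = tab_comb (\<lambda>k. x $ (k - 1))"
  proof
    fix T show "f T = tab_comb (\<lambda>k. x $ (k - 1)) T"
      unfolding f' tab_comb_def using xi by (intro sum.cong refl) auto
  qed
qed

lemma std_affords: "affords_specht n \<mu> std"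
  unfolding affords_specht_def std_dim
proof (intro conjI exI[of _ \<Phi>] ballI allI)
  show "unitary_rep (sym_group n) std" by (rule T.ur)
  show "bij_betw \<Phi> (carrier_vec k) (specht_module n \<mu>)"
    unfolding bij_betw_def
  proof
    show "inj_on \<Phi> (carrier_vec k)"
    proof (rule inj_onI)
      fix y z assume y: "y \<in> carrier_vec k" and z: "z \<in> carrier_vec k" and eq: "\<Phi> y = \<Phi> z"
      have "Q *\<^sub>v y = Q *\<^sub>v z"
        using Q_carrier \<Phi>_tab[of _ y] \<Phi>_tab[of _ z] eq by (intro eq_vecI) auto
      then show "y = z" using QH_Q[OF y] QH_Q[OF z] by metis
    qed
    show "\<Phi> ` carrier_vec k = specht_module n \<mu>"
    proof
      show "\<Phi> ` carrier_vec k \<subseteq> specht_module n \<mu>"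
        using tab_comb_specht Q_in by (auto simp: \<Phi>_def)
      show "specht_module n \<mu> \<subseteq> \<Phi> ` carrier_vec k"
      proof
        fix f assume f: "f \<in> specht_module n \<mu>"
        let ?x = "vec n (\<lambda>i. f (tab (Suc i)))"
        note x = specht_sum_zero[OF f]
        have "f = \<Phi> (mat_adjoint Q *\<^sub>v ?x)" unfolding \<Phi>_def Q_QH[OF x(1)] by (rule x(2))
        moreover have "mat_adjoint Q *\<^sub>v ?x \<in> carrier_vec k" by (rule QH_in) simp
        ultimately show "f \<in> \<Phi> ` carrier_vec k" by blast
      qed
    qed
  qed
next
  fix u v :: "complex vec" and T assume u: "u \<in> carrier_vec k" and v: "v \<in> carrier_vec k"
  have "dim_row Q = n" using Q_carrier by simp
  then show "\<Phi> (u + v) T = \<Phi> u T + \<Phi> v T"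
    unfolding \<Phi>_def tab_comb_def mult_add_distrib_mat_vec[OF Q_carrier u v] sum.distrib[symmetric]
    by (intro sum.cong refl) (auto simp: distrib_right simp del: index_mult_mat_vec)
next
  fix v :: "complex vec" and z T assume v: "v \<in> carrier_vec k"
  have "dim_row Q = n" using Q_carrier by simp
  then show "\<Phi> (z \<cdot>\<^sub>v v) T = z * \<Phi> v T"
    unfolding \<Phi>_def tab_comb_def mult_mat_vec[OF Q_carrier v] sum_distrib_left
    by (intro sum.cong refl) (auto simp del: index_mult_mat_vec)
next
  fix v :: "complex vec" and \<pi> T assume "v \<in> carrier_vec k" "\<pi> \<in> carrier (sym_group n)"
  then show "\<Phi> (std \<pi> *\<^sub>v v) T = \<Phi> v (T \<circ> \<pi>)" by (simp add: \<Phi>_act carrier_sym_group)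
qed

text \<open>Irreducibility is known for \<open>std\<close> only, so Schur's lemma is applied on that
  side: for the intertwiner \<open>M\<close> built from the two bijections to the Specht module,
  \<open>M\<close> times its adjoint is a positive scalar. Injectivity of \<open>M\<close> carries
  this over to the opposite product.\<close>

lemma affords_specht_iso:
  assumes aff: "affords_specht n \<mu> \<sigma>"
  shows "urep (sym_group n) \<sigma>" "rep_iso (sym_group n) \<sigma> std"
proof -
  show u: "urep (sym_group n) \<sigma>"
    using aff A.fin sym_group_is_group unfolding urep_def urep_axioms_def affords_specht_def by blast
  interpret X: urep_pair "sym_group n" \<sigma> std using u std_urep by (simp add: urep_pair_def)
  interpret Y: urep_pair "sym_group n" std \<sigma> using u std_urep by (simp add: urep_pair_def)
  let ?d = "X.R.d"
  obtain \<Psi> where bij: "bij_betw \<Psi> (carrier_vec ?d) (specht_module n \<mu>)"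
    and add: "\<And>u v T. u \<in> carrier_vec ?d \<Longrightarrow> v \<in> carrier_vec ?d \<Longrightarrow> \<Psi> (u + v) T = \<Psi> u T + \<Psi> v T"
    and smult: "\<And>v z T. v \<in> carrier_vec ?d \<Longrightarrow> \<Psi> (z \<cdot>\<^sub>v v) T = z * \<Psi> v T"
    and act: "\<And>v p T. v \<in> carrier_vec ?d \<Longrightarrow> p \<in> carrier (sym_group n) \<Longrightarrow> \<Psi> (\<sigma> p *\<^sub>v v) T = \<Psi> v (T \<circ> p)"
    using aff unfolding affords_specht_def by blast
  define x where "x v = vec n (\<lambda>i. \<Psi> v (tab (Suc i)))" for v
  have spec: "\<Psi> v \<in> specht_module n \<mu>" if "v \<in> carrier_vec ?d" for v
    using bij that by (auto simp: bij_betw_def)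
  have x: "x v \<in> sum_zero" "\<Psi> v = tab_comb (\<lambda>k. x v $ (k - 1))" if "v \<in> carrier_vec ?d" for v
    using specht_sum_zero[OF spec[OF that]] by (simp_all add: x_def)
  have xn: "x v \<in> carrier_vec n" for v by (simp add: x_def)
  define L where "L v = mat_adjoint Q *\<^sub>v x v" for v
  have QL: "Q *\<^sub>v L v = x v" if "v \<in> carrier_vec ?d" for v
    unfolding L_def by (rule Q_QH[OF x(1)[OF that]])
  have L_in: "L v \<in> carrier_vec k" for v unfolding L_def by (rule QH_in[OF xn])
  obtain M where M: "M \<in> carrier_mat k ?d" "\<And>v. v \<in> carrier_vec ?d \<Longrightarrow> L v = M *\<^sub>v v"
  proof (rule linear_matrix[of ?d L k])
    show "L (u + v) = L u + L v" if "u \<in> carrier_vec ?d" "v \<in> carrier_vec ?d" for u v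
    proof -
      have "x (u + v) = x u + x v" using that by (intro eq_vecI) (auto simp: x_def add)
      then show ?thesis
        unfolding L_def using mult_add_distrib_mat_vec[OF mat_adjoint_carrier[OF Q_carrier] xn xn] by simp
    qed
    show "L (c \<cdot>\<^sub>v v) = c \<cdot>\<^sub>v L v" if "v \<in> carrier_vec ?d" for c v
    proof -
      have "x (c \<cdot>\<^sub>v v) = c \<cdot>\<^sub>v x v" using that by (intro eq_vecI) (auto simp: x_def smult)
      then show ?thesis
        unfolding L_def using mult_mat_vec[OF mat_adjoint_carrier[OF Q_carrier] xn] by simp
    qed
  qed (use L_in in auto)
  have inj: "v = w" if "v \<in> carrier_vec ?d" "w \<in> carrier_vec ?d" "M *\<^sub>v v = M *\<^sub>v w" for v w
  proof -
    have "x v = x w" using QL[OF that(1)] QL[OF that(2)] M(2) that by simp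
    then have "\<Psi> v = \<Psi> w" using x(2) that by simp
    then show ?thesis using bij that by (auto simp: bij_betw_def inj_on_def)
  qed
  have surj: "\<exists>v\<in>carrier_vec ?d. M *\<^sub>v v = y" if y: "y \<in> carrier_vec k" for y
  proof -
    have "\<Phi> y \<in> specht_module n \<mu>" using tab_comb_specht[OF Q_in[OF y]] by (simp add: \<Phi>_def)
    then obtain v where v: "v \<in> carrier_vec ?d" "\<Psi> v = \<Phi> y" using bij_betw_imp_surj_on[OF bij] by (metis imageE)
    have "x v = Q *\<^sub>v y" using Q_carrier v by (intro eq_vecI) (simp_all add: x_def \<Phi>_tab del: index_mult_mat_vec)
    then have "L v = y" unfolding L_def using QH_Q[OF y] by simp
    then show ?thesis using v M(2) by auto
  qed
  have Mi: "X.intertwiner M"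
    unfolding X.intertwiner_def std_dim
  proof (intro conjI ballI M(1))
    fix p and v :: "complex vec" assume p: "p \<in> carrier (sym_group n)" and v: "v \<in> carrier_vec ?d"
    then have pn: "p \<in> perms n" by (simp add: carrier_sym_group)
    have pv: "\<sigma> p *\<^sub>v v \<in> carrier_vec ?d" using p v by simp
    have "x (\<sigma> p *\<^sub>v v) = P p *\<^sub>v x v"
    proof (rule eq_vecI)
      fix i assume "i < dim_vec (P p *\<^sub>v x v)"
      then have i: "i < n" by simp
      then have j: "inv' p (Suc i) \<in> {1..n}" using perms_in[OF perms_inv'[OF pn], of "Suc i"] by auto
      have "x (\<sigma> p *\<^sub>v v) $ i = \<Psi> v (tab (Suc i) \<circ> p)" using i p v by (simp add: x_def act)
      also have "\<dots> = \<Psi> v (tab (inv' p (Suc i)))" using i by (subst tab_comp[OF pn]) auto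
      also have "\<dots> = x v $ (inv' p (Suc i) - 1)" using j by (auto simp: x_def)
      also have "\<dots> = (P p *\<^sub>v x v) $ i" by (rule P_index[symmetric, OF pn xn i])
      finally show "x (\<sigma> p *\<^sub>v v) $ i = (P p *\<^sub>v x v) $ i" .
    qed (simp add: x_def)
    then have "Q *\<^sub>v L (\<sigma> p *\<^sub>v v) = Q *\<^sub>v (std p *\<^sub>v L v)"
      using QL[OF pv] QL[OF v] std_Q[OF pn L_in] by simp
    then have "L (\<sigma> p *\<^sub>v v) = std p *\<^sub>v L v" using QH_Q[OF L_in] QH_Q[OF std_in[OF pn L_in]] by metis
    then show "M *\<^sub>v (\<sigma> p *\<^sub>v v) = std p *\<^sub>v (M *\<^sub>v v)" using M(2) pv v by simp
  qed
  note N = X.adjoint_intertwiner[OF Mi]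
  have Mi': "X.intertwiner (mat_adjoint (mat_adjoint M))" using Mi by simp
  have Nc: "mat_adjoint M \<in> carrier_mat ?d k" by (rule mat_adjoint_carrier[OF M(1)])
  obtain v where v: "v \<in> carrier_vec ?d" "M *\<^sub>v v = unit_vec k 0" using surj[of "unit_vec k 0"] by auto
  have "mat_adjoint M *\<^sub>v (M *\<^sub>v v) \<noteq> 0\<^sub>v ?d"
  proof
    assume 0: "mat_adjoint M *\<^sub>v (M *\<^sub>v v) = 0\<^sub>v ?d"
    have "(M *\<^sub>v v) \<bullet>c (M *\<^sub>v v) = (mat_adjoint M *\<^sub>v (M *\<^sub>v v)) \<bullet>c v"
      by (rule cs_adjoint_right[OF M(1) v(1)]) (simp add: v)
    then have "nsq (M *\<^sub>v v) = 0" using 0 v(1) by (simp add: cs_self)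
    then show False using k_pos by (simp add: v(2) nsq_unit_vec)
  qed
  then have ne: "M *\<^sub>v v \<in> carrier_vec T.d" "mat_adjoint M *\<^sub>v (M *\<^sub>v v) \<noteq> 0\<^sub>v X.R.d" by (simp_all add: v)
  obtain c where c: "0 < c" "\<And>y. y \<in> carrier_vec k \<Longrightarrow> M *\<^sub>v (mat_adjoint M *\<^sub>v y) = complex_of_real c \<cdot>\<^sub>v y" "k \<le> ?d"
    using Y.Schur_isometry[OF std_irreducible N Mi' ne] by (simp only: mat_adjoint_adjoint std_dim) blast
  \<comment> \<open>Both sides have the same image under the injective \<open>M\<close>.\<close>
  have c': "mat_adjoint M *\<^sub>v (M *\<^sub>v v) = complex_of_real c \<cdot>\<^sub>v v" if v: "v \<in> carrier_vec ?d" for v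
  proof (rule inj)
    have Mv: "M *\<^sub>v v \<in> carrier_vec k" by (rule mult_mat_vec_carrier[OF M(1) v])
    show "mat_adjoint M *\<^sub>v (M *\<^sub>v v) \<in> carrier_vec ?d" by (rule mult_mat_vec_carrier[OF Nc Mv])
    show "M *\<^sub>v (mat_adjoint M *\<^sub>v (M *\<^sub>v v)) = M *\<^sub>v (complex_of_real c \<cdot>\<^sub>v v)"
      using c(2)[OF Mv] mult_mat_vec[OF M(1) v] by simp
  qed (use v in simp)
  have dim: "?d = k" using c(3) scaled_isometry_dim_le[OF M(1) c(1) c'] by simp
  let ?T' = "complex_of_real (1 / c) \<cdot>\<^sub>m mat_adjoint M"
  have T'v: "?T' *\<^sub>v w = complex_of_real (1 / c) \<cdot>\<^sub>v (mat_adjoint M *\<^sub>v w)" if "w \<in> carrier_vec k" for w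
    by (rule smult_mat_mult_vec[OF Nc that])
  have one: "complex_of_real (1 / c) \<cdot>\<^sub>v (complex_of_real c \<cdot>\<^sub>v w) = w" for w
    using c(1) by (intro eq_vecI) auto
  show "rep_iso (sym_group n) \<sigma> std"
  proof (rule X.rep_isoI[OF Mi])
    show "?T' \<in> carrier_mat ?d T.d" using Nc by simp
    show "?d = T.d" by (simp add: dim)
    show "?T' *\<^sub>v (M *\<^sub>v w) = w" if "w \<in> carrier_vec ?d" for w
      using that by (simp only: T'v mult_mat_vec_carrier[OF M(1)] c' one)
    show "M *\<^sub>v (?T' *\<^sub>v w) = w" if "w \<in> carrier_vec T.d" for w
    proof -
      have w: "w \<in> carrier_vec k" using that by simp
      show ?thesis using mult_mat_vec[OF M(1) mult_mat_vec_carrier[OF Nc w]] w by (simp only: T'v c(2) one)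
    qed
  qed
qed

end

section \<open>The standard representation of the wreath product\<close>

locale wreath_std = wreath_setup G n + std_rep n for G :: "('g, 'm) monoid_scheme" and n
begin

lemma pullback_urep:
  assumes "urep (sym_group n) \<sigma>"
  shows "urep W (\<sigma> \<circ> snd)" "rep_dim W (\<sigma> \<circ> snd) = rep_dim (sym_group n) \<sigma>"
proof -
  interpret X: urep "sym_group n" \<sigma> by (rule assms)
  show dim: "rep_dim W (\<sigma> \<circ> snd) = X.d" by (simp add: rep_dim_def W_one sym_group_one)
  have "unitary_rep W (\<sigma> \<circ> snd)"
    unfolding unitary_rep_def dim
    using X.rho_one X.rho_mult X.rho_unitary
    by (auto simp: W_carrier W_one W_mult carrier_sym_group sym_group_one sym_group_mult)
  then show "urep W (\<sigma> \<circ> snd)" by unfold_locales (simp_all add: W_finite)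
qed

lemma pullback_iso:
  assumes "rep_iso (sym_group n) \<sigma> \<tau>" "urep (sym_group n) \<sigma>" "urep (sym_group n) \<tau>"
  shows "rep_iso W (\<sigma> \<circ> snd) (\<tau> \<circ> snd)"
  using assms(1) unfolding rep_iso_def pullback_urep(2)[OF assms(2)] pullback_urep(2)[OF assms(3)]
  by (auto simp: W_carrier carrier_sym_group)

definition "\<zeta> = (std \<circ> snd :: (nat \<Rightarrow> 'g) \<times> (nat \<Rightarrow> nat) \<Rightarrow> complex mat)"

lemma zeta_urep: "urep W \<zeta>"
  unfolding \<zeta>_def by (rule pullback_urep[OF std_urep])

sublocale Z: wreath_urep G n \<zeta>
  unfolding wreath_urep_def using zeta_urep wreath_setup_axioms by blast

lemma zeta_dim [simp]: "Z.R.d = k"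
  unfolding \<zeta>_def using pullback_urep(2)[OF std_urep] by simp

lemma zeta_se: "\<zeta> (se p) = std p" by (simp add: \<zeta>_def sym_embed_def)

lemma zeta_be: "\<zeta> (be g) = 1\<^sub>m k"
  using T.rho_one by (simp add: \<zeta>_def base_embed_def sym_group_one)

text \<open>All representations affording the Specht module are isomorphic, so the union defining
  \<open>Std_class\<close> is a single class.\<close>

lemma Std_class_eq: "Std_class n G = rep_class W \<zeta>"
proof -
  have "rep_class W (\<sigma> \<circ> snd) = rep_class W \<zeta>" if "affords_specht n \<mu> \<sigma>" for \<sigma>
  proof -
    note s = affords_specht_iso[OF that]
    show ?thesis
      unfolding \<zeta>_def
      by (rule rep_class_eqI[OF pullback_urep(1)[OF s(1)] pullback_urep(1)[OF std_urep] pullback_iso[OF s(2,1) std_urep]])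
  qed
  then show ?thesis unfolding Std_class_def \<mu>_def[symmetric] using std_affords by auto
qed

lemma zeta_fixed: "Z.R.fixed_by (se ` perms n) = {0\<^sub>v k}"
proof -
  have "Z.R.fixed_by (se ` perms n) = T.fixed_by (perms n)"
    by (auto simp: Z.R.fixed_by_def T.fixed_by_def zeta_se)
  then show ?thesis by (simp add: std_fixed)
qed

lemma zeta_nontrivial: "nontrivial_irrep W \<zeta>"
  unfolding nontrivial_irrep_def
proof
  have inv: "T.invariant U" if "Z.R.invariant U" for U
    unfolding T.invariant_def
  proof (intro conjI ballI)
    show "vec_subspace T.d U" using that by (simp add: Z.R.invariant_def)
    fix h u assume "h \<in> carrier (sym_group n)" "u \<in> U"
    then have "\<zeta> (se h) *\<^sub>v u \<in> U" using that se_in[of h] by (auto simp: Z.R.invariant_def carrier_sym_group)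
    then show "std h *\<^sub>v u \<in> U" by (simp add: zeta_se)
  qed
  show "irreducible_rep W \<zeta>"
    unfolding Z.R.irreducible_iff zeta_dim
    using std_irreducible T.irreducible_iff k_pos inv by auto
  have "Z.R.fixed_by (carrier W) \<subseteq> Z.R.fixed_by (se ` perms n)" by (auto simp: Z.R.fixed_by_def)
  moreover have "0\<^sub>v k \<in> Z.R.fixed_by (carrier W)"
    using Z.R.vec_subspace_fixed_by[of "carrier W"] by (simp add: vec_subspace_def)
  ultimately show "fixed_space W \<zeta> = {0\<^sub>v Z.R.d}" using zeta_fixed by (auto simp: Z.R.fixed_space_eq)
qed

text \<open>The base group acts trivially on \<open>\<zeta>\<close>, so only the rates
  \<open>a\<close> enter its Dirichlet form, which is that of the walk.\<close>

lemma zeta_walk_gap: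
  assumes w: "weights a c" and x: "psi W (adm a c) \<zeta> = ereal x"
  shows "walk_gap n a x"
proof (rule walk_gap_std)
  fix y :: "complex vec" assume y: "y \<in> carrier_vec k"
  then have yd: "y \<in> carrier_vec Z.R.d" by simp
  have "x * nsq y \<le> Re ((Z.R.lap (adm a c) *\<^sub>v y) \<bullet>c y)"
    by (rule Z.R.nontrivial_psi_Rayleigh[OF zeta_nontrivial adm_inv[OF w] yd x])
  also have "\<dots> = pair_sum n (\<lambda>i j. a i j * Z.R.diss (se (tr i j)) y) + (\<Sum>g\<in>carrier B. c g * Z.R.diss (be g) y)"
    by (rule Z.Re_lap_adm[OF yd])
  also have "(\<Sum>g\<in>carrier B. c g * Z.R.diss (be g) y) = 0"
    using y by (intro sum.neutral) (simp add: Z.R.diss_def zeta_be nsq_def)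
  also have "pair_sum n (\<lambda>i j. a i j * Z.R.diss (se (tr i j)) y) = T.energy n a y"
    by (simp add: T.energy_def Z.R.diss_def T.diss_def zeta_se)
  finally show "x * nsq y \<le> T.energy n a y" by simp
qed

text \<open>Keeps the standard class out of every orbit in the minimality argument.\<close>

lemma Std_not_Sph: "Std_class n G \<notin> Sph n G"
  using Z.spherical_iff zeta_nontrivial zeta_fixed by (simp add: Std_class_eq nontrivial_irrep_def)

text \<open>The translates of \<open>u\<close> are permuted like the points. Pairing with them
  intertwines \<open>\<rho>\<close> with the permutation representation; the image lies in the
  sum-zero part because \<open>\<rho>\<close> has no fixed vectors, and \<open>u\<close> is not
  mapped to 0, so Schur's lemma applies.\<close>

lemma iso_Std:
  assumes n: "n = Suc m" and irr: "nontrivial_irrep W \<rho>"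
    and fixed: "u \<in> urep.fixed_by W \<rho> (be ` carrier B)" "u \<in> urep.fixed_by W \<rho> (se ` perms m)"
    and u0: "u \<noteq> 0\<^sub>v (rep_dim W \<rho>)"
  shows "rep_iso W \<rho> \<zeta>"
proof -
  have r: "urep W \<rho>" by (rule nontrivial_urep[OF W_group W_finite irr])
  interpret X: wreath_urep G n \<rho> unfolding wreath_urep_def using r wreath_setup_axioms by blast
  interpret Y: urep_pair W \<rho> \<zeta> using r zeta_urep by (simp add: urep_pair_def)
  have ud: "u \<in> carrier_vec X.R.d" and ub: "\<And>g. g \<in> carrier B \<Longrightarrow> \<rho> (be g) *\<^sub>v u = u"
    and us: "\<And>p. p \<in> perms m \<Longrightarrow> \<rho> (se p) *\<^sub>v u = u"
    using fixed by (auto simp: X.R.fixed_by_def)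
  define b where "b i = \<rho> (se (tr i n)) *\<^sub>v u" for i
  have tc: "tr i n \<in> perms n" if "i \<in> {1..n}" for i using that n2 by (intro transpose_perms) auto
  have b_in: "b i \<in> carrier_vec X.R.d" if "i \<in> {1..n}" for i
    unfolding b_def by (rule X.R.act_in[OF se_in[OF tc[OF that]] ud])
  have act_u: "\<rho> (se q) *\<^sub>v u = b (q n)" if q: "q \<in> perms n" for q
  proof -
    have qn: "q n \<in> {1..n}" by (rule perms_in[OF q]) (use n2 in auto)
    have "tr (q n) n \<circ> q \<in> perms m"
      using perms_fix[of "tr (q n) n \<circ> q" m] perms_comp[OF tc[OF qn] q] n by simp
    then have "\<rho> (se (tr (q n) n \<circ> q)) *\<^sub>v u = u" by (rule us)
    then have fix_eq: "\<rho> (se (tr (q n) n)) *\<^sub>v (\<rho> (se q) *\<^sub>v u) = u"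
      using tc[OF qn] q ud by (simp add: se_mult X.R.act_act)
    have "se (tr (q n) n) \<otimes>\<^bsub>W\<^esub> se (tr (q n) n) = \<one>\<^bsub>W\<^esub>"
      using tc[OF qn] by (simp add: se_mult[symmetric] se_one)
    then have "\<rho> (se (tr (q n) n)) *\<^sub>v (\<rho> (se (tr (q n) n)) *\<^sub>v w) = w" if "w \<in> carrier_vec X.R.d" for w
      using tc[OF qn] that by (simp add: X.R.act_act)
    from this[of "\<rho> (se q) *\<^sub>v u"] show ?thesis using q ud by (simp add: fix_eq b_def)
  qed
  \<comment> \<open>The base element is moved to the right past the permutation, where it meets
    \<open>u\<close> and acts trivially.\<close>
  have act_b: "\<rho> (g, p) *\<^sub>v b i = b (p i)" if g: "g \<in> carrier B" and p: "p \<in> perms n" and i: "i \<in> {1..n}" for g p i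
  proof -
    let ?q = "p \<circ> tr i n"
    have q: "?q \<in> perms n" by (rule perms_comp[OF p tc[OF i]])
    let ?g = "perm_act n (inv' ?q) g"
    have g': "?g \<in> carrier B" by (rule perm_act_in[OF perms_inv'[OF q] g])
    have unact: "perm_act n ?q ?g = g"
    proof -
      have "?q \<circ> inv' ?q = id" using inv'_comp_apply[OF q] by (simp add: fun_eq_iff)
      then show ?thesis using perm_act_comp[OF q perms_inv'[OF q], of g] perm_act_id[OF g] by simp
    qed
    have "\<rho> (g, p) *\<^sub>v b i = \<rho> (be g \<otimes>\<^bsub>W\<^esub> se p \<otimes>\<^bsub>W\<^esub> se (tr i n)) *\<^sub>v u"
      unfolding b_def using X.R.act_act[OF _ se_in[OF tc[OF i]] ud, of "(g, p)"] g p
      by (simp add: be_se W_carrier)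
    also have "be g \<otimes>\<^bsub>W\<^esub> se p \<otimes>\<^bsub>W\<^esub> se (tr i n) = be g \<otimes>\<^bsub>W\<^esub> se ?q"
      using g p tc[OF i] by (simp add: W.m_assoc se_mult)
    also have "\<dots> = se ?q \<otimes>\<^bsub>W\<^esub> be ?g" using se_be[OF g' q] unact by simp
    also have "\<rho> (se ?q \<otimes>\<^bsub>W\<^esub> be ?g) *\<^sub>v u = \<rho> (se ?q) *\<^sub>v (\<rho> (be ?g) *\<^sub>v u)"
      using q g' ud by (simp add: X.R.act_act)
    also have "\<dots> = b (?q n)" using ub[OF g'] act_u[OF q] by simp
    finally show ?thesis by simp
  qed
  define M where "M = mat n X.R.d (\<lambda>(i, j). cnj (b (Suc i) $ j))"
  have M: "M \<in> carrier_mat n X.R.d" by (simp add: M_def)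
  have Mv: "(M *\<^sub>v v) $ i = v \<bullet>c b (Suc i)" if "v \<in> carrier_vec X.R.d" "i < n" for v i
  proof -
    have bi: "b (Suc i) \<in> carrier_vec X.R.d" using that by (intro b_in) auto
    show ?thesis
      unfolding mat_vec_index[OF M that] cscalar_prod_sum[OF bi]
      using that by (intro sum.cong refl) (simp add: M_def mult.commute)
  qed
  have M_in: "M *\<^sub>v v \<in> carrier_vec n" if "v \<in> carrier_vec X.R.d" for v by (rule mult_mat_vec_carrier[OF M that])
  have M_act: "M *\<^sub>v (\<rho> (g, p) *\<^sub>v v) = P p *\<^sub>v (M *\<^sub>v v)"
    if g: "g \<in> carrier B" and p: "p \<in> perms n" and v: "v \<in> carrier_vec X.R.d" for g p v
  proof (rule eq_vecI)
    have h: "(g, p) \<in> carrier W" using g p by (simp add: W_carrier)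
    fix i assume "i < dim_vec (P p *\<^sub>v (M *\<^sub>v v))"
    then have i: "i < n" by simp
    let ?j = "inv' p (Suc i)"
    have j: "?j \<in> {1..n}" using perms_in[OF perms_inv'[OF p], of "Suc i"] i by auto
    then have Sj: "Suc (?j - 1) = ?j" "?j - 1 < n" by auto
    have "b (Suc i) = \<rho> (g, p) *\<^sub>v b ?j" using act_b[OF g p j] inv'_comp_apply[OF p] by simp
    then have "(\<rho> (g, p) *\<^sub>v v) \<bullet>c b (Suc i) = v \<bullet>c b ?j"
      using X.R.cs_act_act[OF h v b_in[OF j]] by simp
    then have "(M *\<^sub>v (\<rho> (g, p) *\<^sub>v v)) $ i = (M *\<^sub>v v) $ (?j - 1)"
      using Mv[OF X.R.act_in[OF h v] i] Mv[OF v Sj(2)] Sj(1) by simp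
    then show "(M *\<^sub>v (\<rho> (g, p) *\<^sub>v v)) $ i = (P p *\<^sub>v (M *\<^sub>v v)) $ i"
      using P_index[OF p M_in[OF v] i] by simp
  qed (use M in simp)
  \<comment> \<open>The coordinate sum of \<open>M *\<^sub>v v\<close> is invariant in
    \<open>v\<close>, so summing over the group multiplies it by the group order; but the sum of all
    translates of \<open>v\<close> is 0.\<close>
  have Msz: "M *\<^sub>v v \<in> sum_zero" if v: "v \<in> carrier_vec X.R.d" for v
  proof -
    define s where "s = (\<Sum>i<n. (M *\<^sub>v v) $ i)"
    define av where "av = X.R.gop (\<lambda>_. 1) *\<^sub>v v"
    have "av = 0\<^sub>v X.R.d" using X.R.average_fixed[OF v] irr by (simp add: av_def nontrivial_irrep_def)
    then have "(\<Sum>i<n. (M *\<^sub>v av) $ i) = 0"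
      by (simp add: mat_mult_zero_vec[OF M] del: index_mult_mat_vec)
    moreover have "(M *\<^sub>v av) $ i = (\<Sum>h\<in>carrier W. (M *\<^sub>v (\<rho> h *\<^sub>v v)) $ i)" if i: "i < n" for i
    proof -
      have bi: "b (Suc i) \<in> carrier_vec X.R.d" using i by (intro b_in) auto
      have "av \<in> carrier_vec X.R.d" unfolding av_def using v by simp
      from Mv[OF this i] show ?thesis
        unfolding av_def X.R.cs_gop[OF v bi] using v i
        by (simp add: Mv[OF X.R.act_in] del: index_mult_mat_vec)
    qed
    then have "(\<Sum>i<n. (M *\<^sub>v av) $ i) = (\<Sum>i<n. \<Sum>h\<in>carrier W. (M *\<^sub>v (\<rho> h *\<^sub>v v)) $ i)"
      by (intro sum.cong refl) simp
    then have "(\<Sum>i<n. (M *\<^sub>v av) $ i) = (\<Sum>h\<in>carrier W. \<Sum>i<n. (M *\<^sub>v (\<rho> h *\<^sub>v v)) $ i)"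
      by (simp only: sum.swap[of _ "{..<n}" "carrier W"])
    also have "\<dots> = (\<Sum>h\<in>carrier W. s)"
    proof (intro sum.cong refl)
      fix h assume "h \<in> carrier W"
      then obtain g p where h: "h = (g, p)" "g \<in> carrier B" "p \<in> perms n" by (auto simp: W_carrier)
      show "(\<Sum>i<n. (M *\<^sub>v (\<rho> h *\<^sub>v v)) $ i) = s"
        unfolding h(1) M_act[OF h(2,3) v] s_def by (rule P_sum[OF h(3) M_in[OF v], of "\<lambda>z. z"])
    qed
    ultimately have "of_nat (card (carrier W)) * s = 0" by simp
    moreover have "card (carrier W) \<noteq> 0" using W_finite W.one_closed by auto
    ultimately show ?thesis using M_in[OF v] by (simp add: sum_zero_def s_def del: index_mult_mat_vec)
  qed
  have Qc': "mat_adjoint Q \<in> carrier_mat k n" by (rule mat_adjoint_carrier[OF Q_carrier])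
  have QM: "mat_adjoint Q * M *\<^sub>v v = mat_adjoint Q *\<^sub>v (M *\<^sub>v v)" if "v \<in> carrier_vec X.R.d" for v
    by (rule assoc_mult_mat_vec[OF Qc' M that])
  have "Y.intertwiner (mat_adjoint Q * M)"
    unfolding Y.intertwiner_def zeta_dim
  proof (intro conjI ballI)
    show "mat_adjoint Q * M \<in> carrier_mat k X.R.d" by (rule mult_carrier_mat[OF Qc' M])
    fix h and v :: "complex vec" assume "h \<in> carrier W" and v: "v \<in> carrier_vec X.R.d"
    then obtain g p where h: "h = (g, p)" "g \<in> carrier B" "p \<in> perms n" by (auto simp: W_carrier)
    have hv: "\<rho> h *\<^sub>v v \<in> carrier_vec X.R.d" using \<open>h \<in> carrier W\<close> v by (rule X.R.act_in)
    let ?y = "mat_adjoint Q *\<^sub>v (M *\<^sub>v v)"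
    have y: "?y \<in> carrier_vec k" by (rule QH_in[OF M_in[OF v]])
    have "Q *\<^sub>v (std p *\<^sub>v ?y) = M *\<^sub>v (\<rho> h *\<^sub>v v)"
      using std_Q[OF h(3) y] Q_QH[OF Msz[OF v]] M_act[OF h(2,3) v] h(1) by simp
    then have "std p *\<^sub>v ?y = mat_adjoint Q *\<^sub>v (M *\<^sub>v (\<rho> h *\<^sub>v v))"
      using QH_Q[OF std_in[OF h(3) y]] by simp
    then show "mat_adjoint Q * M *\<^sub>v (\<rho> h *\<^sub>v v) = \<zeta> h *\<^sub>v (mat_adjoint Q * M *\<^sub>v v)"
      using QM[OF hv] QM[OF v] h(1) by (simp add: \<zeta>_def)
  qed
  moreover have "mat_adjoint Q * M *\<^sub>v u \<noteq> 0\<^sub>v Z.R.d"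
  proof
    assume "mat_adjoint Q * M *\<^sub>v u = 0\<^sub>v Z.R.d"
    then have "Q *\<^sub>v 0\<^sub>v k = M *\<^sub>v u" using QM[OF ud] Q_QH[OF Msz[OF ud]] by simp
    then have "M *\<^sub>v u = 0\<^sub>v n" using mat_mult_zero_vec[OF Q_carrier] by simp
    \<comment> \<open>The last coordinate of \<open>M *\<^sub>v u\<close>, at index
      \<open>n - 1\<close>, is the pairing of \<open>u\<close> with \<open>b n = u\<close>.\<close>
    then have "u \<bullet>c b (Suc (n - 1)) = 0" using Mv[OF ud, of "n - 1"] n2 by simp
    then have "u \<bullet>c b n = 0" using n2 by simp
    moreover have "b n = u" using act_u[OF perms_id] us[OF perms_id] by simp
    ultimately show False using u0 ud by (simp add: cs_self nsq_eq_0_iff)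
  qed
  ultimately show ?thesis
    using Y.Schur[of "mat_adjoint Q * M" u] irr zeta_nontrivial ud by (simp add: nontrivial_irrep_def)
qed

end

section \<open>Orthogonality of matrix coefficients\<close>

text \<open>Summing the rank-one maps
  \<open>z \<mapsto> (z \<bullet>c \<rho> h x) \<sigma> h w\<close> over the group gives an
  intertwiner, which vanishes by Schur's lemma; the claim is one of its matrix entries.\<close>

lemma (in urep_pair) coefficient_orthogonality:
  assumes irr: "irreducible_rep H \<rho>" "irreducible_rep H \<sigma>" and ni: "\<not> rep_iso H \<rho> \<sigma>"
    and z: "z \<in> carrier_vec R.d" and x: "x \<in> carrier_vec R.d"
    and w: "w \<in> carrier_vec S.d" and t: "t \<in> carrier_vec S.d"
  shows "(\<Sum>h\<in>carrier H. (z \<bullet>c (\<rho> h *\<^sub>v x)) * ((\<sigma> h *\<^sub>v w) \<bullet>c t)) = 0"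
proof -
  define M where "M = mat S.d R.d (\<lambda>(i, j). \<Sum>h\<in>carrier H. (\<sigma> h *\<^sub>v w) $ i * cnj ((\<rho> h *\<^sub>v x) $ j))"
  have M: "M \<in> carrier_mat S.d R.d" by (simp add: M_def)
  have Mz: "(M *\<^sub>v z) \<bullet>c t = (\<Sum>h\<in>carrier H. (z \<bullet>c (\<rho> h *\<^sub>v x)) * ((\<sigma> h *\<^sub>v w) \<bullet>c t))"
    if z: "z \<in> carrier_vec R.d" and t: "t \<in> carrier_vec S.d" for z t
  proof -
    have ind: "(M *\<^sub>v z) $ i = (\<Sum>h\<in>carrier H. (\<sigma> h *\<^sub>v w) $ i * (z \<bullet>c (\<rho> h *\<^sub>v x)))"
      if i: "i < S.d" for i
    proof -
      have "(M *\<^sub>v z) $ i =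
          (\<Sum>j<R.d. \<Sum>h\<in>carrier H. (\<sigma> h *\<^sub>v w) $ i * cnj ((\<rho> h *\<^sub>v x) $ j) * z $ j)"
        unfolding mat_vec_index[OF M z i] using i by (intro sum.cong refl) (simp add: M_def sum_distrib_right)
      also have "\<dots> = (\<Sum>h\<in>carrier H. \<Sum>j<R.d. (\<sigma> h *\<^sub>v w) $ i * cnj ((\<rho> h *\<^sub>v x) $ j) * z $ j)"
        by (rule sum.swap)
      also have "\<dots> = (\<Sum>h\<in>carrier H. (\<sigma> h *\<^sub>v w) $ i * (z \<bullet>c (\<rho> h *\<^sub>v x)))"
        by (intro sum.cong refl)
          (simp only: cscalar_prod_sum[OF R.act_in[OF _ x]] sum_distrib_left mult.assoc mult.commute[of "z $ _"])
      finally show ?thesis .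
    qed
    have "(M *\<^sub>v z) \<bullet>c t =
        (\<Sum>i<S.d. \<Sum>h\<in>carrier H. (\<sigma> h *\<^sub>v w) $ i * (z \<bullet>c (\<rho> h *\<^sub>v x)) * cnj (t $ i))"
      unfolding cscalar_prod_sum[OF t] by (intro sum.cong refl) (simp only: ind sum_distrib_right lessThan_iff)
    also have "\<dots> = (\<Sum>h\<in>carrier H. \<Sum>i<S.d. (\<sigma> h *\<^sub>v w) $ i * (z \<bullet>c (\<rho> h *\<^sub>v x)) * cnj (t $ i))"
      by (rule sum.swap)
    also have "\<dots> = (\<Sum>h\<in>carrier H. (z \<bullet>c (\<rho> h *\<^sub>v x)) * ((\<sigma> h *\<^sub>v w) \<bullet>c t))"
      by (intro sum.cong refl) (simp only: cscalar_prod_sum[OF t] sum_distrib_left ac_simps)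
    finally show ?thesis .
  qed
  have "intertwiner M"
    unfolding intertwiner_def
  proof (intro conjI ballI M)
    fix k and z :: "complex vec" assume k: "k \<in> carrier H" and z: "z \<in> carrier_vec R.d"
    have Mz_in: "M *\<^sub>v z \<in> carrier_vec S.d" by (rule mult_mat_vec_carrier[OF M z])
    show "M *\<^sub>v (\<rho> k *\<^sub>v z) = \<sigma> k *\<^sub>v (M *\<^sub>v z)"
    proof (rule vec_eq_csI)
      show "M *\<^sub>v (\<rho> k *\<^sub>v z) \<in> carrier_vec S.d" by (rule mult_mat_vec_carrier[OF M R.act_in[OF k z]])
      show "\<sigma> k *\<^sub>v (M *\<^sub>v z) \<in> carrier_vec S.d" by (rule S.act_in[OF k Mz_in])
      fix t :: "complex vec" assume t: "t \<in> carrier_vec S.d"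
      have t': "\<sigma> (inv k) *\<^sub>v t \<in> carrier_vec S.d" using k t by (intro S.act_in) auto
      have "(M *\<^sub>v (\<rho> k *\<^sub>v z)) \<bullet>c t =
          (\<Sum>h\<in>carrier H. ((\<rho> k *\<^sub>v z) \<bullet>c (\<rho> (k \<otimes> h) *\<^sub>v x)) * ((\<sigma> (k \<otimes> h) *\<^sub>v w) \<bullet>c t))"
        unfolding Mz[OF R.act_in[OF k z] t] by (rule R.sum_left_mult[OF k, symmetric])
      also have "\<dots> = (\<Sum>h\<in>carrier H. (z \<bullet>c (\<rho> h *\<^sub>v x)) * ((\<sigma> h *\<^sub>v w) \<bullet>c (\<sigma> (inv k) *\<^sub>v t)))"
      proof (intro sum.cong refl arg_cong2[of _ _ _ _ times])
        fix h assume h: "h \<in> carrier H"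
        show "(\<rho> k *\<^sub>v z) \<bullet>c (\<rho> (k \<otimes> h) *\<^sub>v x) = z \<bullet>c (\<rho> h *\<^sub>v x)"
          using R.cs_act_act[OF k z R.act_in[OF h x]] R.act_act[OF k h x] by simp
        show "(\<sigma> (k \<otimes> h) *\<^sub>v w) \<bullet>c t = (\<sigma> h *\<^sub>v w) \<bullet>c (\<sigma> (inv k) *\<^sub>v t)"
          using S.cs_act_left[OF k S.act_in[OF h w] t] S.act_act[OF k h w] by simp
      qed
      also have "\<dots> = (M *\<^sub>v z) \<bullet>c (\<sigma> (inv k) *\<^sub>v t)" by (rule Mz[OF z t', symmetric])
      also have "\<dots> = (\<sigma> k *\<^sub>v (M *\<^sub>v z)) \<bullet>c t" by (rule S.cs_act_left[OF k Mz_in t, symmetric])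
      finally show "(M *\<^sub>v (\<rho> k *\<^sub>v z)) \<bullet>c t = (\<sigma> k *\<^sub>v (M *\<^sub>v z)) \<bullet>c t" .
    qed
  qed
  then have "M *\<^sub>v z = 0\<^sub>v S.d" using Schur[OF irr _ z] ni by blast
  then show ?thesis using Mz[OF z t] t by simp
qed

section \<open>Gap-determining families\<close>

context wreath_std begin

lemma nontrivial_wreath_urep: "nontrivial_irrep W \<sigma> \<Longrightarrow> wreath_urep G n \<sigma>"
  using nontrivial_urep[OF W_group W_finite] wreath_setup_axioms by (simp add: wreath_urep_def)

text \<open>The Dirichlet form at an eigenvector attaining the gap is the gap times the squared
  norm, so a bound for the form on all vectors suffices.\<close>

lemma psi_lower:
  assumes w: "weights a c" and s: "nontrivial_irrep W \<sigma>"
    and low: "\<And>u. u \<in> carrier_vec (rep_dim W \<sigma>) \<Longrightarrow>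
      y * nsq u \<le> pair_sum n (\<lambda>i j. a i j * urep.diss \<sigma> (se (tr i j)) u) +
        (\<Sum>g\<in>carrier B. c g * urep.diss \<sigma> (be g) u)"
  shows "ereal y \<le> psi W (adm a c) \<sigma>"
proof -
  interpret X: wreath_urep G n \<sigma> by (rule nontrivial_wreath_urep[OF s])
  obtain u x where u: "u \<in> carrier_vec X.R.d" "u \<noteq> 0\<^sub>v X.R.d"
      "eigenvector (X.R.lap (adm a c)) u (complex_of_real x)" "psi W (adm a c) \<sigma> = ereal x"
    using X.R.nontrivial_psi[where w = "adm a c", OF s adm_inv[OF w]] by blast
  have "y * nsq u \<le> x * nsq u"
    using low[OF u(1)] X.Re_lap_adm[OF u(1)] X.R.eigen_form[OF u(3) X.R.gop_carrier] by simp
  then show ?thesis using u(1,2) by (simp add: u(4) nsq_pos_iff[symmetric])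
qed

text \<open>Without vectors fixed by the symmetric group, the transpositions alone already
  contribute the gap of \<open>\<zeta>\<close>, which bounds the walk; the base weights only add to
  the form.\<close>

lemma psi_zeta_le:
  assumes w: "weights a c" and irr: "nontrivial_irrep W \<sigma>"
    and ns: "urep.fixed_by W \<sigma> (se ` perms n) = {0\<^sub>v (rep_dim W \<sigma>)}"
  shows "psi W (adm a c) \<zeta> \<le> psi W (adm a c) \<sigma>"
proof -
  interpret X: wreath_urep G n \<sigma> by (rule nontrivial_wreath_urep[OF irr])
  obtain u y where u: "u \<in> carrier_vec X.R.d" "u \<noteq> 0\<^sub>v X.R.d"
      "eigenvector (X.R.lap (adm a c)) u (complex_of_real y)" "psi W (adm a c) \<sigma> = ereal y"
    using X.R.nontrivial_psi[where w = "adm a c", OF irr adm_inv[OF w]] by blast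
  obtain x where x: "psi W (adm a c) \<zeta> = ereal x"
    using Z.R.nontrivial_psi[where w = "adm a c", OF zeta_nontrivial adm_inv[OF w]] by blast
  have "x * nsq u \<le> pair_sum n (\<lambda>i j. a i j * X.R.diss (se (tr i j)) u)"
    using w u(1) ns
    by (intro X.wreath_aldous[OF le_refl _ zeta_walk_gap[OF w x] u(1)]) (auto simp: weights_def)
  also have "\<dots> \<le> \<dots> + (\<Sum>g\<in>carrier B. c g * X.R.diss (be g) u)"
    using w u(1) by (auto simp: weights_def intro!: sum_nonneg mult_nonneg_nonneg)
  also have "\<dots> = y * nsq u"
    using X.Re_lap_adm[OF u(1)] X.R.eigen_form[OF u(3) X.R.gop_carrier] by simp
  finally show ?thesis using u(1,2) by (simp add: x u(4) nsq_pos_iff[symmetric])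
qed

lemma psi_class_adm:
  "weights a c \<Longrightarrow> nontrivial_irrep W \<sigma> \<Longrightarrow> psi_class W (adm a c) (rep_class W \<sigma>) = psi W (adm a c) \<sigma>"
  by (rule psi_class_eq[where w = "adm a c", OF W_group W_finite _ adm_inv])

lemma spherical_vector:
  assumes irr: "irreducible_rep W \<rho>" and C: "rep_class W \<rho> \<in> Sph n G"
  obtains v where "v \<in> urep.fixed_by W \<rho> (se ` perms n)" "v \<noteq> 0\<^sub>v (rep_dim W \<rho>)"
proof -
  have r: "urep W \<rho>" by (rule irreducible_urep[OF W_group W_finite irr])
  interpret X: wreath_urep G n \<rho> unfolding wreath_urep_def using r wreath_setup_axioms by blast
  have "X.R.fixed_by (se ` perms n) \<noteq> {0\<^sub>v X.R.d}" using X.spherical_iff[OF irr] C by simp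
  moreover have "0\<^sub>v X.R.d \<in> X.R.fixed_by (se ` perms n)"
    using X.R.vec_subspace_fixed_by[OF subgroup.subset[OF se_subgroup[OF le_refl]]]
    by (simp add: vec_subspace_def)
  ultimately show ?thesis using that by blast
qed

text \<open>Conjugation turns a spherical vector into one of the contragredient.\<close>

lemma dual_Sph:
  assumes irr: "irreducible_rep W \<rho>" and C: "rep_class W \<rho> \<in> Sph n G"
  shows "dual_class W (rep_class W \<rho>) \<in> Sph n G"
proof -
  have r: "urep W \<rho>" by (rule irreducible_urep[OF W_group W_finite irr])
  interpret X: wreath_urep G n \<rho> unfolding wreath_urep_def using r wreath_setup_axioms by blast
  interpret Y: wreath_urep G n "contragredient W \<rho>"
    unfolding wreath_urep_def using X.R.contra_urep wreath_setup_axioms by blast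
  have sub: "se ` perms n \<subseteq> carrier W" by auto
  obtain v where v: "v \<in> X.R.fixed_by (se ` perms n)" "v \<noteq> 0\<^sub>v X.R.d"
    by (rule spherical_vector[OF irr C])
  have "conjugate v \<in> Y.R.fixed_by (se ` perms n)" by (rule X.R.contra_fixed_by[OF sub v(1)])
  moreover have "conjugate v \<noteq> 0\<^sub>v X.R.d"
  proof
    assume "conjugate v = 0\<^sub>v X.R.d"
    then have "conjugate (conjugate v) = conjugate (0\<^sub>v X.R.d :: complex vec)" by (rule arg_cong)
    then show False using v(2) by simp
  qed
  ultimately have "Y.R.fixed_by (se ` perms n) \<noteq> {0\<^sub>v Y.R.d}"
    unfolding X.R.contra_dim by blast
  then show ?thesis using Y.spherical_iff[OF X.R.contra_irreducible[OF irr]] by (simp add: dual_class_eq[OF r])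
qed

lemma orbit_mem_Sph:
  assumes "\<O> \<in> Sph_duality_orbits n G" "C \<in> \<O>"
  shows "C \<in> Sph n G"
proof -
  obtain D where D: "D \<in> Sph n G" "\<O> = {D, dual_class W D}"
    using assms(1) by (auto simp: Sph_duality_orbits_def)
  then obtain \<rho> where "irreducible_rep W \<rho>" "D = rep_class W \<rho>" by (auto simp: Sph_def Irr_def)
  then show ?thesis using dual_Sph[of \<rho>] D assms(2) by auto
qed

lemma std_sph_gap_determining:
  assumes "is_std_sph_collection n G \<M>"
  shows "gap_determining n G \<M>"
proof -
  obtain \<S> where M: "\<M> = insert (Std_class n G) \<S>" and S: "\<S> \<subseteq> Sph n G - {triv_class W}"
    and orb: "\<forall>\<O>\<in>Sph_duality_orbits n G. \<exists>!C. C \<in> \<S> \<inter> \<O>"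
    using assms unfolding is_std_sph_collection_def by (elim exE conjE) (rule that)
  have sub: "\<M> \<subseteq> Irr W - {triv_class W}"
    using S Irr_nontrivial_iff[OF W_group W_finite, of "Std_class n G"] zeta_nontrivial
    by (auto simp: M Sph_def Std_class_eq)
  moreover have "psi_group W w = (INF C\<in>\<M>. psi_class W w C)" if adm: "admissible n G w" for w
  proof -
    obtain a c where ac: "weights a c" "w = adm a c" using adm admissible_iff by blast
    have sym: "\<And>h. h \<in> carrier W \<Longrightarrow> w (inv\<^bsub>W\<^esub> h) = w h" using adm_inv[OF ac(1)] ac(2) by simp
    have cls: "psi_class W w (rep_class W \<sigma>) = psi W w \<sigma>" if "nontrivial_irrep W \<sigma>" for \<sigma>
      using psi_class_adm[OF ac(1) that] ac(2) by simp
    have "psi_group W w \<le> psi_class W w C" if "C \<in> \<M>" for C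
    proof -
      have "C \<in> Irr W - {triv_class W}" using sub that by blast
      then obtain \<rho> where r: "nontrivial_irrep W \<rho>" "C = rep_class W \<rho>"
        unfolding Irr_nontrivial_iff[OF W_group W_finite] by blast
      then show ?thesis using psi_group_le[where w = w, OF W_group W_finite r(1) sym] cls by simp
    qed
    then have le: "psi_group W w \<le> (INF C\<in>\<M>. psi_class W w C)" by (rule INF_greatest)
    \<comment> \<open>The gap of the group is dominated from below by that of a non-trivial
      irreducible \<open>\<sigma>\<close>; it remains to find a member of the collection with gap at
      most that of \<open>\<sigma>\<close>.\<close>
    obtain \<sigma> where s: "nontrivial_irrep W \<sigma>" "psi W w \<sigma> \<le> psi_group W w"
      using psi_group_attained[where w = w, OF W_group W_finite zeta_nontrivial sym] by blast
    interpret X: wreath_urep G n \<sigma> by (rule nontrivial_wreath_urep[OF s(1)])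
    have irr: "irreducible_rep W \<sigma>" using s(1) by (simp add: nontrivial_irrep_def)
    have "\<exists>D\<in>\<M>. psi_class W w D \<le> psi W w \<sigma>"
    proof (cases "rep_class W \<sigma> \<in> Sph n G")
      case True
      have "rep_class W \<sigma> \<noteq> triv_class W" using X.R.nontrivial_iff_triv_class[OF irr] s(1) by simp
      then have "{rep_class W \<sigma>, dual_class W (rep_class W \<sigma>)} \<in> Sph_duality_orbits n G"
        using True by (auto simp: Sph_duality_orbits_def)
      then obtain D where D: "D \<in> \<S>" "D = rep_class W \<sigma> \<or> D = dual_class W (rep_class W \<sigma>)"
        using ex1_implies_ex[OF bspec[OF orb]] by blast
      have "psi_class W w D \<le> psi W w \<sigma>"
        using D(2) cls[OF s(1)] cls[OF X.R.contra_nontrivial[OF s(1)]]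
          X.R.contra_psi_le[where w = w, OF s(1) sym] dual_class_eq[OF X.R.urep_axioms] by auto
      then show ?thesis using D(1) M by blast
    next
      case False
      then have "psi W w \<zeta> \<le> psi W w \<sigma>"
        using psi_zeta_le[OF ac(1) s(1)] X.spherical_iff[OF irr] ac(2) by simp
      then show ?thesis using M cls[OF zeta_nontrivial] by (auto simp: Std_class_eq)
    qed
    then have "(INF C\<in>\<M>. psi_class W w C) \<le> psi W w \<sigma>" by (auto intro: INF_lower2)
    then show ?thesis using le s(2) by (meson order.antisym order.trans)
  qed
  ultimately show ?thesis by (simp add: gap_determining_def)
qed

text \<open>With weights for which only the class or orbit of \<open>\<rho>\<close> has a gap below
  \<open>y\<close>, the member found here must belong to it.\<close>

lemma gap_determining_separates:
  assumes E: "gap_determining n G \<E>" and w: "weights a c" and r: "nontrivial_irrep W \<rho>"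
    and upper: "psi W (adm a c) \<rho> < ereal y"
  obtains \<sigma> where "nontrivial_irrep W \<sigma>" "rep_class W \<sigma> \<in> \<E>" "psi W (adm a c) \<sigma> < ereal y"
proof -
  have "admissible n G (adm a c)" using w admissible_iff by blast
  then have "(INF C\<in>\<E>. psi_class W (adm a c) C) = psi_group W (adm a c)"
    using E by (simp add: gap_determining_def)
  also have "\<dots> < ereal y"
    using psi_group_le[where w = "adm a c", OF W_group W_finite r adm_inv[OF w]] upper by (rule order.strict_trans1)
  finally obtain C where C: "C \<in> \<E>" "psi_class W (adm a c) C < ereal y" by (auto simp: INF_less_iff)
  then have "C \<in> Irr W - {triv_class W}" using E by (auto simp: gap_determining_def)
  then obtain \<sigma> where "nontrivial_irrep W \<sigma>" "C = rep_class W \<sigma>"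
    unfolding Irr_nontrivial_iff[OF W_group W_finite] by blast
  then show ?thesis using that C psi_class_adm[OF w] by simp
qed


section \<open>Necessity of the standard representation\<close>

lemma base_fixed_act:
  assumes s: "wreath_urep G n \<sigma>" and u: "u \<in> urep.fixed_by W \<sigma> (be ` carrier B)"
    and g: "g \<in> carrier B" and p: "p \<in> perms n"
  shows "\<sigma> (g, p) *\<^sub>v u = \<sigma> (se p) *\<^sub>v u"
proof -
  interpret X: wreath_urep G n \<sigma> by (rule s)
  have ud: "u \<in> carrier_vec X.R.d" using u by (simp add: X.R.fixed_by_def)
  let ?g = "perm_act n (inv' p) g"
  have g': "?g \<in> carrier B" by (rule perm_act_in[OF perms_inv'[OF p] g])
  have "p \<circ> inv' p = id" using inv'_comp_apply[OF p] by (simp add: fun_eq_iff)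
  then have "perm_act n p ?g = g"
    using perm_act_comp[OF p perms_inv'[OF p], of g] perm_act_id[OF g] by simp
  then have "(g, p) = se p \<otimes>\<^bsub>W\<^esub> be ?g" using se_be[OF g' p] be_se[OF g p] by simp
  moreover have "\<sigma> (be ?g) *\<^sub>v u = u" using u g' by (simp add: X.R.fixed_by_def)
  ultimately show ?thesis using X.R.act_act[OF se_in[OF p] be_in[OF g'] ud] by simp
qed

text \<open>The base group is normal. Consequently an irreducible representation has no non-zero
  vector fixed by it, or only such vectors.\<close>

lemma base_fixed_invariant:
  assumes s: "wreath_urep G n \<sigma>"
  shows "urep.invariant W \<sigma> (urep.fixed_by W \<sigma> (be ` carrier B))"
proof -
  interpret X: wreath_urep G n \<sigma> by (rule s)
  have "\<sigma> h *\<^sub>v u \<in> X.R.fixed_by (be ` carrier B)"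
    if h: "h \<in> carrier W" and u: "u \<in> X.R.fixed_by (be ` carrier B)" for h u
  proof -
    obtain g p where gp: "h = (g, p)" "g \<in> carrier B" "p \<in> perms n" using h by (auto simp: W_carrier)
    have ud: "u \<in> carrier_vec X.R.d" using u by (simp add: X.R.fixed_by_def)
    have hu: "\<sigma> h *\<^sub>v u = \<sigma> (se p) *\<^sub>v u" using base_fixed_act[OF s u gp(2,3)] gp(1) by simp
    have "\<sigma> (be g') *\<^sub>v (\<sigma> h *\<^sub>v u) = \<sigma> h *\<^sub>v u" if g': "g' \<in> carrier B" for g'
      using X.R.act_act[OF be_in[OF g'] se_in[OF gp(3)] ud] base_fixed_act[OF s u g' gp(3)]
      by (simp add: hu be_se[OF g' gp(3)])
    then show ?thesis using h ud by (simp add: X.R.fixed_by_def)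
  qed
  moreover have "vec_subspace X.R.d (X.R.fixed_by (be ` carrier B))"
    by (rule X.R.vec_subspace_fixed_by) auto
  ultimately show ?thesis by (simp add: X.R.invariant_def)
qed

text \<open>Up to scale, uniform base weights act as the averaging projection, so the form measures
  the squared distance to the vectors fixed by the base group.\<close>

lemma sum_base_proj:
  assumes s: "wreath_urep G n \<sigma>" and u: "u \<in> carrier_vec (rep_dim W \<sigma>)"
  shows "(\<Sum>g\<in>carrier B. urep.diss \<sigma> (be g) u) =
    real (card (carrier B)) * (nsq u - Re ((urep.proj W \<sigma> (be ` carrier B) *\<^sub>v u) \<bullet>c u))"
proof -
  interpret X: wreath_urep G n \<sigma> by (rule s)
  have inj: "inj_on be (carrier B)" by (auto simp: inj_on_def base_embed_def)
  have "card (carrier B) \<noteq> 0" using B_finite B.one_closed by auto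
  moreover have "(X.R.proj (be ` carrier B) *\<^sub>v u) \<bullet>c u =
      (\<Sum>g\<in>carrier B. (\<sigma> (be g) *\<^sub>v u) \<bullet>c u) / of_nat (card (carrier B))"
    using X.R.cs_proj[of "be ` carrier B" u u] u by (simp add: sum.reindex[OF inj] card_image[OF inj] image_subset_iff)
  ultimately show ?thesis
    by (simp add: X.R.diss_def sum_subtractf right_diff_distrib Re_divide_of_nat)
qed

lemma Std_necessary:
  assumes E: "gap_determining n G \<E>"
  shows "Std_class n G \<in> \<E>"
proof (rule ccontr)
  assume no: "Std_class n G \<notin> \<E>"
  obtain m where m: "n = Suc m" "1 \<le> m" using n2 by (cases n) auto
  \<comment> \<open>Rate 1 on the edges at \<open>n\<close> and \<open>n + 1\<close> on everything
    else: the gap of \<open>\<zeta>\<close> is then at most \<open>n\<close>, all other non-trivial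
    gaps are at least \<open>n + 1\<close>.\<close>
  define a where "a i j = (if j = n then 1 else real n + 1)" for i j :: nat
  define c :: "(nat \<Rightarrow> 'g) \<Rightarrow> real" where "c = (\<lambda>_. real n + 1)"
  have w: "weights a c" by (simp add: weights_def a_def c_def)
  have am: "pair_sum m (\<lambda>i j. a i j * F i j) = (real n + 1) * pair_sum m F" for F
    unfolding pair_sum_mult[symmetric] by (rule pair_sum_cong) (simp add: a_def m)
  obtain x where x: "psi W (adm a c) \<zeta> = ereal x"
    using Z.R.nontrivial_psi[where w = "adm a c", OF zeta_nontrivial adm_inv[OF w]] by blast
  have "x \<le> real n"
  proof -
    \<comment> \<open>Constant on the points below \<open>n\<close>, so only the edges at
      \<open>n\<close> contribute: energy \<open>m * n^2\<close> against squared norm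
      \<open>m * n\<close>.\<close>
    define f where "f i = (if i = n then real m else - 1)" for i
    have f: "(\<Sum>i\<in>{1..n}. F (f i)) = real m * F (- 1) + F (real m)" for F :: "real \<Rightarrow> real"
      by (simp add: m f_def)
    have "x * (\<Sum>i\<in>{1..n}. (f i)\<^sup>2) \<le> pair_sum n (\<lambda>i j. a i j * (f i - f j)\<^sup>2)"
      using zeta_walk_gap[OF w x] f[of "\<lambda>z. z"] by (intro walk_gapD) simp_all
    also have "\<dots> = (real n + 1) * pair_sum m (\<lambda>i j. (f i - f j)\<^sup>2) + real m * (real n)\<^sup>2"
      unfolding m(1) pair_sum_Suc unfolding m(1)[symmetric] am
      by (simp add: a_def f_def) (simp add: m(1) power2_eq_square algebra_simps)
    also have "pair_sum m (\<lambda>i j. (f i - f j)\<^sup>2) = pair_sum m (\<lambda>i j. 0)"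
      by (rule pair_sum_cong) (simp add: f_def m)
    finally have "x * (real m * real n) \<le> real n * (real m * real n)"
      unfolding f[of "\<lambda>z. z\<^sup>2"] by (simp add: pair_sum_def power2_eq_square m(1) algebra_simps)
    then show ?thesis using m by simp
  qed
  then have "psi W (adm a c) \<zeta> < ereal (real n + 1)" by (simp add: x)
  then obtain \<sigma> where s: "nontrivial_irrep W \<sigma>" "rep_class W \<sigma> \<in> \<E>" "psi W (adm a c) \<sigma> < ereal (real n + 1)"
    using gap_determining_separates[OF E w zeta_nontrivial] by blast
  interpret X: wreath_urep G n \<sigma> by (rule nontrivial_wreath_urep[OF s(1)])
  have ni: "\<not> rep_iso W \<sigma> \<zeta>"
    using s(2) no rep_class_eqI[OF X.R.urep_axioms zeta_urep] by (auto simp: Std_class_eq)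
  have irr: "irreducible_rep W \<sigma>" using s(1) by (simp add: nontrivial_irrep_def)
  let ?U = "X.R.fixed_by (be ` carrier B)"
  have base: "?U = {0\<^sub>v X.R.d} \<or> ?U = carrier_vec X.R.d"
    using base_fixed_invariant[OF X.wreath_urep_axioms] irr X.R.irreducible_iff by blast
  have "ereal (real n + 1) \<le> psi W (adm a c) \<sigma>"
  proof (rule psi_lower[OF w s(1)])
    fix u :: "complex vec" assume u: "u \<in> carrier_vec X.R.d"
    have d0: "0 \<le> X.R.diss (se (tr i j)) u" if "1 \<le> i" "i < j" "j \<le> n" for i j
      using that u by (intro X.R.diss_nonneg se_in transpose_perms) auto
    have base0: "0 \<le> (\<Sum>g\<in>carrier B. X.R.diss (be g) u)" using u by (intro sum_nonneg) auto
    have walk0: "0 \<le> pair_sum n (\<lambda>i j. a i j * X.R.diss (se (tr i j)) u)"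
      using d0 by (intro pair_sum_nonneg mult_nonneg_nonneg) (auto simp: a_def)
    have csum: "(\<Sum>g\<in>carrier B. c g * X.R.diss (be g) u) = (real n + 1) * (\<Sum>g\<in>carrier B. X.R.diss (be g) u)"
      by (simp add: c_def sum_distrib_left)
    from base show "(real n + 1) * nsq u \<le> pair_sum n (\<lambda>i j. a i j * X.R.diss (se (tr i j)) u) +
        (\<Sum>g\<in>carrier B. c g * X.R.diss (be g) u)"
    proof
      assume U0: "?U = {0\<^sub>v X.R.d}"
      \<comment> \<open>The averaging projection over the base group vanishes, so the base weights
        alone give at least \<open>(n + 1) * nsq u\<close>.\<close>
      then have "X.R.proj (be ` carrier B) *\<^sub>v u = 0\<^sub>v X.R.d"
        using u by (intro X.R.proj_orth[OF be_subgroup]) auto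
      then have "(\<Sum>g\<in>carrier B. X.R.diss (be g) u) = real (card (carrier B)) * nsq u"
        using sum_base_proj[OF X.wreath_urep_axioms u] u by simp
      moreover have "1 \<le> card (carrier B)"
        using B_finite B.one_closed by (metis One_nat_def Suc_leI card_gt_0_iff empty_iff)
      then have "1 * nsq u \<le> real (card (carrier B)) * nsq u" by (intro mult_right_mono) auto
      ultimately have "(real n + 1) * nsq u \<le> (\<Sum>g\<in>carrier B. c g * X.R.diss (be g) u)"
        unfolding csum by (intro mult_left_mono) auto
      then show ?thesis using walk0 by simp
    next
      assume U1: "?U = carrier_vec X.R.d"
      \<comment> \<open>The base group acts trivially here, so a non-zero vector fixed by the
        stabilizer of \<open>n\<close> would identify \<open>\<sigma>\<close> with
        \<open>\<zeta>\<close>.\<close>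
      have fixm: "v = 0\<^sub>v X.R.d" if v: "v \<in> X.R.fixed_by (se ` perms m)" for v
      proof (rule ccontr)
        assume "v \<noteq> 0\<^sub>v X.R.d"
        moreover have "v \<in> ?U" using v U1 by (simp add: X.R.fixed_by_def)
        ultimately show False using iso_Std[OF m(1) s(1) _ v] ni by blast
      qed
      \<comment> \<open>On the points below \<open>n\<close> the rates are constant; the complete
        graph on \<open>m\<close> points has gap \<open>m\<close>, and
        \<open>m \<ge> 1\<close>.\<close>
      have "walk_gap m a ((real n + 1) * real m)"
        unfolding walk_gap_def am by (auto simp: pair_sum_complete)
      then have "(real n + 1) * real m * nsq u \<le> pair_sum m (\<lambda>i j. a i j * X.R.diss (se (tr i j)) u)"
      proof (rule X.wreath_aldous[rotated 2])
        show "u \<bullet>c v = 0" if "v \<in> X.R.fixed_by (se ` perms m)" for v using fixm[OF that] u by simp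
      qed (use m(1) u in \<open>auto simp: a_def\<close>)
      also have "\<dots> \<le> pair_sum n (\<lambda>i j. a i j * X.R.diss (se (tr i j)) u)"
      proof -
        have "0 \<le> (\<Sum>i\<in>{1..m}. a i (Suc m) * X.R.diss (se (tr i (Suc m))) u)"
          using d0 m(1) by (intro sum_nonneg mult_nonneg_nonneg) (auto simp: a_def)
        then show ?thesis unfolding m(1) pair_sum_Suc by simp
      qed
      finally have "(real n + 1) * real m * nsq u \<le> pair_sum n (\<lambda>i j. a i j * X.R.diss (se (tr i j)) u)" .
      moreover have "(real n + 1) * 1 * nsq u \<le> (real n + 1) * real m * nsq u"
        using m(2) by (intro mult_right_mono mult_left_mono) auto
      moreover have "0 \<le> (real n + 1) * (\<Sum>g\<in>carrier B. X.R.diss (be g) u)" using base0 by simp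
      ultimately show ?thesis unfolding csum mult_1_right by linarith
    qed
  qed
  then show False using s(3) by simp
qed

section \<open>Spherical vectors and the necessity of the duality orbits\<close>

lemma spherical_act:
  assumes s: "wreath_urep G n \<sigma>" and u: "u \<in> urep.fixed_by W \<sigma> (se ` perms n)"
    and g: "g \<in> carrier B" and p: "p \<in> perms n"
  shows "\<sigma> (g, p) *\<^sub>v u = \<sigma> (be g) *\<^sub>v u"
proof -
  interpret X: wreath_urep G n \<sigma> by (rule s)
  have "u \<in> carrier_vec X.R.d" "\<sigma> (se p) *\<^sub>v u = u" using u p by (auto simp: X.R.fixed_by_def)
  then show ?thesis using X.R.act_act[OF be_in[OF g] se_in[OF p], of u] be_se[OF g p] by simp
qed

lemma sum_W_base_eq_0:
  fixes F :: "(nat \<Rightarrow> 'g) \<times> (nat \<Rightarrow> nat) \<Rightarrow> complex"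
  assumes "\<And>g p. g \<in> carrier B \<Longrightarrow> p \<in> perms n \<Longrightarrow> F (g, p) = F (be g)"
    and "(\<Sum>h\<in>carrier W. F h) = 0"
  shows "(\<Sum>g\<in>carrier B. F (be g)) = 0"
proof -
  have "card (perms n) \<noteq> 0" using perms_finite perms_id by (metis card_eq_0_iff empty_iff)
  then show ?thesis using sum_W_base[of F] assms by simp
qed

text \<open>Both factors are unchanged when \<open>h\<close> is multiplied on the right by a
  permutation, since \<open>v\<close> and \<open>u\<close> are spherical. So the orthogonality
  relation over the wreath product is a multiple of the sum over the base group.\<close>

lemma spherical_orthogonality:
  assumes irr: "irreducible_rep W \<tau>" "irreducible_rep W \<sigma>" and ni: "\<not> rep_iso W \<tau> \<sigma>"
    and v: "v \<in> urep.fixed_by W \<tau> (se ` perms n)" and u: "u \<in> urep.fixed_by W \<sigma> (se ` perms n)"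
    and t: "t \<in> carrier_vec (rep_dim W \<sigma>)"
  shows "(\<Sum>g\<in>carrier B. (v \<bullet>c (\<tau> (be g) *\<^sub>v v)) * ((\<sigma> (be g) *\<^sub>v u) \<bullet>c t)) = 0"
proof -
  have us: "urep W \<tau>" "urep W \<sigma>" using irreducible_urep[OF W_group W_finite] irr by blast+
  then have ws: "wreath_urep G n \<tau>" "wreath_urep G n \<sigma>"
    unfolding wreath_urep_def using wreath_setup_axioms by blast+
  interpret Y: urep_pair W \<tau> \<sigma> using us by (simp add: urep_pair_def)
  have vd: "v \<in> carrier_vec Y.R.d" and ud: "u \<in> carrier_vec Y.S.d"
    using v u by (simp_all add: Y.R.fixed_by_def Y.S.fixed_by_def)
  show ?thesis
    by (rule sum_W_base_eq_0[where F = "\<lambda>h. (v \<bullet>c (\<tau> h *\<^sub>v v)) * ((\<sigma> h *\<^sub>v u) \<bullet>c t)"])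
      (simp_all only: spherical_act[OF ws(1) v] spherical_act[OF ws(2) u]
        Y.coefficient_orthogonality[OF irr ni vd vd ud t])
qed

text \<open>The counterpart of the previous relation with the trivial representation in place of
  \<open>\<tau>\<close>.\<close>

lemma spherical_sum_zero:
  assumes s: "nontrivial_irrep W \<sigma>" and u: "u \<in> urep.fixed_by W \<sigma> (se ` perms n)"
    and t: "t \<in> carrier_vec (rep_dim W \<sigma>)"
  shows "(\<Sum>g\<in>carrier B. (\<sigma> (be g) *\<^sub>v u) \<bullet>c t) = 0"
proof -
  interpret X: wreath_urep G n \<sigma> by (rule nontrivial_wreath_urep[OF s])
  have ud: "u \<in> carrier_vec X.R.d" using u by (simp add: X.R.fixed_by_def)
  have "X.R.gop (\<lambda>_. 1) *\<^sub>v u = 0\<^sub>v X.R.d"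
    using X.R.average_fixed[OF ud] s by (simp add: nontrivial_irrep_def)
  then have "(\<Sum>h\<in>carrier W. (\<sigma> h *\<^sub>v u) \<bullet>c t) = 0"
    using X.R.cs_gop[OF ud t, of "\<lambda>_. 1"] t by simp
  then show ?thesis
    by (intro sum_W_base_eq_0[where F = "\<lambda>h. (\<sigma> h *\<^sub>v u) \<bullet>c t"])
      (simp_all only: spherical_act[OF X.wreath_urep_axioms u])
qed

text \<open>The base Laplacian is the total weight \<open>s\<close> minus the weighted sum of the
  group elements; by assumption the latter vanishes on spherical vectors, so the Laplacian is
  \<open>s\<close> there. On the orthogonal complement the transpositions at rate \<open>s\<close>
  contribute at least \<open>n * s\<close>, the gap of the complete graph.\<close>

lemma psi_lower_of_annihilated:
  assumes w: "weights (\<lambda>_ _. s) c" and s: "s = (\<Sum>g\<in>carrier B. c g)" and irr: "nontrivial_irrep W \<sigma>"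
    and ann: "\<And>u t. u \<in> urep.fixed_by W \<sigma> (se ` perms n) \<Longrightarrow> t \<in> carrier_vec (rep_dim W \<sigma>) \<Longrightarrow>
      (\<Sum>g\<in>carrier B. complex_of_real (c g) * ((\<sigma> (be g) *\<^sub>v u) \<bullet>c t)) = 0"
  shows "ereal s \<le> psi W (adm (\<lambda>_ _. s) c) \<sigma>"
proof (rule psi_lower[OF w irr])
  interpret X: wreath_urep G n \<sigma> by (rule nontrivial_wreath_urep[OF irr])
  have c0: "0 \<le> c g" "c (inv\<^bsub>B\<^esub> g) = c g" if "g \<in> carrier B" for g using w that by (auto simp: weights_def)
  have s0: "0 \<le> s" unfolding s by (intro sum_nonneg c0)
  note sub = se_subgroup[OF le_refl[of n]]
  fix u :: "complex vec" assume u: "u \<in> carrier_vec X.R.d"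
  define u0 where "u0 = X.R.proj (se ` perms n) *\<^sub>v u"
  define u1 where "u1 = u - u0"
  have u0: "u0 \<in> X.R.fixed_by (se ` perms n)" unfolding u0_def by (rule X.R.proj_fixed[OF sub u])
  have d: "u0 \<in> carrier_vec X.R.d" "u1 \<in> carrier_vec X.R.d" unfolding u0_def u1_def using u by auto
  have usum: "u = u0 + u1" using u d by (intro eq_vecI) (auto simp: u1_def)
  have orth: "u1 \<bullet>c y = 0" if "y \<in> X.R.fixed_by (se ` perms n)" for y
    unfolding u1_def u0_def by (rule X.R.resid_orth[OF sub u that])
  have "real n * s * nsq u1 \<le> pair_sum n (\<lambda>i j. s * X.R.diss (se (tr i j)) u1)"
  proof (rule X.wreath_aldous[OF le_refl s0 _ d(2) orth])
    show "walk_gap n (\<lambda>_ _. s) (real n * s)"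
      unfolding walk_gap_def pair_sum_mult by (auto simp: pair_sum_complete)
  qed
  \<comment> \<open>The spherical part \<open>u0\<close> is fixed by the transpositions, so
    \<open>u\<close> and \<open>u1\<close> have the same dissipation along them.\<close>
  also have "\<dots> = pair_sum n (\<lambda>i j. s * X.R.diss (se (tr i j)) u)"
  proof (rule pair_sum_cong)
    fix i j assume ij: "1 \<le> i" "i < j" "j \<le> n"
    then have p: "tr i j \<in> perms n" by (intro transpose_perms) auto
    then have h: "se (tr i j) \<in> carrier W" by (rule se_in)
    have "\<sigma> (se (tr i j)) *\<^sub>v u0 = u0" using u0 p by (simp add: X.R.fixed_by_def)
    then have "\<sigma> (se (tr i j)) *\<^sub>v u1 = \<sigma> (se (tr i j)) *\<^sub>v u - u0"
      using mult_minus_distrib_mat_vec[OF X.R.rho_carrier[OF h] u d(1)] by (simp add: u1_def)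
    moreover have "\<sigma> (se (tr i j)) *\<^sub>v u - u0 - (u - u0) = \<sigma> (se (tr i j)) *\<^sub>v u - u"
      using u d(1) X.R.act_in[OF h u] by (intro eq_vecI) (simp_all del: index_mult_mat_vec)
    ultimately have "\<sigma> (se (tr i j)) *\<^sub>v u1 - u1 = \<sigma> (se (tr i j)) *\<^sub>v u - u" by (simp only: u1_def)
    then show "s * X.R.diss (se (tr i j)) u1 = s * X.R.diss (se (tr i j)) u"
      by (simp only: X.R.diss_eq[OF h u] X.R.diss_eq[OF h d(2)])
  qed
  finally have walk: "real n * s * nsq u1 \<le> pair_sum n (\<lambda>i j. s * X.R.diss (se (tr i j)) u)" .
  define S where "S x y = (\<Sum>g\<in>carrier B. complex_of_real (c g) * ((\<sigma> (be g) *\<^sub>v x) \<bullet>c y))" for x y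
  have sumc: "(\<Sum>g\<in>carrier B. c g * X.R.diss (be g) x) = s * nsq x - Re (S x x)" for x
    by (simp add: S_def X.R.diss_def right_diff_distrib sum_subtractf s sum_distrib_right)
  have add: "S (x + y) z = S x z + S y z" "S z (x + y) = S z x + S z y"
    if "x \<in> carrier_vec X.R.d" "y \<in> carrier_vec X.R.d" "z \<in> carrier_vec X.R.d" for x y z
    unfolding S_def sum.distrib[symmetric] distrib_left[symmetric] using that
    by (auto intro!: sum.cong
        simp: mult_add_distrib_mat_vec[OF X.R.rho_carrier] cs_add_left[of _ X.R.d] cs_add_right[of _ X.R.d])
  have S0: "S u0 t = 0" if "t \<in> carrier_vec X.R.d" for t unfolding S_def by (rule ann[OF u0 that])
  \<comment> \<open>Symmetry of \<open>c\<close> makes \<open>S\<close> hermitian, so the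
    assumption, which concerns spherical vectors in the first argument, removes both mixed
    terms.\<close>
  have "S u1 u0 = (\<Sum>g\<in>carrier B. complex_of_real (c (inv\<^bsub>B\<^esub> g)) * ((\<sigma> (be (inv\<^bsub>B\<^esub> g)) *\<^sub>v u1) \<bullet>c u0))"
    unfolding S_def by (rule sum.reindex_bij_witness[of _ "m_inv B" "m_inv B"]) auto
  also have "\<dots> = cnj (S u0 u1)"
    unfolding S_def cnj_sum
  proof (intro sum.cong refl)
    fix g assume g: "g \<in> carrier B"
    have "(\<sigma> (be (inv\<^bsub>B\<^esub> g)) *\<^sub>v u1) \<bullet>c u0 = u1 \<bullet>c (\<sigma> (be g) *\<^sub>v u0)"
      using X.R.cs_act_right[OF be_in[OF g] d(2,1)] inv_be[OF g] by simp
    also have "\<dots> = cnj ((\<sigma> (be g) *\<^sub>v u0) \<bullet>c u1)"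
      by (rule cs_commute[OF X.R.act_in[OF be_in[OF g] d(1)] d(2)])
    finally show "complex_of_real (c (inv\<^bsub>B\<^esub> g)) * ((\<sigma> (be (inv\<^bsub>B\<^esub> g)) *\<^sub>v u1) \<bullet>c u0) =
        cnj (complex_of_real (c g) * ((\<sigma> (be g) *\<^sub>v u0) \<bullet>c u1))"
      using c0(2)[OF g] by simp
  qed
  finally have "S u u = S u1 u1"
    using S0 d u by (subst (1 2) usum) (simp add: add)
  moreover have "0 \<le> (\<Sum>g\<in>carrier B. c g * X.R.diss (be g) u1)"
    using d(2) by (intro sum_nonneg mult_nonneg_nonneg c0) auto
  ultimately have "s * nsq u - s * nsq u1 \<le> (\<Sum>g\<in>carrier B. c g * X.R.diss (be g) u)"
    by (simp add: sumc)
  moreover have "1 * (s * nsq u1) \<le> real n * (s * nsq u1)"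
    using n2 s0 by (intro mult_right_mono) auto
  ultimately show "s * nsq u \<le> pair_sum n (\<lambda>i j. s * X.R.diss (se (tr i j)) u) +
      (\<Sum>g\<in>carrier B. c g * X.R.diss (be g) u)"
    using walk by (simp add: mult.assoc)
qed

text \<open>The threshold is the total base weight \<open>s\<close>, which is also the rate of every
  transposition. The Rayleigh quotient at the spherical vector \<open>v\<close> shows that
  \<open>\<rho>\<close> has gap at most \<open>s - nsq v\<close>, while every class outside the
  orbit has gap at least \<open>s\<close>.\<close>

lemma orbit_necessary:
  assumes E: "gap_determining n G \<E>" and orb: "\<O> \<in> Sph_duality_orbits n G"
  shows "\<E> \<inter> \<O> \<noteq> {}"
proof
  assume no: "\<E> \<inter> \<O> = {}"
  obtain C where C: "C \<in> Sph n G" "C \<noteq> triv_class W" "\<O> = {C, dual_class W C}"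
    using orb by (auto simp: Sph_duality_orbits_def)
  then obtain \<rho> where irr: "irreducible_rep W \<rho>" and Cr: "C = rep_class W \<rho>" by (auto simp: Sph_def Irr_def)
  have r: "urep W \<rho>" by (rule irreducible_urep[OF W_group W_finite irr])
  interpret X: wreath_urep G n \<rho> unfolding wreath_urep_def using r wreath_setup_axioms by blast
  have nt: "nontrivial_irrep W \<rho>" using X.R.nontrivial_iff_triv_class[OF irr] C(2) Cr by simp
  have sub: "se ` perms n \<subseteq> carrier W" by auto
  obtain v where v: "v \<in> X.R.fixed_by (se ` perms n)" "v \<noteq> 0\<^sub>v X.R.d"
    using spherical_vector[OF irr] C(1) Cr by blast
  have vd: "v \<in> carrier_vec X.R.d" using v(1) by (simp add: X.R.fixed_by_def)
  define \<kappa> where "\<kappa> g = (\<rho> (be g) *\<^sub>v v) \<bullet>c v" for g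
  \<comment> \<open>The constant makes the weights nonnegative because
    \<open>Re (\<kappa> g) \<ge> - nsq v\<close>; the real part makes them symmetric because
    \<open>\<kappa>\<close> takes conjugate values at inverse elements.\<close>
  define c where "c g = nsq v + Re (\<kappa> g)" for g
  define s where "s = (\<Sum>g\<in>carrier B. c g)"
  have gv: "\<rho> (be g) *\<^sub>v v \<in> carrier_vec X.R.d" if "g \<in> carrier B" for g
    by (rule X.R.act_in[OF be_in[OF that] vd])
  have cnj_\<kappa>: "v \<bullet>c (\<rho> (be g) *\<^sub>v v) = cnj (\<kappa> g)" if "g \<in> carrier B" for g
    unfolding \<kappa>_def by (rule cs_commute[OF gv[OF that] vd])
  have w: "weights (\<lambda>_ _. s) c"
  proof -
    have c0: "0 \<le> c g" if "g \<in> carrier B" for g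
      using X.R.diss_le[OF be_in[OF that] vd] by (simp add: c_def \<kappa>_def X.R.diss_def)
    have "\<kappa> (inv\<^bsub>B\<^esub> g) = cnj (\<kappa> g)" if g: "g \<in> carrier B" for g
      using X.R.cs_act_right[OF be_in[OF g] vd vd] cnj_\<kappa>[OF g] inv_be[OF g] by (simp add: \<kappa>_def)
    moreover have "0 \<le> s" unfolding s_def by (intro sum_nonneg c0)
    ultimately show ?thesis using c0 by (simp add: weights_def c_def)
  qed
  have "psi W (adm (\<lambda>_ _. s) c) \<rho> < ereal s"
  proof -
    obtain x where x: "psi W (adm (\<lambda>_ _. s) c) \<rho> = ereal x"
      using X.R.nontrivial_psi[where w = "adm (\<lambda>_ _. s) c", OF nt adm_inv[OF w]] by blast
    have "x * nsq v \<le> Re ((X.R.lap (adm (\<lambda>_ _. s) c) *\<^sub>v v) \<bullet>c v)"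
      by (rule X.R.nontrivial_psi_Rayleigh[OF nt adm_inv[OF w] vd x])
    also have "\<dots> = pair_sum n (\<lambda>i j. s * X.R.diss (se (tr i j)) v) + (\<Sum>g\<in>carrier B. c g * X.R.diss (be g) v)"
      by (rule X.Re_lap_adm[OF vd])
    also have "pair_sum n (\<lambda>i j. s * X.R.diss (se (tr i j)) v) = pair_sum n (\<lambda>i j. 0)"
    proof (rule pair_sum_cong)
      fix i j assume "1 \<le> i" "i < j" "j \<le> n"
      then have "tr i j \<in> perms n" by (intro transpose_perms) auto
      then have "\<rho> (se (tr i j)) *\<^sub>v v = v" using v(1) by (simp add: X.R.fixed_by_def)
      then show "s * X.R.diss (se (tr i j)) v = 0" by (simp add: X.R.diss_def nsq_def)
    qed
    also have "\<dots> = 0" by (simp add: pair_sum_def)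
    \<comment> \<open>Weight times dissipation is the product of
      \<open>nsq v + Re (\<kappa> g)\<close> and \<open>nsq v - Re (\<kappa> g)\<close>.\<close>
    also have "(\<Sum>g\<in>carrier B. c g * X.R.diss (be g) v) = (\<Sum>g\<in>carrier B. (nsq v)\<^sup>2 - (Re (\<kappa> g))\<^sup>2)"
      by (intro sum.cong refl) (simp add: c_def \<kappa>_def X.R.diss_def power2_eq_square algebra_simps)
    finally have le: "x * nsq v \<le> real (card (carrier B)) * (nsq v)\<^sup>2 - (\<Sum>g\<in>carrier B. (Re (\<kappa> g))\<^sup>2)"
      by (simp add: sum_subtractf)
    have "\<kappa> \<one>\<^bsub>B\<^esub> = complex_of_real (nsq v)" using vd by (simp add: \<kappa>_def be_one cs_self)
    \<comment> \<open>The identity element alone contributes \<open>(nsq v)^2\<close>; this makes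
      the inequality for the gap strict.\<close>
    then have sq: "(nsq v)\<^sup>2 \<le> (\<Sum>g\<in>carrier B. (Re (\<kappa> g))\<^sup>2)"
      using member_le_sum[of "\<one>\<^bsub>B\<^esub>" "carrier B" "\<lambda>g. (Re (\<kappa> g))\<^sup>2"] B_finite by simp
    \<comment> \<open>The sum of \<open>Re (\<kappa> g)\<close> is the order of the base group times
      the squared norm of the projection of \<open>v\<close>. Being nonnegative, it gives
      \<open>s \<ge> card (carrier B) * nsq v\<close>.\<close>
    let ?p = "X.R.proj (be ` carrier B)"
    have "(?p *\<^sub>v v) \<bullet>c v = (?p *\<^sub>v v) \<bullet>c (?p *\<^sub>v v)"
      using X.R.hermitian_proj[OF be_subgroup] X.R.proj_id[OF be_subgroup X.R.proj_fixed[OF be_subgroup vd]] vd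
      by (metis X.R.proj_in hermitian_on_def)
    then have "0 \<le> Re ((?p *\<^sub>v v) \<bullet>c v)" by (simp add: cs_self)
    moreover have "(\<Sum>g\<in>carrier B. Re (\<kappa> g)) = real (card (carrier B)) * Re ((?p *\<^sub>v v) \<bullet>c v)"
      using sum_base_proj[OF X.wreath_urep_axioms vd]
      by (simp add: X.R.diss_def \<kappa>_def sum_subtractf right_diff_distrib)
    ultimately have "0 \<le> nsq v * (\<Sum>g\<in>carrier B. Re (\<kappa> g))" by simp
    moreover have "s = real (card (carrier B)) * nsq v + (\<Sum>g\<in>carrier B. Re (\<kappa> g))"
      by (simp add: s_def c_def sum.distrib)
    ultimately have "x * nsq v \<le> (s - nsq v) * nsq v"
      using le sq by (simp add: power2_eq_square algebra_simps)
    moreover have "0 < nsq v" using v(2) vd nsq_pos_iff by blast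
    ultimately show ?thesis by (simp add: x)
  qed
  then obtain \<sigma> where s: "nontrivial_irrep W \<sigma>" "rep_class W \<sigma> \<in> \<E>" "psi W (adm (\<lambda>_ _. s) c) \<sigma> < ereal s"
    using gap_determining_separates[OF E w nt] by blast
  interpret Y: wreath_urep G n \<sigma> by (rule nontrivial_wreath_urep[OF s(1)])
  have irr': "irreducible_rep W \<sigma>" using s(1) by (simp add: nontrivial_irrep_def)
  have ni: "\<not> rep_iso W \<rho> \<sigma>"
    using rep_class_eqI[OF r Y.R.urep_axioms] s(2) no C(3) Cr by auto
  have ni': "\<not> rep_iso W (contragredient W \<rho>) \<sigma>"
    using rep_class_eqI[OF X.R.contra_urep Y.R.urep_axioms] dual_class_eq[OF r] s(2) no C(3) Cr by auto
  have "ereal s \<le> psi W (adm (\<lambda>_ _. s) c) \<sigma>"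
  proof (rule psi_lower_of_annihilated[OF w s_def s(1)])
    fix u t :: "complex vec" assume u: "u \<in> Y.R.fixed_by (se ` perms n)" and t: "t \<in> carrier_vec Y.R.d"
    let ?f = "\<lambda>g. (\<sigma> (be g) *\<^sub>v u) \<bullet>c t"
    have 1: "(\<Sum>g\<in>carrier B. ?f g) = 0" by (rule spherical_sum_zero[OF s(1) u t])
    have "(\<Sum>g\<in>carrier B. cnj (\<kappa> g) * ?f g) =
        (\<Sum>g\<in>carrier B. (v \<bullet>c (\<rho> (be g) *\<^sub>v v)) * ?f g)"
      by (intro sum.cong refl) (simp add: cnj_\<kappa>)
    also have "\<dots> = 0" by (rule spherical_orthogonality[OF irr irr' ni v(1) u t])
    finally have 2: "(\<Sum>g\<in>carrier B. cnj (\<kappa> g) * ?f g) = 0" .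
    have "(\<Sum>g\<in>carrier B. \<kappa> g * ?f g) =
        (\<Sum>g\<in>carrier B. (conjugate v \<bullet>c (contragredient W \<rho> (be g) *\<^sub>v conjugate v)) * ?f g)"
    proof (intro sum.cong refl arg_cong2[of _ _ _ _ times])
      fix g assume g: "g \<in> carrier B"
      have cv: "conjugate v \<in> carrier_vec X.R.d" using vd by simp
      have "contragredient W \<rho> (be g) *\<^sub>v conjugate v = conjugate (\<rho> (be g) *\<^sub>v v)"
        by (rule X.R.contra_vec[OF be_in[OF g] vd])
      then have "conjugate v \<bullet>c (contragredient W \<rho> (be g) *\<^sub>v conjugate v) = conjugate v \<bullet> (\<rho> (be g) *\<^sub>v v)"
        by simp
      also have "\<dots> = (\<rho> (be g) *\<^sub>v v) \<bullet>c v" by (rule comm_scalar_prod[OF cv gv[OF g]])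
      finally show "\<kappa> g = conjugate v \<bullet>c (contragredient W \<rho> (be g) *\<^sub>v conjugate v)"
        by (simp add: \<kappa>_def)
    qed
    also have "\<dots> = 0"
      by (rule spherical_orthogonality[OF X.R.contra_irreducible[OF irr] irr' ni' X.R.contra_fixed_by[OF sub v(1)] u t])
    finally have 3: "(\<Sum>g\<in>carrier B. \<kappa> g * ?f g) = 0" .
    \<comment> \<open>The weights split into a constant, half of \<open>\<kappa>\<close> and half of
      its conjugate: coefficients of the trivial representation, of the contragredient and of
      \<open>\<rho>\<close> as they enter the three relations.\<close>
    have "complex_of_real (c g) = complex_of_real (nsq v) + (\<kappa> g + cnj (\<kappa> g)) / 2" for g
      by (simp add: c_def complex_add_cnj)
    then have "(\<Sum>g\<in>carrier B. complex_of_real (c g) * ?f g) =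
        (\<Sum>g\<in>carrier B. complex_of_real (nsq v) * ?f g + (\<kappa> g * ?f g + cnj (\<kappa> g) * ?f g) / 2)"
      by (intro sum.cong refl) (simp only: distrib_right times_divide_eq_left)
    also have "\<dots> = complex_of_real (nsq v) * (\<Sum>g\<in>carrier B. ?f g) +
        ((\<Sum>g\<in>carrier B. \<kappa> g * ?f g) + (\<Sum>g\<in>carrier B. cnj (\<kappa> g) * ?f g)) / 2"
      by (simp only: sum.distrib sum_distrib_left sum_divide_distrib add_divide_distrib)
    finally show "(\<Sum>g\<in>carrier B. complex_of_real (c g) * ?f g) = 0" by (simp add: 1 2 3)
  qed
  then show False using s(3) by simp
qed

section \<open>Minimality\<close>

lemma std_sph_minimal:
  assumes M: "is_std_sph_collection n G \<M>"
  shows "minimal_gap_determining n G \<M>"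
  unfolding minimal_gap_determining_def
proof (intro conjI allI impI notI)
  show "gap_determining n G \<M>" by (rule std_sph_gap_determining[OF M])
  fix \<E> assume sub: "\<E> \<subset> \<M>" and E: "gap_determining n G \<E>"
  obtain \<S> where S: "\<M> = insert (Std_class n G) \<S>" "\<S> \<subseteq> Sph n G - {triv_class W}"
    and orb: "\<forall>\<O>\<in>Sph_duality_orbits n G. \<exists>!C. C \<in> \<S> \<inter> \<O>"
    using M unfolding is_std_sph_collection_def by (elim exE conjE) (rule that)
  obtain C where C: "C \<in> \<M>" "C \<notin> \<E>" using sub by blast
  then have CS: "C \<in> \<S>" using Std_necessary[OF E] S(1) by blast
  let ?O = "{C, dual_class W C}"
  have O: "?O \<in> Sph_duality_orbits n G" using CS S(2) unfolding Sph_duality_orbits_def by blast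
  then obtain D where D: "D \<in> \<E>" "D \<in> ?O" using orbit_necessary[OF E] by blast
  \<comment> \<open>The orbit of \<open>C\<close> meets the smaller family in some \<open>D\<close>.
    Being spherical, \<open>D\<close> is not the standard class, so it belongs to the transversal
    and equals \<open>C\<close>.\<close>
  then have "D \<in> \<S>" using sub S(1) orbit_mem_Sph[OF O] Std_not_Sph by blast
  moreover have "\<exists>!D. D \<in> \<S> \<inter> ?O" by (rule bspec[OF orb O])
  ultimately have "D = C" using CS D(2) by (elim ex1E) blast
  then show False using C(2) D(1) by simp
qed

end

theorem theorem6p12:
  fixes G :: "('g, 'm) monoid_scheme" and n :: nat
  assumes "group G" and "finite (carrier G)" and "n \<ge> 2"
  shows "(\<forall>\<M>. is_std_sph_collection n G \<M> \<longrightarrow>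
            gap_determining n G \<M> \<and> minimal_gap_determining n G \<M>) \<and>
         (\<forall>\<E>. gap_determining n G \<E> \<longrightarrow>
            Std_class n G \<in> \<E> \<and> (\<forall>\<O>\<in>Sph_duality_orbits n G. \<E> \<inter> \<O> \<noteq> {}))"
proof -
  interpret wreath_std G n
    using assms by (simp add: wreath_std_def wreath_setup_def std_rep_def)
  show ?thesis
    using std_sph_gap_determining std_sph_minimal Std_necessary orbit_necessary by blast
qed

end
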